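(* Let $(M,g)$ be a compact two-dimensional Riemannian manifold with smooth boundary $\partial M$ and let $\xi$ be a Killing field for $g$ which is tangent to $\partial M$. Let $u=\nabla_g^\perp\psi\in C^2(M)$ be an Arnol'd stable state on $(M,g)$ with stream function $\psi:M\to\mathbb{R}$. Then $\mathcal{L}_\xi\psi=0$ on $M$, where $\mathcal{L}_\xi$ is the Lie derivative along $\xi$.
   Context: For a function $\psi$ on the (oriented) surface $(M,g)$, $\nabla_g^\perp\psi$ is the vector field $u=( *_g d\psi)^\sharp$ ($*_g$ the Hodge star, $\sharp$ the musical isomorphism of $g$), in coordinates $u^i=-\sqrt{\det g}\,g^{ij}\epsilon_{jk}g^{kl}\partial_{x^l}\psi$. A state $u=\nabla_g^\perp\psi$ is a steady Euler state with vorticity profile $F$ if $\Delta_g\psi=F(\psi)$ in $M$ and $\psi$ is constant on (each component of) $\partial M$, where $\Delta_g$ is the Laplace--Beltrami operator and $F:\mathbb{R}\to\mathbb{R}$ is continuously differentiable. It is called Arnol'd stable if either $$-\lambda_1<F'(\psi)<0\ \text{ on } M,\qquad\text{or}\qquad 0<F'(\psi)<\infty\ \text{ on } M,$$ where $\lambda_1>0$ is the smallest eigenvalue of $-\Delta_g$ on $M$ with zero Dirichlet boundary conditions. *)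

theory Defs
  imports "HOL-Analysis.Analysis"
begin

section \<open>Functions of class \<open>C\<^sup>k\<close> on relatively open subsets of the half-plane\<close>

definition half_plane :: "(real^2) set" where
  "half_plane = {x. x $ 2 \<ge> 0}"

text \<open>
  Derivatives are taken within the set \<open>S\<close>. If \<open>S\<close> is relatively open in the half-plane they are
  unique; they are the ordinary partial derivatives at points with \<open>x $ 2 > 0\<close> and
  one-sided ones in the second coordinate direction at points with \<open>x $ 2 = 0\<close>.
\<close>

definition partial_within :: "(real^2) set \<Rightarrow> 2 \<Rightarrow> (real^2 \<Rightarrow> real) \<Rightarrow> real^2 \<Rightarrow> real" where
  "partial_within S i f x = frechet_derivative f (at x within S) (axis i 1)"

primrec Ck_on :: "nat \<Rightarrow> (real^2) set \<Rightarrow> (real^2 \<Rightarrow> real) \<Rightarrow> bool" where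
  "Ck_on 0 S f \<longleftrightarrow> continuous_on S f"
| "Ck_on (Suc k) S f \<longleftrightarrow> f differentiable_on S \<and> (\<forall>i. Ck_on k S (partial_within S i f))"

definition smooth_on :: "(real^2) set \<Rightarrow> (real^2 \<Rightarrow> real) \<Rightarrow> bool" where
  "smooth_on S f \<longleftrightarrow> (\<forall>k. Ck_on k S f)"


section \<open>Oriented smooth surfaces with boundary\<close>

text \<open>
  A chart is a pair of its domain and its coordinate map; the values of the coordinate map outside
  the domain are irrelevant. Points of the boundary are those sent to the line \<open>x $ 2 = 0\<close>.
\<close>

type_synonym 'a chart = "'a set \<times> ('a \<Rightarrow> real^2)"

definition chart_image :: "'a chart \<Rightarrow> (real^2) set" where
  "chart_image c = snd c ` fst c"

definition chart_inv :: "'a chart \<Rightarrow> real^2 \<Rightarrow> 'a" where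
  "chart_inv c = inv_into (fst c) (snd c)"

definition chart_deriv :: "'a chart \<Rightarrow> 2 \<Rightarrow> ('a \<Rightarrow> real) \<Rightarrow> 'a \<Rightarrow> real" where
  "chart_deriv c i f p = partial_within (chart_image c) i (f \<circ> chart_inv c) (snd c p)"

text \<open>The Jacobian matrix, at \<open>p\<close>, of the change of coordinates from \<open>c\<close> to \<open>d\<close>.\<close>

definition transition_jacobian :: "'a chart \<Rightarrow> 'a chart \<Rightarrow> 'a \<Rightarrow> real^2^2" where
  "transition_jacobian c d p = (\<chi> i j. chart_deriv c j (\<lambda>q. snd d q $ i) p)"

locale oriented_surface =
  fixes X :: "'a topology" and A :: "'a chart set"
  assumes Hausdorff: "Hausdorff_space X"
    and second_countable: "second_countable X"
    and chart_domain: "c \<in> A \<Longrightarrow> openin X (fst c)"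
    and chart_cover: "(\<Union>c\<in>A. fst c) = topspace X"
    and chart_open_image: "c \<in> A \<Longrightarrow> openin (top_of_set half_plane) (chart_image c)"
    and chart_homeomorphic:
      "c \<in> A \<Longrightarrow> homeomorphic_map (subtopology X (fst c)) (top_of_set (chart_image c)) (snd c)"
    and transition_smooth:
      "\<lbrakk>c \<in> A; d \<in> A\<rbrakk> \<Longrightarrow> smooth_on (snd c ` (fst c \<inter> fst d)) (\<lambda>x. snd d (chart_inv c x) $ i)"
    and transition_oriented:
      "\<lbrakk>c \<in> A; d \<in> A; p \<in> fst c; p \<in> fst d\<rbrakk> \<Longrightarrow> det (transition_jacobian c d p) > 0"

definition surface_boundary :: "'a chart set \<Rightarrow> 'a set" where
  "surface_boundary A = {p. \<exists>c\<in>A. p \<in> fst c \<and> snd c p $ 2 = 0}"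

definition Ck_function :: "'a chart set \<Rightarrow> nat \<Rightarrow> ('a \<Rightarrow> real) \<Rightarrow> bool" where
  "Ck_function A k f \<longleftrightarrow> (\<forall>c\<in>A. Ck_on k (chart_image c) (f \<circ> chart_inv c))"


section \<open>Vector fields and metrics\<close>

text \<open>
  Tensor fields are families of components: \<open>\<xi> c p\<close> and \<open>g c p\<close> hold the components at
  \<open>p \<in> fst c\<close> with respect to the chart \<open>c\<close>, and are subject to the transformation law of
  contravariant vectors and of covariant 2-tensors, respectively. Values at \<open>p \<notin> fst c\<close> are irrelevant.
\<close>

type_synonym 'a vfield = "'a chart \<Rightarrow> 'a \<Rightarrow> real^2"
type_synonym 'a tensor2 = "'a chart \<Rightarrow> 'a \<Rightarrow> real^2^2"

definition vector_field :: "'a chart set \<Rightarrow> 'a vfield \<Rightarrow> bool" where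
  "vector_field A \<xi> \<longleftrightarrow>
     (\<forall>c\<in>A. \<forall>d\<in>A. \<forall>p \<in> fst c \<inter> fst d. \<xi> d p = transition_jacobian c d p *v \<xi> c p)"

definition Ck_vector_field :: "'a chart set \<Rightarrow> nat \<Rightarrow> 'a vfield \<Rightarrow> bool" where
  "Ck_vector_field A k \<xi> \<longleftrightarrow> vector_field A \<xi> \<and>
     (\<forall>c\<in>A. \<forall>i. Ck_on k (chart_image c) (\<lambda>x. \<xi> c (chart_inv c x) $ i))"

definition smooth_vector_field :: "'a chart set \<Rightarrow> 'a vfield \<Rightarrow> bool" where
  "smooth_vector_field A \<xi> \<longleftrightarrow> (\<forall>k. Ck_vector_field A k \<xi>)"

definition riemannian_metric :: "'a chart set \<Rightarrow> 'a tensor2 \<Rightarrow> bool" where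
  "riemannian_metric A g \<longleftrightarrow>
     (\<forall>c\<in>A. \<forall>i j. smooth_on (chart_image c) (\<lambda>x. g c (chart_inv c x) $ i $ j)) \<and>
     (\<forall>c\<in>A. \<forall>p\<in>fst c. transpose (g c p) = g c p) \<and>
     (\<forall>c\<in>A. \<forall>p\<in>fst c. \<forall>v. v \<noteq> 0 \<longrightarrow> v \<bullet> (g c p *v v) > 0) \<and>
     (\<forall>c\<in>A. \<forall>d\<in>A. \<forall>p \<in> fst c \<inter> fst d.
        g c p = transpose (transition_jacobian c d p) ** g d p ** transition_jacobian c d p)"

locale compact_riemannian_surface = oriented_surface X A
  for X :: "'a topology" and A :: "'a chart set" +
  fixes g :: "'a tensor2"
  assumes compact: "compact_space X"
    and metric: "riemannian_metric A g"

definition lie_derivative :: "'a vfield \<Rightarrow> ('a \<Rightarrow> real) \<Rightarrow> 'a chart \<Rightarrow> 'a \<Rightarrow> real" where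
  "lie_derivative \<xi> f c p = (\<Sum>k\<in>UNIV. \<xi> c p $ k * chart_deriv c k f p)"

definition lie_derivative_tensor2 :: "'a vfield \<Rightarrow> 'a tensor2 \<Rightarrow> 'a tensor2" where
  "lie_derivative_tensor2 \<xi> g c p = (\<chi> i j.
     (\<Sum>k\<in>UNIV. \<xi> c p $ k * chart_deriv c k (\<lambda>q. g c q $ i $ j) p
       + g c p $ k $ j * chart_deriv c i (\<lambda>q. \<xi> c q $ k) p
       + g c p $ i $ k * chart_deriv c j (\<lambda>q. \<xi> c q $ k) p))"

definition killing_field :: "'a chart set \<Rightarrow> 'a tensor2 \<Rightarrow> 'a vfield \<Rightarrow> bool" where
  "killing_field A g \<xi> \<longleftrightarrow>
     smooth_vector_field A \<xi> \<and> (\<forall>c\<in>A. \<forall>p\<in>fst c. lie_derivative_tensor2 \<xi> g c p = 0)"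

definition tangent_to_boundary :: "'a chart set \<Rightarrow> 'a vfield \<Rightarrow> bool" where
  "tangent_to_boundary A \<xi> \<longleftrightarrow>
     (\<forall>c\<in>A. \<forall>p \<in> fst c \<inter> surface_boundary A. \<xi> c p $ 2 = 0)"

definition levi_civita :: "2 \<Rightarrow> 2 \<Rightarrow> real" where
  "levi_civita j k = (if j = 1 \<and> k = 2 then 1 else if j = 2 \<and> k = 1 then -1 else 0)"

text \<open>
  The vector field \<open>(*\<^sub>g d\<psi>)\<^sup>\<sharp>\<close> in positively oriented coordinates. In the Euclidean plane it is
  \<open>(-\<partial>\<^sub>2\<psi>, \<partial>\<^sub>1\<psi>)\<close>.
\<close>

definition grad_perp :: "'a tensor2 \<Rightarrow> ('a \<Rightarrow> real) \<Rightarrow> 'a vfield" where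
  "grad_perp g \<psi> c p = (\<chi> i. - sqrt (det (g c p)) *
     (\<Sum>j\<in>UNIV. \<Sum>k\<in>UNIV. \<Sum>l\<in>UNIV.
        matrix_inv (g c p) $ i $ j * levi_civita j k * matrix_inv (g c p) $ k $ l * chart_deriv c l \<psi> p))"

definition laplace_beltrami :: "'a tensor2 \<Rightarrow> ('a \<Rightarrow> real) \<Rightarrow> 'a chart \<Rightarrow> 'a \<Rightarrow> real" where
  "laplace_beltrami g f c p = 1 / sqrt (det (g c p)) *
     (\<Sum>i\<in>UNIV. chart_deriv c i
        (\<lambda>q. sqrt (det (g c q)) * (\<Sum>j\<in>UNIV. matrix_inv (g c q) $ i $ j * chart_deriv c j f q)) p)"


section \<open>Arnol'd stable steady states\<close>

definition dirichlet_eigenvalue :: "'a chart set \<Rightarrow> 'a tensor2 \<Rightarrow> real \<Rightarrow> bool" where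
  "dirichlet_eigenvalue A g \<mu> \<longleftrightarrow>
     (\<exists>f. Ck_function A 2 f \<and> (\<exists>c\<in>A. \<exists>p\<in>fst c. f p \<noteq> 0) \<and>
        (\<forall>p\<in>surface_boundary A. f p = 0) \<and>
        (\<forall>c\<in>A. \<forall>p\<in>fst c. - laplace_beltrami g f c p = \<mu> * f p))"

definition smallest_dirichlet_eigenvalue :: "'a chart set \<Rightarrow> 'a tensor2 \<Rightarrow> real \<Rightarrow> bool" where
  "smallest_dirichlet_eigenvalue A g \<mu> \<longleftrightarrow>
     dirichlet_eigenvalue A g \<mu> \<and> (\<forall>\<nu>. dirichlet_eigenvalue A g \<nu> \<longrightarrow> \<mu> \<le> \<nu>)"

definition steady_euler_state ::
  "'a topology \<Rightarrow> 'a chart set \<Rightarrow> 'a tensor2 \<Rightarrow> (real \<Rightarrow> real) \<Rightarrow> ('a \<Rightarrow> real) \<Rightarrow> 'a vfield \<Rightarrow> bool" where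
  "steady_euler_state X A g F \<psi> u \<longleftrightarrow>
     (\<forall>c\<in>A. \<forall>p\<in>fst c. u c p = grad_perp g \<psi> c p) \<and>
     (\<forall>s. F differentiable (at s)) \<and> continuous_on UNIV (deriv F) \<and>
     (\<forall>c\<in>A. \<forall>p\<in>fst c. laplace_beltrami g \<psi> c p = F (\<psi> p)) \<and>
     (\<forall>C \<in> connected_components_of (subtopology X (surface_boundary A)).
        \<exists>b. \<forall>p\<in>C. \<psi> p = b)"

text \<open>
  In the first alternative \<open>\<mu>\<close> (the \<open>\<lambda>\<^sub>1\<close> of the surface) is positive automatically. The alternative is void on a
  surface without boundary, where constants are eigenfunctions and \<open>\<mu> = 0\<close>.
\<close>

definition arnold_stable_state ::
  "'a topology \<Rightarrow> 'a chart set \<Rightarrow> 'a tensor2 \<Rightarrow> (real \<Rightarrow> real) \<Rightarrow> ('a \<Rightarrow> real) \<Rightarrow> 'a vfield \<Rightarrow> bool" where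
  "arnold_stable_state X A g F \<psi> u \<longleftrightarrow>
     steady_euler_state X A g F \<psi> u \<and>
     ((\<exists>\<mu>. smallest_dirichlet_eigenvalue A g \<mu> \<and>
         (\<forall>p\<in>topspace X. - \<mu> < deriv F (\<psi> p) \<and> deriv F (\<psi> p) < 0)) \<or>
      (\<forall>p\<in>topspace X. 0 < deriv F (\<psi> p)))"

end

(*
  With f the derivative of psi along xi, differentiating the equation of psi along the flow of isometries gives
  Delta f = F'(psi) f, and f = 0 on the boundary since xi is tangent to it. If w > 0 satisfies Delta w < F'(psi) w, then
  at an interior maximum of f/w this forces f <= 0, hence f = 0 (apply it to f and -f). For F' > 0 take w = 1.
  Suppose -lambda_1 < F' < 0 and f is not 0 on a component E. Then E has a boundary, as otherwise its indicator would be an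
  eigenfunction, and xi has only nondegenerate zeros on E. Contracting the area form with xi gives a closed one-form alpha
  that vanishes on boundary vectors. Near each point alpha has a primitive whose level sets are connected; starting at a
  boundary circle, these primitives are continued to a function k from E onto [0,T] with dk = alpha and connected fibres,
  whose only extrema lie on k = 0 and k = T. Then |xi|^2 = n(k) and Delta (W o k) = (n W')'(k), so that separation of
  variables reduces the eigenvalue problem for functions of k to (n W')' = - nu W on [0,T]. For sup(-F'(psi)) < m < lambda_1,
  this Sturm-Liouville problem either has an eigenvalue nu <= m, which contradicts the choice of lambda_1, or for nu = m it
  has a positive solution W, and w = W o k is as required.
*)
theory Submission
  imports Defs
begin

section \<open>A singular Sturm--Liouville problem\<close>

text \<open>Minimality is all that is used of lambda_1. A first eigenfunction of M could not serve
  as w: M need not be connected, and it may vanish on E. Hence w is built on E itself, and m is kept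
  strictly above sup(-F'(psi)), which compactness allows, so that the inequality for w is strict
  everywhere. That |xi|^2 is a function of k comes from Cartan's formula: the Lie derivative of
  xi^flat along xi vanishes, so d|xi|^2 = kap alpha with kap the curl of xi; thus n' = kap. Likewise
  the Hodge star takes d(W o k) to W'(k) xi^flat up to sign, whose exterior derivative gives (n
  W')'. The start at a boundary circle makes n(0) > 0, so T is the only possible singular end. For
  nu = 0 the solution is explicit and positive; as nu grows to m, positivity can be lost only
  through t = 0, and that is an eigenvalue. The obstacle on the global side is that alpha is closed
  but not known to be exact, and that orbits of xi are not known to be closed. The construction of k
  therefore rests on two local facts only: primitives are open maps onto intervals, and their local
  fibres are connected.\<close>

lemma DERIV_chain_within:
 assumes "(f has_field_derivative f') (at x within S)" "(g has_field_derivative g') (at (f x) within R)"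
  "\<And>y. y \<in> S ==> f y \<in> R"
 shows "((%y. g (f y)) has_field_derivative g' * f') (at x within S)" using DERIV_image_chain[of g g' f x S f'] DERIV_subset[OF assms(2)] assms(1,3)
 by (auto simp: o_def image_subset_iff)

text \<open>\<open>n\<close> is the squared length of the Killing field as a function of the level.
  The end 0 is a boundary circle, so \<open>n\<close> is positive there; T is either another
  boundary circle or a zero of the field, and then \<open>n\<close> has a simple zero.\<close>

locale sturm_liouville =
 fixes n dn :: "real => real" and T :: real
 assumes T_pos: "0 < T"
  and dn: "\<And>t. t \<in> {0..T} ==> (n has_real_derivative dn t) (at t within {0..T})"
  and dn_cont: "continuous_on {0..T} dn"
  and n_pos: "\<And>t. 0 \<le> t ==> t < T ==> 0 < n t"
  and n_end: "0 < n T \<or> n T = 0 \<and> dn T < 0"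
begin

text \<open>
 A solution of \<open>(n W')' = - \<nu> W\<close> that is regular at \<open>T\<close> satisfies \<open>n W' = \<nu> (T - t) avg W\<close>, up to the flux \<open>n W'\<close>
 at \<open>T\<close>. The factor \<open>(T - t) / n\<close> is continuous up to \<open>T\<close> even if \<open>n T = 0\<close>, so that solutions are power series
 in \<open>\<nu>\<close> obtained by iterating \<open>KK\<close>.
\<close>

definition avg :: "(real => real) => real => real" where
 "avg u s = integral {0..1} (%x. u (s + (T - s) * x))"

definition rr :: "real => real" where
 "rr s = (if n s = 0 then - 1 / dn T else (T - s) / n s)"

definition KK :: "(real => real) => real => real" where
 "KK u t = integral {t..T} (%s. rr s * avg u s)"

lemma n_cont: "continuous_on {0..T} n" by (rule DERIV_continuous_on[OF dn])

lemma n_zero: "t \<in> {0..T} ==> n t = 0 ==> t = T" using n_pos[of t] by (cases "t = T") auto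

text \<open>The only delicate point is T when \<open>n T = 0\<close>: there n(s) / (s - T) tends to
  \<open>dn T\<close>, and the value chosen in \<open>rr\<close> is minus the inverse of this
  limit.\<close>

lemma rr_cont: "continuous_on {0..T} rr"
proof (cases "n T = 0")
 case False
 then have nz: "n t \<noteq> 0" if "t \<in> {0..T}" for t using n_zero[OF that] by auto
 have "continuous_on {0..T} (%s. (T - s) / n s)" using nz by (intro continuous_intros n_cont) auto
 then show ?thesis by (rule continuous_on_eq) (use nz in \<open>auto simp: rr_def\<close>)
next
 case True
 then have dT: "dn T < 0" using n_end by auto
 show ?thesis unfolding continuous_on_eq_continuous_within
 proof
  fix t assume t: "t \<in> {0..T}"
  show "continuous (at t within {0..T}) rr"
  proof (cases "t = T")
   case False
   then have tT: "t < T" using t by auto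
   have "continuous_on {0..<T} (%s. (T - s) / n s)" using n_pos by (intro continuous_intros continuous_on_subset[OF n_cont]) force+
   then have "continuous_on {0..<T} rr" by (rule continuous_on_eq) (use n_pos in \<open>force simp: rr_def\<close>)
   then have c: "continuous (at t within {0..<T}) rr" using t tT by (auto simp: continuous_on_eq_continuous_within)
   have "at t within {0..T} = at t within {0..<T}" by (rule at_within_nhd[of _ "{..<T}"]) (use tT in auto)
   then show ?thesis using c by simp
  next
   case tT: True
   have "((%s. (n s - n T) / (s - T)) \<longlongrightarrow> dn T) (at T within {0..T})" using dn[of T] T_pos by (auto simp: has_field_derivative_iff)
   then have "((%s. - inverse ((n s - n T) / (s - T))) \<longlongrightarrow> - inverse (dn T)) (at T within {0..T})" using dT by (intro tendsto_intros) auto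
   moreover have "\<forall>\<^sub>F s in at T within {0..T}. - inverse ((n s - n T) / (s - T)) = rr s" unfolding eventually_at_filter
   proof (rule eventuallyI, intro impI)
    fix s assume s: "s \<noteq> T" "s \<in> {0..T}"
    then have "n s \<noteq> 0" using n_zero by blast
    then show "- inverse ((n s - n T) / (s - T)) = rr s" using True s unfolding rr_def by (simp add: divide_simps)
   qed
   ultimately have "(rr \<longlongrightarrow> - inverse (dn T)) (at T within {0..T})" by (rule Lim_transform_eventually)
   then show ?thesis using True unfolding tT continuous_within rr_def by (simp add: divide_inverse)
  qed
 qed
qed

lemma n_rr: "t \<in> {0..T} ==> n t * rr t = T - t" using n_zero[of t] unfolding rr_def by auto

lemma avg_arg: "s \<in> {0..T} ==> x \<in> {0..1} ==> s + (T - s) * x \<in> {s..T}"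
proof -
 assume a: "s \<in> {0..T}" "x \<in> {0..1}"
 then have "0 \<le> (T - s) * x" "(T - s) * x \<le> (T - s) * 1" by (intro mult_nonneg_nonneg mult_left_mono; simp)+
 then show ?thesis by simp
qed

text \<open>Rescaling to the fixed interval [0,1] turns the average into a parameter integral, so it
  stays continuous at t = T, where the interval of averaging degenerates.\<close>

lemma avg_cont2:
 assumes "continuous_on (U \<times> {0..T}) (%(y,t). f y t)"
 shows "continuous_on (U \<times> {0..T}) (%(y,t). avg (f y) t)"
proof -
 have "continuous_on ((U \<times> {0..T}) \<times> {0..1}) (%(p,x). f (fst p) (snd p + (T - snd p) * x))"
 proof -
  have "continuous_on ((U \<times> {0..T}) \<times> {0..1}) ((%(y,t). f y t) \<circ> (%(p,x). (fst p, snd p + (T - snd p) * x)))"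
  proof (rule continuous_on_compose)
   show "continuous_on ((U \<times> {0..T}) \<times> {0..1}) (%(p,x). (fst p, snd p + (T - snd p) * x))"
    unfolding case_prod_beta by (intro continuous_intros)
   have "(%(p,x). (fst p, snd p + (T - snd p) * x)) ` ((U \<times> {0..T}) \<times> {0..1}) \<subseteq> U \<times> {0..T}" using avg_arg by fastforce
   then show "continuous_on ((%(p,x). (fst p, snd p + (T - snd p) * x)) ` ((U \<times> {0..T}) \<times> {0..1})) (%(y,t). f y t)"
    using continuous_on_subset[OF assms] by blast
  qed
  then show ?thesis by (simp add: o_def case_prod_beta)
 qed
 then show ?thesis using integral_continuous_on_param[of "U \<times> {0..T}" 0 1 "%p x. f (fst p) (snd p + (T - snd p) * x)"]
  unfolding avg_def by (simp add: case_prod_beta)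
qed

lemma avg_cont:
 assumes "continuous_on {0..T} f" shows "continuous_on {0..T} (avg f)"
proof -
 have "continuous_on ({0::real} \<times> {0..T}) (%(y,t). f t)" unfolding case_prod_beta by (intro continuous_on_compose2[OF assms] continuous_intros) auto
 from avg_cont2[OF this] have c: "continuous_on ({0::real} \<times> {0..T}) (%(y,t). avg f t)" .
 have "continuous_on {0..T} ((%(y,t). avg f t) \<circ> (%t. (0::real,t)))"
  by (rule continuous_on_compose) (auto intro!: continuous_intros continuous_on_subset[OF c])
 then show ?thesis by (simp add: o_def)
qed

lemma comp_int:
 fixes u :: "real => real"
 assumes "continuous_on {0..T} u" "s \<in> {0..T}"
 shows "(%x. u (s + (T - s) * x)) integrable_on {0..1}"
proof (rule integrable_continuous_real, rule continuous_on_compose2[OF assms(1)])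
 show "(%x. s + (T - s) * x) ` {0..1} \<subseteq> {0..T}" using avg_arg[OF assms(2)] assms(2) by fastforce
qed (intro continuous_intros)

lemma avg_integral:
 assumes "continuous_on {0..T} u" "s \<in> {0..T}"
 shows "(T - s) * avg u s = integral {s..T} u"
proof -
 define U where "U t = integral {0..t} u" for t
 have dU: "(U has_real_derivative u t) (at t within {0..T})" if "t \<in> {0..T}" for t unfolding U_def using integral_has_real_derivative[OF assms(1) that] .
 have "((%x. (T - s) * u (s + (T - s) * x)) has_integral (U (s + (T - s) * 1) - U (s + (T - s) * 0))) {0..1}"
 proof (rule fundamental_theorem_of_calculus)
  fix x :: real assume x: "x \<in> {0..1}"
  have "((%x. U (s + (T - s) * x)) has_real_derivative u (s + (T - s) * x) * (T - s)) (at x within {0..1})"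
  proof (rule DERIV_chain_within[where R = "{0..T}" and g = U and f = "%x. s + (T - s) * x"])
   show "((%x. s + (T - s) * x) has_real_derivative T - s) (at x within {0..1})" by (auto intro!: derivative_eq_intros)
   show "(U has_real_derivative u (s + (T - s) * x)) (at (s + (T - s) * x) within {0..T})"
    using dU[of "s + (T - s) * x"] avg_arg[OF assms(2) x] assms(2) by auto
  qed (use avg_arg[OF assms(2)] assms(2) in force)
  then show "((%x. U (s + (T - s) * x)) has_vector_derivative (T - s) * u (s + (T - s) * x)) (at x within {0..1})"
   by (simp add: has_real_derivative_iff_has_vector_derivative mult.commute)
 qed simp
 then have "integral {0..1} (%x. (T - s) * u (s + (T - s) * x)) = U T - U s" by (simp add: integral_unique del: integral_mult_right)
 moreover have "integral {0..s} u + integral {s..T} u = integral {0..T} u" by (rule Henstock_Kurzweil_Integration.integral_combine)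
   (use assms(2) integrable_continuous_real[OF assms(1)] in auto)
 then have "U T - U s = integral {s..T} u" unfolding U_def by simp
 ultimately show ?thesis unfolding avg_def by simp
qed

lemma tail_derivative:
 assumes "continuous_on {0..T} f" "t \<in> {0..T}"
 shows "((%t. integral {t..T} f) has_real_derivative - f t) (at t within {0..T})"
proof -
 have "((%t. integral {0..T} f - integral {0..t} f) has_real_derivative 0 - f t) (at t within {0..T})"
  by (intro DERIV_diff integral_has_real_derivative assms) auto
 moreover have *: "integral {0..T} f - integral {0..t} f = integral {t..T} f" if "t \<in> {0..T}" for t
 proof -
  have "integral {0..t} f + integral {t..T} f = integral {0..T} f" by (rule Henstock_Kurzweil_Integration.integral_combine)
    (use that integrable_continuous_real[OF assms(1)] in auto)
  then show ?thesis by simp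
 qed
 ultimately show ?thesis using has_field_derivative_transform_within[of "%t. integral {0..T} f - integral {0..t} f" "0 - f t" t "{0..T}" 1
    "%t. integral {t..T} f"] assms(2) * by simp
qed

section \<open>Solutions as power series in the parameter\<close>

definition ws :: "(real => real) => nat => real => real" where
 "ws w0 k = (KK ^^ k) w0"

lemma ws_0 [simp]: "ws w0 0 = w0" and ws_Suc: "ws w0 (Suc k) = KK (ws w0 k)" unfolding ws_def by auto

lemma KK_integrand_cont: "continuous_on {0..T} u ==> continuous_on {0..T} (%s. rr s * avg u s)" by (intro continuous_intros rr_cont avg_cont)

lemma KK_deriv: "continuous_on {0..T} u ==> t \<in> {0..T} ==> (KK u has_real_derivative - (rr t * avg u t)) (at t within {0..T})"
 unfolding KK_def using tail_derivative[OF KK_integrand_cont, of u t] by simp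

lemma KK_cont: "continuous_on {0..T} u ==> continuous_on {0..T} (KK u)" by (rule DERIV_continuous_on[OF KK_deriv])

lemma avg_bound:
 assumes "continuous_on {0..T} u" "s \<in> {0..T}" "\<And>x. x \<in> {s..T} ==> \<bar>u x\<bar> \<le> B"
 shows "\<bar>avg u s\<bar> \<le> B"
proof -
 have "norm (integral {0..1} (%x. u (s + (T - s) * x))) \<le> integral {0..1} (%x::real. B)"
  by (rule integral_norm_bound_integral[OF comp_int[OF assms(1,2)]]) (use avg_arg[OF assms(2)] assms(3) in auto)
 then show ?thesis unfolding avg_def by simp
qed

definition CC :: real where "CC = (SOME C. 0 < C \<and> (\<forall>t\<in>{0..T}. \<bar>rr t\<bar> \<le> C))"

lemma CC: "0 < CC" "t \<in> {0..T} ==> \<bar>rr t\<bar> \<le> CC"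
proof -
 have "compact (rr ` {0..T})" by (intro compact_continuous_image rr_cont) auto
 then obtain C where "0 < C" "\<forall>y\<in>rr ` {0..T}. norm y \<le> C" using bounded_pos compact_imp_bounded by metis
 then have "\<exists>C. 0 < C \<and> (\<forall>t\<in>{0..T}. \<bar>rr t\<bar> \<le> C)" by auto
 from someI_ex[OF this] show "0 < CC" "t \<in> {0..T} ==> \<bar>rr t\<bar> \<le> CC" unfolding CC_def by auto
qed

text \<open>Each application of \<open>KK\<close> gains the factor CC (T - t) / (k + 1). This
  produces the factorial in \<open>ws_bound\<close>, and with it convergence for every value of the
  parameter.\<close>

lemma KK_bound:
 assumes u: "continuous_on {0..T} u" and t: "t \<in> {0..T}" and b: "\<And>x. x \<in> {t..T} ==> \<bar>u x\<bar> \<le> B * (T - x) ^ k"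
  and B: "0 \<le> B"
 shows "\<bar>KK u t\<bar> \<le> CC * B * (T - t) ^ Suc k / real (Suc k)"
proof -
 have i: "((%s. CC * B * (T - s) ^ k) has_integral
   (- (CC * B * (T - T) ^ Suc k / real (Suc k)) - (- (CC * B * (T - t) ^ Suc k / real (Suc k))))) {t..T}"
 proof (rule fundamental_theorem_of_calculus)
  fix x assume "x \<in> {t..T}"
  show "((%s. - (CC * B * (T - s) ^ Suc k / real (Suc k))) has_vector_derivative CC * B * (T - x) ^ k) (at x within {t..T})"
   unfolding has_real_derivative_iff_has_vector_derivative[symmetric]
  proof -
   have "((%s. T - s) has_real_derivative -1) (at x within {t..T})" by (auto intro!: derivative_eq_intros)
   from DERIV_cmult[OF DERIV_power[OF this, of "Suc k"], of "- (CC * B / real (Suc k))"]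
   show "((%s. - (CC * B * (T - s) ^ Suc k / real (Suc k))) has_real_derivative CC * B * (T - x) ^ k) (at x within {t..T})"
    by (simp add: mult.assoc del: of_nat_Suc power_Suc)
  qed
 qed (use t in auto)
 have "norm (integral {t..T} (%s. rr s * avg u s)) \<le> integral {t..T} (%s. CC * B * (T - s) ^ k)"
 proof (rule integral_norm_bound_integral)
  show "(%s. rr s * avg u s) integrable_on {t..T}" using t by (intro integrable_continuous_real continuous_on_subset[OF KK_integrand_cont[OF u]]) auto
  show "(%s. CC * B * (T - s) ^ k) integrable_on {t..T}" using i by blast
  fix s assume s: "s \<in> {t..T}"
  then have s': "s \<in> {0..T}" using t by auto
  have "\<bar>avg u s\<bar> \<le> B * (T - s) ^ k"
  proof (rule avg_bound[OF u s'])
   fix x assume x: "x \<in> {s..T}"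
   then have "\<bar>u x\<bar> \<le> B * (T - x) ^ k" using b s by auto
   also have "\<dots> \<le> B * (T - s) ^ k" using x s' B by (intro mult_left_mono power_mono) auto
   finally show "\<bar>u x\<bar> \<le> B * (T - s) ^ k" .
  qed
  then have "\<bar>rr s\<bar> * \<bar>avg u s\<bar> \<le> CC * (B * (T - s) ^ k)" using CC s' by (intro mult_mono) auto
  then show "norm (rr s * avg u s) \<le> CC * B * (T - s) ^ k" by (simp add: abs_mult mult.assoc)
 qed
 also have "\<dots> = CC * B * (T - t) ^ Suc k / real (Suc k)" using integral_unique[OF i] by simp
 finally show ?thesis unfolding KK_def by simp
qed

lemma ws_cont: "continuous_on {0..T} w0 ==> continuous_on {0..T} (ws w0 k)" by (induction k) (auto simp: ws_Suc intro: KK_cont)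

lemma ws_bound:
 assumes w0: "continuous_on {0..T} w0" and M: "\<And>t. t \<in> {0..T} ==> \<bar>w0 t\<bar> \<le> M"
 shows "t \<in> {0..T} ==> \<bar>ws w0 k t\<bar> \<le> M * CC ^ k / fact k * (T - t) ^ k"
proof (induction k arbitrary: t)
 case 0 then show ?case using M by simp
next
 case (Suc k)
 have "\<bar>KK (ws w0 k) t\<bar> \<le> CC * (M * CC ^ k / fact k) * (T - t) ^ Suc k / real (Suc k)"
 proof (rule KK_bound[OF ws_cont[OF w0] Suc.prems])
  show "\<bar>ws w0 k x\<bar> \<le> M * CC ^ k / fact k * (T - x) ^ k" if "x \<in> {t..T}" for x using Suc.IH[of x] that Suc.prems by auto
  have "0 \<le> M" using M[OF Suc.prems] by linarith
  then show "0 \<le> M * CC ^ k / fact k" using CC(1) by simp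
 qed
 also have "\<dots> = M * CC ^ Suc k / fact (Suc k) * (T - t) ^ Suc k" by (simp add: field_simps)
 finally show ?case by (simp add: ws_Suc)
qed

text \<open>The Neumann series for the inverse of 1 + \<nu> \<open>KK\<close>, applied to
  \<open>w0\<close>.\<close>

definition WW :: "(real => real) => real => real => real" where
 "WW w0 \<nu> t = (\<Sum>k. (- \<nu>) ^ k * ws w0 k t)"

lemma WW_uniform:
 assumes w0: "continuous_on {0..T} w0"
 shows "uniform_limit ({-m..m} \<times> {0..T}) (%N (\<nu>,t). \<Sum>k<N. (- \<nu>) ^ k * ws w0 k t) (%(\<nu>,t). WW w0 \<nu> t) sequentially"
proof -
 have "compact (w0 ` {0..T})" by (intro compact_continuous_image w0) auto
 then obtain M where M: "0 < M" "\<forall>y\<in>w0 ` {0..T}. norm y \<le> M" using bounded_pos compact_imp_bounded by metis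
 have "uniform_limit ({-m..m} \<times> {0..T}) (%N p. \<Sum>k<N. (- fst p) ^ k * ws w0 k (snd p))
  (%p. \<Sum>k. (- fst p) ^ k * ws w0 k (snd p)) sequentially"
 proof (rule Weierstrass_m_test)
  fix k and p :: "real \<times> real" assume p: "p \<in> {-m..m} \<times> {0..T}"
  then have t: "snd p \<in> {0..T}" and nu: "\<bar>fst p\<bar> \<le> \<bar>m\<bar>" by auto
  have "\<bar>ws w0 k (snd p)\<bar> \<le> M * CC ^ k / fact k * (T - snd p) ^ k" using ws_bound[OF w0 _ t] M by auto
  also have "\<dots> \<le> M * CC ^ k / fact k * T ^ k" using t M CC by (intro mult_left_mono power_mono) auto
  finally have "\<bar>fst p\<bar> ^ k * \<bar>ws w0 k (snd p)\<bar> \<le> \<bar>m\<bar> ^ k * (M * CC ^ k / fact k * T ^ k)"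
   using nu by (intro mult_mono power_mono) auto
  then show "norm ((- fst p) ^ k * ws w0 k (snd p)) \<le> M * (inverse (fact k) * (\<bar>m\<bar> * CC * T) ^ k)"
   by (simp add: abs_mult power_abs power_mult_distrib field_simps)
 next
  show "summable (%k. M * (inverse (fact k) * (\<bar>m\<bar> * CC * T) ^ k))" by (intro summable_mult summable_exp)
 qed
 then show ?thesis unfolding WW_def by (simp add: case_prod_beta')
qed

lemma WW_cont2:
 assumes w0: "continuous_on {0..T} w0"
 shows "continuous_on ({-m..m} \<times> {0..T}) (%(\<nu>,t). WW w0 \<nu> t)"
proof (rule uniform_limit_theorem[OF _ WW_uniform[OF w0]])
 have "continuous_on ({-m..m} \<times> {0..T}) (%p. ws w0 k (snd p))" for k
  by (rule continuous_on_compose2[OF ws_cont[OF w0, of k]]) (auto intro!: continuous_intros)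
 then show "\<forall>\<^sub>F N in sequentially. continuous_on ({-m..m} \<times> {0..T}) (%(\<nu>,t). \<Sum>k<N. (- \<nu>) ^ k * ws w0 k t)"
  unfolding case_prod_beta by (intro always_eventually allI continuous_intros) auto
qed simp

lemma WW_cont:
 assumes w0: "continuous_on {0..T} w0" shows "continuous_on {0..T} (WW w0 \<nu>)"
proof -
 have "continuous_on {0..T} ((%(\<nu>,t). WW w0 \<nu> t) \<circ> (%t. (\<nu>,t)))" by (rule continuous_on_compose)
   (auto intro!: continuous_intros continuous_on_subset[OF WW_cont2[OF w0, of "\<bar>\<nu>\<bar>"]])
 then show ?thesis by (simp add: o_def)
qed

lemma avg_lin:
 assumes "continuous_on {0..T} u" "continuous_on {0..T} v" "s \<in> {0..T}"
 shows "avg (%x. u x + c * v x) s = avg u s + c * avg v s"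
 unfolding avg_def using comp_int[OF assms(1,3)] integrable_on_cmult_left[OF comp_int[OF assms(2,3)], of c] by (subst integral_add) auto

lemma KK_lin:
 assumes u: "continuous_on {0..T} u" and v: "continuous_on {0..T} v" and t: "t \<in> {0..T}"
 shows "KK (%x. u x + c * v x) t = KK u t + c * KK v t"
proof -
 have i: "(%s. rr s * avg f s) integrable_on {t..T}" if "continuous_on {0..T} f" for f
  using t by (intro integrable_continuous_real continuous_on_subset[OF KK_integrand_cont[OF that]]) auto
 have "KK (%x. u x + c * v x) t = integral {t..T} (%s. rr s * avg u s + c * (rr s * avg v s))"
  unfolding KK_def using avg_lin[OF u v] t by (intro integral_cong) (auto simp: algebra_simps)
 also have "\<dots> = KK u t + c * KK v t" unfolding KK_def using i[OF u] integrable_on_cmult_left[OF i[OF v], of c] by (subst integral_add) auto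
 finally show ?thesis .
qed

lemma KK_partial:
 assumes w0: "continuous_on {0..T} w0" and t: "t \<in> {0..T}"
 shows "(\<Sum>k<Suc N. (- \<nu>) ^ k * ws w0 k t) = w0 t - \<nu> * KK (%t. \<Sum>k<N. (- \<nu>) ^ k * ws w0 k t) t"
proof (induction N)
 case 0
 have "avg (%x. 0) s = 0" for s unfolding avg_def by simp
 then show ?case by (simp add: KK_def)
next
 case (Suc N)
 have "KK (%t. \<Sum>k<Suc N. (- \<nu>) ^ k * ws w0 k t) t = KK (%t. \<Sum>k<N. (- \<nu>) ^ k * ws w0 k t) t + (- \<nu>) ^ N * ws w0 (Suc N) t"
  using KK_lin[of "%t. \<Sum>k<N. (- \<nu>) ^ k * ws w0 k t" "ws w0 N" t "(- \<nu>) ^ N"] t ws_cont[OF w0] by (simp add: ws_Suc continuous_intros)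
 then show ?case using Suc by (simp add: algebra_simps)
qed

lemma KK_close:
 assumes u: "continuous_on {0..T} u" and v: "continuous_on {0..T} v" and t: "t \<in> {0..T}"
  and b: "\<And>x. x \<in> {0..T} ==> \<bar>u x - v x\<bar> \<le> B"
 shows "\<bar>KK u t - KK v t\<bar> \<le> CC * B * T"
proof -
 have "KK (%x. u x + (-1) * v x) t = KK u t + (-1) * KK v t" by (rule KK_lin[OF u v t])
 moreover have B: "0 \<le> B" using b[OF t] by linarith
 moreover have "\<bar>KK (%x. u x + (-1) * v x) t\<bar> \<le> CC * B * (T - t) ^ Suc 0 / real (Suc 0)"
  using b t B by (intro KK_bound continuous_intros u v) auto
 moreover from B have "CC * B * (T - t) \<le> CC * B * T" using CC t by (intro mult_left_mono) auto
 ultimately show ?thesis by simp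
qed

text \<open>The recursion \<open>KK_partial\<close> passes to the limit: the partial sums converge
  uniformly on {0..T}, and \<open>KK\<close> is Lipschitz in the supremum norm by
  \<open>KK_close\<close>.\<close>

lemma WW_eq:
 assumes w0: "continuous_on {0..T} w0" and t: "t \<in> {0..T}"
 shows "WW w0 \<nu> t = w0 t - \<nu> * KK (WW w0 \<nu>) t"
proof -
 define S where "S N t = (\<Sum>k<N. (- \<nu>) ^ k * ws w0 k t)" for N t
 have S: "continuous_on {0..T} (S N)" for N unfolding S_def by (intro continuous_intros ws_cont[OF w0])
 have ul: "\<forall>\<^sub>F N in sequentially. \<forall>x\<in>{0..T}. \<bar>S N x - WW w0 \<nu> x\<bar> < e" if "e > 0" for e
 proof -
  have "\<forall>\<^sub>F N in sequentially. \<forall>x\<in>{- \<bar>\<nu>\<bar>..\<bar>\<nu>\<bar>} \<times> {0..T}. dist (case x of (\<nu>, t) => \<Sum>k<N. (- \<nu>) ^ k * ws w0 k t) (case x of (\<nu>, t) => WW w0 \<nu> t) < e"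
   using uniform_limitD[OF WW_uniform[OF w0, of "\<bar>\<nu>\<bar>"] that] .
  then show ?thesis
  proof eventually_elim
   case (elim N)
   show ?case
   proof
    fix x assume "x \<in> {0..T}"
    then have "(\<nu>, x) \<in> {- \<bar>\<nu>\<bar>..\<bar>\<nu>\<bar>} \<times> {0..T}" using abs_ge_self[of \<nu>] abs_ge_minus_self[of \<nu>] by simp
    from bspec[OF elim this] show "\<bar>S N x - WW w0 \<nu> x\<bar> < e" by (simp add: S_def dist_real_def)
   qed
  qed
 qed
 have lim: "(%N. S N t) \<longlonglongrightarrow> WW w0 \<nu> t" unfolding tendsto_iff dist_real_def
 proof (intro allI impI)
  fix e :: real assume "0 < e"
  from ul[OF this] show "\<forall>\<^sub>F x in sequentially. \<bar>S x t - WW w0 \<nu> t\<bar> < e" by eventually_elim (use t in auto)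
 qed
 have "(%N. KK (S N) t) \<longlonglongrightarrow> KK (WW w0 \<nu>) t" unfolding tendsto_iff
 proof (intro allI impI)
  fix e :: real assume e: "0 < e"
  define d where "d = e / (2 * CC * T)"
  have d: "d > 0" unfolding d_def using e CC T_pos by simp
  from ul[OF d] show "\<forall>\<^sub>F N in sequentially. dist (KK (S N) t) (KK (WW w0 \<nu>) t) < e"
  proof eventually_elim
   case (elim N)
   have "\<bar>KK (S N) t - KK (WW w0 \<nu>) t\<bar> \<le> CC * d * T" using elim by (intro KK_close S WW_cont w0 t) (auto intro: less_imp_le)
   also have "CC * d * T = e / 2" unfolding d_def using CC T_pos by simp
   finally show ?case using e by (simp add: dist_real_def)
  qed
 qed
 then have "(%N. w0 t - \<nu> * KK (S N) t) \<longlonglongrightarrow> w0 t - \<nu> * KK (WW w0 \<nu>) t" by (intro tendsto_intros)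
 moreover have "(%N. w0 t - \<nu> * KK (S N) t) = (%N. S (Suc N) t)" unfolding S_def using KK_partial[OF w0 t] by auto
 ultimately have "(%N. S (Suc N) t) \<longlonglongrightarrow> w0 t - \<nu> * KK (WW w0 \<nu>) t" by simp
 moreover have "(%N. S (Suc N) t) \<longlonglongrightarrow> WW w0 \<nu> t" using lim by (rule LIMSEQ_Suc)
 ultimately show ?thesis using LIMSEQ_unique by blast
qed

text \<open>The equation (n W')' = - \<nu> W solved for W''. Where n vanishes, W1 need not be
  differentiable; only the limiting form of the equation at T is recorded, which is what makes W o k
  twice continuously differentiable at a zero of the field.\<close>

definition sol :: "real => (real => real) => (real => real) => bool" where
 "sol \<nu> W W1 \<longleftrightarrow> continuous_on {0..T} W1 \<and>
   (\<forall>t\<in>{0..T}. (W has_real_derivative W1 t) (at t within {0..T})) \<and>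
   (\<forall>t\<in>{0..T}. 0 < n t --> (W1 has_real_derivative - (\<nu> * W t + dn t * W1 t) / n t) (at t within {0..T})) \<and>
   (n T = 0 --> \<nu> * W T + dn T * W1 T = 0)"

lemma solD:
 assumes "sol \<nu> W W1"
 shows "continuous_on {0..T} W1" "t \<in> {0..T} ==> (W has_real_derivative W1 t) (at t within {0..T})"
  "t \<in> {0..T} ==> 0 < n t ==> (W1 has_real_derivative - (\<nu> * W t + dn t * W1 t) / n t) (at t within {0..T})"
  "n T = 0 ==> \<nu> * W T + dn T * W1 T = 0" using assms unfolding sol_def by simp_all

lemma sol_cont: "sol \<nu> W W1 ==> continuous_on {0..T} W" by (rule DERIV_continuous_on[OF solD(2)])

lemma sol_add:
 assumes "sol \<nu> W W1" "sol \<nu> V V1"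
 shows "sol \<nu> (%t. W t + e * V t) (%t. W1 t + e * V1 t)" unfolding sol_def
proof (intro conjI ballI impI)
 show "continuous_on {0..T} (%t. W1 t + e * V1 t)" by (intro continuous_intros solD(1)[OF assms(1)] solD(1)[OF assms(2)])
 fix t assume t: "t \<in> {0..T}"
 show "((%t. W t + e * V t) has_real_derivative W1 t + e * V1 t) (at t within {0..T})"
  by (intro DERIV_add DERIV_cmult solD(2)[OF assms(1) t] solD(2)[OF assms(2) t])
 assume nt: "0 < n t"
 have "((%t. W1 t + e * V1 t) has_real_derivative - (\<nu> * W t + dn t * W1 t) / n t + e * (- (\<nu> * V t + dn t * V1 t) / n t)) (at t within {0..T})"
  by (intro DERIV_add DERIV_cmult solD(3)[OF assms(1) t nt] solD(3)[OF assms(2) t nt])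
 moreover have "- (\<nu> * W t + dn t * W1 t) / n t + e * (- (\<nu> * V t + dn t * V1 t) / n t) =
  - (\<nu> * (W t + e * V t) + dn t * (W1 t + e * V1 t)) / n t" using nt by (simp add: field_simps)
 ultimately show "((%t. W1 t + e * V1 t) has_real_derivative - (\<nu> * (W t + e * V t) + dn t * (W1 t + e * V1 t)) / n t) (at t within {0..T})" by simp
next
 assume n: "n T = 0"
 have "\<nu> * (W T + e * V T) + dn T * (W1 T + e * V1 T) = (\<nu> * W T + dn T * W1 T) + e * (\<nu> * V T + dn T * V1 T)" by (simp add: algebra_simps)
 then show "\<nu> * (W T + e * V T) + dn T * (W1 T + e * V1 T) = 0" using solD(4)[OF assms(1) n] solD(4)[OF assms(2) n] by simp
qed

definition WW1 :: "(real => real) => (real => real) => real => real => real" where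
 "WW1 w0 w0' \<nu> t = w0' t + \<nu> * (rr t * avg (WW w0 \<nu>) t)"

text \<open>The start \<open>w0\<close> solves the equation for \<nu> = 0, its flux n w0' being the
  constant \<open>c0\<close>. For general \<nu> the flux n W' is \<open>c0\<close> plus \<nu> times
  the integral of W from t to T, and the quotient of this by n is differentiated.\<close>

lemma WW_sol:
 assumes d: "\<And>t. t \<in> {0..T} ==> (w0 has_real_derivative w0' t) (at t within {0..T})" and c: "continuous_on {0..T} w0'"
  and c0: "\<And>t. t \<in> {0..T} ==> n t * w0' t = c0" and e: "n T = 0 ==> w0' T = 0"
 shows "sol \<nu> (WW w0 \<nu>) (WW1 w0 w0' \<nu>)"
proof -
 have w0: "continuous_on {0..T} w0" by (rule DERIV_continuous_on[OF d])
 note W = WW_cont[OF w0, of \<nu>]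
 show ?thesis unfolding sol_def
 proof (intro conjI ballI impI)
  show "continuous_on {0..T} (WW1 w0 w0' \<nu>)" unfolding WW1_def by (intro continuous_intros c rr_cont avg_cont W)
  fix t assume t: "t \<in> {0..T}"
  have "((%t. w0 t - \<nu> * KK (WW w0 \<nu>) t) has_real_derivative w0' t - \<nu> * - (rr t * avg (WW w0 \<nu>) t)) (at t within {0..T})"
   by (intro DERIV_diff DERIV_cmult d t KK_deriv W)
  then show "(WW w0 \<nu> has_real_derivative WW1 w0 w0' \<nu> t) (at t within {0..T})"
   using has_field_derivative_transform_within[of _ _ t "{0..T}" 1 "WW w0 \<nu>"] t WW_eq[OF w0] unfolding WW1_def by simp
  assume nt: "0 < n t"
  define I where "I s = integral {s..T} (WW w0 \<nu>)" for s
  have nW: "n s * WW1 w0 w0' \<nu> s = c0 + \<nu> * I s" if s: "s \<in> {0..T}" for s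
  proof -
   have "n s * WW1 w0 w0' \<nu> s = n s * w0' s + \<nu> * ((n s * rr s) * avg (WW w0 \<nu>) s)" unfolding WW1_def by (simp add: algebra_simps)
   then show ?thesis unfolding n_rr[OF s] c0[OF s] avg_integral[OF W s] I_def .
  qed
  have "\<exists>r>0. \<forall>s\<in>{0..T}. dist s t < r --> n s \<noteq> 0"
  proof (cases "n T = 0")
   case True
   then have "t < T" using nt t by (cases "t = T") auto
   then show ?thesis using n_pos t by (intro exI[of _ "T - t"]) (fastforce simp: dist_real_def)
  next
   case False then show ?thesis using n_zero by (intro exI[of _ 1]) (metis zero_less_one)
  qed
  then obtain r where r: "r > 0" "\<And>s. s \<in> {0..T} ==> dist s t < r ==> n s \<noteq> 0" by blast
  have "((%s. (c0 + \<nu> * I s) / n s) has_real_derivative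
    ((0 + \<nu> * - WW w0 \<nu> t) * n t - (c0 + \<nu> * I t) * dn t) / (n t * n t)) (at t within {0..T})"
   unfolding I_def using nt by (intro DERIV_divide DERIV_add DERIV_const DERIV_cmult tail_derivative W t dn) auto
  moreover have "((0 + \<nu> * - WW w0 \<nu> t) * n t - (c0 + \<nu> * I t) * dn t) / (n t * n t) =
    - (\<nu> * WW w0 \<nu> t + dn t * WW1 w0 w0' \<nu> t) / n t"
   unfolding nW[OF t, symmetric] using nt by (simp add: field_simps)
  ultimately have "((%s. (c0 + \<nu> * I s) / n s) has_real_derivative - (\<nu> * WW w0 \<nu> t + dn t * WW1 w0 w0' \<nu> t) / n t) (at t within {0..T})"
   by simp
  then show "(WW1 w0 w0' \<nu> has_real_derivative - (\<nu> * WW w0 \<nu> t + dn t * WW1 w0 w0' \<nu> t) / n t) (at t within {0..T})"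
  proof (rule has_field_derivative_transform_within[OF _ r(1) t])
   fix s assume s: "s \<in> {0..T}" "dist s t < r"
   then show "(c0 + \<nu> * I s) / n s = WW1 w0 w0' \<nu> s" using nW[OF s(1), symmetric] r(2)[OF s] by simp
  qed
 next
  assume nT: "n T = 0"
  have "T * 0 = 0" by simp
  have "avg (WW w0 \<nu>) T = WW w0 \<nu> T" unfolding avg_def by simp
  then show "\<nu> * WW w0 \<nu> T + dn T * WW1 w0 w0' \<nu> T = 0" unfolding WW1_def e[OF nT] rr_def using nT n_end by simp
 qed
qed

section \<open>Positivity of solutions and the shooting alternative\<close>

lemma at_interior: "0 < t ==> t < T ==> at t within {0..T} = at t" by (rule at_within_interior) auto

text \<open>Continuation in \<nu>. At the least \<nu> for which U has a zero, that zero is interior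
  and a minimum of W \<ge> 0, so W' = 0 there. Beyond it the flux n W' does not increase, hence W
  does not increase, stays 0 up to T, and U vanishes at T by continuity, a contradiction. The factor
  \<open>h\<close> allows W itself to vanish at T.\<close>

lemma positive_of_ends:
 assumes m: "0 \<le> m" and s: "\<And>\<nu>. \<nu> \<in> {0..m} ==> sol \<nu> (W \<nu>) (W1 \<nu>)"
  and U: "continuous_on ({0..m} \<times> {0..T}) (%(\<nu>,t). U \<nu> t)"
  and WU: "\<And>\<nu> t. \<nu> \<in> {0..m} ==> t \<in> {0..T} ==> W \<nu> t = h t * U \<nu> t"
  and h: "\<And>t. 0 \<le> t ==> t < T ==> 0 < h t" "0 \<le> h T"
  and U0: "\<And>t. t \<in> {0..T} ==> 0 < U 0 t"
  and e: "\<And>\<nu>. \<nu> \<in> {0..m} ==> 0 < U \<nu> 0" "\<And>\<nu>. \<nu> \<in> {0..m} ==> 0 < U \<nu> T"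
  and t: "t \<in> {0..T}"
 shows "0 < U m t"
proof (rule ccontr)
 assume neg: "\<not> 0 < U m t"
 have Uc1: "continuous_on {0..m} (%\<nu>. U \<nu> t)" if "t \<in> {0..T}" for t
 proof -
  have "continuous_on {0..m} ((%(\<nu>,t). U \<nu> t) \<circ> (%\<nu>. (\<nu>,t)))"
   by (rule continuous_on_compose) (use that in \<open>auto intro!: continuous_intros continuous_on_subset[OF U]\<close>)
  then show ?thesis by (simp add: o_def)
 qed
 have Uc2: "continuous_on {0..T} (U \<nu>)" if "\<nu> \<in> {0..m}" for \<nu>
 proof -
  have "continuous_on {0..T} ((%(\<nu>,t). U \<nu> t) \<circ> (%t. (\<nu>,t)))"
   by (rule continuous_on_compose) (use that in \<open>auto intro!: continuous_intros continuous_on_subset[OF U]\<close>)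
  then show ?thesis by (simp add: o_def)
 qed
 define D where "D = {p \<in> {0..m} \<times> {0..T}. (%(\<nu>,t). U \<nu> t) p \<le> 0}"
 have "closed D" unfolding D_def by (rule continuous_on_closed_Collect_le[OF U]) (auto intro: closed_Times)
 moreover have "bounded D" by (rule bounded_subset[of "{0..m} \<times> {0..T}"]) (auto simp: D_def intro: bounded_Times)
 ultimately have "compact D" using compact_eq_bounded_closed by blast
 then have cB: "compact (fst ` D)" by (intro compact_continuous_image continuous_intros)
 have "(m, t) \<in> D" unfolding D_def using neg m t by auto
 then have "fst ` D \<noteq> {}" by blast
 then obtain \<mu> where mu: "\<mu> \<in> fst ` D" and least: "\<And>\<nu>. \<nu> \<in> fst ` D ==> \<mu> \<le> \<nu>"
  using compact_attains_inf[OF cB] by blast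
 obtain t1 where t1: "\<mu> \<in> {0..m}" "t1 \<in> {0..T}" "U \<mu> t1 \<le> 0" using mu unfolding D_def by auto
 have pos: "0 < U \<nu> s" if "0 \<le> \<nu>" "\<nu> < \<mu>" "s \<in> {0..T}" for \<nu> s
 proof (rule ccontr)
  assume "\<not> 0 < U \<nu> s"
  then have "(\<nu>, s) \<in> D" unfolding D_def using that t1(1) by auto
  then show False using least[of \<nu>] that(2) by force
 qed
 have mu0: "0 < \<mu>" using U0[OF t1(2)] t1 by (cases "\<mu> = 0") auto
 have nn: "0 \<le> U \<mu> s" if s: "s \<in> {0..T}" for s
 proof (rule continuous_ge_on_closure[of "{0..<\<mu>}" "%\<nu>. U \<nu> s"])
  show "continuous_on (closure {0..<\<mu>}) (%\<nu>. U \<nu> s)" using t1(1) mu0 by (intro continuous_on_subset[OF Uc1[OF s]]) auto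
  show "\<mu> \<in> closure {0..<\<mu>}" using mu0 by auto
 qed (use pos s in \<open>force intro: less_imp_le\<close>)
 have z: "U \<mu> t1 = 0" using nn[OF t1(2)] t1(3) by simp
 have t1i: "0 < t1" "t1 < T" using z e[OF t1(1)] t1(2) by (cases "t1 = 0"; cases "t1 = T"; force)+
 note S = s[OF t1(1)]
 define V where "V = W \<mu>"
 define V1 where "V1 = W1 \<mu>"
 note S = S[folded V_def V1_def]
 have Vnn: "0 \<le> V s" if "s \<in> {0..T}" for s
 proof -
  have "0 \<le> h s" using h(1)[of s] h(2) that by (cases "s = T") (auto intro: less_imp_le)
  then show ?thesis unfolding V_def WU[OF t1(1) that] using nn[OF that] by simp
 qed
 have Vt1: "V t1 = 0" unfolding V_def WU[OF t1(1,2)] z by simp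
 have dV: "DERIV V s :> V1 s" if "0 < s" "s < T" for s using solD(2)[OF S, of s] that at_interior[OF that] by auto
 have V1t1: "V1 t1 = 0"
 proof (rule DERIV_local_min[OF dV[OF t1i]])
  show "0 < min t1 (T - t1)" using t1i by auto
  show "\<forall>y. \<bar>t1 - y\<bar> < min t1 (T - t1) --> V t1 \<le> V y"
  proof (intro allI impI)
   fix y assume "\<bar>t1 - y\<bar> < min t1 (T - t1)"
   then have "y \<in> {0..T}" using t1i by (simp add: abs_less_iff)
   then show "V t1 \<le> V y" using Vnn Vt1 by simp
  qed
 qed
 have dP: "DERIV (%s. n s * V1 s) s :> - (\<mu> * V s)" if "0 < s" "s < T" for s
 proof -
  have ns: "0 < n s" using n_pos that by auto
  have "DERIV (%s. n s * V1 s) s :> dn s * V1 s + - (\<mu> * V s + dn s * V1 s) / n s * n s"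
   using DERIV_mult[OF dn[of s] solD(3)[OF S, of s]] that ns at_interior[OF that] by auto
  then show ?thesis using ns by simp
 qed
 have V1le: "V1 s \<le> 0" if "t1 \<le> s" "s < T" for s
 proof -
  have "n s * V1 s \<le> n t1 * V1 t1"
  proof (rule DERIV_nonpos_imp_nonincreasing[OF that(1)])
   fix x assume "t1 \<le> x" "x \<le> s"
   then show "\<exists>y. DERIV (%s. n s * V1 s) x :> y \<and> y \<le> 0" using dP[of x] Vnn[of x] mu0 t1i that by (intro exI[of _ "- (\<mu> * V x)"]) auto
  qed
  then show ?thesis using V1t1 n_pos[of s] that t1i by (simp add: mult_le_0_iff)
 qed
 have Vz: "V s = 0" if "t1 \<le> s" "s < T" for s
 proof -
  have "V s \<le> V t1"
  proof (rule DERIV_nonpos_imp_nonincreasing[OF that(1)])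
   fix x assume "t1 \<le> x" "x \<le> s"
   then show "\<exists>y. DERIV V x :> y \<and> y \<le> 0" using dV[of x] V1le[of x] t1i that by (intro exI[of _ "V1 x"]) auto
  qed
  then show ?thesis using Vt1 Vnn[of s] that t1i by auto
 qed
 have Uz: "U \<mu> s = 0" if "t1 \<le> s" "s < T" for s using Vz[OF that] WU[OF t1(1), of s] h(1)[of s] that t1i unfolding V_def by auto
 have "U \<mu> T \<le> 0"
 proof (rule continuous_le_on_closure[of "{t1..<T}" "U \<mu>"])
  show "continuous_on (closure {t1..<T}) (U \<mu>)" using t1i by (intro continuous_on_subset[OF Uc2[OF t1(1)]]) auto
  show "T \<in> closure {t1..<T}" using t1i by auto
 qed (use Uz in auto)
 then show False using e(2)[OF t1(1)] by simp
qed

lemma WW_zero: "continuous_on {0..T} w0 ==> t \<in> {0..T} ==> WW w0 0 t = w0 t" using WW_eq[of w0 t 0] by simp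

lemma WW_end: "continuous_on {0..T} w0 ==> WW w0 \<nu> T = w0 T" using WW_eq[of w0 T \<nu>] T_pos by (simp add: KK_def)

text \<open>The solution with W(T) = 1 and no flux at T; if \<open>n T = 0\<close>, this is the one
  that is regular at T.\<close>

lemma neumann_sol: "n T = 0 \<or> 0 < n T ==> sol \<nu> (WW (%_. 1) \<nu>) (WW1 (%_. 1) (%_. 0) \<nu>)" by (rule WW_sol[where ?c0.0 = 0]) auto

lemma ivt_positive:
 assumes f: "continuous_on {0..m} f" and m: "0 \<le> m" and "0 < f 0" and nz: "\<And>x. x \<in> {0..m} ==> f x \<noteq> (0::real)"
  and x: "x \<in> {0..m::real}"
 shows "0 < f x"
proof (rule ccontr)
 assume "\<not> 0 < f x"
 then have "\<exists>y\<ge>0. y \<le> x \<and> f y = 0" using IVT2'[of f x 0 0] continuous_on_subset[OF f, of "{0..x}"] x assms(3) by auto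
 then show False using nz x by force
qed

text \<open>If \<open>n T = 0\<close>, the solution regular at T is followed as \<nu> grows until it
  vanishes at 0; no condition is imposed at T, which then comes from interior points of the surface.
  If \<open>n T > 0\<close>, the solution with W(T) = 0 is followed in the same way. Without an
  eigenvalue up to m it is positive except at T, and a small multiple of the solution with W(T) = 1
  repairs this end.\<close>

theorem shooting:
 assumes m: "0 \<le> m"
 shows "(\<exists>\<nu> W W1. 0 \<le> \<nu> \<and> \<nu> \<le> m \<and> sol \<nu> W W1 \<and> W 0 = 0 \<and> (0 < n T --> W T = 0) \<and> (\<exists>t\<in>{0..T}. W t \<noteq> 0)) \<or>
  (\<exists>W W1. sol m W W1 \<and> (\<forall>t\<in>{0..T}. 0 < W t))"
proof (cases "n T = 0")
 case True
 let ?w = "%_::real. 1::real"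
 have c: "continuous_on {0..T} ?w" by simp
 note s = neumann_sol[OF disjI1[OF True]]
 have U: "continuous_on ({0..m} \<times> {0..T}) (%(\<nu>,t). WW ?w \<nu> t)" using m by (intro continuous_on_subset[OF WW_cont2[OF c, of m]]) auto
 show ?thesis
 proof (cases "\<exists>\<nu>\<in>{0..m}. WW ?w \<nu> 0 = 0")
  case True2: True
  then obtain \<nu> where "\<nu> \<in> {0..m}" "WW ?w \<nu> 0 = 0" by blast
  moreover have "WW ?w \<nu> T \<noteq> 0" using WW_end[OF c] by simp
  ultimately show ?thesis using s[of \<nu>] True T_pos by (intro disjI1 exI[of _ \<nu>] exI[of _ "WW ?w \<nu>"] exI[of _ "WW1 ?w (%_. 0) \<nu>"]) auto
 next
  case False
  have c0: "continuous_on {0..m} (%\<nu>. WW ?w \<nu> 0)"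
  proof -
   have "continuous_on {0..m} ((%(\<nu>,t). WW ?w \<nu> t) \<circ> (%\<nu>. (\<nu>,0)))"
    by (rule continuous_on_compose) (use T_pos in \<open>auto intro!: continuous_intros continuous_on_subset[OF U]\<close>)
   then show ?thesis by (simp add: o_def)
  qed
  have p0: "0 < WW ?w \<nu> 0" if "\<nu> \<in> {0..m}" for \<nu> using ivt_positive[OF c0 m _ _ that] False WW_zero[OF c, of 0] T_pos by auto
  have "0 < WW ?w m t" if "t \<in> {0..T}" for t
  proof (rule positive_of_ends[OF m s U _ _ _ _ _ _ that])
   show "WW ?w \<nu> t = (%_. 1) t * WW ?w \<nu> t" for \<nu> t by simp
  qed (use WW_zero[OF c] WW_end[OF c] p0 in auto)
  then show ?thesis using s[of m] by blast
 qed
next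
 case False
 then have nT: "0 < n T" using n_end by auto
 have np: "0 < n t" if "t \<in> {0..T}" for t using n_pos[of t] nT that by (cases "t = T") auto
 have ci: "continuous_on {0..T} (%s. 1 / n s)" using np by (intro continuous_intros n_cont) force
 \<comment> \<open>The solution for \<nu> = 0 that vanishes at T; its flux is -1.\<close>
 define w where "w t = integral {t..T} (%s. 1 / n s)" for t
 define w' where "w' t = - (1 / n t)" for t
 have dw: "(w has_real_derivative w' t) (at t within {0..T})" if "t \<in> {0..T}" for t unfolding w_def w'_def using tail_derivative[OF ci that] .
 have cw': "continuous_on {0..T} w'" unfolding w'_def by (intro continuous_intros ci)
 have cw: "continuous_on {0..T} w" by (rule DERIV_continuous_on[OF dw])
 have wT: "w T = 0" unfolding w_def by simp
 have s: "sol \<nu> (WW w \<nu>) (WW1 w w' \<nu>)" for \<nu>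
 proof (rule WW_sol[OF dw cw', where ?c0.0 = "-1"])
  show "n t * w' t = -1" if "t \<in> {0..T}" for t unfolding w'_def using np[OF that] by simp
 qed (use False in auto)
 \<comment> \<open>The quotient W / (T - t), written as an average of -W' so that it is continuous
   up to T, where its value 1 / n T is positive.\<close>
 define U where "U \<nu> = avg (%s. - WW1 w w' \<nu> s)" for \<nu>
 have WWc: "continuous_on ({0..m} \<times> {0..T}) (%(\<nu>,t). WW w \<nu> t)" using m by (intro continuous_on_subset[OF WW_cont2[OF cw, of m]]) auto
 have W1c: "continuous_on ({0..m} \<times> {0..T}) (%(\<nu>,t). - WW1 w w' \<nu> t)"
 proof -
  have 1: "continuous_on ({0..m} \<times> {0..T}) (%p. w' (snd p))" by (rule continuous_on_compose2[OF cw']) (auto intro!: continuous_intros)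
  have 2: "continuous_on ({0..m} \<times> {0..T}) (%p. rr (snd p))" by (rule continuous_on_compose2[OF rr_cont]) (auto intro!: continuous_intros)
  have 3: "continuous_on ({0..m} \<times> {0..T}) (%p. avg (WW w (fst p)) (snd p))" using avg_cont2[OF WWc] by (simp add: case_prod_beta)
  show ?thesis unfolding WW1_def case_prod_beta by (intro continuous_intros 1 2 3)
 qed
 have Uc: "continuous_on ({0..m} \<times> {0..T}) (%(\<nu>,t). U \<nu> t)" unfolding U_def by (rule avg_cont2[OF W1c])
 have WU: "WW w \<nu> t = (T - t) * U \<nu> t" if t: "t \<in> {0..T}" for \<nu> t
 proof -
  note c = solD(1)[OF s[of \<nu>]]
  have A: "(T - t) * U \<nu> t = integral {t..T} (%s. - WW1 w w' \<nu> s)" unfolding U_def by (rule avg_integral[OF continuous_on_minus[OF c] t])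
  have hi: "((%s. - WW1 w w' \<nu> s) has_integral (- WW w \<nu> T - - WW w \<nu> t)) {t..T}"
  proof (rule fundamental_theorem_of_calculus)
   fix x assume "x \<in> {t..T}"
   then have "((%s. - WW w \<nu> s) has_real_derivative - WW1 w w' \<nu> x) (at x within {t..T})"
    using t by (intro DERIV_minus DERIV_subset[OF solD(2)[OF s[of \<nu>]]]) auto
   then show "((%s. - WW w \<nu> s) has_vector_derivative - WW1 w w' \<nu> x) (at x within {t..T})"
    by (simp add: has_real_derivative_iff_has_vector_derivative)
  qed (use t in auto)
  show ?thesis unfolding A integral_unique[OF hi] using WW_end[OF cw, of \<nu>] wT by simp
 qed
 have UT: "0 < U \<nu> T" for \<nu>
 proof -
  have "U \<nu> T = - WW1 w w' \<nu> T" unfolding U_def avg_def by simp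
  also have "\<dots> = 1 / n T" unfolding WW1_def w'_def rr_def using nT by simp
  finally show ?thesis using nT by simp
 qed
 have wpos: "0 < w t" if "0 \<le> t" "t < T" for t
 proof -
  have "w T < w t"
  proof (rule DERIV_neg_imp_decreasing_open[OF that(2)])
   fix x assume x: "t < x" "x < T"
   then have "DERIV w x :> w' x" using dw[of x] at_interior[of x] that by auto
   moreover have "w' x < 0" unfolding w'_def using np[of x] x that by auto
   ultimately show "\<exists>y. DERIV w x :> y \<and> y < 0" by blast
  qed (use that in \<open>auto intro: continuous_on_subset[OF cw]\<close>)
  then show ?thesis using wT by simp
 qed
 have U0: "0 < U 0 t" if "t \<in> {0..T}" for t
 proof (cases "t = T")
  case False
  then have "0 < (T - t) * U 0 t" "0 < T - t" using WU[OF that, of 0] WW_zero[OF cw that] wpos[of t] that by auto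
  then show ?thesis using zero_less_mult_pos by blast
 qed (use UT in simp)
 show ?thesis
 proof (cases "\<exists>\<nu>\<in>{0..m}. U \<nu> 0 = 0")
  case True
  then obtain \<nu> where nu: "\<nu> \<in> {0..m}" "U \<nu> 0 = 0" by blast
  have "WW w \<nu> 0 = 0" "WW w \<nu> T = 0" using WU[of 0 \<nu>] WU[of T \<nu>] nu T_pos by auto
  moreover have "\<exists>t\<in>{0..T}. WW w \<nu> t \<noteq> 0"
  proof (rule ccontr)
   assume "\<not> (\<exists>t\<in>{0..T}. WW w \<nu> t \<noteq> 0)"
   then have z: "U \<nu> t = 0" if "t \<in> {0..<T}" for t using WU[of t \<nu>] that by force
   have "U \<nu> T \<le> 0"
   proof (rule continuous_le_on_closure[of "{0..<T}" "U \<nu>"])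
    show "continuous_on (closure {0..<T}) (U \<nu>)" unfolding U_def using T_pos by (auto intro!: avg_cont continuous_intros solD(1)[OF s[of \<nu>]])
    show "T \<in> closure {0..<T}" using T_pos by auto
   qed (use z in auto)
   then show False using UT[of \<nu>] by simp
  qed
  ultimately show ?thesis using s[of \<nu>] nu by auto
 next
  case False
  have c0: "continuous_on {0..m} (%\<nu>. U \<nu> 0)"
  proof -
   have "continuous_on {0..m} ((%(\<nu>,t). U \<nu> t) \<circ> (%\<nu>. (\<nu>,0)))"
    by (rule continuous_on_compose) (use T_pos in \<open>auto intro!: continuous_intros continuous_on_subset[OF Uc]\<close>)
   then show ?thesis by (simp add: o_def)
  qed
  have p0: "0 < U \<nu> 0" if "\<nu> \<in> {0..m}" for \<nu> using ivt_positive[OF c0 m _ _ that] False U0[of 0] T_pos by auto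
  have Um: "0 < U m t" if "t \<in> {0..T}" for t
  proof (rule positive_of_ends[OF m s Uc _ _ _ _ _ _ that])
   show "WW w \<nu> t = (%t. T - t) t * U \<nu> t" if "t \<in> {0..T}" for \<nu> t using WU[OF that] by simp
  qed (use U0 UT p0 in auto)
  let ?o = "%_::real. 1::real"
  have co: "continuous_on {0..T} ?o" by simp
  \<comment> \<open>Positive near T, hence it compensates the zero of the first solution at T; its
    sign elsewhere is not controlled.\<close>
  define V where "V = WW ?o m"
  have sV: "sol m V (WW1 ?o (%_. 0) m)" unfolding V_def by (rule neumann_sol) (use nT in simp)
  have Vc: "continuous_on {0..T} V" by (rule sol_cont[OF sV])
  have VT: "V T = 1" unfolding V_def using WW_end[OF co] by simp
  have Uc2: "continuous_on {0..T} (U m)" unfolding U_def by (intro avg_cont continuous_intros solD(1)[OF s[of m]])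
  obtain d where d: "0 < d" "\<And>x. x \<in> {0..T} ==> dist x T < d ==> dist (V x) (V T) < 1"
   using Vc T_pos unfolding continuous_on_iff by (metis atLeastAtMost_iff less_eq_real_def zero_less_one)
  obtain u where u: "u \<in> {0..T}" "\<And>x. x \<in> {0..T} ==> U m u \<le> U m x" using continuous_attains_inf[OF _ _ Uc2] T_pos by auto
  obtain v where v: "v \<in> {0..T}" "\<And>x. x \<in> {0..T} ==> \<bar>V x\<bar> \<le> \<bar>V v\<bar>"
   using continuous_attains_sup[OF _ _ continuous_on_rabs[OF Vc]] T_pos by auto
  \<comment> \<open>Near T both summands are nonnegative. At distance at least d from T the first
    one is at least d times the minimum of U, and e keeps the second below half of that.\<close>
  define e where "e = d * U m u / (2 * (\<bar>V v\<bar> + 1))"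
  have e: "0 < e" unfolding e_def using d(1) Um[OF u(1)] by (intro divide_pos_pos mult_pos_pos) auto
  have "0 < WW w m t + e * V t" if t: "t \<in> {0..T}" for t
  proof (cases "dist t T < d")
   case True
   then have "0 < V t" using d(2)[OF t] VT by (auto simp: dist_real_def)
   then have "0 < e * V t" using e by simp
   moreover have "0 \<le> WW w m t" using WU[OF t, of m] Um[OF t] t by simp
   ultimately show ?thesis by simp
  next
   case False
   then have dt: "d \<le> T - t" using t by (auto simp: dist_real_def)
   have "d * U m u \<le> (T - t) * U m t" by (rule mult_mono[OF dt u(2)[OF t]]) (use t Um[OF u(1)] in auto)
   then have 1: "d * U m u \<le> WW w m t" unfolding WU[OF t] .
   have "e * \<bar>V t\<bar> \<le> e * (\<bar>V v\<bar> + 1)" using v(2)[OF t] e by (intro mult_left_mono) auto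
   also have "\<dots> = d * U m u / 2" unfolding e_def by (simp add: field_simps)
   also have "\<dots> < d * U m u" using d(1) Um[OF u(1)] by simp
   finally have "\<bar>e * V t\<bar> < d * U m u" using e by (simp add: abs_mult)
   then show ?thesis using 1 by linarith
  qed
  then show ?thesis using sol_add[OF s[of m] sV, of e] by blast
 qed
qed

end

section \<open>Level functions with connected fibres\<close>

lemma connectedin_two:
 assumes "connectedin X S" "openin X A" "openin X B" "S \<subseteq> A \<union> B" "A \<inter> B \<inter> S = {}"
 shows "S \<subseteq> A \<or> S \<subseteq> B"
proof -
 have "A \<inter> S = {} \<or> B \<inter> S = {}" using assms unfolding connectedin by meson
 then show ?thesis using assms(4) by auto
qed

lemma connectedin_iff_two:
 "connectedin X S \<longleftrightarrow> S \<subseteq> topspace X \<and> (\<forall>A B. openin X A \<and> openin X B \<and> S \<subseteq> A \<union> B \<and> A \<inter> B \<inter> S = {}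
   --> S \<subseteq> A \<or> S \<subseteq> B)" (is "_ \<longleftrightarrow> ?R")
proof
 assume "connectedin X S" then show ?R using connectedin_two[of X S] connectedin_subset_topspace by blast
next
 assume R: ?R
 show "connectedin X S" unfolding connectedin
 proof (intro conjI notI)
  show "S \<subseteq> topspace X" using R by blast
  assume "\<exists>E1 E2. openin X E1 \<and> openin X E2 \<and> S \<subseteq> E1 \<union> E2 \<and> E1 \<inter> E2 \<inter> S = {} \<and> E1 \<inter> S \<noteq> {} \<and> E2 \<inter> S \<noteq> {}"
  then obtain A B where A: "openin X A" "openin X B" "S \<subseteq> A \<union> B" "A \<inter> B \<inter> S = {}" "A \<inter> S \<noteq> {}" "B \<inter> S \<noteq> {}"
   by (elim exE conjE)
  then have "S \<subseteq> A \<or> S \<subseteq> B" using R by simp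
  then show False using A(4-6) by auto
 qed
qed

text \<open>All that the global construction needs to know about a point: h is open onto an interval
  J and has connected fibres. J is open at regular points and half-open where \<open>a\<close> is an
  extremal value, which happens at the boundary and at zeros of the field.\<close>

definition level_patch :: "'a topology => ('a => real) => real => 'a set => real set => real => bool" where
 "level_patch X h a U J e \<longleftrightarrow> openin X U \<and> e > 0 \<and>
   J \<in> {{a - e<..<a + e}, {a..<a + e}, {a - e<..a}} \<and> h ` U = J \<and>
   (\<forall>V. openin X V \<and> V \<subseteq> U --> openin (top_of_set J) (h ` V)) \<and>
   (\<forall>v. connectedin X {y\<in>U. h y = v})"

lemma level_patchD:
 assumes "level_patch X h a U J e"
 shows "openin X U" "e > 0" "J = {a - e<..<a + e} \<or> J = {a..<a + e} \<or> J = {a - e<..a}"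
  "h ` U = J" "\<And>V. openin X V ==> V \<subseteq> U ==> openin (top_of_set J) (h ` V)"
  "\<And>v. connectedin X {y\<in>U. h y = v}" "y \<in> U ==> h y \<in> J" using assms unfolding level_patch_def by auto

text \<open>
 \<open>loc U h\<close> says that \<open>h\<close> is a primitive on \<open>U\<close> of a fixed closed one-form, whose zeros are local extrema of the
 primitives.
\<close>

locale level_foliation =
 fixes X :: "'a topology" and loc :: "'a set => ('a => real) => bool"
 assumes compact_X: "compact_space X"
  and Hausdorff_X: "Hausdorff_space X"
  and connected_X: "connected_space X"
  and loc_open: "loc U h ==> openin X U"
  and loc_cont: "loc U h ==> continuous_map (subtopology X U) euclideanreal h"
  and loc_local: "[|openin X U; \<And>x. x \<in> U ==> \<exists>V k. loc V k \<and> x \<in> V \<and> (\<forall>y\<in>V \<inter> U. k y = h y)|] ==> loc U h"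
  and loc_shift: "loc U h ==> loc U (%x. h x + c)"
  and loc_unique: "[|loc U h; loc U h'; x \<in> U; h x = h' x|] ==>
    \<exists>V. openin X V \<and> x \<in> V \<and> V \<subseteq> U \<and> (\<forall>y\<in>V. h y = h' y)"
  and loc_exists: "x \<in> topspace X ==> \<exists>U h. loc U h \<and> x \<in> U"
  and loc_patch: "[|loc G h; x \<in> G|] ==> \<exists>U J e. level_patch X h (h x) U J e \<and> x \<in> U \<and> U \<subseteq> G"
begin

section \<open>Local extrema of primitives\<close>

definition lmin :: "'a => bool" where
 "lmin x \<longleftrightarrow> (\<exists>U h. loc U h \<and> x \<in> U \<and> (\<forall>y\<in>U. h x \<le> h y))"
definition lmax :: "'a => bool" where
 "lmax x \<longleftrightarrow> (\<exists>U h. loc U h \<and> x \<in> U \<and> (\<forall>y\<in>U. h y \<le> h x))"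

lemma loc_sub: "U \<subseteq> topspace X" if "loc U h" using loc_open[OF that] openin_subset by blast

lemma loc_restrict: "loc V h" if "loc U h" "openin X V" "V \<subseteq> U" using that by (intro loc_local) auto

lemma loc_cong: "loc U h'" if "loc U h" "\<And>y. y \<in> U ==> h' y = h y" using that loc_open[OF that(1)] by (intro loc_local[of U h']) auto

lemma loc_unique_shift:
 assumes "loc U h" "loc W h'" "x \<in> U" "x \<in> W"
 shows "\<exists>V. openin X V \<and> x \<in> V \<and> V \<subseteq> U \<inter> W \<and> (\<forall>y\<in>V. h y = h' y + (h x - h' x))"
proof -
 have o: "openin X (U \<inter> W)" using assms loc_open by blast
 have 1: "loc (U \<inter> W) h" using loc_restrict[OF assms(1) o] by auto
 have 2: "loc (U \<inter> W) (%y. h' y + (h x - h' x))" using loc_restrict[OF loc_shift[OF assms(2)] o] by auto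
 show ?thesis using loc_unique[OF 1 2, of x] assms by auto
qed

lemma preimage_open:
 assumes "loc U h" "open T" shows "openin X {y\<in>U. h y \<in> T}"
proof -
 have "openin (subtopology X U) {y \<in> topspace (subtopology X U). h y \<in> T}"
  using openin_continuous_map_preimage[OF loc_cont[OF assms(1)]] assms(2) by simp
 then have "openin (subtopology X U) {y\<in>U. h y \<in> T}" using loc_sub[OF assms(1)] by (simp add: Int_absorb1 topspace_subtopology)
 then show ?thesis using loc_open[OF assms(1)] openin_open_subtopology by blast
qed

text \<open>Two primitives differ by a constant near a common point, so being a minimum does not
  depend on the primitive.\<close>

lemma lmin_iff: assumes "loc U h" "x \<in> U"
 shows "lmin x \<longleftrightarrow> (\<exists>V. openin X V \<and> x \<in> V \<and> V \<subseteq> U \<and> (\<forall>y\<in>V. h x \<le> h y))"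
proof
 assume "lmin x"
 then obtain W h' where W: "loc W h'" "x \<in> W" "\<forall>y\<in>W. h' x \<le> h' y" unfolding lmin_def by blast
 obtain V where V: "openin X V" "x \<in> V" "V \<subseteq> U \<inter> W" "\<forall>y\<in>V. h y = h' y + (h x - h' x)"
  using loc_unique_shift[OF assms(1) W(1) assms(2) W(2)] by blast
 have "V \<subseteq> U" "V \<subseteq> W" using V by auto
 show "\<exists>V. openin X V \<and> x \<in> V \<and> V \<subseteq> U \<and> (\<forall>y\<in>V. h x \<le> h y)"
 proof (intro exI[of _ V] conjI ballI)
  fix y assume "y \<in> V"
  then have "h y = h' y + (h x - h' x)" "h' x \<le> h' y" using V(4) W(3) \<open>V \<subseteq> W\<close> by blast+
  then show "h x \<le> h y" by simp
 qed (use V(1,2) \<open>V \<subseteq> U\<close> in auto)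
next
 assume "\<exists>V. openin X V \<and> x \<in> V \<and> V \<subseteq> U \<and> (\<forall>y\<in>V. h x \<le> h y)"
 then show "lmin x" unfolding lmin_def using loc_restrict[OF assms(1)] by blast
qed

lemma lmax_iff: assumes "loc U h" "x \<in> U"
 shows "lmax x \<longleftrightarrow> (\<exists>V. openin X V \<and> x \<in> V \<and> V \<subseteq> U \<and> (\<forall>y\<in>V. h y \<le> h x))"
proof
 assume "lmax x"
 then obtain W h' where W: "loc W h'" "x \<in> W" "\<forall>y\<in>W. h' y \<le> h' x" unfolding lmax_def by blast
 obtain V where V: "openin X V" "x \<in> V" "V \<subseteq> U \<inter> W" "\<forall>y\<in>V. h y = h' y + (h x - h' x)"
  using loc_unique_shift[OF assms(1) W(1) assms(2) W(2)] by blast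
 have "V \<subseteq> U" "V \<subseteq> W" using V by auto
 show "\<exists>V. openin X V \<and> x \<in> V \<and> V \<subseteq> U \<and> (\<forall>y\<in>V. h y \<le> h x)"
 proof (intro exI[of _ V] conjI ballI)
  fix y assume "y \<in> V"
  then have "h y = h' y + (h x - h' x)" "h' y \<le> h' x" using V(4) W(3) \<open>V \<subseteq> W\<close> by blast+
  then show "h y \<le> h x" by simp
 qed (use V(1,2) \<open>V \<subseteq> U\<close> in auto)
next
 assume "\<exists>V. openin X V \<and> x \<in> V \<and> V \<subseteq> U \<and> (\<forall>y\<in>V. h y \<le> h x)"
 then show "lmax x" unfolding lmax_def using loc_restrict[OF assms(1)] by blast
qed

lemma normal_X: "normal_space X" using compact_Hausdorff_or_regular_imp_normal_space compact_X Hausdorff_X by blast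

lemma normal_between:
 assumes "closedin X S" "openin X U" "S \<subseteq> U"
 obtains V C where "openin X V" "closedin X C" "S \<subseteq> V" "V \<subseteq> C" "C \<subseteq> U"
proof -
 obtain V where V: "openin X V" "S \<subseteq> V" "X closure_of V \<subseteq> U" using normal_X[unfolded normal_space_alt, THEN spec, THEN spec, THEN mp,
   OF conjI[OF assms(1) conjI[OF assms(2,3)]]] by auto
 show thesis by (rule that[OF V(1) closedin_closure_of V(2) closure_of_subset[OF openin_subset[OF V(1)]] V(3)])
qed

text \<open>Openness of h, used in place of motion along a transversal: arbitrarily near y all
  values of J close to \<open>h y\<close> are taken.\<close>

lemma patch_steps:
 assumes p: "level_patch X h a U J e" and V: "openin X V" "y \<in> V" "y \<in> U"
 obtains d where "d > 0" "\<And>v. v \<in> J ==> \<bar>v - h y\<bar> < d ==> \<exists>z\<in>V \<inter> U. h z = v"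
proof -
 have "openin (top_of_set J) (h ` (V \<inter> U))" using level_patchD(5)[OF p, of "V \<inter> U"] level_patchD(1)[OF p] V(1) by auto
 then obtain T where T: "open T" "h ` (V \<inter> U) = J \<inter> T" by (auto simp: openin_open)
 have "h y \<in> T" using T(2) V(2,3) by blast
 then obtain d where "d > 0" "\<And>v. \<bar>v - h y\<bar> < d ==> v \<in> T" using T(1) unfolding open_dist dist_real_def by blast
 with T that show thesis by (metis IntI imageE)
qed

lemma patch_not_lmin:
 assumes p: "level_patch X h a U J e" and G: "loc G h" "U \<subseteq> G" and y: "y \<in> U" "v \<in> J" "v < h y"
 shows "\<not> lmin y"
proof
 assume "lmin y"
 then obtain V where V: "openin X V" "y \<in> V" "\<forall>z\<in>V. h y \<le> h z" using lmin_iff[OF G(1), of y] subsetD[OF G(2) y(1)] by blast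
 obtain d where d: "d > 0" "\<And>v. v \<in> J ==> \<bar>v - h y\<bar> < d ==> \<exists>z\<in>V \<inter> U. h z = v"
  using patch_steps[OF p V(1,2) y(1)] by blast
 \<comment> \<open>J is an interval, so \<open>v\<close> may be replaced by a value of J that is
   still below \<open>h y\<close> but within reach of \<open>patch_steps\<close>.\<close>
 define v' where "v' = max v (h y - d/2)"
 have "v' \<in> J" using level_patchD(7)[OF p y(1)] level_patchD(3)[OF p] y d(1) unfolding v'_def by auto
 moreover have "\<bar>v' - h y\<bar> < d" "v' < h y" using d(1) y(3) unfolding v'_def by auto
 ultimately show False using d(2)[of v'] V(3) by fastforce
qed

lemma patch_not_lmax:
 assumes p: "level_patch X h a U J e" and G: "loc G h" "U \<subseteq> G" and y: "y \<in> U" "v \<in> J" "h y < v"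
 shows "\<not> lmax y"
proof
 assume "lmax y"
 then obtain V where V: "openin X V" "y \<in> V" "\<forall>z\<in>V. h z \<le> h y" using lmax_iff[OF G(1), of y] subsetD[OF G(2) y(1)] by blast
 obtain d where d: "d > 0" "\<And>v. v \<in> J ==> \<bar>v - h y\<bar> < d ==> \<exists>z\<in>V \<inter> U. h z = v"
  using patch_steps[OF p V(1,2) y(1)] by blast
 define v' where "v' = min v (h y + d/2)"
 have "v' \<in> J" using level_patchD(7)[OF p y(1)] level_patchD(3)[OF p] y d(1) unfolding v'_def by auto
 moreover have "\<bar>v' - h y\<bar> < d" "v' > h y" using d(1) y(3) unfolding v'_def by auto
 ultimately show False using d(2)[of v'] V(3) by fastforce
qed

lemma local_patch_at:
 assumes "x \<in> topspace X"
 obtains G h U J e where "loc G h" "x \<in> U" "U \<subseteq> G" "h x = 0" "level_patch X h 0 U J e"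
proof -
 obtain G h0 where G: "loc G h0" "x \<in> G" using loc_exists[OF assms] by blast
 define h where "h = (%y. h0 y + - h0 x)"
 have h: "loc G h" "h x = 0" unfolding h_def using loc_shift[OF G(1), of "- h0 x"] by auto
 obtain U J e where "level_patch X h (h x) U J e" "x \<in> U" "U \<subseteq> G" using loc_patch[OF h(1) G(2)] by blast
 then show thesis using that[OF h(1) _ _ h(2)] unfolding h(2) by blast
qed

text \<open>The local primitives agree on K because \<Phi> forces the value 0 there, but on overlaps
  away from K they may differ by constants. Only finitely many are needed, and the points where two
  of them differ form a closed set missing K, which is removed.\<close>

lemma glue_along:
 assumes K: "closedin X K"
  and L: "\<And>x. x \<in> K ==> \<exists>U h. loc U h \<and> x \<in> U \<and> (\<forall>y\<in>U. \<Phi> y (h y))"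
  and z: "\<And>y t. \<Phi> y t ==> y \<in> K ==> t = 0"
 shows "\<exists>G h. loc G h \<and> K \<subseteq> G \<and> (\<forall>y\<in>G. \<Phi> y (h y))"
proof -
 have cK: "compactin X K" using K compact_X closedin_compact_space by blast
 have "\<exists>U h V C. loc U h \<and> x \<in> V \<and> openin X V \<and> V \<subseteq> C \<and> closedin X C \<and> C \<subseteq> U \<and> (\<forall>y\<in>U. \<Phi> y (h y))"
  if x: "x \<in> K" for x
 proof -
  obtain U h where U: "loc U h" "x \<in> U" "\<forall>y\<in>U. \<Phi> y (h y)" using L[OF x] by blast
  have "closedin X {x}" using U loc_sub[OF U(1)] Hausdorff_X by (meson closedin_Hausdorff_singleton subsetD)
  then obtain V C where "openin X V" "closedin X C" "{x} \<subseteq> V" "V \<subseteq> C" "C \<subseteq> U"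
   using normal_between[of "{x}" U] loc_open[OF U(1)] U(2) by blast
  then show ?thesis using U by blast
 qed
 then obtain U h V C where UV: "\<And>x. x \<in> K ==> loc (U x) (h x) \<and> x \<in> V x \<and> openin X (V x) \<and> V x \<subseteq> C x \<and>
   closedin X (C x) \<and> C x \<subseteq> U x \<and> (\<forall>y\<in>U x. \<Phi> y (h x y))" by metis
 have UV1: "loc (U x) (h x)" "x \<in> V x" "openin X (V x)" "V x \<subseteq> C x" "closedin X (C x)" "C x \<subseteq> U x" "V x \<subseteq> U x" if "x \<in> K" for x
  using UV[OF that] by auto
 have UV2: "\<Phi> y (h x y)" if "x \<in> K" "y \<in> U x" for x y using UV[OF that(1)] that(2) by blast
 obtain F where F: "finite F" "F \<subseteq> K" "K \<subseteq> (\<Union>x\<in>F. V x)"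
 proof -
  have "\<forall>U\<in>V ` K. openin X U" "K \<subseteq> \<Union>(V ` K)" using UV1(2,3) by auto
  then obtain \<F> where "finite \<F>" "\<F> \<subseteq> V ` K" "K \<subseteq> \<Union>\<F>" using cK unfolding compactin_def by (meson)
  then show thesis using that by (metis finite_subset_image)
 qed
 \<comment> \<open>The closed cores \<open>C i\<close> are needed here: agreement is an open
   condition on the overlap of the open sets \<open>U i\<close>, so disagreement is closed only
   after restriction to closed sets inside them.\<close>
 define E where "E i j = {y \<in> C i \<inter> C j. h i y \<noteq> h j y}" for i j
 have Ecl: "closedin X (E i j)" if "i \<in> F" "j \<in> F" for i j
 proof -
  have ij: "i \<in> K" "j \<in> K" using that F by auto
  have "openin X {y \<in> U i \<inter> U j. h i y = h j y}"
  proof (subst openin_subopen, clarify)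
   fix y assume y: "y \<in> U i" "y \<in> U j" "h i y = h j y"
   obtain W where "openin X W" "y \<in> W" "W \<subseteq> U i \<inter> U j" "\<forall>z\<in>W. h i z = h j z + (h i y - h j y)"
    using loc_unique_shift[OF UV1(1)[OF ij(1)] UV1(1)[OF ij(2)] y(1,2)] by blast
   then show "\<exists>T. openin X T \<and> y \<in> T \<and> T \<subseteq> {y \<in> U i \<inter> U j. h i y = h j y}" using y by (intro exI[of _ W]) auto
  qed
  moreover have "E i j = C i \<inter> C j - {y \<in> U i \<inter> U j. h i y = h j y}" unfolding E_def using UV1(6)[OF ij(1)] UV1(6)[OF ij(2)] by blast
  ultimately show ?thesis using closedin_Int[OF UV1(5)[OF ij(1)] UV1(5)[OF ij(2)]] by (metis closedin_diff)
 qed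
 define G where "G = (\<Union>x\<in>F. V x) - (\<Union>i\<in>F. \<Union>j\<in>F. E i j)"
 have Gop: "openin X G" unfolding G_def
 proof (intro openin_diff openin_Union closedin_Union)
  fix S assume "S \<in> (%i. \<Union>j\<in>F. E i j) ` F"
  then obtain i where "i \<in> F" "S = (\<Union>j\<in>F. E i j)" by blast
  then show "closedin X S" using F Ecl by (auto intro!: closedin_Union)
 qed (use F UV1(3) in auto)
 have KG: "K \<subseteq> G"
 proof
  fix y assume y: "y \<in> K"
  have "y \<notin> E i j" if "i \<in> F" "j \<in> F" for i j
  proof
   assume "y \<in> E i j"
   have ij: "i \<in> K" "j \<in> K" using that F by auto
   have "y \<in> U i" "y \<in> U j" "h i y \<noteq> h j y" using \<open>y \<in> E i j\<close> UV1(6)[OF ij(1)] UV1(6)[OF ij(2)] unfolding E_def by blast+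
   moreover have "h i y = 0" "h j y = 0" using z[OF UV2[OF ij(1)] y] z[OF UV2[OF ij(2)] y] calculation by auto
   ultimately show False by simp
  qed
  then show "y \<in> G" unfolding G_def using y F by blast
 qed
 define k where "k y = h (SOME i. i \<in> F \<and> y \<in> V i) y" for y
 have k: "k y = h i y" if "y \<in> G" "i \<in> F" "y \<in> V i" for y i
 proof -
  define j where "j = (SOME i. i \<in> F \<and> y \<in> V i)"
  have j: "j \<in> F \<and> y \<in> V j" unfolding j_def by (rule someI_ex) (use that in blast)
  then have "y \<in> C i \<inter> C j" using UV1(4)[of i] UV1(4)[of j] F that by blast
  moreover have "y \<notin> E i j" using that j unfolding G_def by blast
  ultimately show ?thesis unfolding k_def j_def[symmetric] E_def by auto
 qed
 have Gin: "\<exists>i\<in>F. y \<in> V i" if "y \<in> G" for y using that unfolding G_def by blast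
 have "loc G k"
 proof (rule loc_local[OF Gop])
  fix x assume x: "x \<in> G"
  obtain i where i: "i \<in> F" "x \<in> V i" using Gin[OF x] by blast
  then have iK: "i \<in> K" using F by blast
  have "loc (V i) (h i)" using loc_restrict[OF UV1(1,3,7)] iK by blast
  then show "\<exists>V k'. loc V k' \<and> x \<in> V \<and> (\<forall>y\<in>V \<inter> G. k' y = k y)"
   using i k by (intro exI[of _ "V i"] exI[of _ "h i"]) auto
 qed
 moreover have "\<Phi> y (k y)" if y: "y \<in> G" for y
 proof -
  obtain i where i: "i \<in> F" "y \<in> V i" using Gin[OF y] by blast
  then show ?thesis using k[OF y i] UV2[of i y] UV1(7)[of i] F by auto
 qed
 ultimately show ?thesis using KG by blast
qed

text \<open>K is covered by finitely many patches, each with connected fibres. Two patches that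
  overlap at a point of K share points of every fibre of small level v \<ge> 0, because no point of
  K is a maximum. Hence a separation of such a fibre would sort the patches into two classes and
  separate K.\<close>

lemma collar:
 assumes G: "loc G h" "K \<subseteq> G" and K: "closedin X K" "connectedin X K" "K \<noteq> {}"
  and zero: "\<And>y. y \<in> G ==> h y = 0 \<longleftrightarrow> y \<in> K"
  and nmax: "\<And>x. x \<in> K ==> \<not> lmax x"
 obtains e H where "e > 0" "openin X H" "K \<subseteq> H" "H \<subseteq> G" "\<And>y. y \<in> H ==> \<bar>h y\<bar> < e"
  "\<And>r. r < e ==> closedin X {y\<in>H. \<bar>h y\<bar> \<le> r}" "\<And>v. 0 \<le> v ==> v < e ==> \<exists>y\<in>H. h y = v"
  "\<And>v. 0 \<le> v ==> v < e ==> connectedin X {y\<in>H. h y = v}"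
proof -
 have cK: "compactin X K" using K compact_X closedin_compact_space by blast
 obtain D C where D: "openin X D" "closedin X C" "K \<subseteq> D" "D \<subseteq> C" "C \<subseteq> G"
  using normal_between[OF K(1) loc_open[OF G(1)] G(2)] by blast
 \<comment> \<open>On the compact set C - W the function h has no zero, so its modulus is bounded
   below.\<close>
 have small: "\<exists>e>0. \<forall>y\<in>C - W. e \<le> \<bar>h y\<bar>" if W: "openin X W" "K \<subseteq> W" for W
 proof -
  have "compactin X (C - W)" using closedin_compact_space[OF compact_X closedin_diff[OF D(2) W(1)]] .
  then have "compact (h ` (C - W))" using image_compactin[OF _ loc_cont[OF G(1)], of "C - W"] D(5) by (auto simp: compactin_subtopology)
  moreover have "0 \<notin> h ` (C - W)"
  proof
   assume "0 \<in> h ` (C - W)"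
   then obtain y where "y \<in> C" "y \<notin> W" "h y = 0" by force
   then show False using zero[of y] D(5) W(2) by blast
  qed
  ultimately have "open (- (h ` (C - W)))" "0 \<in> - (h ` (C - W))" using compact_imp_closed open_Compl by auto
  then obtain e where e: "e > 0" "ball 0 e \<subseteq> - (h ` (C - W))" unfolding open_contains_ball by blast
  have "e \<le> \<bar>h y\<bar>" if "y \<in> C - W" for y
  proof (rule ccontr)
   assume "\<not> e \<le> \<bar>h y\<bar>"
   then have "h y \<in> ball 0 e" by (simp add: dist_real_def)
   then show False using e(2) that by blast
  qed
  then show ?thesis using e(1) by blast
 qed
 obtain e0 where e0: "e0 > 0" "\<And>y. y \<in> C - D ==> e0 \<le> \<bar>h y\<bar>" using small[OF D(1,3)] by blast
 define H0 where "H0 = {y\<in>D. \<bar>h y\<bar> < e0}"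
 have H0op: "openin X H0"
 proof -
  have "H0 = D \<inter> {y\<in>G. h y \<in> {-e0<..<e0}}" unfolding H0_def using D by auto
  then show ?thesis using preimage_open[OF G(1), of "{-e0<..<e0}"] D(1) by auto
 qed
 have KH0: "K \<subseteq> H0" unfolding H0_def using D zero G(2) e0 by force
 have H0G: "H0 \<subseteq> G" unfolding H0_def using D by auto
 have hH0: "loc H0 h" using loc_restrict[OF G(1) H0op H0G] .
 have "\<exists>U J e. level_patch X h 0 U J e \<and> x \<in> U \<and> U \<subseteq> H0" if x: "x \<in> K" for x
 proof -
  have "h x = 0" using x zero G(2) by auto
  then show ?thesis using loc_patch[OF hH0, of x] x KH0 by auto
 qed
 then obtain U J e where U0: "\<And>x. x \<in> K ==> level_patch X h 0 (U x) (J x) (e x) \<and> x \<in> U x \<and> U x \<subseteq> H0" by metis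
 have U: "openin X (U x) \<and> x \<in> U x \<and> U x \<subseteq> H0 \<and> e x > 0" "\<And>v. connectedin X {y\<in>U x. h y = v}" if "x \<in> K" for x
  using U0[OF that] level_patchD(1,2,6) by blast+
 obtain F where F: "finite F" "F \<subseteq> K" "K \<subseteq> (\<Union>x\<in>F. U x)"
 proof -
  have "\<forall>W\<in>U ` K. openin X W" "K \<subseteq> \<Union>(U ` K)" using U by auto
  then obtain \<F> where "finite \<F>" "\<F> \<subseteq> U ` K" "K \<subseteq> \<Union>\<F>" using cK unfolding compactin_def by (meson)
  then show thesis using that by (metis finite_subset_image)
 qed
 \<comment> \<open>A patch lying below level 0 would make y a local maximum, so J contains all small
   values v \<ge> 0.\<close>
 have up: "\<exists>d>0. \<forall>v. 0 \<le> v \<and> v < d --> (\<exists>z\<in>V \<inter> U x. h z = v)"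
  if V: "openin X V" "y \<in> V" "y \<in> U x" "y \<in> K" "x \<in> K" for V x y
 proof -
  have hy: "h y = 0" using V zero G(2) by auto
  have p: "level_patch X h 0 (U x) (J x) (e x)" using U0 V(5) by blast
  have J: "J x = {0 - e x<..<0 + e x} \<or> J x = {0..<0 + e x} \<or> J x = {0 - e x<..0}" using level_patchD(3)[OF p] .
  have "lmax y" if "J x = {0 - e x<..0}"
  proof -
   have "\<forall>z\<in>U x. h z \<le> h y" using level_patchD(7)[OF p] that hy by force
   then show ?thesis using U[OF V(5)] V(3) hH0 KH0 V(4) lmax_iff[OF hH0, of y] by blast
  qed
  then have J2: "J x \<noteq> {0 - e x<..0}" using nmax V(4) by blast
  obtain d where d: "d > 0" "\<And>v. v \<in> J x ==> \<bar>v - h y\<bar> < d ==> \<exists>z\<in>V \<inter> U x. h z = v"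
   using patch_steps[OF p V(1-3)] by blast
  show ?thesis
  proof (intro exI[of _ "min d (e x)"] conjI allI impI)
   show "0 < min d (e x)" using d U[OF V(5)] by auto
   fix v assume v: "0 \<le> v \<and> v < min d (e x)"
   from J J2 have "J x = {0 - e x<..<0 + e x} \<or> J x = {0..<0 + e x}" by blast
   then have "v \<in> J x" using v by (elim disjE) simp_all
   then show "\<exists>z\<in>V \<inter> U x. h z = v" by (rule d(2)) (use v hy in simp)
  qed
 qed
 have "\<exists>d>0. U i \<inter> U j \<inter> K \<noteq> {} --> (\<forall>v. 0 \<le> v \<and> v < d --> (\<exists>z\<in>U i \<inter> U j. h z = v))"
  if ij: "i \<in> F" "j \<in> F" for i j
 proof (cases "U i \<inter> U j \<inter> K = {}")
  case True then show ?thesis by (intro exI[of _ 1]) auto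
 next
  case False
  then obtain y where y: "y \<in> U i" "y \<in> U j" "y \<in> K" by blast
  have "openin X (U i)" "j \<in> K" using U(1)[of i] ij F(2) by blast+
  from up[OF this(1) y this(2)] show ?thesis by blast
 qed
 then obtain d where d: "\<And>i j. i \<in> F ==> j \<in> F ==> d i j > 0 \<and> (U i \<inter> U j \<inter> K \<noteq> {} -->
   (\<forall>v. 0 \<le> v \<and> v < d i j --> (\<exists>z\<in>U i \<inter> U j. h z = v)))" by metis
 have Fne: "F \<noteq> {}" using F K by auto
 define d0 where "d0 = Min ((%(i,j). d i j) ` (F \<times> F))"
 have d0: "d0 > 0" "\<And>i j. i \<in> F ==> j \<in> F ==> d0 \<le> d i j"
 proof -
  have fin: "finite ((%(i,j). d i j) ` (F \<times> F))" using F(1) by blast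
  show "d0 > 0" unfolding d0_def using d Fne by (subst Min_gr_iff[OF fin]) auto
  show "d0 \<le> d i j" if "i \<in> F" "j \<in> F" for i j unfolding d0_def using that by (intro Min_le[OF fin]) (auto intro!: image_eqI[of _ _ "(i,j)"])
 qed
 obtain e1 where e1: "e1 > 0" "\<And>y. y \<in> C - (\<Union>x\<in>F. U x) ==> e1 \<le> \<bar>h y\<bar>"
 proof -
  have "openin X (\<Union>x\<in>F. U x)" using U(1) F(2) by (intro openin_Union) auto
  then show thesis using small[OF _ F(3)] that by blast
 qed
 define e2 where "e2 = min d0 (min e0 e1)"
 have e2: "e2 > 0" "e2 \<le> d0" "e2 \<le> e0" "e2 \<le> e1" unfolding e2_def using d0 e0 e1 by auto
 define H where "H = {y\<in>D. \<bar>h y\<bar> < e2}"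
 have Hop: "openin X H"
 proof -
  have "H = D \<inter> {y\<in>G. h y \<in> {-e2<..<e2}}" unfolding H_def using D by auto
  then show ?thesis using preimage_open[OF G(1), of "{-e2<..<e2}"] D(1) by auto
 qed
 have fib: "{y\<in>H. h y = v} = (\<Union>i\<in>F. {y\<in>U i. h y = v})" if "0 \<le> v" "v < e2" for v
 proof (intro equalityI subsetI)
  fix y assume "y \<in> {y\<in>H. h y = v}"
  then have "y \<in> D" "h y = v" unfolding H_def by auto
  moreover have "y \<in> (\<Union>x\<in>F. U x)" using e1(2)[of y] calculation D e2 that by force
  ultimately show "y \<in> (\<Union>i\<in>F. {y\<in>U i. h y = v})" by auto
 next
  fix y assume "y \<in> (\<Union>i\<in>F. {y\<in>U i. h y = v})"
  then have "h y = v" "y \<in> H0" using U F by blast+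
  then show "y \<in> {y\<in>H. h y = v}" unfolding H_def H0_def using that by auto
 qed
 have pne: "\<exists>z\<in>U i \<inter> U j. h z = v" if "i \<in> F" "j \<in> F" "U i \<inter> U j \<inter> K \<noteq> {}" "0 \<le> v" "v < e2" for i j v
  using d[OF that(1,2)] d0(2)[OF that(1,2)] that(3-5) e2 by force
 show thesis
 proof
  show "e2 > 0" "openin X H" using e2 Hop by auto
  show "K \<subseteq> H" unfolding H_def using D zero G(2) e2 by force
  show "H \<subseteq> G" unfolding H_def using D by auto
  show "\<bar>h y\<bar> < e2" if "y \<in> H" for y using that unfolding H_def by auto
  show "closedin X {y\<in>H. \<bar>h y\<bar> \<le> r}" if r: "r < e2" for r
  proof -
   have "{y\<in>H. \<bar>h y\<bar> \<le> r} = C - {y\<in>G. h y \<in> {x. \<bar>x\<bar> > r}}"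
   proof (intro equalityI subsetI)
    fix y assume "y \<in> {y\<in>H. \<bar>h y\<bar> \<le> r}"
    then show "y \<in> C - {y\<in>G. h y \<in> {x. \<bar>x\<bar> > r}}" unfolding H_def using D(4) by auto
   next
    fix y assume y: "y \<in> C - {y\<in>G. h y \<in> {x. \<bar>x\<bar> > r}}"
    then have "\<bar>h y\<bar> \<le> r" using D(5) by auto
    moreover from this have "y \<in> D" using e0(2)[of y] y r e2(3) by auto
    ultimately show "y \<in> {y\<in>H. \<bar>h y\<bar> \<le> r}" unfolding H_def using r by auto
   qed
   moreover have op: "open {x::real. \<bar>x\<bar> > r}" by (intro open_Collect_less continuous_intros)
   ultimately show ?thesis using closedin_diff[OF D(2) preimage_open[OF G(1) op]] by simp
  qed
  show "\<exists>y\<in>H. h y = v" if v: "0 \<le> v" "v < e2" for v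
  proof -
   obtain i where i: "i \<in> F" using Fne by blast
   have "i \<in> U i \<inter> U i \<inter> K" using U(1)[of i] F(2) i by blast
   then obtain z where "z \<in> U i" "h z = v" using pne[OF i i _ v] by blast
   then have "z \<in> {y\<in>H. h y = v}" unfolding fib[OF v] using i by blast
   then show ?thesis by blast
  qed
  show "connectedin X {y\<in>H. h y = v}" if v: "0 \<le> v" "v < e2" for v unfolding connectedin_iff_two
  proof (intro conjI allI impI; (elim conjE)?)
   show "{y\<in>H. h y = v} \<subseteq> topspace X" using openin_subset[OF Hop] by auto
   fix A B assume AB: "openin X A" "openin X B" "{y\<in>H. h y = v} \<subseteq> A \<union> B"
     "A \<inter> B \<inter> {y\<in>H. h y = v} = {}"
   define P where "P i = {y\<in>U i. h y = v}" for i
   have PH: "P i \<subseteq> {y\<in>H. h y = v}" if i: "i \<in> F" for i using fib[OF v] i unfolding P_def by blast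
   have dich: "P i \<subseteq> A \<or> P i \<subseteq> B" if i: "i \<in> F" for i
   proof (rule connectedin_two[OF _ AB(1,2)])
    show "connectedin X (P i)" unfolding P_def using U(2) F(2) i by blast
   qed (use AB(3,4) PH[OF i] in auto)
   \<comment> \<open>The patches are sorted by the side of the fibre that they carry; both unions
     are open and together they cover K.\<close>
   define KA where "KA = (\<Union>i\<in>{i\<in>F. P i \<subseteq> A}. U i)"
   define KB where "KB = (\<Union>i\<in>{i\<in>F. P i \<subseteq> B}. U i)"
   have Uo: "openin X (U i)" if "i \<in> F" for i using U(1)[of i] F(2) that by blast
   have op: "openin X KA" "openin X KB" unfolding KA_def KB_def by (rule openin_Union, clarsimp simp: Uo)+
   have cov: "K \<subseteq> KA \<union> KB"
   proof
    fix x assume "x \<in> K"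
    then obtain i where i: "i \<in> F" "x \<in> U i" using F(3) by blast
    from dich[OF i(1)] have "U i \<subseteq> KA \<or> U i \<subseteq> KB" unfolding KA_def KB_def using i(1) by (elim disjE) auto
    then show "x \<in> KA \<union> KB" using i(2) by blast
   qed
   have disj: "KA \<inter> KB \<inter> K = {}"
   proof (rule ccontr)
    assume "KA \<inter> KB \<inter> K \<noteq> {}"
    then obtain i j where ij: "i \<in> F" "j \<in> F" "P i \<subseteq> A" "P j \<subseteq> B" "U i \<inter> U j \<inter> K \<noteq> {}"
     unfolding KA_def KB_def by (auto simp only: UN_iff Int_iff mem_Collect_eq ex_in_conv[symmetric])
    obtain z where "z \<in> P i" "z \<in> P j" using pne[OF ij(1,2,5) v] unfolding P_def by blast
    then show False using AB(4) ij(3,4) PH[OF ij(1)] by blast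
   qed
   have cen: "i \<in> U i \<inter> K" if "i \<in> F" for i using U(1)[of i] F(2) that by blast
   have sub: "P i \<subseteq> A" if i: "i \<in> F" "K \<subseteq> KA" for i
   proof (rule ccontr)
    assume "\<not> P i \<subseteq> A"
    then have "P i \<subseteq> B" using dich[OF i(1)] by simp
    then have "U i \<subseteq> KB" using i(1) unfolding KB_def by auto
    then show False using cen[OF i(1)] i(2) disj by blast
   qed
   have sub': "P i \<subseteq> B" if i: "i \<in> F" "K \<subseteq> KB" for i
   proof (rule ccontr)
    assume "\<not> P i \<subseteq> B"
    then have "P i \<subseteq> A" using dich[OF i(1)] by simp
    then have "U i \<subseteq> KA" using i(1) unfolding KA_def by auto
    then show False using cen[OF i(1)] i(2) disj by blast
   qed
   have "K \<subseteq> KA \<or> K \<subseteq> KB" using connectedin_two[OF K(2) op cov disj] .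
   then show "{y\<in>H. h y = v} \<subseteq> A \<or> {y\<in>H. h y = v} \<subseteq> B"
    unfolding fib[OF v] P_def[symmetric] by (elim disjE) (use sub sub' in \<open>simp_all add: UN_subset_iff\<close>)
  qed
 qed
qed

text \<open>
 Tubes grow from a local minimum; a maximal one fills the space except for the fibre on which it ends.
\<close>

definition tube :: "'a set => ('a => real) => bool" where
 "tube Q k \<longleftrightarrow> loc Q k \<and> (\<forall>y\<in>Q. 0 \<le> k y) \<and> (\<forall>r\<in>k ` Q. {0..r} \<subseteq> k ` Q \<and> (\<exists>r'\<in>k ` Q. r < r')) \<and>
   (\<forall>r\<in>k ` Q. closedin X {y\<in>Q. k y \<le> r}) \<and> (\<forall>r. connectedin X {y\<in>Q. k y = r}) \<and>
   (\<forall>y\<in>Q. 0 < k y --> \<not> lmin y \<and> \<not> lmax y)"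

lemma tubeD:
 assumes "tube Q k"
 shows "loc Q k" "\<And>y. y \<in> Q ==> 0 \<le> k y" "\<And>r. r \<in> k ` Q ==> {0..r} \<subseteq> k ` Q"
  "\<And>r. r \<in> k ` Q ==> \<exists>r'\<in>k ` Q. r < r'" "\<And>r. r \<in> k ` Q ==> closedin X {y\<in>Q. k y \<le> r}"
  "\<And>r. connectedin X {y\<in>Q. k y = r}" "\<And>y. y \<in> Q ==> 0 < k y ==> \<not> lmin y \<and> \<not> lmax y" using assms unfolding tube_def by meson+

text \<open>A collar of K is glued to the tube. With Q empty and T = 0 the same argument starts a
  tube at a set of minima, which is why the absence of minima on K is assumed for T > 0
  only.\<close>

lemma tube_extend:
 assumes t: "tube Q k" and im: "k ` Q = {0..<T}" and K: "closedin X K" "connectedin X K" "K \<noteq> {}"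
  and disj: "Q \<inter> K = {}" and cl: "closedin X (Q \<union> K)" and T: "0 \<le> T"
  and loc: "\<And>x. x \<in> K ==> \<exists>U h. loc U h \<and> x \<in> U \<and> (\<forall>y\<in>U. (y \<in> K \<longleftrightarrow> h y = 0) \<and> (y \<in> Q \<longleftrightarrow> h y < 0) \<and>
   (y \<in> Q --> k y = T + h y))"
  and nmax: "\<And>x. x \<in> K ==> \<not> lmax x" and nmin: "\<And>x. x \<in> K ==> T > 0 ==> \<not> lmin x"
 shows "\<exists>Q' k'. tube Q' k' \<and> Q \<union> K \<subseteq> Q' \<and> (\<forall>y\<in>Q. k' y = k y) \<and> (\<forall>y\<in>Q'-Q. T \<le> k' y)"
proof -
 obtain G h where G: "loc G h" "K \<subseteq> G" and Gp: "\<forall>y\<in>G. (y \<in> K \<longleftrightarrow> h y = 0) \<and> (y \<in> Q \<longleftrightarrow> h y < 0) \<and>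
   (y \<in> Q --> k y = T + h y)"
  using glue_along[OF K(1), of "%y t. (y \<in> K \<longleftrightarrow> t = 0) \<and> (y \<in> Q \<longleftrightarrow> t < 0) \<and>
   (y \<in> Q --> k y = T + t)"] loc by blast
 \<comment> \<open>In a patch around a point of K, a positive value is neither the least value,
   since 0 is taken as well, nor the greatest one, since J is open above it.\<close>
 have notmax_open: "\<exists>W. openin X W \<and> K \<subseteq> W \<and> W \<subseteq> G \<and> (\<forall>y\<in>W. h y > 0 --> \<not> lmin y \<and> \<not> lmax y)"
 proof -
  have "\<exists>U. openin X U \<and> x \<in> U \<and> U \<subseteq> G \<and> (\<forall>y\<in>U. h y > 0 --> \<not> lmin y \<and> \<not> lmax y)" if x: "x \<in> K" for x
  proof -
   have hx: "h x = 0" using x Gp G by auto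
   obtain U J e where U: "level_patch X h 0 U J e" "x \<in> U" "U \<subseteq> G" using loc_patch[OF G(1), of x] x G(2) unfolding hx by blast
   have "\<not> lmin y \<and> \<not> lmax y" if y: "y \<in> U" "h y > 0" for y
   proof -
    have J: "h y \<in> J" "0 \<in> J" using level_patchD(7)[OF U(1)] U(2) y(1) hx by force+
    then have "(h y + e)/2 \<in> J" "h y < (h y + e)/2" using level_patchD(2,3)[OF U(1)] y(2) by auto
    then show ?thesis using patch_not_lmin[OF U(1) G(1) U(3) y(1) J(2) y(2)]
      patch_not_lmax[OF U(1) G(1) U(3) y(1)] by blast
   qed
   then have "openin X U \<and> (\<forall>y\<in>U. h y > 0 --> \<not> lmin y \<and> \<not> lmax y)" using level_patchD(1)[OF U(1)] by blast
   then show ?thesis using U by blast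
  qed
  then obtain U where U: "\<And>x. x \<in> K ==> openin X (U x) \<and> x \<in> U x \<and> U x \<subseteq> G \<and> (\<forall>y\<in>U x. h y > 0 --> \<not> lmin y \<and> \<not> lmax y)"
   by metis
  show ?thesis
  proof (intro exI[of _ "\<Union>x\<in>K. U x"] conjI ballI)
   show "openin X (\<Union>x\<in>K. U x)" using U by (auto intro!: openin_Union)
  qed (use U in \<open>blast+\<close>)
 qed
 then obtain W where W: "openin X W" "K \<subseteq> W" "W \<subseteq> G" "\<forall>y\<in>W. h y > 0 --> \<not> lmin y \<and> \<not> lmax y" by blast
 have hW: "loc W h" using loc_restrict[OF G(1) W(1,3)] .
 have zW: "\<And>y. y \<in> W ==> h y = 0 \<longleftrightarrow> y \<in> K" using Gp W by blast
 obtain e H where e: "e > 0" "openin X H" "K \<subseteq> H" "H \<subseteq> W" "\<And>y. y \<in> H ==> \<bar>h y\<bar> < e"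
  "\<And>r. r < e ==> closedin X {y\<in>H. \<bar>h y\<bar> \<le> r}" "\<And>v. 0 \<le> v ==> v < e ==> \<exists>y\<in>H. h y = v"
  "\<And>v. 0 \<le> v ==> v < e ==> connectedin X {y\<in>H. h y = v}" using collar[OF hW W(2) K zW nmax] by blast
 have HQ: "y \<in> Q \<longleftrightarrow> h y < 0" "y \<in> Q ==> k y = T + h y" "y \<in> K \<longleftrightarrow> h y = 0" if "y \<in> H" for y
  using Gp that e(4) W(3) by blast+
 define k' where "k' y = (if y \<in> Q then k y else T + h y)" for y
 define Q' where "Q' = Q \<union> H"
 have kH: "k' y = T + h y" if "y \<in> H" for y using HQ[OF that] unfolding k'_def by auto
 have kQ: "k' y = k y" if "y \<in> Q" for y using that unfolding k'_def by auto
 have Qlt: "k y < T" "0 \<le> k y" if "y \<in> Q" for y using im that by (metis atLeastLessThan_iff imageI)+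
 have locQ: "loc Q k" using t unfolding tube_def by blast
 have im': "k' ` Q' = {0..<T+e}"
 proof (intro equalityI subsetI)
  fix r assume "r \<in> k' ` Q'"
  then obtain y where y: "y \<in> Q \<or> (y \<in> H \<and> y \<notin> Q)" "r = k' y" unfolding Q'_def by blast
  then show "r \<in> {0..<T+e}"
  proof (elim disjE)
   assume "y \<in> Q" then show ?thesis using Qlt[of y] kQ[of y] y(2) e(1) T by simp
  next
   assume yH: "y \<in> H \<and> y \<notin> Q"
   then have "0 \<le> h y" "h y < e" "r = T + h y" using HQ(1)[of y] e(5)[of y] kH[of y] y(2) by auto
   then show ?thesis using T by simp
  qed
 next
  fix r assume r: "r \<in> {0..<T+e}"
  show "r \<in> k' ` Q'"
  proof (cases "r < T")
   case True
   then obtain y where "y \<in> Q" "k y = r" using im r by (metis atLeastLessThan_iff imageE)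
   then show ?thesis using kQ unfolding Q'_def by force
  next
   case False
   then obtain y where "y \<in> H" "h y = r - T" using e(7)[of "r-T"] r by auto
   then show ?thesis using kH unfolding Q'_def by force
  qed
 qed
 have fib1: "{y\<in>Q'. k' y = r} = {y\<in>Q. k y = r}" if "r < T" for r using kQ kH HQ that unfolding Q'_def by force
 have fib2: "{y\<in>Q'. k' y = r} = {y\<in>H. h y = r - T}" if "r \<ge> T" for r using kQ kH HQ Qlt that unfolding Q'_def by force
 have "tube Q' k'" unfolding tube_def
 proof (intro conjI ballI allI impI)
  show "loc Q' k'"
  proof (rule loc_local)
   show "openin X Q'" unfolding Q'_def using loc_open[OF locQ] e(2) by auto
   fix x assume "x \<in> Q'"
   then consider "x \<in> Q" | "x \<in> H" unfolding Q'_def by blast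
   then show "\<exists>V k. loc V k \<and> x \<in> V \<and> (\<forall>y\<in>V \<inter> Q'. k y = k' y)"
   proof cases
    case 1 then show ?thesis using locQ kQ by (intro exI[of _ Q] exI[of _ k]) auto
   next
    case 2
    have "loc H h" using loc_restrict[OF hW e(2,4)] .
    from loc_shift[OF this, of T] show ?thesis using 2 kH by (intro exI[of _ H] exI[of _ "%x. h x + T"]) auto
   qed
  qed
  fix y assume "y \<in> Q'" then have "k' y \<in> {0..<T+e}" unfolding im'[symmetric] by (rule imageI)
  then show "0 \<le> k' y" by simp
 next
  fix r assume "r \<in> k' ` Q'" then show "{0..r} \<subseteq> k' ` Q'" unfolding im' by auto
 next
  fix r assume r: "r \<in> k' ` Q'" then show "\<exists>r'\<in>k' ` Q'. r < r'" unfolding im' by (intro bexI[of _ "(r + (T + e))/2"]) auto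
 next
  fix r assume r: "r \<in> k' ` Q'"
  show "closedin X {y\<in>Q'. k' y \<le> r}"
  proof (cases "r < T")
   case True
   then have "{y\<in>Q'. k' y \<le> r} = {y\<in>Q. k y \<le> r}" using kQ kH HQ unfolding Q'_def by force
   moreover have "r \<in> k ` Q" using True r unfolding im im' by auto
   ultimately show ?thesis using tubeD(5)[OF t, of r] by simp
  next
   case False
   then have r2: "0 \<le> r - T" "r - T < e" using r unfolding im' by auto
   have "{y\<in>Q'. k' y \<le> r} = (Q \<union> K) \<union> {y\<in>H. \<bar>h y\<bar> \<le> r - T}"
   proof (intro equalityI subsetI)
    fix y assume "y \<in> {y\<in>Q'. k' y \<le> r}"
    then consider "y \<in> Q" | "y \<in> H" "y \<notin> Q" "k' y \<le> r" unfolding Q'_def by blast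
    then show "y \<in> (Q \<union> K) \<union> {y\<in>H. \<bar>h y\<bar> \<le> r - T}" using kH[of y] HQ[of y] by cases auto
   next
    fix y assume "y \<in> (Q \<union> K) \<union> {y\<in>H. \<bar>h y\<bar> \<le> r - T}"
    then consider "y \<in> Q" | "y \<in> K" | "y \<in> H" "\<bar>h y\<bar> \<le> r - T" by blast
    then show "y \<in> {y\<in>Q'. k' y \<le> r}"
    proof cases
     case 1 then show ?thesis using kQ[of y] Qlt[of y] False unfolding Q'_def by auto
    next
     case 2
     then have "y \<in> H" using e(3) by blast
     then show ?thesis using kH[of y] HQ[of y] 2 False unfolding Q'_def by auto
    next
     case 3 then show ?thesis using kH[of y] unfolding Q'_def by auto
    qed
   qed
   then show ?thesis using closedin_Un[OF cl e(6)[OF r2(2)]] by simp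
  qed
 next
  fix r show "connectedin X {y\<in>Q'. k' y = r}"
  proof (cases "r < T")
   case True then show ?thesis using fib1 tubeD(6)[OF t, of r] by simp
  next
   case False
   show ?thesis
   proof (cases "r < T + e")
    case True then show ?thesis using fib2 e(8)[of "r - T"] False by auto
   next
    case False2: False
    have "r \<notin> k' ` Q'" unfolding im' using False2 by auto
    then have "{y\<in>Q'. k' y = r} = {}" by blast
    then show ?thesis by (simp only: connectedin_empty)
   qed
  qed
 next
  fix y assume y: "y \<in> Q'" "0 < k' y"
  have "\<not> lmin y \<and> \<not> lmax y"
  proof (cases "y \<in> Q")
   case True then show ?thesis using tubeD(7)[OF t True] y kQ by auto
  next
   case False
   then have H: "y \<in> H" "h y \<ge> 0" using y(1) HQ(1)[of y] unfolding Q'_def by auto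
   show ?thesis
   proof (cases "h y = 0")
    case True
    then have "y \<in> K" using HQ H by blast
    moreover have "T > 0" using kH[OF H(1)] True y(2) by auto
    ultimately show ?thesis using nmin nmax by blast
   next
    case False then show ?thesis using W(4) H subsetD[OF e(4) H(1)] by auto
   qed
  qed
  then show "\<not> lmin y" "\<not> lmax y" by auto
 qed
 moreover have "T \<le> k' y" if "y \<in> Q'-Q" for y using kH[of y] HQ(1)[of y] that unfolding Q'_def by auto
 moreover have "Q \<union> K \<subseteq> Q'" using e(3) unfolding Q'_def by blast
 ultimately show ?thesis using kQ by (intro exI[of _ Q'] exI[of _ k'] conjI ballI) auto
qed

lemma closure_in_sub:
 assumes "closedin X C" "C \<subseteq> Q" "x \<in> X closure_of C" shows "x \<in> Q" using assms closure_of_closedin[OF assms(1)] by auto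

text \<open>A priori Q could meet a patch around a frontier point in any open set. It meets it
  exactly in the sublevel set h < 0: membership in Q spreads along the connected fibres of the patch
  and, because sublevel sets of the tube are closed in X, downwards in h. It cannot reach x itself,
  so it stops at level 0, and the frontier value T is the supremum of k.\<close>

lemma frontier_local:
 assumes t: "tube Q k" and x: "x \<in> X closure_of Q" "x \<notin> Q"
 obtains U h G J e T where "loc G h" "x \<in> U" "U \<subseteq> G" "h x = 0" "level_patch X h 0 U J e" "k ` Q = {0..<T}" "T > 0"
  "J = {0 - e<..<0 + e} \<or> J = {0 - e<..0}"
  "\<And>y. y \<in> U ==> y \<in> Q \<longleftrightarrow> h y < 0" "\<And>y. y \<in> U ==> y \<in> Q ==> k y = T + h y"
  "\<And>y. y \<in> U ==> y \<in> X closure_of Q \<longleftrightarrow> h y \<le> 0"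
proof -
 have lQ: "loc Q k" using tubeD(1)[OF t] .
 have oQ: "openin X Q" using loc_open[OF lQ] .
 have clk: "closedin X {y\<in>Q. k y \<le> r}" if "r \<in> k ` Q" for r using tubeD(5)[OF t that] .
 have cleq: "closedin X {y\<in>Q. k y = r}" if r: "r \<in> k ` Q" for r
 proof -
  have "{y\<in>Q. k y = r} = {y\<in>Q. k y \<le> r} - {y\<in>Q. k y \<in> {..<r}}" by auto
  then show ?thesis using closedin_diff[OF clk[OF r] preimage_open[OF lQ open_lessThan]] by simp
 qed
 have meets: "\<exists>y\<in>W. y \<in> Q" if "openin X W" "z \<in> W" "z \<in> X closure_of Q" for W z using that unfolding in_closure_of by blast
 have "x \<in> topspace X" using x(1) unfolding in_closure_of by blast
 then obtain G h U J e where G: "loc G h" and xU: "x \<in> U" and UG: "U \<subseteq> G" and hx: "h x = 0"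
  and p: "level_patch X h 0 U J e" by (rule local_patch_at)
 have oU: "openin X U" and hU: "h ` U = J" and e: "e > 0" using level_patchD[OF p] by auto
 have Jc: "J = {0 - e<..<0 + e} \<or> J = {0..<0 + e} \<or> J = {0 - e<..0}" using level_patchD(3)[OF p] .
 have hJ: "h y \<in> J" if "y \<in> U" for y using that hU by blast
 have JU: "\<exists>z\<in>U. h z = v" if "v \<in> J" for v using that hU by blast
 \<comment> \<open>A fibre of the patch that meets Q stays in Q with constant k. Near a point of Q
   the two primitives differ by a constant, which gives openness, and the fibre {k = k y} of the
   tube is closed in X.\<close>
 have one: "z \<in> Q \<and> k z = k y" if y: "y \<in> Q" "y \<in> U" and z: "z \<in> U" "h z = h y" for y z
 proof -
  let ?F = "{z\<in>U. h z = h y}"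
  have con: "connectedin X ?F" using level_patchD(6)[OF p] .
  define S where "S = {V. openin X V \<and> V \<subseteq> U \<inter> Q \<and> (\<forall>v\<in>V. h v = h y --> k v = k y)}"
  have oS: "openin X (\<Union>S)" unfolding S_def by (rule openin_Union) auto
  have "w \<in> \<Union>S" if w: "w \<in> U" "h w = h y" "w \<in> Q" "k w = k y" for w
  proof -
   obtain V where V: "openin X V" "w \<in> V" "V \<subseteq> G \<inter> Q" "\<forall>v\<in>V. h v = k v + (h w - k w)"
    using loc_unique_shift[OF G lQ, of w] UG w by blast
   have "openin X (V \<inter> U)" using V oU by blast
   moreover have "V \<inter> U \<subseteq> U \<inter> Q" using V by auto
   moreover have "\<forall>v\<in>V \<inter> U. h v = h y --> k v = k y" using V(4) w by auto
   ultimately have "V \<inter> U \<in> S" unfolding S_def using w by auto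
   then show ?thesis using V(2) w(1) by blast
  qed
  moreover have "k v = k y \<and> v \<in> Q" if "v \<in> \<Union>S" "v \<in> ?F" for v using that unfolding S_def by auto
  ultimately have SF: "\<Union>S \<inter> ?F = {w\<in>?F. w \<in> Q \<and> k w = k y}" by blast
  define R where "R = topspace X - {w\<in>Q. k w = k y}"
  have oR: "openin X R" unfolding R_def using cleq[of "k y"] y(1) by blast
  have Ft: "?F \<subseteq> topspace X" using openin_subset[OF oU] by auto
  have "?F \<subseteq> \<Union>S \<or> ?F \<subseteq> R"
  proof (rule connectedin_two[OF con oS oR])
   show "?F \<subseteq> \<Union>S \<union> R" using SF Ft unfolding R_def by blast
   show "\<Union>S \<inter> R \<inter> ?F = {}" using SF unfolding R_def by blast
  qed
  moreover have "y \<notin> R" "y \<in> ?F" using y unfolding R_def by auto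
  ultimately have "?F \<subseteq> \<Union>S" by blast
  then have "z \<in> \<Union>S \<inter> ?F" using z by blast
  then show ?thesis unfolding SF by simp
 qed
 have two: "\<exists>d>0. \<forall>v\<in>J. \<bar>v - h y\<bar> < d --> (\<forall>z\<in>U. h z = v --> z \<in> Q \<and> k z = k y + (v - h y))"
  if y: "y \<in> Q" "y \<in> U" for y
 proof -
  obtain V where V: "openin X V" "y \<in> V" "V \<subseteq> G \<inter> Q" "\<forall>v\<in>V. h v = k v + (h y - k y)"
   using loc_unique_shift[OF G lQ, of y] UG y by blast
  obtain d where d: "d > 0" "\<And>v. v \<in> J ==> \<bar>v - h y\<bar> < d ==> \<exists>z\<in>V \<inter> U. h z = v"
   using patch_steps[OF p V(1,2) y(2)] by blast
  have "z \<in> Q \<and> k z = k y + (v - h y)" if v: "v \<in> J" "\<bar>v - h y\<bar> < d" and z: "z \<in> U" "h z = v" for v z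
  proof -
   obtain w where w: "w \<in> V" "w \<in> U" "h w = v" using d(2)[OF v] by blast
   have "w \<in> Q" using w V(3) by blast
   then have "z \<in> Q \<and> k z = k w" using one[of w z] w z by simp
   moreover have "h w = k w + (h y - k y)" using V(4) w(1) by blast
   ultimately show ?thesis using w(3) by simp
  qed
  then show ?thesis using d(1) by blast
 qed
 \<comment> \<open>Continuation downwards: the values of h over which the whole patch fibre lies in
   Q with the expected value of k form an open and closed subset of the interval I.\<close>
 have three: "z \<in> Q \<and> k z = k y + (h z - h y)" if y: "y \<in> Q" "y \<in> U" and z: "z \<in> U" "h z \<le> h y" for y z
 proof -
  define I where "I = {h z..h y}"
  have IJ: "I \<subseteq> J" unfolding I_def using hJ[OF y(2)] hJ[OF z(1)] Jc by auto
  define Good where "Good = {v\<in>I. \<forall>w\<in>U. h w = v --> w \<in> Q \<and> k w = k y + (v - h y)}"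
  have op: "openin (top_of_set I) Good"
  proof (subst openin_subopen, clarify)
   fix v assume v: "v \<in> Good"
   then have vJ: "v \<in> J" using IJ unfolding Good_def by auto
   obtain w where w: "w \<in> U" "h w = v" using JU[OF vJ] by blast
   have wQ: "w \<in> Q" "k w = k y + (v - h y)" using v w unfolding Good_def by auto
   obtain d where d: "d > 0" "\<forall>v'\<in>J. \<bar>v' - h w\<bar> < d --> (\<forall>z\<in>U. h z = v' --> z \<in> Q \<and> k z = k w + (v' - h w))"
    using two[OF wQ(1) w(1)] by blast
   have "I \<inter> ball v d \<subseteq> Good"
   proof
    fix v' assume "v' \<in> I \<inter> ball v d"
    then have "v' \<in> I" "v' \<in> J" "\<bar>v' - h w\<bar> < d" using IJ w(2) by (auto simp: dist_real_def)
    then show "v' \<in> Good" unfolding Good_def using d(2) wQ(2) w(2) by auto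
   qed
   moreover have "openin (top_of_set I) (I \<inter> ball v d)" by (simp add: openin_open_Int)
   ultimately show "\<exists>T. openin (top_of_set I) T \<and> v \<in> T \<and> T \<subseteq> Good"
    using v d(1) unfolding Good_def by (intro exI[of _ "I \<inter> ball v d"]) auto
  qed
  \<comment> \<open>Over a limit value v some point w of the patch lies in the closure of {k \<le> k
    y}, which is closed and contained in Q. So w lies in Q, and \<open>one\<close> takes care of the
    rest of its fibre.\<close>
  have cl: "closedin (top_of_set I) Good" unfolding closedin_limpt
  proof (intro conjI allI impI)
   show "Good \<subseteq> I" unfolding Good_def by auto
   fix v assume v: "v islimpt Good \<and> v \<in> I"
   then have vI: "v \<in> I" and vJ: "v \<in> J" using IJ by auto
   obtain w where w: "w \<in> U" "h w = v" using JU[OF vJ] by blast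
   have near: "\<exists>w'\<in>W. w' \<in> U \<and> w' \<in> Q \<and> h w' \<in> Good \<and> \<bar>h w' - v\<bar> < d0 \<and> k w' = k y + (h w' - h y)"
    if W: "openin X W" "w \<in> W" and d0: "d0 > 0" for W d0
   proof -
    obtain d where d: "d > 0" "\<And>v'. v' \<in> J ==> \<bar>v' - h w\<bar> < d ==> \<exists>z\<in>W \<inter> U. h z = v'"
     using patch_steps[OF p W w(1)] by blast
    obtain v' where v': "v' \<in> Good" "dist v' v < min d d0" using v d d0 unfolding islimpt_approachable by (meson min_less_iff_conj)
    then have "v' \<in> J" using IJ unfolding Good_def by auto
    then obtain w' where w': "w' \<in> W" "w' \<in> U" "h w' = v'" using d(2)[of v'] v' w(2) by (auto simp: dist_real_def)
    then show ?thesis using v' unfolding Good_def by (intro bexI[of _ w']) (auto simp: dist_real_def)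
   qed
   have kyQ: "k y \<in> k ` Q" using y by blast
   have "w \<in> X closure_of {q\<in>Q. k q \<le> k y}" unfolding in_closure_of
   proof (intro conjI allI impI)
    show "w \<in> topspace X" using w openin_subset[OF oU] by auto
    fix W assume W: "w \<in> W \<and> openin X W"
    obtain w' where "w' \<in> W" "w' \<in> Q" "h w' \<in> Good" "k w' = k y + (h w' - h y)" using near[of W 1] W by auto
    then show "\<exists>y'. y' \<in> {q \<in> Q. k q \<le> k y} \<and> y' \<in> W" unfolding Good_def I_def by auto
   qed
   then have wQ: "w \<in> Q" using closure_in_sub[OF clk[OF kyQ]] by blast
   obtain d where d: "d > 0" "\<forall>v'\<in>J. \<bar>v' - h w\<bar> < d --> (\<forall>z\<in>U. h z = v' --> z \<in> Q \<and> k z = k w + (v' - h w))"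
    using two[OF wQ w(1)] by blast
   obtain w' where w': "w' \<in> U" "\<bar>h w' - v\<bar> < d" "k w' = k y + (h w' - h y)" using near[of Q d] wQ oQ d(1) by blast
   then have "k w' = k w + (h w' - h w)" using d(2) hJ[OF w'(1)] w(2) by blast
   then have kw: "k w = k y + (v - h y)" using w' w by simp
   show "v \<in> Good" unfolding Good_def
   proof (intro CollectI conjI ballI impI)
    show "v \<in> I" by (rule vI)
    fix w2 assume "w2 \<in> U" "h w2 = v"
    then show "w2 \<in> Q" "k w2 = k y + (v - h y)" using one[OF wQ w(1), of w2] w(2) kw by auto
   qed
  qed
  have "h y \<in> Good" unfolding Good_def I_def using one[OF y] z by auto
  moreover have "connected I" unfolding I_def by simp
  ultimately have "Good = I" using op cl unfolding connected_clopen by blast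
  moreover have "h z \<in> I" unfolding I_def using z by auto
  ultimately show ?thesis unfolding Good_def using z(1) by blast
 qed
 have neg: "h y < 0" if "y \<in> Q" "y \<in> U" for y using three[OF that xU] hx x(2) by force
 obtain y0 where y0: "y0 \<in> U" "y0 \<in> Q" using meets[OF oU xU x(1)] by blast
 define T where "T = k y0 - h y0"
 have kT: "k y = T + h y" if "y \<in> Q" "y \<in> U" for y using three[OF that y0(1)] three[OF y0(2,1) that(2)] unfolding T_def by linarith
 have all: "y \<in> Q" if y: "y \<in> U" "h y < 0" for y
 proof -
  let ?W = "{z\<in>G. h z \<in> {h y<..}} \<inter> U"
  have "openin X ?W" using preimage_open[OF G open_greaterThan] oU by blast
  moreover have "x \<in> ?W" using xU UG hx y by auto
  ultimately obtain z where "z \<in> ?W" "z \<in> Q" using meets x(1) by blast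
  then show ?thesis using three[of z y] y by auto
 qed
 have J2: "J = {0 - e<..<0 + e} \<or> J = {0 - e<..0}" using Jc neg[OF y0(2,1)] hJ[OF y0(1)] by auto
 have im: "k ` Q = {0..<T}"
 proof -
  \<comment> \<open>If a value \<ge> T occurred, T itself would be a value of k, and the frontier
    point x would lie in the closed set {k \<le> T} inside Q.\<close>
  have nT: "r < T" if r: "r \<in> k ` Q" for r
  proof (rule ccontr)
   assume "\<not> r < T"
   have ky: "0 \<le> k y0" "k y0 < T" using tubeD(2)[OF t y0(2)] kT[OF y0(2,1)] neg[OF y0(2,1)] by auto
   then have "T \<in> {0..r}" using \<open>\<not> r < T\<close> by auto
   then have TQ: "T \<in> k ` Q" using tubeD(3)[OF t r] by blast
   have "x \<in> X closure_of {q\<in>Q. k q \<le> T}" unfolding in_closure_of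
   proof (intro conjI allI impI)
    show "x \<in> topspace X" by fact
    fix W assume W: "x \<in> W \<and> openin X W"
    then obtain z where "z \<in> W \<inter> U" "z \<in> Q" using meets[of "W \<inter> U" x] oU xU x(1) by blast
    then show "\<exists>y'. y' \<in> {q \<in> Q. k q \<le> T} \<and> y' \<in> W" using kT[of z] neg[of z] by (intro exI[of _ z]) auto
   qed
   then show False using closure_in_sub[OF clk[OF TQ]] x(2) by blast
  qed
  have "r \<in> k ` Q" if r: "0 \<le> r" "r < T" for r
  proof -
   define v where "v = max (r - T) (-e/2)"
   have "v \<in> J" "v < 0" using J2 e r unfolding v_def by auto
   then obtain z where z: "z \<in> U" "h z = v" using JU by blast
   then have zQ: "z \<in> Q" using all \<open>v < 0\<close> by blast
   then have "r \<le> k z" using kT[OF zQ z(1)] z(2) unfolding v_def by auto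
   moreover have "{0..k z} \<subseteq> k ` Q" using tubeD(3)[OF t] zQ by blast
   ultimately show ?thesis using r(1) by auto
  qed
  then show ?thesis using nT tubeD(2)[OF t] by force
 qed
 have Tpos: "T > 0" using im y0(2) by (metis atLeastLessThan_empty_iff emptyE imageI le_less_linear)
 have cl: "y \<in> X closure_of Q \<longleftrightarrow> h y \<le> 0" if y: "y \<in> U" for y
 proof
  assume c: "y \<in> X closure_of Q"
  show "h y \<le> 0"
  proof (rule ccontr)
   assume "\<not> h y \<le> 0"
   let ?W = "{z\<in>G. h z \<in> {0<..}} \<inter> U"
   have "openin X ?W" using preimage_open[OF G open_greaterThan] oU by blast
   moreover have "y \<in> ?W" using y UG \<open>\<not> h y \<le> 0\<close> by auto
   ultimately obtain z where "z \<in> ?W" "z \<in> Q" using meets c by blast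
   then show False using neg[of z] by auto
  qed
 next
  assume hy: "h y \<le> 0"
  show "y \<in> X closure_of Q" unfolding in_closure_of
  proof (intro conjI allI impI)
   show "y \<in> topspace X" using y openin_subset[OF oU] by auto
   fix W assume W: "y \<in> W \<and> openin X W"
   then have W': "openin X W" "y \<in> W" by auto
   obtain d where d: "d > 0" "\<And>v'. v' \<in> J ==> \<bar>v' - h y\<bar> < d ==> \<exists>z\<in>W \<inter> U. h z = v'"
    using patch_steps[OF p W' y] by blast
   define v where "v = max (h y - d/2) ((h y - e)/2)"
   have "-e < h y" using hJ[OF y] J2 by auto
   then have "v \<in> J" "\<bar>v - h y\<bar> < d" "v < 0" using J2 hy d(1) e unfolding v_def by (auto simp: field_simps max_def)
   then obtain z where "z \<in> W" "z \<in> U" "h z = v" using d(2) by blast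
   then show "\<exists>y'. y' \<in> Q \<and> y' \<in> W" using all[of z] \<open>v < 0\<close> by blast
  qed
 qed
 show thesis using that[OF G xU UG hx p im Tpos J2 _ _ cl] all neg kT by blast
qed

lemma not_lmin_lmax: "\<not> (lmin x \<and> lmax x)"
proof
 assume m: "lmin x \<and> lmax x"
 then have "x \<in> topspace X" unfolding lmin_def using loc_sub by blast
 then obtain G h U J e where G: "loc G h" "x \<in> U" "U \<subseteq> G" "h x = 0" and p: "level_patch X h 0 U J e" by (rule local_patch_at)
 have "\<exists>v\<in>J. v \<noteq> 0" using level_patchD(2,3)[OF p] by (elim disjE) (rule bexI[of _ "e/2"] bexI[of _ "-e/2"]; simp; fail)+
 then obtain v where "v \<in> J" "v < h x \<or> h x < v" using G(4) by force
 then show False using patch_not_lmin[OF p G(1,3,2)] patch_not_lmax[OF p G(1,3,2)] m by blast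
qed

lemma lmin_patch:
 assumes p: "level_patch X h 0 U J e" and G: "loc G h" "U \<subseteq> G" and x: "x \<in> U" "h x = 0" "lmin x"
 shows "J = {0..<e}" "\<And>y. y \<in> U ==> lmin y \<longleftrightarrow> h y = 0"
proof -
 show J: "J = {0..<e}"
 proof (rule ccontr)
  assume "J \<noteq> {0..<e}"
  then have "-e/2 \<in> J" "-e/2 < h x" using level_patchD(2,3)[OF p] x(2) by auto
  then show False using patch_not_lmin[OF p G x(1)] x(3) by blast
 qed
 fix y assume y: "y \<in> U"
 show "lmin y \<longleftrightarrow> h y = 0"
 proof
  assume "lmin y"
  moreover have "h y \<ge> 0" using level_patchD(7)[OF p y] J by auto
  moreover have "0 \<in> J" using J level_patchD(2)[OF p] by auto
  ultimately show "h y = 0" using patch_not_lmin[OF p G y, of 0] by fastforce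
 next
  assume hy: "h y = 0"
  have "\<forall>z\<in>U. h y \<le> h z" using level_patchD(7)[OF p] J hy by auto
  then show "lmin y" using lmin_iff[OF G(1), of y] y G(2) level_patchD(1)[OF p] by blast
 qed
qed

lemma closedin_lmin: "closedin X {x\<in>topspace X. lmin x}"
proof -
 have "openin X {x\<in>topspace X. \<not> lmin x}"
 proof (subst openin_subopen, clarify)
  fix x assume x: "x \<in> topspace X" "\<not> lmin x"
  obtain G h U J e where G: "loc G h" "x \<in> U" "U \<subseteq> G" "h x = 0" and p: "level_patch X h 0 U J e" using local_patch_at[OF x(1)] by blast
  have "J \<noteq> {0..<0+e}"
  proof
   assume "J = {0..<0+e}"
   then have "\<forall>z\<in>U. h x \<le> h z" using level_patchD(7)[OF p] G(4) by auto
   then show False using lmin_iff[OF G(1), of x] G level_patchD(1)[OF p] x(2) by blast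
  qed
  then have J: "J = {0 - e<..<0 + e} \<or> J = {0 - e<..0}" using level_patchD(3)[OF p] by auto
  have "\<not> lmin y" if y: "y \<in> U" for y
  proof -
   have "(h y - e)/2 \<in> J" "(h y - e)/2 < h y" using J level_patchD(7)[OF p y] level_patchD(2)[OF p] by auto
   then show ?thesis using patch_not_lmin[OF p G(1,3) y] by blast
  qed
  then show "\<exists>T. openin X T \<and> x \<in> T \<and> T \<subseteq> {x \<in> topspace X. \<not> lmin x}"
   using level_patchD(1)[OF p] G(2) openin_subset by (intro exI[of _ U]) blast
 qed
 moreover have "{x\<in>topspace X. lmin x} = topspace X - {x\<in>topspace X. \<not> lmin x}" by auto
 ultimately show ?thesis by auto
qed

text \<open>The bottom fibre is the component of b in the closed set of minima. Near each of its
  points the zero fibre of a patch is connected and consists of minima, so it belongs to the same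
  component.\<close>

lemma tube_start:
 assumes b: "lmin b"
 shows "\<exists>Q k. tube Q k \<and> Q \<noteq> {}"
proof -
 define LM where "LM = {x\<in>topspace X. lmin x}"
 define K where "K = connected_component_of_set (subtopology X LM) b"
 have bt: "b \<in> topspace X" using b loc_sub unfolding lmin_def by blast
 have bLM: "b \<in> topspace (subtopology X LM)" unfolding LM_def using b bt by auto
 have KLM: "K \<subseteq> LM" using connectedin_connected_component_of[of "subtopology X LM" b] unfolding K_def connectedin_subtopology by blast
 have conK: "connectedin X K" using connectedin_connected_component_of[of "subtopology X LM" b] unfolding K_def connectedin_subtopology by blast
 have bK: "b \<in> K" unfolding K_def using bLM connected_component_of_refl by fastforce
 have "closedin (subtopology X LM) K" unfolding K_def by (rule closedin_connected_component_of)
 then have clK: "closedin X K" using closedin_lmin unfolding LM_def by (metis closedin_closed_subtopology)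
 have te: "tube {} (%_. 0)" unfolding tube_def using loc_local[of "{}" "%_. 0"] by auto
 have "\<exists>Q' k'. tube Q' k' \<and> {} \<union> K \<subseteq> Q' \<and> (\<forall>y\<in>{}. k' y = 0) \<and> (\<forall>y\<in>Q'-{}. 0 \<le> k' y)"
 proof (rule tube_extend[OF te _ clK conK])
  show "K \<noteq> {}" using bK by blast
  show "closedin X ({} \<union> K)" using clK by simp
  fix x assume xK: "x \<in> K"
  then have x: "lmin x" "x \<in> topspace X" using KLM unfolding LM_def by auto
  then show "\<not> lmax x" using not_lmin_lmax by blast
  obtain G h U J e where G: "loc G h" "x \<in> U" "U \<subseteq> G" "h x = 0" and p: "level_patch X h 0 U J e" using local_patch_at[OF x(2)] by blast
  note lp = lmin_patch[OF p G(1,3,2,4) x(1)]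
  have U: "U \<subseteq> topspace X" using openin_subset[OF level_patchD(1)[OF p]] .
  have sub: "{y\<in>U. h y = 0} \<subseteq> K"
  proof -
   have "{y\<in>U. h y = 0} \<subseteq> LM" unfolding LM_def using lp(2) U by blast
   then have "connectedin (subtopology X LM) {y\<in>U. h y = 0}" using level_patchD(6)[OF p] unfolding connectedin_subtopology by blast
   moreover have "x \<in> {y\<in>U. h y = 0}" using G by auto
   ultimately have "{y\<in>U. h y = 0} \<subseteq> connected_component_of_set (subtopology X LM) x" by (rule connected_component_of_maximal)
   moreover have "connected_component_of_set (subtopology X LM) x = K"
   proof -
    have "connected_component_of (subtopology X LM) b x" using xK unfolding K_def by simp
    then have "connected_component_of (subtopology X LM) b = connected_component_of (subtopology X LM) x"
     using connected_component_of_equiv[of "subtopology X LM" b x] by blast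
    then show ?thesis unfolding K_def by simp
   qed
   ultimately show ?thesis by simp
  qed
  have "y \<in> K \<longleftrightarrow> h y = 0" if "y \<in> U" for y using lp(2)[OF that] sub that KLM unfolding LM_def by blast
  moreover have "\<not> h y < 0" if "y \<in> U" for y using level_patchD(7)[OF p that] lp(1) by auto
  moreover have "loc U h" using loc_restrict[OF G(1) level_patchD(1)[OF p] G(3)] .
  ultimately show "\<exists>U h. loc U h \<and> x \<in> U \<and> (\<forall>y\<in>U. (y \<in> K \<longleftrightarrow> h y = 0) \<and> (y \<in> {} \<longleftrightarrow> h y < 0) \<and>
   (y \<in> {} --> 0 = 0 + h y))" using G(2) by blast
 qed auto
 then show ?thesis using bK by blast
qed

text \<open>New points must lie above the old ones. Then fibres and sublevel sets of a tube are not
  enlarged by extensions, so that connectedness and closedness survive in the union of a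
  chain.\<close>

definition tube_le :: "'a set \<times> ('a => real) => 'a set \<times> ('a => real) => bool" where
 "tube_le = (%(Q,k) (Q',k'). Q \<subseteq> Q' \<and> (\<forall>y\<in>Q. k' y = k y) \<and> (\<forall>y\<in>Q'-Q. \<forall>r\<in>k ` Q. r \<le> k' y))"

lemma tube_le_iff: "tube_le (Q,k) (Q',k') \<longleftrightarrow> Q \<subseteq> Q' \<and> (\<forall>y\<in>Q. k' y = k y) \<and> (\<forall>y\<in>Q'-Q. \<forall>z\<in>Q. k z \<le> k' y)"
 unfolding tube_le_def by auto

lemma maximal_tube:
 assumes "tube Q0 k0" "Q0 \<noteq> {}"
 obtains Q k where "tube Q k" "Q \<noteq> {}" "\<And>Q' k'. tube Q' k' ==> tube_le (Q,k) (Q',k') ==> Q' = Q"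
proof -
 \<comment> \<open>Functions are set to 0 off their tube; otherwise tubes differing only by
   irrelevant values would violate antisymmetry of the order.\<close>
 define nz where "nz = (%(Q::'a set) (k::'a => real) y. if y \<in> Q then k y else 0)"
 have tn: "tube Q (nz Q k)" if "tube Q k" for Q k
 proof -
  have *: "nz Q k y = k y" if "y \<in> Q" for y using that unfolding nz_def by auto
  have im: "nz Q k ` Q = k ` Q" using * by force
  have fi: "{y\<in>Q. nz Q k y \<le> r} = {y\<in>Q. k y \<le> r}" "{y\<in>Q. nz Q k y = r} = {y\<in>Q. k y = r}" for r using * by auto
  have "loc Q (nz Q k)" using loc_cong[OF tubeD(1)[OF that]] * by blast
  then show ?thesis using that unfolding tube_def im fi using * by simp
 qed
 define A where "A = {(Q,k). tube Q k \<and> Q \<noteq> {} \<and> (\<forall>y. y \<notin> Q --> k y = 0)}"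
 have "\<exists>m\<in>A. \<forall>a\<in>A. tube_le m a --> a = m"
 proof (rule predicate_Zorn)
  show "partial_order_on A (relation_of tube_le A)"
  proof (rule partial_order_on_relation_ofI)
   show "tube_le a a" if "a \<in> A" for a unfolding tube_le_def by auto
   show "tube_le a c" if "a \<in> A" "b \<in> A" "c \<in> A" "tube_le a b" "tube_le b c" for a b c
   proof -
    obtain Q k Q1 k1 Q2 k2 where [simp]: "a = (Q,k)" "b = (Q1,k1)" "c = (Q2,k2)" by (metis surj_pair)
    have 1: "Q \<subseteq> Q1" "\<And>y. y\<in>Q ==> k1 y = k y" "\<And>y z. y\<in>Q1 ==> y \<notin> Q ==> z\<in>Q ==> k z \<le> k1 y"
     and 2: "Q1 \<subseteq> Q2" "\<And>y. y\<in>Q1 ==> k2 y = k1 y" "\<And>y z. y\<in>Q2 ==> y \<notin> Q1 ==> z\<in>Q1 ==> k1 z \<le> k2 y"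
     using that(4,5) by (auto simp: tube_le_iff)
    have "k z \<le> k2 y" if "y \<in> Q2" "y \<notin> Q" "z \<in> Q" for y z
    proof (cases "y \<in> Q1")
     case True then show ?thesis using 1(3)[OF True that(2,3)] 2(2)[OF True] by simp
    next
     case False
     have "z \<in> Q1" using 1(1) that(3) by blast
     then show ?thesis using 2(3)[OF that(1) False, of z] 1(2)[OF that(3)] by simp
    qed
    then show ?thesis using 1 2 by (auto simp: tube_le_iff)
   qed
   show "a = b" if "a \<in> A" "b \<in> A" "tube_le a b" "tube_le b a" for a b
   proof -
    obtain Q k Q1 k1 where [simp]: "a = (Q,k)" "b = (Q1,k1)" by (metis surj_pair)
    have Q: "Q1 = Q" using that(3,4) by (auto simp: tube_le_iff)
    moreover have "k1 y = k y" for y using that unfolding A_def Q by (cases "y \<in> Q") (auto simp: tube_le_iff)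
    ultimately show ?thesis by auto
   qed
  qed
  fix C assume C: "C \<in> Chains (relation_of tube_le A)"
  then have CA: "C \<subseteq> A" and Cc: "\<And>a b. a \<in> C ==> b \<in> C ==> tube_le a b \<or> tube_le b a" unfolding Chains_def relation_of_def by auto
  show "\<exists>u\<in>A. \<forall>a\<in>C. tube_le a u"
  proof (cases "C = {}")
   case True
   have "(Q0, nz Q0 k0) \<in> A" using tn[OF assms(1)] assms(2) unfolding A_def by (simp add: nz_def)
   then show ?thesis using True by blast
  next
   case False
   define QQ where "QQ = (\<Union>(Q,k)\<in>C. Q)"
   define kk where "kk y = (if y \<in> QQ then snd (SOME a. a \<in> C \<and> y \<in> fst a) y else 0)" for y
   have tC: "tube Q k" "Q \<noteq> {}" if "(Q,k) \<in> C" for Q k using that CA unfolding A_def by auto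
   have ord: "(Q \<subseteq> Q' \<and> (\<forall>y\<in>Q. k' y = k y) \<and> (\<forall>y\<in>Q'-Q. \<forall>z\<in>Q. k z \<le> k' y)) \<or>
     (Q' \<subseteq> Q \<and> (\<forall>y\<in>Q'. k y = k' y) \<and> (\<forall>y\<in>Q-Q'. \<forall>z\<in>Q'. k' z \<le> k y))"
    if "(Q,k) \<in> C" "(Q',k') \<in> C" for Q k Q' k' using Cc[OF that] unfolding tube_le_iff by blast
   have kk: "kk y = k y" if a: "(Q,k) \<in> C" "y \<in> Q" for Q k y
   proof -
    define b where "b = (SOME a. a \<in> C \<and> y \<in> fst a)"
    have b: "b \<in> C \<and> y \<in> fst b" unfolding b_def by (rule someI_ex) (use a in force)
    obtain Q' k' where b': "b = (Q',k')" by (metis surj_pair)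
    have "y \<in> QQ" unfolding QQ_def using a by blast
    then have "kk y = k' y" unfolding kk_def b_def[symmetric] b' by simp
    moreover have "k' y = k y" using ord[OF a(1), of Q' k'] b a(2) unfolding b' by auto
    ultimately show ?thesis by simp
   qed
   have QQ: "\<exists>Q k. (Q,k) \<in> C \<and> y \<in> Q" if "y \<in> QQ" for y using that unfolding QQ_def by blast
   have QC: "Q \<subseteq> QQ" if "(Q,k) \<in> C" for Q k using that unfolding QQ_def by blast
   \<comment> \<open>The inequality is strict because k has no greatest value on Q: it is compared
     at a point \<open>z'\<close> that lies higher than z.\<close>
   have above: "k z < kk y" if a: "(Q,k) \<in> C" "z \<in> Q" "y \<in> QQ" "y \<notin> Q" for Q k y z
   proof -
    obtain Q' k' where b: "(Q',k') \<in> C" "y \<in> Q'" using QQ[OF a(3)] by blast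
    obtain z' where z': "z' \<in> Q" "k z < k z'" using tubeD(4)[OF tC(1)[OF a(1)], of "k z"] a(2) by blast
    have "k z' \<le> k' y" using ord[OF a(1) b(1)] b(2) a(4) z'(1) by blast
    then show ?thesis using kk[OF b] z'(2) by simp
   qed
   have cut: "{y\<in>QQ. kk y \<le> k z} = {y\<in>Q. k y \<le> k z}" "{y\<in>QQ. kk y = k z} = {y\<in>Q. k y = k z}"
    if a: "(Q,k) \<in> C" "z \<in> Q" for Q k z using above[OF a] kk[OF a(1)] QC[OF a(1)] by force+
   have ne: "QQ \<noteq> {}" using False tC(2) QC by (metis equals0I subset_empty surj_pair)
   have "tube QQ kk" unfolding tube_def
   proof (intro conjI ballI allI impI)
    show "loc QQ kk"
    proof (rule loc_local)
     show "openin X QQ" unfolding QQ_def using loc_open tubeD(1)[OF tC(1)] by (intro openin_Union) auto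
     fix x assume "x \<in> QQ"
     then obtain Q k where a: "(Q,k) \<in> C" "x \<in> Q" using QQ by blast
     show "\<exists>V k. loc V k \<and> x \<in> V \<and> (\<forall>y\<in>V \<inter> QQ. k y = kk y)"
      using tubeD(1)[OF tC(1)[OF a(1)]] a(2) kk[OF a(1)] by (intro exI[of _ Q] exI[of _ k]) auto
    qed
    fix y assume "y \<in> QQ"
    then obtain Q k where a: "(Q,k) \<in> C" "y \<in> Q" using QQ by blast
    then show "0 \<le> kk y" using tubeD(2)[OF tC(1)[OF a(1)] a(2)] kk[OF a] by simp
   next
    fix r assume "r \<in> kk ` QQ"
    then obtain y where y: "y \<in> QQ" "r = kk y" by blast
    obtain Q k where a: "(Q,k) \<in> C" "y \<in> Q" using QQ[OF y(1)] by blast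
    have r: "r \<in> k ` Q" "r = k y" using kk[OF a] a(2) y(2) by auto
    have sub: "k ` Q \<subseteq> kk ` QQ" using kk[OF a(1)] QC[OF a(1)] by force
    note t = tC(1)[OF a(1)]
    show "{0..r} \<subseteq> kk ` QQ" using tubeD(3)[OF t r(1)] sub by blast
    show "\<exists>r'\<in>kk ` QQ. r < r'" using tubeD(4)[OF t r(1)] sub by blast
    show "closedin X {y\<in>QQ. kk y \<le> r}" using tubeD(5)[OF t r(1)] cut(1)[OF a] unfolding r(2) by simp
   next
    fix r show "connectedin X {y\<in>QQ. kk y = r}"
    proof (cases "r \<in> kk ` QQ")
     case True
     then obtain y where y: "y \<in> QQ" "r = kk y" by blast
     obtain Q k where a: "(Q,k) \<in> C" "y \<in> Q" using QQ[OF y(1)] by blast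
     have r: "r = k y" using kk[OF a] y(2) by auto
     show ?thesis unfolding r cut(2)[OF a] using tubeD(6)[OF tC(1)[OF a(1)]] .
    next
     case False
     then have "{y\<in>QQ. kk y = r} = {}" by blast
     then show ?thesis by (simp only: connectedin_empty)
    qed
   next
    fix y assume y: "y \<in> QQ" "0 < kk y"
    obtain Q k where a: "(Q,k) \<in> C" "y \<in> Q" using QQ[OF y(1)] by blast
    then show "\<not> lmin y" "\<not> lmax y" using tubeD(7)[OF tC(1)[OF a(1)] a(2)] kk[OF a] y(2) by auto
   qed
   then have "(QQ,kk) \<in> A" unfolding A_def using ne by (auto simp: kk_def)
   moreover have "tube_le a (QQ,kk)" if "a \<in> C" for a
   proof -
    obtain Q k where a: "a = (Q,k)" by (metis surj_pair)
    then have "(Q,k) \<in> C" using that by simp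
    then show ?thesis unfolding a tube_le_iff using kk QC above by (auto intro: less_imp_le)
   qed
   ultimately show ?thesis by blast
  qed
 qed
 then obtain Q k where m: "(Q,k) \<in> A" "\<And>a. a \<in> A ==> tube_le (Q,k) a ==> a = (Q,k)" by auto
 show thesis
 proof (rule that)
  show "tube Q k" "Q \<noteq> {}" using m(1) unfolding A_def by auto
  fix Q' k' assume q: "tube Q' k'" "tube_le (Q,k) (Q',k')"
  have "Q' \<noteq> {}" using q(2) \<open>Q \<noteq> {}\<close> by (auto simp: tube_le_iff)
  then have "(Q', nz Q' k') \<in> A" unfolding A_def using tn[OF q(1)] by (auto simp: nz_def)
  moreover have "tube_le (Q,k) (Q', nz Q' k')" using q(2) unfolding tube_le_iff nz_def by auto
  ultimately show "Q' = Q" using m(2) by blast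
 qed
qed

text \<open>A maximal tube Q has a nonempty frontier K, since k attains no maximum on Q while X is
  compact. K is connected as a limit of connected fibres. Without a maximum on K the tube could be
  extended; if one point of K is a maximum, then all are, and Q \<union> K is open and
  closed.\<close>

theorem global_level_function:
 assumes b: "lmin b"
 shows "\<exists>k T. loc (topspace X) k \<and> 0 < T \<and> k ` topspace X = {0..T} \<and> (\<forall>r. connectedin X {y\<in>topspace X. k y = r}) \<and>
  (\<forall>y\<in>topspace X. 0 < k y \<and> k y < T --> \<not> lmin y \<and> \<not> lmax y)"
proof -
 obtain Q0 k0 where q0: "tube Q0 k0" "Q0 \<noteq> {}" using tube_start[OF b] by blast
 obtain Q k where t: "tube Q k" and ne: "Q \<noteq> {}"
  and mx: "\<And>Q' k'. tube Q' k' ==> tube_le (Q,k) (Q',k') ==> Q' = Q" using maximal_tube[OF q0] by blast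
 have lQ: "loc Q k" and oQ: "openin X Q" using tubeD(1)[OF t] loc_open by auto
 have Qt: "Q \<subseteq> topspace X" using openin_subset[OF oQ] .
 define K where "K = X closure_of Q - Q"
 have QK: "Q \<union> K = X closure_of Q" unfolding K_def using closure_of_subset[OF Qt] by blast
 have clK: "closedin X K" unfolding K_def using closedin_diff[OF closedin_closure_of oQ] .
 have clop: "Q = topspace X" if "closedin X Q" using connected_X oQ that ne unfolding connected_space_clopen_in by blast
 have "K \<noteq> {}"
 proof
  assume "K = {}"
  then have "closedin X Q" using QK closedin_closure_of[of X Q] by simp
  then have Q: "Q = topspace X" by (rule clop)
  then have "compact (k ` Q)" using image_compactin[OF _ loc_cont[OF lQ], of Q] compact_X by (simp add: compact_space_def)
  then obtain r where "r \<in> k ` Q" "\<forall>r'\<in>k ` Q. r' \<le> r" using compact_attains_sup[of "k ` Q"] ne by blast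
  then show False using tubeD(4)[OF t] by fastforce
 qed
 then obtain x0 where x0: "x0 \<in> K" by blast
 obtain T where T: "k ` Q = {0..<T}" "T > 0" using frontier_local[OF t, of x0] x0 unfolding K_def by (metis DiffD1 DiffD2)
 let ?fr = "%U h. \<forall>y\<in>U. (y \<in> Q \<longleftrightarrow> h y < 0) \<and> (y \<in> Q --> k y = T + h y) \<and> (y \<in> K \<longleftrightarrow> h y = 0)"
 have fl: "\<exists>U h G J e. loc G h \<and> x \<in> U \<and> U \<subseteq> G \<and> h x = 0 \<and> level_patch X h 0 U J e \<and>
  (J = {0 - e<..<0 + e} \<or> J = {0 - e<..0}) \<and> ?fr U h" if x: "x \<in> K" for x
 proof -
  have c: "x \<in> X closure_of Q" "x \<notin> Q" using x unfolding K_def by auto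
  show ?thesis
  proof (rule frontier_local[OF t c])
   fix U h G J e T'
   assume f: "loc G h" "x \<in> U" "U \<subseteq> G" "h x = 0" "level_patch X h 0 U J e"
    "k ` Q = {0..<T'}" "T' > 0" "J = {0 - e<..<0 + e} \<or> J = {0 - e<..0}" and
    g: "\<And>y. y \<in> U ==> y \<in> Q \<longleftrightarrow> h y < 0" "\<And>y. y \<in> U ==> y \<in> Q ==> k y = T' + h y"
    "\<And>y. y \<in> U ==> y \<in> X closure_of Q \<longleftrightarrow> h y \<le> 0"
   have "T' = T" using f(6,7) T by (metis atLeastLessThan_eq_iff)
   moreover have "y \<in> K \<longleftrightarrow> h y = 0" if "y \<in> U" for y using g(1,3)[OF that] unfolding K_def by auto
   ultimately show ?thesis using f g by (intro exI[of _ U] exI[of _ h] exI[of _ G] exI[of _ J] exI[of _ e]) simp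
  qed
 qed
 have Kt: "K \<subseteq> topspace X" using closedin_subset[OF clK] .
 \<comment> \<open>Every fibre of level close to T enters a given neighbourhood of a point of
   K.\<close>
 have reach: "\<exists>r1<T. \<forall>r. r1 < r \<and> r < T --> (\<exists>y\<in>W. y \<in> Q \<and> k y = r)" if W: "openin X W" "x \<in> W" "x \<in> K" for W x
 proof -
  obtain U h G J e where f: "loc G h" "x \<in> U" "U \<subseteq> G" "h x = 0" and p: "level_patch X h 0 U J e"
   and J: "J = {0 - e<..<0 + e} \<or> J = {0 - e<..0}"
   and g: "?fr U h" using fl[OF W(3)] by blast
  obtain d where d: "d > 0" "\<And>v. v \<in> J ==> \<bar>v - h x\<bar> < d ==> \<exists>z\<in>W \<inter> U. h z = v"
   using patch_steps[OF p W(1,2) f(2)] by blast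
  have e: "e > 0" using level_patchD(2)[OF p] .
  show ?thesis
  proof (intro exI[of _ "T - min d e"] conjI allI impI)
   show "T - min d e < T" using d(1) e by auto
   fix r assume r: "T - min d e < r \<and> r < T"
   then have "r - T \<in> J" "\<bar>r - T - h x\<bar> < d" using J f(4) by auto
   then obtain z where z: "z \<in> W" "z \<in> U" "h z = r - T" using d(2) by blast
   then show "\<exists>y\<in>W. y \<in> Q \<and> k y = r" using g r by (intro bexI[of _ z]) auto
  qed
 qed
 \<comment> \<open>If disjoint open sets P and R separated K, then k would stay below some r0 < T on
   the compact rest of the closure of Q. A fibre of level between r0 and T would lie in P \<union> R
   and, by \<open>reach\<close>, meet both.\<close>
 have conK: "connectedin X K" unfolding connectedin_iff_two
 proof (intro conjI allI impI; (elim conjE)?)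
  show "K \<subseteq> topspace X" by (rule Kt)
  fix A B assume AB: "openin X A" "openin X B" "K \<subseteq> A \<union> B" "A \<inter> B \<inter> K = {}"
  show "K \<subseteq> A \<or> K \<subseteq> B"
  proof (rule ccontr)
   assume "\<not> (K \<subseteq> A \<or> K \<subseteq> B)"
   then obtain a b where ab: "a \<in> K" "a \<in> A" "b \<in> K" "b \<in> B" using AB(3) by blast
   have "closedin X (K - B)" "closedin X (K - A)" using clK AB by auto
   moreover have "disjnt (K - B) (K - A)" using AB(3) unfolding disjnt_def by blast
   ultimately obtain P R where PR: "openin X P" "openin X R" "K - B \<subseteq> P" "K - A \<subseteq> R" "disjnt P R"
    using normal_X unfolding normal_space_def by metis
   have aP: "a \<in> P" "b \<in> R" using ab AB(4) PR by blast+
   define S where "S = X closure_of Q - (P \<union> R)"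
   have KPR: "K \<subseteq> P \<union> R" using PR(3,4) AB(4) by blast
   have SQ: "S \<subseteq> Q" unfolding S_def QK[symmetric] using KPR by blast
   have "closedin X S" unfolding S_def using PR by (intro closedin_diff openin_Un) auto
   then have "compact (k ` S)" using image_compactin[OF _ loc_cont[OF lQ], of S] SQ closedin_compact_space[OF compact_X] by (simp add: compactin_subtopology)
   then have "\<exists>r0<T. \<forall>y\<in>S. k y \<le> r0"
   proof (cases "S = {}")
    case True then show ?thesis using T(2) by (intro exI[of _ 0]) auto
   next
    case False
    then obtain r where "r \<in> k ` S" "\<forall>r'\<in>k ` S. r' \<le> r" using compact_attains_sup[of "k ` S"] \<open>compact (k ` S)\<close> by blast
    moreover have "r < T" using \<open>r \<in> k ` S\<close> SQ T(1) by (metis atLeastLessThan_iff imageE imageI subsetD)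
    ultimately show ?thesis by blast
   qed
   then obtain r0 where r0: "r0 < T" "\<And>y. y \<in> S ==> k y \<le> r0" by blast
   obtain r1 where r1: "r1 < T" "\<And>r. r1 < r ==> r < T ==> \<exists>y\<in>P. y \<in> Q \<and> k y = r" using reach[OF PR(1) aP(1) ab(1)] by blast
   obtain r2 where r2: "r2 < T" "\<And>r. r2 < r ==> r < T ==> \<exists>y\<in>R. y \<in> Q \<and> k y = r" using reach[OF PR(2) aP(2) ab(3)] by blast
   define r where "r = (max r0 (max r1 r2) + T)/2"
   have r: "r0 < r" "r1 < r" "r2 < r" "r < T" unfolding r_def using r0 r1 r2 by auto
   have "{y\<in>Q. k y = r} \<subseteq> P \<or> {y\<in>Q. k y = r} \<subseteq> R"
   proof (rule connectedin_two[OF tubeD(6)[OF t] PR(1,2)])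
    show "{y\<in>Q. k y = r} \<subseteq> P \<union> R"
    proof
     fix y assume y: "y \<in> {y\<in>Q. k y = r}"
     then have "y \<notin> S" using r0(2)[of y] r(1) by auto
     then show "y \<in> P \<union> R" unfolding S_def using y QK by blast
    qed
   qed (use PR(5) in \<open>auto simp: disjnt_def\<close>)
   moreover obtain y z where "y \<in> P" "y \<in> Q" "k y = r" "z \<in> R" "z \<in> Q" "k z = r" using r1(2)[OF r(2,4)] r2(2)[OF r(3,4)] by blast
   ultimately show False using PR(5) unfolding disjnt_def by blast
  qed
 qed
 show ?thesis
 proof (cases "\<exists>x\<in>K. lmax x")
  case False
  have "\<exists>Q' k'. tube Q' k' \<and> Q \<union> K \<subseteq> Q' \<and> (\<forall>y\<in>Q. k' y = k y) \<and> (\<forall>y\<in>Q'-Q. T \<le> k' y)"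
  proof (rule tube_extend[OF t T(1) clK conK \<open>K \<noteq> {}\<close>])
   show "Q \<inter> K = {}" unfolding K_def by blast
   show "closedin X (Q \<union> K)" unfolding QK by simp
   show "0 \<le> T" using T by simp
   fix x assume x: "x \<in> K"
   show "\<not> lmax x" using False x by blast
   obtain U h G J e where f: "loc G h" "x \<in> U" "U \<subseteq> G" "h x = 0" and p: "level_patch X h 0 U J e"
    and J: "J = {0 - e<..<0 + e} \<or> J = {0 - e<..0}"
    and g: "?fr U h" using fl[OF x] by blast
   have "loc U h" using loc_restrict[OF f(1) level_patchD(1)[OF p] f(3)] .
   then show "\<exists>U h. loc U h \<and> x \<in> U \<and> (\<forall>y\<in>U. (y \<in> K \<longleftrightarrow> h y = 0) \<and> (y \<in> Q \<longleftrightarrow> h y < 0) \<and>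
    (y \<in> Q --> k y = T + h y))" using f(2) g by blast
   have "-e/2 \<in> J" "-e/2 < h x" using J level_patchD(2)[OF p] f(4) by auto
   then show "\<not> lmin x" using patch_not_lmin[OF p f(1,3,2)] by blast
  qed
  then obtain Q' k' where Q': "tube Q' k'" "Q \<union> K \<subseteq> Q'" "\<forall>y\<in>Q. k' y = k y" "\<forall>y\<in>Q'-Q. T \<le> k' y" by blast
  have "tube_le (Q,k) (Q',k')" unfolding tube_le_iff
  proof (intro conjI ballI)
   fix y z assume "y \<in> Q' - Q" "z \<in> Q"
   then have "T \<le> k' y" "k z < T" using Q'(4) T(1) by (blast, metis atLeastLessThan_iff imageI)
   then show "k z \<le> k' y" by simp
  qed (use Q' in auto)
  then have "Q' = Q" using mx[OF Q'(1)] by blast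
  then show ?thesis using Q'(2) x0 unfolding K_def by blast
 next
  case True
  then obtain x1 where x1: "x1 \<in> K" "lmax x1" by blast
  \<comment> \<open>The shape of J decides whether points of K are maxima, so this property is
    locally constant on the connected set K. Around a maximum the closure of Q fills a
    neighbourhood.\<close>
  have type: "\<exists>U. openin X U \<and> x \<in> U \<and> (lmax x --> (\<forall>y\<in>U. y \<in> Q \<union> K \<and> (y \<in> K --> lmax y))) \<and>
   (\<not> lmax x --> (\<forall>y\<in>U \<inter> K. \<not> lmax y))" if x: "x \<in> K" for x
  proof -
   obtain U h G J e where f: "loc G h" "x \<in> U" "U \<subseteq> G" "h x = 0" and p: "level_patch X h 0 U J e"
    and J: "J = {0 - e<..<0 + e} \<or> J = {0 - e<..0}"
    and g: "?fr U h" using fl[OF x] by blast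
   have oU: "openin X U" and e: "e > 0" using level_patchD[OF p] by auto
   from J show ?thesis
   proof
    assume J1: "J = {0 - e<..<0 + e}"
    have "\<not> lmax y" if y: "y \<in> U" "y \<in> K" for y
    proof -
     have "e/2 \<in> J" "h y < e/2" using g y e J1 by auto
     then show ?thesis using patch_not_lmax[OF p f(1,3) y(1)] by blast
    qed
    then show ?thesis using oU f(2) x by blast
   next
    assume J1: "J = {0 - e<..0}"
    have hle: "h y \<le> 0" if "y \<in> U" for y using level_patchD(7)[OF p that] J1 by auto
    have "y \<in> Q \<union> K" if "y \<in> U" for y using g hle[OF that] that by force
    moreover have "lmax y" if y: "y \<in> U" "y \<in> K" for y
    proof -
     have "\<forall>z\<in>U. h z \<le> h y" using hle g y by auto
     then show ?thesis using lmax_iff[OF f(1), of y] y(1) f(3) oU by blast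
    qed
    ultimately show ?thesis using oU f(2) x by blast
   qed
  qed
  then obtain U where U: "\<And>x. x \<in> K ==> openin X (U x) \<and> x \<in> U x \<and> (lmax x --> (\<forall>y\<in>U x. y \<in> Q \<union> K \<and> (y \<in> K --> lmax y))) \<and>
   (\<not> lmax x --> (\<forall>y\<in>U x \<inter> K. \<not> lmax y))" by metis
  have U1: "openin X (U x)" "x \<in> U x" if "x \<in> K" for x using U[OF that] by simp_all
  have U2: "y \<in> Q \<union> K" "y \<in> K ==> lmax y" if "x \<in> K" "lmax x" "y \<in> U x" for x y using U[OF that(1)] that(2,3) by auto
  have U3: "\<not> lmax y" if "x \<in> K" "\<not> lmax x" "y \<in> U x" "y \<in> K" for x y using U[OF that(1)] that(2-4) by auto
  define KA where "KA = (\<Union>x\<in>{x\<in>K. lmax x}. U x)"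
  define KB where "KB = (\<Union>x\<in>{x\<in>K. \<not> lmax x}. U x)"
  have o: "openin X KA" "openin X KB" unfolding KA_def KB_def by (rule openin_Union, clarsimp simp: U1)+
  have KA: "lmax y" if "y \<in> KA" "y \<in> K" for y
  proof -
   obtain x where "x \<in> K" "lmax x" "y \<in> U x" using \<open>y \<in> KA\<close> unfolding KA_def by auto
   then show ?thesis using U2(2)[of x y] that(2) by simp
  qed
  have KB: "\<not> lmax y" if "y \<in> KB" "y \<in> K" for y
  proof -
   obtain x where "x \<in> K" "\<not> lmax x" "y \<in> U x" using \<open>y \<in> KB\<close> unfolding KB_def by auto
   then show ?thesis using U3[of x y] that(2) by simp
  qed
  have cov: "K \<subseteq> KA \<union> KB"
  proof
   fix y assume "y \<in> K"
   then show "y \<in> KA \<union> KB" unfolding KA_def KB_def using U1(2)[of y] by (cases "lmax y") auto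
  qed
  have "KA \<inter> KB \<inter> K = {}" using KA KB by blast
  then have "K \<subseteq> KA \<or> K \<subseteq> KB" using connectedin_two[OF conK o cov] by blast
  then have KKA: "K \<subseteq> KA" using KB x1 by blast
  have KAQ: "KA \<subseteq> Q \<union> K"
  proof
   fix y assume "y \<in> KA"
   then obtain x where "x \<in> K" "lmax x" "y \<in> U x" unfolding KA_def by auto
   then show "y \<in> Q \<union> K" using U2(1) by simp
  qed
  have "Q \<union> K = Q \<union> KA" using KKA KAQ by blast
  then have "openin X (Q \<union> K)" using oQ o(1) by auto
  moreover have "closedin X (Q \<union> K)" unfolding QK by simp
  ultimately have top: "Q \<union> K = topspace X" using connected_X ne unfolding connected_space_clopen_in by blast
  define k' where "k' y = (if y \<in> Q then k y else T)" for y
  have QKd: "y \<notin> Q" if "y \<in> K" for y using that unfolding K_def by blast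
  have lt: "k y < T" "0 \<le> k y" if "y \<in> Q" for y using T(1) that by (metis atLeastLessThan_iff imageI)+
  have "loc (topspace X) k'"
  proof (rule loc_local)
   fix x assume "x \<in> topspace X"
   then consider "x \<in> Q" | "x \<in> K" using top by blast
   then show "\<exists>V k. loc V k \<and> x \<in> V \<and> (\<forall>y\<in>V \<inter> topspace X. k y = k' y)"
   proof cases
    case 1 then show ?thesis using lQ unfolding k'_def by (intro exI[of _ Q] exI[of _ k]) auto
   next
    case 2
    obtain U h G J e where f: "loc G h" "x \<in> U" "U \<subseteq> G" "h x = 0" and p: "level_patch X h 0 U J e"
     and g: "?fr U h" using fl[OF 2] by blast
    have "loc U (%y. h y + T)" using loc_shift[OF loc_restrict[OF f(1) level_patchD(1)[OF p] f(3)]] .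
    moreover have "h y + T = k' y" if "y \<in> U" "y \<in> topspace X" for y using g that top unfolding k'_def by (cases "y \<in> Q") auto
    ultimately show ?thesis using f(2) by blast
   qed
  qed simp
  moreover have "k' ` topspace X = {0..T}"
  proof -
   have "k' ` topspace X = k' ` Q \<union> k' ` K" using top by blast
   moreover have "k' ` Q = {0..<T}" using T(1) unfolding k'_def by force
   moreover have "k' ` K = {T}" using QKd x0 unfolding k'_def by force
   ultimately show ?thesis using T(2) by auto
  qed
  moreover have "connectedin X {y\<in>topspace X. k' y = r}" for r
  proof (cases "r = T")
   case True
   have "{y\<in>topspace X. k' y = r} = K" unfolding True k'_def using top QKd lt by force
   then show ?thesis using conK by simp
  next
   case False
   then have "{y\<in>topspace X. k' y = r} = {y\<in>Q. k y = r}" unfolding k'_def using Qt by auto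
   then show ?thesis using tubeD(6)[OF t] by simp
  qed
  moreover have "\<not> lmin y \<and> \<not> lmax y" if "y \<in> topspace X" "0 < k' y" "k' y < T" for y
   using that tubeD(7)[OF t, of y] unfolding k'_def by (auto split: if_splits)
  ultimately show ?thesis using T(2) by blast
 qed
qed

end

section \<open>One-sided calculus on the half-plane\<close>

abbreviation rel_open :: "(real^2) set => bool" where
 "rel_open S \<equiv> openin (top_of_set half_plane) S"

text \<open>Total differentiability within S, with the two coefficients named; the existence of
  partial derivatives alone would not allow the chain rule.\<close>

definition has_partials :: "(real^2 => real) => real => real => real^2 => (real^2) set => bool" where
 "has_partials f a b x S \<longleftrightarrow> (f has_derivative (%v. a * v $ 1 + b * v $ 2)) (at x within S)"

lemma convex_half_plane: "convex half_plane"
proof -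
 have "half_plane = {x. axis 2 1 \<bullet> x \<ge> 0}" unfolding half_plane_def by (simp add: inner_axis inner_commute)
 then show ?thesis using convex_halfspace_ge[of 0 "axis 2 1 :: real^2"] by simp
qed

lemma rel_open_half_plane: "rel_open S ==> S \<subseteq> half_plane" using openin_imp_subset by blast

lemma rel_open_ball:
 assumes "rel_open S" "x \<in> S" obtains r where "r > 0" "ball x r \<inter> half_plane \<subseteq> S" using assms unfolding openin_contains_ball by blast

lemma rel_open_step:
 assumes "rel_open S" "x \<in> S"
 obtains r where "r > 0" "\<And>v. v $ 2 \<ge> 0 ==> norm v < r ==> x + v \<in> S"
proof -
 obtain r where r: "r > 0" "ball x r \<inter> half_plane \<subseteq> S" using rel_open_ball[OF assms] .
 have "x $ 2 \<ge> 0" using rel_open_half_plane[OF assms(1)] assms(2) unfolding half_plane_def by auto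
 then have "x + v \<in> S" if "v $ 2 \<ge> 0" "norm v < r" for v using that r(2) unfolding half_plane_def by (auto simp: dist_norm)
 then show thesis using that r(1) by blast
qed

lemma rel_open_interior:
 assumes "rel_open S" "x \<in> S" "x $ 2 > 0"
 shows "x \<in> interior S"
proof -
 obtain T where T: "open T" "S = half_plane \<inter> T" using assms(1) by (auto simp: openin_open)
 have "open (T \<inter> {x. x $ 2 > 0})" using T(1) by (intro open_Int open_Collect_less continuous_intros)
 moreover have "T \<inter> {x. x $ 2 > 0} \<subseteq> S" unfolding T(2) half_plane_def by auto
 ultimately show ?thesis using assms T(2) by (intro interiorI[of "T \<inter> {x. x $ 2 > 0}"]) auto
qed

lemma vec2_eq: "(v::real^2) = (v $ 1) *\<^sub>R axis 1 1 + (v $ 2) *\<^sub>R axis 2 1" by (simp add: vec_eq_iff axis_def forall_2)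

lemma linear_vec2:
 fixes D :: "real^2 => real" assumes "linear D"
 shows "D v = D (axis 1 1) * v $ 1 + D (axis 2 1) * v $ 2"
proof -
 have "D v = D ((v $ 1) *\<^sub>R axis 1 1 + (v $ 2) *\<^sub>R axis 2 1)" using vec2_eq[of v] by simp
 then show ?thesis using assms by (simp add: linear_add linear_cmul mult.commute)
qed

text \<open>Positive multiples of the basis vectors stay in the half-plane, and they determine the
  derivative even at boundary points.\<close>

lemma derivative_unique_rel_open:
 assumes S: "rel_open S" "x \<in> S" and "(f has_derivative D) (at x within S)" "(f has_derivative D') (at x within S)"
 shows "D = D'"
proof (rule frechet_derivative_unique_within[OF assms(3,4)])
 fix i :: "real^2" and e :: real assume i: "i \<in> Basis" "0 < e"
 obtain r where r: "r > 0" "\<And>v. v $ 2 \<ge> 0 ==> norm v < r ==> x + v \<in> S" using rel_open_step[OF S] by blast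
 define d where "d = min (e/2) (r/2)"
 have "0 < d" "d < e" "d < r" unfolding d_def using i r by auto
 moreover have "(d *\<^sub>R i) $ 2 \<ge> 0" using i(1) \<open>0 < d\<close> by (auto simp: Basis_vec_def axis_def)
 moreover have "norm (d *\<^sub>R i) < r" using i(1) \<open>0 < d\<close> \<open>d < r\<close> by simp
 ultimately show "\<exists>d. 0 < \<bar>d\<bar> \<and> \<bar>d\<bar> < e \<and> x + d *\<^sub>R i \<in> S" using r(2) by (intro exI[of _ d]) auto
qed

lemma partial_within_eq:
 assumes "rel_open S" "x \<in> S" "(f has_derivative D) (at x within S)"
 shows "partial_within S i f x = D (axis i 1)"
proof -
 have "(f has_derivative frechet_derivative f (at x within S)) (at x within S)" using assms(3) frechet_derivative_works differentiableI by blast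
 then show ?thesis unfolding partial_within_def using derivative_unique_rel_open[OF assms(1,2)] assms(3) by metis
qed

lemma has_partials_eq:
 assumes "rel_open S" "x \<in> S" "has_partials f a b x S"
 shows "partial_within S 1 f x = a" "partial_within S 2 f x = b"
 using partial_within_eq[OF assms(1,2) assms(3)[unfolded has_partials_def]] by (auto simp: axis_def)

lemma has_partials_differentiable:
 assumes "f differentiable (at x within S)"
 shows "has_partials f (partial_within S 1 f x) (partial_within S 2 f x) x S"
proof -
 have d: "(f has_derivative frechet_derivative f (at x within S)) (at x within S)" using assms frechet_derivative_works by blast
 have "frechet_derivative f (at x within S) = (%v. partial_within S 1 f x * v $ 1 + partial_within S 2 f x * v $ 2)"
  unfolding partial_within_def by (rule ext, rule linear_vec2[OF has_derivative_linear[OF d]])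
 then show ?thesis using d unfolding has_partials_def by simp
qed

lemma has_partials_imp_differentiable: "has_partials f a b x S ==> f differentiable (at x within S)" unfolding has_partials_def differentiable_def by blast

lemma has_partials_const: "has_partials (%_. c) 0 0 x S" unfolding has_partials_def by simp

lemma has_partials_add:
 "has_partials f a b x S ==> has_partials g a' b' x S ==> has_partials (%x. f x + g x) (a + a') (b + b') x S"
 unfolding has_partials_def by (drule (1) has_derivative_add) (simp add: algebra_simps)

lemma has_partials_mult:
 "has_partials f a b x S ==> has_partials g a' b' x S ==>
  has_partials (%x. f x * g x) (a * g x + f x * a') (b * g x + f x * b') x S"
 unfolding has_partials_def by (drule (1) has_derivative_mult) (simp add: algebra_simps)

lemma has_partials_cmult: "has_partials f a b x S ==> has_partials (%x. c * f x) (c * a) (c * b) x S"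
 using has_partials_mult[OF has_partials_const, of f a b x S c] by simp

lemma has_partials_minus: "has_partials f a b x S ==> has_partials (%x. - f x) (- a) (- b) x S" using has_partials_cmult[of f a b x S "-1"] by simp

lemma has_partials_diff:
 "has_partials f a b x S ==> has_partials g a' b' x S ==> has_partials (%x. f x - g x) (a - a') (b - b') x S"
 using has_partials_add[OF _ has_partials_minus, of f a b x S g a' b'] by simp

lemma has_partials_compose:
 assumes "has_partials f a b x S" "(h has_real_derivative h') (at (f x) within R)" "f ` S \<subseteq> R"
 shows "has_partials (%x. h (f x)) (h' * a) (h' * b) x S"
proof -
 have "(h has_derivative (*) h') (at (f x) within f ` S)" using has_derivative_subset[OF assms(2)[unfolded has_field_derivative_def] assms(3)] .
 from has_derivative_in_compose[OF assms(1)[unfolded has_partials_def] this]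
 show ?thesis unfolding has_partials_def by (simp add: algebra_simps)
qed

lemma has_partials_inverse:
 assumes "has_partials f a b x S" "f x \<noteq> 0"
 shows "has_partials (%x. inverse (f x)) (- a * inverse (f x) * inverse (f x)) (- b * inverse (f x) * inverse (f x)) x S"
 using has_partials_compose[OF assms(1) DERIV_inverse[OF assms(2)], where R = UNIV] by (simp add: power2_eq_square mult.commute mult.left_commute)

lemma has_partials_sqrt:
 assumes "has_partials f a b x S" "f x > 0"
 shows "has_partials (%x. sqrt (f x)) (a / (2 * sqrt (f x))) (b / (2 * sqrt (f x))) x S"
proof -
 have "(sqrt has_real_derivative inverse (sqrt (f x)) / 2) (at (f x))" using DERIV_real_sqrt[OF assms(2)] .
 from has_partials_compose[OF assms(1) this] show ?thesis by (simp add: field_simps)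
qed

lemma has_partials_cong:
 assumes "has_partials f a b x S" "x \<in> S" "\<And>y. y \<in> S ==> g y = f y"
 shows "has_partials g a b x S" using has_derivative_transform[OF assms(2,3)] assms(1) unfolding has_partials_def by simp

lemma has_partials_mono: "has_partials f a b x S ==> S' \<subseteq> S ==> has_partials f a b x S'" unfolding has_partials_def by (rule has_derivative_subset)

lemma at_within_rel_open:
 assumes "rel_open S'" "x \<in> S'" "S' \<subseteq> S" "rel_open S"
 shows "at x within S' = at x within S"
proof -
 obtain T where T: "open T" "S' = half_plane \<inter> T" using assms(1) by (auto simp: openin_open)
 have "S' \<inter> T - {x} = S \<inter> T - {x}" using T assms(3) rel_open_half_plane[OF assms(4)] by blast
 then show ?thesis using at_within_nhd[of x T S' S] T assms(2) by blast
qed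

lemma partial_within_subset:
 assumes "rel_open S'" "x \<in> S'" "S' \<subseteq> S" "rel_open S"
 shows "partial_within S' i f x = partial_within S i f x" unfolding partial_within_def at_within_rel_open[OF assms] ..

lemma has_partials_subset_iff:
 assumes "rel_open S'" "x \<in> S'" "S' \<subseteq> S" "rel_open S"
 shows "has_partials f a b x S' \<longleftrightarrow> has_partials f a b x S" unfolding has_partials_def at_within_rel_open[OF assms] ..

lemma partial_within_cong:
 assumes "x \<in> S" "\<And>y. y \<in> S ==> f y = g y"
 shows "partial_within S i f x = partial_within S i g x"
proof -
 have "(f has_derivative D) (at x within S) \<longleftrightarrow> (g has_derivative D) (at x within S)" for D
  using has_derivative_transform[OF assms(1), of f g] has_derivative_transform[OF assms(1), of g f] assms(2) by auto
 then show ?thesis unfolding partial_within_def frechet_derivative_def by simp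
qed

section \<open>Functions of class C^k\<close>

lemma Ck_on_cong: "(\<And>y. y \<in> S ==> f y = g y) ==> Ck_on k S f = Ck_on k S g"
proof (induction k arbitrary: f g)
 case 0 then show ?case by (simp cong: continuous_on_cong)
next
 case (Suc k)
 have "f differentiable (at x within S) \<longleftrightarrow> g differentiable (at x within S)" if "x \<in> S" for x unfolding differentiable_def
  using has_derivative_transform[OF that, of f g] has_derivative_transform[OF that, of g f] Suc.prems by auto
 moreover have "Ck_on k S (partial_within S i f) = Ck_on k S (partial_within S i g)" for i by (rule Suc.IH) (rule partial_within_cong, use Suc.prems in auto)
 ultimately show ?case by (simp add: differentiable_on_def)
qed

lemma Ck_on_continuous: "Ck_on k S f ==> continuous_on S f" by (cases k) (auto intro: differentiable_imp_continuous_on)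

lemma Ck_on_SucD: "Ck_on (Suc k) S f ==> Ck_on k S f"
proof (induction k arbitrary: f)
 case 0 then show ?case using Ck_on_continuous[of "Suc 0" S f] by simp
next
 case (Suc k) then show ?case by simp
qed

lemma Ck_on_partials:
 assumes "Ck_on (Suc k) S f" "x \<in> S"
 shows "has_partials f (partial_within S 1 f x) (partial_within S 2 f x) x S"
 using assms by (intro has_partials_differentiable) (simp add: differentiable_on_def)

text \<open>The closure properties that follow are inductions on k by this rule: a differentiation
  rule names the partial derivatives, and the induction hypothesis makes them C^k.\<close>

lemma Ck_on_SucI:
 assumes S: "rel_open S" and h: "\<And>x. x \<in> S ==> has_partials f (a x) (b x) x S" and "Ck_on k S a" "Ck_on k S b"
 shows "Ck_on (Suc k) S f"
proof -
 have "f differentiable_on S" unfolding differentiable_on_def using has_partials_imp_differentiable[OF h] by simp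
 moreover have "Ck_on k S (partial_within S i f)" for i
 proof -
  have "i = 1 \<or> i = 2" using exhaust_2 .
  then show ?thesis
  proof
   assume "i = 1"
   then show ?thesis using has_partials_eq(1)[OF S _ h] assms(3) Ck_on_cong[of S "partial_within S 1 f" a] by auto
  next
   assume "i = 2"
   then show ?thesis using has_partials_eq(2)[OF S _ h] assms(4) Ck_on_cong[of S "partial_within S 2 f" b] by auto
  qed
 qed
 ultimately show ?thesis by simp
qed

lemma Ck_on_const: "rel_open S ==> Ck_on k S (%_. c)"
proof (induction k arbitrary: c)
 case (Suc k) show ?case by (rule Ck_on_SucI[OF Suc.prems has_partials_const]) (rule Suc)+
qed simp

lemma Ck_on_add: "rel_open S ==> Ck_on k S f ==> Ck_on k S g ==> Ck_on k S (%x. f x + g x)"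
proof (induction k arbitrary: f g)
 case 0 then show ?case by (simp add: continuous_on_add)
next
 case (Suc k)
 have p: "Ck_on k S (partial_within S i f)" "Ck_on k S (partial_within S i g)" for i using Suc.prems by auto
 show ?case by (rule Ck_on_SucI[OF Suc.prems(1) has_partials_add[OF Ck_on_partials[OF Suc.prems(2)] Ck_on_partials[OF Suc.prems(3)]]])
   (assumption | rule Suc.IH[OF Suc.prems(1) p])+
qed

lemma Ck_on_mult: "rel_open S ==> Ck_on k S f ==> Ck_on k S g ==> Ck_on k S (%x. f x * g x)"
proof (induction k arbitrary: f g)
 case 0 then show ?case by (simp add: continuous_on_mult)
next
 case (Suc k)
 have p: "Ck_on k S (partial_within S i f)" "Ck_on k S (partial_within S i g)" for i using Suc.prems by auto
 have q: "Ck_on k S f" "Ck_on k S g" using Suc.prems Ck_on_SucD by auto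
 show ?case by (rule Ck_on_SucI[OF Suc.prems(1) has_partials_mult[OF Ck_on_partials[OF Suc.prems(2)] Ck_on_partials[OF Suc.prems(3)]]])
   (assumption | intro Suc.IH Ck_on_add Suc.prems(1) p q)+
qed

lemma Ck_on_cmult: "rel_open S ==> Ck_on k S f ==> Ck_on k S (%x. c * f x)" by (rule Ck_on_mult[OF _ Ck_on_const])

lemma Ck_on_minus: "rel_open S ==> Ck_on k S f ==> Ck_on k S (%x. - f x)" using Ck_on_cmult[of S k f "-1"] by simp

lemma Ck_on_diff: "rel_open S ==> Ck_on k S f ==> Ck_on k S g ==> Ck_on k S (%x. f x - g x)" using Ck_on_add[OF _ _ Ck_on_minus, of S k f g] by simp

lemma Ck_on_inverse: "rel_open S ==> Ck_on k S f ==> (\<And>x. x \<in> S ==> f x \<noteq> 0) ==> Ck_on k S (%x. inverse (f x))"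
proof (induction k arbitrary: f)
 case 0 then show ?case by (simp add: continuous_on_inverse)
next
 case (Suc k)
 have p: "Ck_on k S (partial_within S i f)" for i using Suc.prems by auto
 have q: "Ck_on k S (%x. inverse (f x))" using Suc.IH[OF Suc.prems(1) Ck_on_SucD[OF Suc.prems(2)] Suc.prems(3)] .
 show ?case by (rule Ck_on_SucI[OF Suc.prems(1) has_partials_inverse[OF Ck_on_partials[OF Suc.prems(2)] Suc.prems(3)]])
   (assumption | intro Ck_on_mult Ck_on_minus Suc.prems(1) p q)+
qed

lemma Ck_on_sqrt: "rel_open S ==> Ck_on k S f ==> (\<And>x. x \<in> S ==> f x > 0) ==> Ck_on k S (%x. sqrt (f x))"
proof (induction k arbitrary: f)
 case 0 then show ?case by (simp add: continuous_on_real_sqrt)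
next
 case (Suc k)
 have p: "Ck_on k S (partial_within S i f)" for i using Suc.prems by auto
 have q: "Ck_on k S (%x. sqrt (f x))" using Suc.IH[OF Suc.prems(1) Ck_on_SucD[OF Suc.prems(2)] Suc.prems(3)] .
 have "f x \<noteq> 0" if "x \<in> S" for x using Suc.prems(3)[OF that] by simp
 then have i: "Ck_on k S (%x. inverse (2 * sqrt (f x)))" by (intro Ck_on_inverse[OF Suc.prems(1)] Ck_on_cmult[OF Suc.prems(1)] q) auto
 show ?case by (rule Ck_on_SucI[OF Suc.prems(1) has_partials_sqrt[OF Ck_on_partials[OF Suc.prems(2)] Suc.prems(3)]])
   (assumption | (unfold divide_inverse)?, intro Ck_on_mult Suc.prems(1) p i)+
qed

lemma Ck_on_subset:
 assumes "rel_open S'" "S' \<subseteq> S" "rel_open S"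
 shows "Ck_on k S f ==> Ck_on k S' f"
proof (induction k arbitrary: f)
 case 0 then show ?case using assms(2) continuous_on_subset by auto
next
 case (Suc k)
 have "Ck_on k S' (partial_within S' i f)" for i
  using Suc Ck_on_cong[of S' "partial_within S' i f" "partial_within S i f"] partial_within_subset[OF assms(1) _ assms(2,3)] by auto
 moreover have "f differentiable_on S'" using Suc.prems assms(2) differentiable_on_subset by auto
 ultimately show ?case by simp
qed

lemma line_derivative:
 assumes "has_partials f a b (x + s *\<^sub>R v) S" "\<And>t. t \<in> I ==> x + t *\<^sub>R v \<in> S"
 shows "((%t. f (x + t *\<^sub>R v)) has_real_derivative a * v $ 1 + b * v $ 2) (at s within I)"
proof -
 have 1: "((%t. x + t *\<^sub>R v) has_derivative (%t. t *\<^sub>R v)) (at s within I)" by (auto intro!: derivative_eq_intros)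
 have 2: "(f has_derivative (%v. a * v $ 1 + b * v $ 2)) (at (x + s *\<^sub>R v) within (%t. x + t *\<^sub>R v) ` I)"
  by (rule has_derivative_subset[OF assms(1)[unfolded has_partials_def]]) (use assms(2) in auto)
 from has_derivative_in_compose[OF 1 2]
 have "((%t. f (x + t *\<^sub>R v)) has_derivative (%t. a * (t *\<^sub>R v) $ 1 + b * (t *\<^sub>R v) $ 2)) (at s within I)" .
 moreover have "(%t. a * (t *\<^sub>R v) $ 1 + b * (t *\<^sub>R v) $ 2) = (*) (a * v $ 1 + b * v $ 2)" by (auto simp: algebra_simps)
 ultimately show ?thesis unfolding has_field_derivative_def by simp
qed

lemma mvt_within:
 fixes f :: "real => real"
 assumes "a < b" "\<And>x. x \<in> {a..b} ==> (f has_real_derivative f' x) (at x within {a..b})"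
 shows "\<exists>z\<in>{a<..<b}. f b - f a = (b - a) * f' z" using mvt_simple[OF assms(1), of f "%x. (*) (f' x)"] assms(2)
 by (auto simp: has_field_derivative_def mult.commute)

text \<open>The second difference of f over a square of side h is evaluated by the mean value
  theorem in both orders. Both sides of the square point into the half-plane, so the argument holds
  at boundary points too.\<close>

lemma mixed_partials:
 assumes S: "rel_open S" and f: "Ck_on 2 S f" and x: "x \<in> S"
 shows "partial_within S 2 (partial_within S 1 f) x = partial_within S 1 (partial_within S 2 f) x"
proof -
 let ?e = "%i::2. axis i 1 :: real^2"
 let ?f1 = "partial_within S 1 f" and ?f2 = "partial_within S 2 f"
 let ?f12 = "partial_within S 2 ?f1" and ?f21 = "partial_within S 1 ?f2"
 have C: "Ck_on (Suc (Suc 0)) S f" using f by (simp add: numeral_2_eq_2)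
 have C1: "Ck_on (Suc 0) S ?f1" "Ck_on (Suc 0) S ?f2" using C by auto
 have cont: "continuous_on S ?f12" "continuous_on S ?f21" using C by auto
 obtain r where r: "r > 0" "\<And>v. v $ 2 \<ge> 0 ==> norm v < r ==> x + v \<in> S" using rel_open_step[OF S x] by blast
 define P where "P s t = x + s *\<^sub>R ?e 1 + t *\<^sub>R ?e 2" for s t
 have PS: "P s t \<in> S" if "0 \<le> s" "0 \<le> t" "s + t < r" for s t
 proof -
  have "norm (s *\<^sub>R ?e 1 + t *\<^sub>R ?e 2) \<le> s + t" using norm_triangle_ineq[of "s *\<^sub>R ?e 1" "t *\<^sub>R ?e 2"] that by simp
  then show ?thesis unfolding P_def using r(2)[of "s *\<^sub>R ?e 1 + t *\<^sub>R ?e 2"] that by (simp add: axis_def add.assoc)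
 qed
 have d1: "((%s. h (P s t)) has_real_derivative partial_within S 1 h (P s t)) (at s within I)"
  if "Ck_on (Suc 0) S h" "s \<in> I" "I \<subseteq> {0..<r - t}" "0 \<le> t" for h s t I
 proof -
  have eq: "P s t = x + t *\<^sub>R ?e 2 + s *\<^sub>R ?e 1" for s unfolding P_def by simp
  have "((%s. h (x + t *\<^sub>R ?e 2 + s *\<^sub>R ?e 1)) has_real_derivative partial_within S 1 h (P s t) * ?e 1 $ 1 + partial_within S 2 h (P s t) * ?e 1 $ 2) (at s within I)"
   unfolding eq
  proof (rule line_derivative)
   show "has_partials h (partial_within S 1 h (x + t *\<^sub>R ?e 2 + s *\<^sub>R ?e 1)) (partial_within S 2 h (x + t *\<^sub>R ?e 2 + s *\<^sub>R ?e 1)) (x + t *\<^sub>R ?e 2 + s *\<^sub>R ?e 1) S"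
    using Ck_on_partials[OF that(1) PS[of s t]] that unfolding eq by force
   fix s assume "s \<in> I"
   then show "x + t *\<^sub>R ?e 2 + s *\<^sub>R ?e 1 \<in> S" using PS[of s t] that unfolding eq by force
  qed
  then show ?thesis unfolding eq by (simp add: axis_def)
 qed
 have d2: "((%t. h (P s t)) has_real_derivative partial_within S 2 h (P s t)) (at t within I)"
  if "Ck_on (Suc 0) S h" "t \<in> I" "I \<subseteq> {0..<r - s}" "0 \<le> s" for h s t I
 proof -
  have "((%t. h (x + s *\<^sub>R ?e 1 + t *\<^sub>R ?e 2)) has_real_derivative partial_within S 1 h (P s t) * ?e 2 $ 1 + partial_within S 2 h (P s t) * ?e 2 $ 2) (at t within I)"
   unfolding P_def
  proof (rule line_derivative)
   show "has_partials h (partial_within S 1 h (x + s *\<^sub>R ?e 1 + t *\<^sub>R ?e 2)) (partial_within S 2 h (x + s *\<^sub>R ?e 1 + t *\<^sub>R ?e 2)) (x + s *\<^sub>R ?e 1 + t *\<^sub>R ?e 2) S"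
    using Ck_on_partials[OF that(1) PS[of s t]] that unfolding P_def by force
   fix t assume "t \<in> I"
   then show "x + s *\<^sub>R ?e 1 + t *\<^sub>R ?e 2 \<in> S" using PS[of s t] that unfolding P_def by force
  qed
  then show ?thesis unfolding P_def by (simp add: axis_def)
 qed
 have near: "\<exists>s t s' t'. 0 < s \<and> s < h \<and> 0 < t \<and> t < h \<and> 0 < s' \<and> s' < h \<and> 0 < t' \<and> t' < h \<and> ?f12 (P s t) = ?f21 (P s' t')"
  if h: "0 < h" "h < r/2" for h
 proof -
  have I: "{0..h} \<subseteq> {0..<r - t}" if "0 \<le> t" "t \<le> h" for t using h that by auto
  have C0: "Ck_on (Suc 0) S f" using C Ck_on_SucD by blast
  obtain s where s: "s \<in> {0<..<h}" "(f (P h h) - f (P h 0)) - (f (P 0 h) - f (P 0 0)) = (h - 0) * (?f1 (P s h) - ?f1 (P s 0))"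
   using mvt_within[OF h(1), of "%s. f (P s h) - f (P s 0)" "%s. ?f1 (P s h) - ?f1 (P s 0)"]
    DERIV_diff[OF d1[OF C0 _ I] d1[OF C0 _ I]] h by fastforce
  obtain t where t: "t \<in> {0<..<h}" "?f1 (P s h) - ?f1 (P s 0) = (h - 0) * ?f12 (P s t)"
   using mvt_within[OF h(1), of "%t. ?f1 (P s t)" "%t. ?f12 (P s t)"] d2[OF C1(1) _ I] s(1) by fastforce
  obtain t' where t': "t' \<in> {0<..<h}" "(f (P h h) - f (P 0 h)) - (f (P h 0) - f (P 0 0)) = (h - 0) * (?f2 (P h t') - ?f2 (P 0 t'))"
   using mvt_within[OF h(1), of "%t. f (P h t) - f (P 0 t)" "%t. ?f2 (P h t) - ?f2 (P 0 t)"]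
    DERIV_diff[OF d2[OF C0 _ I] d2[OF C0 _ I]] h by fastforce
  obtain s' where s': "s' \<in> {0<..<h}" "?f2 (P h t') - ?f2 (P 0 t') = (h - 0) * ?f21 (P s' t')"
   using mvt_within[OF h(1), of "%s. ?f2 (P s t')" "%s. ?f21 (P s t')"] d1[OF C1(2) _ I] t'(1) by fastforce
  have "h * (h * ?f12 (P s t)) = h * (h * ?f21 (P s' t'))" using s(2) t(2) s'(2) t'(2) by (simp add: algebra_simps)
  then have "?f12 (P s t) = ?f21 (P s' t')" using h by simp
  then show ?thesis using s(1) t(1) s'(1) t'(1) by (metis greaterThanLessThan_iff)
 qed
 show ?thesis
 proof (rule ccontr)
  assume ne: "?f12 x \<noteq> ?f21 x"
  define e where "e = \<bar>?f12 x - ?f21 x\<bar> / 2"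
  have e: "e > 0" unfolding e_def using ne by simp
  obtain d1 where d1: "d1 > 0" "\<And>y. y \<in> S ==> dist y x < d1 ==> dist (?f12 y) (?f12 x) < e" using cont(1) x e unfolding continuous_on_iff by metis
  obtain d2 where d2: "d2 > 0" "\<And>y. y \<in> S ==> dist y x < d2 ==> dist (?f21 y) (?f21 x) < e" using cont(2) x e unfolding continuous_on_iff by metis
  define h where "h = min (r/4) (min (d1/4) (d2/4))"
  have h: "0 < h" "h < r/2" "h < d1/2" "h < d2/2" unfolding h_def using r d1 d2 by auto
  obtain s t s' t' where st: "0 < s" "s < h" "0 < t" "t < h" "0 < s'" "s' < h" "0 < t'" "t' < h" "?f12 (P s t) = ?f21 (P s' t')"
   using near[OF h(1,2)] by blast
  have dP: "dist (P s t) x \<le> s + t" if "0 < s" "0 < t" for s t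
   using norm_triangle_ineq[of "s *\<^sub>R ?e 1" "t *\<^sub>R ?e 2"] that unfolding P_def by (simp add: dist_norm add.assoc)
  have "dist (?f12 (P s t)) (?f12 x) < e" using dP[OF st(1,3)] st h by (intro d1(2) PS) auto
  moreover have "dist (?f21 (P s' t')) (?f21 x) < e" using dP[OF st(5,7)] st h by (intro d2(2) PS) auto
  moreover have False if "\<bar>z - p\<bar> < e'" "\<bar>z - q\<bar> < e'" "e' = \<bar>p - q\<bar> / 2" for z p q e' :: real
   using that by (auto simp: abs_if split: if_splits)
  ultimately show False unfolding st(9) dist_real_def using e_def by blast
 qed
qed

lemma segment_in_half_ball:
 assumes "x \<in> ball a r \<inter> half_plane" "y \<in> ball a r \<inter> half_plane" "t \<in> {0..1}"
 shows "x + t *\<^sub>R (y - x) \<in> ball a r \<inter> half_plane"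
proof -
 have "convex (ball a r \<inter> half_plane)" by (intro convex_Int convex_ball convex_half_plane)
 moreover have "x + t *\<^sub>R (y - x) = (1 - t) *\<^sub>R x + t *\<^sub>R y" by (simp add: algebra_simps)
 ultimately show ?thesis using assms convexD_alt by (metis atLeastAtMost_iff)
qed

lemma partial_add:
 assumes "rel_open S" "x \<in> S" "Ck_on 1 S f" "Ck_on 1 S g"
 shows "partial_within S i (%x. f x + g x) x = partial_within S i f x + partial_within S i g x"
 using has_partials_eq[OF assms(1,2) has_partials_add[OF Ck_on_partials Ck_on_partials], of 0 f 0 g] assms exhaust_2[of i] by auto

lemma partial_mult:
 assumes "rel_open S" "x \<in> S" "Ck_on 1 S f" "Ck_on 1 S g"
 shows "partial_within S i (%x. f x * g x) x = partial_within S i f x * g x + f x * partial_within S i g x"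
 using has_partials_eq[OF assms(1,2) has_partials_mult[OF Ck_on_partials Ck_on_partials], of 0 f 0 g] assms exhaust_2[of i] by auto

lemma partial_const:
 assumes "rel_open S" "x \<in> S" shows "partial_within S i (%x. c) x = 0" using has_partials_eq[OF assms(1,2) has_partials_const] exhaust_2[of i] by auto

lemma partial_minus:
 assumes "rel_open S" "x \<in> S" "Ck_on 1 S f"
 shows "partial_within S i (%x. - f x) x = - partial_within S i f x"
 using has_partials_eq[OF assms(1,2) has_partials_minus[OF Ck_on_partials], of 0 f] assms exhaust_2[of i] by auto

lemma partial_diff:
 assumes "rel_open S" "x \<in> S" "Ck_on 1 S f" "Ck_on 1 S g"
 shows "partial_within S i (%x. f x - g x) x = partial_within S i f x - partial_within S i g x"
 using has_partials_eq[OF assms(1,2) has_partials_diff[OF Ck_on_partials Ck_on_partials], of 0 f 0 g] assms exhaust_2[of i] by auto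

lemma partial_cmult:
 assumes "rel_open S" "x \<in> S" "Ck_on 1 S f"
 shows "partial_within S i (%x. c * f x) x = c * partial_within S i f x"
 using has_partials_eq[OF assms(1,2) has_partials_cmult[OF Ck_on_partials], of 0 f] assms exhaust_2[of i] by auto

lemma partial_sqrt:
 assumes "rel_open S" "x \<in> S" "Ck_on 1 S f" "f x > 0"
 shows "partial_within S i (%x. sqrt (f x)) x = partial_within S i f x / (2 * sqrt (f x))"
 using has_partials_eq[OF assms(1,2) has_partials_sqrt[OF Ck_on_partials], of 0 f] assms exhaust_2[of i] by auto

lemma partial_divide:
 assumes "rel_open S" "x \<in> S" "Ck_on 1 S f" "Ck_on 1 S g" "g x \<noteq> 0"
 shows "partial_within S i (%x. f x / g x) x = (partial_within S i f x * g x - f x * partial_within S i g x) / (g x * g x)"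
proof -
 have "has_partials (%x. f x * inverse (g x))
   (partial_within S 1 f x * inverse (g x) + f x * (- partial_within S 1 g x * inverse (g x) * inverse (g x)))
   (partial_within S 2 f x * inverse (g x) + f x * (- partial_within S 2 g x * inverse (g x) * inverse (g x))) x S"
  using assms by (intro has_partials_mult has_partials_inverse Ck_on_partials[of 0]) auto
 from has_partials_eq[OF assms(1,2) this] show ?thesis using exhaust_2[of i] assms(5) by (auto simp: divide_simps)
qed

lemma partial_mult2:
 assumes "rel_open S" "x \<in> S" "Ck_on 1 S f" "Ck_on 1 S g" "Ck_on 1 S h" "Ck_on 1 S k"
 shows "partial_within S i (%x. f x * g x + h x * k x) x = partial_within S i f x * g x + f x * partial_within S i g x
   + (partial_within S i h x * k x + h x * partial_within S i k x)"
 unfolding partial_add[OF assms(1,2) Ck_on_mult[OF assms(1,3,4)] Ck_on_mult[OF assms(1,5,6)]]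
  partial_mult[OF assms(1-4)] partial_mult[OF assms(1,2,5,6)] ..

section \<open>Killing fields in a chart\<close>

text \<open>
 \<open>E\<close>, \<open>F\<close>, \<open>G\<close> are the coefficients of the metric and \<open>X1\<close>, \<open>X2\<close> the components of the Killing field.
\<close>

locale killing_chart =
 fixes S :: "(real^2) set" and E F G X1 X2 :: "real^2 => real"
 assumes S: "rel_open S"
  and smooth: "Ck_on k S E" "Ck_on k S F" "Ck_on k S G" "Ck_on k S X1" "Ck_on k S X2"
  and E_pos: "x \<in> S ==> 0 < E x" and det_pos: "x \<in> S ==> 0 < E x * G x - F x * F x"
  and K11: "x \<in> S ==> X1 x * partial_within S 1 E x + X2 x * partial_within S 2 E x
   + 2 * (E x * partial_within S 1 X1 x + F x * partial_within S 1 X2 x) = 0"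
  and K12: "x \<in> S ==> X1 x * partial_within S 1 F x + X2 x * partial_within S 2 F x
   + (F x * partial_within S 1 X1 x + G x * partial_within S 1 X2 x)
   + (E x * partial_within S 2 X1 x + F x * partial_within S 2 X2 x) = 0"
  and K22: "x \<in> S ==> X1 x * partial_within S 1 G x + X2 x * partial_within S 2 G x
   + 2 * (F x * partial_within S 2 X1 x + G x * partial_within S 2 X2 x) = 0"
begin

abbreviation "D \<equiv> partial_within S"
abbreviation "D1 f \<equiv> D 1 f"
abbreviation "D2 f \<equiv> D 2 f"

text \<open>
 The form \<open>al\<close> is, up to sign, the interior product of the field with the area form. It is closed because the field is divergence
 free, and the squared length \<open>N\<close> of the field satisfies \<open>dN = kap al\<close>, where \<open>kap\<close> is the curl of the field.
\<close>

definition r :: "real^2 => real" where "r x = sqrt (E x * G x - F x * F x)"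
definition al1 :: "real^2 => real" where "al1 x = r x * X2 x"
definition al2 :: "real^2 => real" where "al2 x = - (r x * X1 x)"
definition Y1 :: "real^2 => real" where "Y1 x = E x * X1 x + F x * X2 x"
definition Y2 :: "real^2 => real" where "Y2 x = F x * X1 x + G x * X2 x"
definition N :: "real^2 => real" where "N x = X1 x * Y1 x + X2 x * Y2 x"
definition kap :: "real^2 => real" where "kap x = (D1 Y2 x - D2 Y1 x) / r x"

lemmas Ck_intros = Ck_on_add[OF S] Ck_on_mult[OF S] Ck_on_diff[OF S] Ck_on_minus[OF S] smooth Ck_on_const[OF S]

lemma r_pos: "x \<in> S ==> 0 < r x" unfolding r_def using det_pos by simp
lemma r_sq: "x \<in> S ==> r x * r x = E x * G x - F x * F x" unfolding r_def using det_pos[of x] by simp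

lemma r_smooth: "Ck_on k S r" unfolding r_def by (intro Ck_on_sqrt[OF S] Ck_intros det_pos)

lemma al_smooth: "Ck_on k S al1" "Ck_on k S al2" unfolding al1_def al2_def by (intro Ck_intros r_smooth)+
lemma Y_smooth: "Ck_on k S Y1" "Ck_on k S Y2" unfolding Y1_def Y2_def by (intro Ck_intros)+
lemma N_smooth: "Ck_on k S N" unfolding N_def by (intro Ck_intros Y_smooth)+

lemma partial_smooth: "(\<And>k. Ck_on k S f) ==> Ck_on k S (D i f)" using Ck_on.simps(2) by blast

lemma kap_smooth: "Ck_on k S kap" unfolding kap_def divide_inverse
 by (intro Ck_intros Ck_on_inverse[OF S] r_smooth partial_smooth Y_smooth) (use r_pos in force)

lemma partial_r:
 assumes x: "x \<in> S"
 shows "2 * r x * D i r x = D i E x * G x + E x * D i G x - 2 * F x * D i F x"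
proof -
 have c: "Ck_on 1 S (%x. E x * G x)" "Ck_on 1 S (%x. F x * F x)" by (intro Ck_intros)+
 have "D i r x = D i (%x. E x * G x - F x * F x) x / (2 * r x)" using partial_sqrt[OF S x Ck_on_diff[OF S c] det_pos[OF x], of i] unfolding r_def .
 then show ?thesis using r_pos[OF x] partial_diff[OF S x c, of i] partial_mult[OF S x smooth(1) smooth(3), of i]
   partial_mult[OF S x smooth(2) smooth(2), of i] by (simp add: field_simps)
qed

text \<open>The trace of the Killing equations with respect to the metric: a Killing field preserves
  the area density \<open>r\<close>. The factor 2r avoids square roots.\<close>

lemma div_free:
 assumes x: "x \<in> S"
 shows "X1 x * D1 r x + X2 x * D2 r x = - r x * (D1 X1 x + D2 X2 x)"
proof -
 have "2 * r x * (X1 x * D1 r x + X2 x * D2 r x) = X1 x * (2 * r x * D1 r x) + X2 x * (2 * r x * D2 r x)" by (simp add: algebra_simps)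
 also have "\<dots> = 2 * r x * (- r x * (D1 X1 x + D2 X2 x))" unfolding partial_r[OF x] using K11[OF x] K12[OF x] K22[OF x] r_sq[OF x] by algebra
 finally show ?thesis using r_pos[OF x] by (simp only: mult_cancel_left) auto
qed

lemma partial_al:
 assumes x: "x \<in> S"
 shows "D i al1 x = D i r x * X2 x + r x * D i X2 x"
  "D i al2 x = - (D i r x * X1 x + r x * D i X1 x)" unfolding al1_def al2_def
 using partial_mult[OF S x r_smooth smooth(5), of i] partial_mult[OF S x r_smooth smooth(4), of i]
  partial_minus[OF S x Ck_on_mult[OF S r_smooth smooth(4)], of i] by simp_all

lemma alpha_closed: "x \<in> S ==> D2 al1 x = D1 al2 x" using div_free[of x] by (simp add: partial_al algebra_simps)

lemma partial_Y:
 assumes x: "x \<in> S"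
 shows "D i Y1 x = D i E x * X1 x + E x * D i X1 x + (D i F x * X2 x + F x * D i X2 x)"
  "D i Y2 x = D i F x * X1 x + F x * D i X1 x + (D i G x * X2 x + G x * D i X2 x)"
 unfolding Y1_def Y2_def by (rule partial_mult2[OF S x smooth(1) smooth(4) smooth(2) smooth(5)] partial_mult2[OF S x smooth(2) smooth(4) smooth(3) smooth(5)])+

text \<open>Cartan's formula applied to the dual one-form Y of the field, whose Lie derivative along
  the field vanishes: dN is minus the interior product of the field with dY, and dY is
  \<open>kap\<close> times the area form.\<close>

lemma N_partials:
 assumes x: "x \<in> S"
 shows "D1 N x = kap x * al1 x" "D2 N x = kap x * al2 x"
proof -
 have N: "D i N x = D i X1 x * Y1 x + X1 x * D i Y1 x
   + (D i X2 x * Y2 x + X2 x * D i Y2 x)" for i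
  unfolding N_def by (rule partial_mult2[OF S x smooth(4) Y_smooth(1) smooth(5) Y_smooth(2)])
 have k: "kap x * al1 x = (D1 Y2 x - D2 Y1 x) * X2 x" "kap x * al2 x = - (D1 Y2 x - D2 Y1 x) * X1 x"
  unfolding kap_def al1_def al2_def using r_pos[OF x] by (simp_all add: field_simps)
 show "D1 N x = kap x * al1 x" unfolding N k partial_Y[OF x] Y1_def Y2_def using K11[OF x] K12[OF x] by algebra
 show "D2 N x = kap x * al2 x" unfolding N k partial_Y[OF x] Y1_def Y2_def using K22[OF x] K12[OF x] by algebra
qed

text \<open>The wedge product of \<open>al\<close> with the dual one-form is N times the area form;
  this is the term that carries n W'' in the Laplacian of W o k.\<close>

lemma N_alpha: "x \<in> S ==> r x * N x = al1 x * Y2 x - al2 x * Y1 x" unfolding N_def al1_def al2_def by (simp add: algebra_simps)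

lemma N_nonneg:
 assumes x: "x \<in> S" shows "0 \<le> N x" "N x = 0 \<longleftrightarrow> X1 x = 0 \<and> X2 x = 0"
proof -
 have e: "E x * N x = (E x * X1 x + F x * X2 x)\<^sup>2 + (E x * G x - F x * F x) * (X2 x)\<^sup>2"
  unfolding N_def Y1_def Y2_def by (simp add: power2_eq_square algebra_simps)
 then have "0 \<le> E x * N x" using det_pos[OF x] by simp
 then show "0 \<le> N x" using E_pos[OF x] by (simp add: zero_le_mult_iff)
 show "N x = 0 \<longleftrightarrow> X1 x = 0 \<and> X2 x = 0"
 proof
  assume "N x = 0"
  then have "(E x * X1 x + F x * X2 x)\<^sup>2 + (E x * G x - F x * F x) * (X2 x)\<^sup>2 = 0" using e by simp
  then have "(E x * X1 x + F x * X2 x)\<^sup>2 = 0 \<and> (E x * G x - F x * F x) * (X2 x)\<^sup>2 = 0"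
   using det_pos[OF x] by (subst (asm) add_nonneg_eq_0_iff) auto
  then show "X1 x = 0 \<and> X2 x = 0" using det_pos[OF x] E_pos[OF x] by auto
 qed (simp add: N_def)
qed

text \<open>At a zero the Killing equations say that the derivative of the field is skew for the
  metric, hence determined by the single number \<open>kap\<close>. The derivative of
  \<open>al\<close>, which is the Hessian of its primitive, is then \<open>kap\<close>/2 times the
  metric, so a zero with \<open>kap\<close> \<noteq> 0 is a definite extremum.\<close>

lemma zero_structure:
 assumes x: "x \<in> S" "X1 x = 0" "X2 x = 0"
 shows "D1 al1 x = kap x / 2 * E x" "D2 al1 x = kap x / 2 * F x" "D1 al2 x = kap x / 2 * F x" "D2 al2 x = kap x / 2 * G x"
  "r x * r x * D1 X2 x = kap x / 2 * r x * E x" "r x * r x * D1 X1 x = - kap x / 2 * r x * F x"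
  "r x * r x * D2 X1 x = - kap x / 2 * r x * G x" "r x * r x * D2 X2 x = kap x / 2 * r x * F x"
proof -
 have k: "kap x * r x = F x * D1 X1 x + G x * D1 X2 x - (E x * D2 X1 x + F x * D2 X2 x)" unfolding kap_def partial_Y[OF x(1)] using x r_pos[OF x(1)] by simp
 define a where "a = F x * D1 X1 x + G x * D1 X2 x"
 have e: "E x * D1 X1 x + F x * D1 X2 x = 0" "E x * D2 X1 x + F x * D2 X2 x = - a" "F x * D2 X1 x + G x * D2 X2 x = 0"
  using K11[OF x(1)] K12[OF x(1)] K22[OF x(1)] x unfolding a_def by auto
 have a: "a = kap x / 2 * r x" using k e unfolding a_def by simp
 note rs = r_sq[OF x(1)]
 have 1: "r x * r x * D1 X2 x = a * E x" "r x * r x * D1 X1 x = - a * F x"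
  "r x * r x * D2 X1 x = - a * G x" "r x * r x * D2 X2 x = a * F x" unfolding rs using e a_def by algebra+
 then show "r x * r x * D1 X2 x = kap x / 2 * r x * E x" "r x * r x * D1 X1 x = - kap x / 2 * r x * F x"
  "r x * r x * D2 X1 x = - kap x / 2 * r x * G x" "r x * r x * D2 X2 x = kap x / 2 * r x * F x" unfolding a by simp_all
 then have "r x * (r x * D1 X2 x) = r x * (kap x / 2 * E x)" "r x * (r x * D1 X1 x) = r x * (- kap x / 2 * F x)"
  "r x * (r x * D2 X1 x) = r x * (- kap x / 2 * G x)" "r x * (r x * D2 X2 x) = r x * (kap x / 2 * F x)" by (simp_all add: algebra_simps)
 then have "r x * D1 X2 x = kap x / 2 * E x" "r x * D1 X1 x = - kap x / 2 * F x"
  "r x * D2 X1 x = - kap x / 2 * G x" "r x * D2 X2 x = kap x / 2 * F x" using r_pos[OF x(1)] by (simp_all only: mult_cancel_left) auto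
 then show "D1 al1 x = kap x / 2 * E x" "D2 al1 x = kap x / 2 * F x" "D1 al2 x = kap x / 2 * F x" "D2 al2 x = kap x / 2 * G x"
  unfolding partial_al[OF x(1)] using x by simp_all
qed

text \<open>The second part serves at boundary points, where \<open>X2\<close> vanishes along the
  boundary line.\<close>

lemma degenerate_zero:
 assumes x: "x \<in> S" "X1 x = 0" "X2 x = 0"
 shows "kap x = 0 ==> D1 X1 x = 0 \<and> D2 X1 x = 0 \<and> D1 X2 x = 0 \<and> D2 X2 x = 0"
  "D1 X2 x = 0 ==> kap x = 0" using zero_structure(5-8)[OF x] r_pos[OF x(1)] E_pos[OF x(1)] by auto

text \<open>
 The size of the one-jet. The Killing equation expresses second derivatives through the one-jet, so a field whose
 one-jet vanishes at a point vanishes near it.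
\<close>

definition mm :: "real^2 => real" where
 "mm x = \<bar>X1 x\<bar> + \<bar>X2 x\<bar> + \<bar>D1 X1 x\<bar> + \<bar>D2 X1 x\<bar> + \<bar>D1 X2 x\<bar> + \<bar>D2 X2 x\<bar>"

definition dom :: "real^2 => (real^2 => real) => bool" where
 "dom a f \<longleftrightarrow> (\<exists>C\<ge>0. \<exists>d>0. \<forall>x\<in>S \<inter> ball a d. \<bar>f x\<bar> \<le> C * mm x)"

lemma mm_nonneg: "0 \<le> mm x" unfolding mm_def by simp

lemma dom_base: "dom a X1" "dom a X2" "dom a (D1 X1)" "dom a (D2 X1)" "dom a (D1 X2)" "dom a (D2 X2)"
 unfolding dom_def by (rule exI[of _ 1], simp, rule exI[of _ 1], simp add: mm_def)+

lemma dom_add: assumes "dom a f" "dom a g" shows "dom a (%x. f x + g x)"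
proof -
 obtain C d where 1: "0 \<le> C" "0 < d" "\<And>x. x \<in> S \<inter> ball a d ==> \<bar>f x\<bar> \<le> C * mm x" using assms(1) unfolding dom_def by blast
 obtain C' d' where 2: "0 \<le> C'" "0 < d'" "\<And>x. x \<in> S \<inter> ball a d' ==> \<bar>g x\<bar> \<le> C' * mm x" using assms(2) unfolding dom_def by blast
 have "\<bar>f x + g x\<bar> \<le> (C + C') * mm x" if "x \<in> S \<inter> ball a (min d d')" for x
 proof -
  have "\<bar>f x\<bar> \<le> C * mm x" "\<bar>g x\<bar> \<le> C' * mm x" using 1(3)[of x] 2(3)[of x] that by auto
  then show ?thesis by (simp add: distrib_right)
 qed
 then show ?thesis unfolding dom_def using 1 2 by (intro exI[of _ "C + C'"] conjI exI[of _ "min d d'"]) auto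
qed

lemma dom_mult: assumes a: "a \<in> S" and g: "continuous_on S g" and f: "dom a f" shows "dom a (%x. g x * f x)"
proof -
 obtain C d where 1: "0 \<le> C" "0 < d" "\<And>x. x \<in> S \<inter> ball a d ==> \<bar>f x\<bar> \<le> C * mm x" using f unfolding dom_def by blast
 obtain d' where 2: "0 < d'" "\<And>x. x \<in> S ==> dist x a < d' ==> dist (g x) (g a) < 1" using g a unfolding continuous_on_iff by (metis zero_less_one)
 have "\<bar>g x * f x\<bar> \<le> ((\<bar>g a\<bar> + 1) * C) * mm x" if "x \<in> S \<inter> ball a (min d d')" for x
 proof -
  have "\<bar>g x\<bar> \<le> \<bar>g a\<bar> + 1" using 2(2)[of x] that by (auto simp: dist_real_def dist_commute)
  moreover have "\<bar>f x\<bar> \<le> C * mm x" using 1(3)[of x] that by auto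
  ultimately have "\<bar>g x\<bar> * \<bar>f x\<bar> \<le> (\<bar>g a\<bar> + 1) * (C * mm x)" by (intro mult_mono) auto
  then show ?thesis by (simp add: abs_mult mult.assoc)
 qed
 then show ?thesis unfolding dom_def using 1 2 by (intro exI[of _ "(\<bar>g a\<bar> + 1) * C"] conjI exI[of _ "min d d'"]) auto
qed

lemma dom_cong: "dom a f ==> (\<And>x. x \<in> S ==> g x = f x) ==> dom a g" unfolding dom_def by (metis IntD1)

text \<open>Differentiating the three Killing equations in both directions gives six linear
  equations. The unknowns \<open>A1\<close> and \<open>A2\<close> are the second derivatives with an
  index lowered; since they are symmetric in i and j, there are six of them, and each is found
  modulo the one-jet. The metric is then inverted.\<close>

lemma dom_second:
 assumes a: "a \<in> S"
 shows "dom a (D i (D1 X1))" "dom a (D i (D2 X1))"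
  "dom a (D i (D1 X2))" "dom a (D i (D2 X2))"
proof -
 note c = Ck_on_continuous[of 0]
 have cE: "continuous_on S E" "continuous_on S F" "continuous_on S G" using smooth Ck_on_continuous by blast+
 have cp: "continuous_on S (D i h)" if "\<And>k. Ck_on k S h" for i h using partial_smooth[OF that] Ck_on_continuous by blast
 have cpp: "continuous_on S (D j (D i h))" if "\<And>k. Ck_on k S h" for i j h by (rule cp) (rule partial_smooth[OF that])
 have ci: "continuous_on S (%x. inverse (r x * r x))" using Ck_on_continuous[OF r_smooth] r_pos by (intro continuous_intros) force+
 have C1: "Ck_on 1 S (D i h)" if "\<And>k. Ck_on k S h" for i h using partial_smooth[OF that] .
 note sm = smooth
 have mix: "D2 (D1 h) x = D1 (D2 h) x" if "\<And>k. Ck_on k S h" "x \<in> S" for h x using mixed_partials[OF S that(1,2)] .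
 have exp: "D i (%x. X1 x * D 1 H x + X2 x * D 2 H x) x =
   D i X1 x * D1 H x + X1 x * D i (D1 H) x +
   (D i X2 x * D2 H x + X2 x * D i (D2 H) x)" if H: "\<And>k. Ck_on k S H" and x: "x \<in> S" for H i x
  by (rule partial_mult2[OF S x smooth(4) C1[OF H] smooth(5) C1[OF H]])
 \<comment> \<open>\<open>lo\<close> and \<open>B\<close> collect the terms that contain at most
   first derivatives of the field.\<close>
 define lo where "lo H i x = D i X1 x * D1 H x + X1 x * D i (D1 H) x +
   (D i X2 x * D2 H x + X2 x * D i (D2 H) x)" for H :: "real^2 => real" and i x
 have ii: "i = 1 \<or> i = 2" for i :: 2 using exhaust_2 .
 have dX: "dom a (D i X1)" "dom a (D i X2)" for i using ii[of i] dom_base by auto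
 have dlo: "dom a (lo H i)" if H: "\<And>k. Ck_on k S H" for H i
  unfolding lo_def mult.commute[of "D i X1 _"] mult.commute[of "D i X2 _"] mult.commute[of "X1 _"] mult.commute[of "X2 _"]
  by (intro dom_add dom_mult[OF a] dX dom_base cp cpp H)
 define B where "B H J i j x = D i H x * D j X1 x + D i J x * D j X2 x"
  for H J :: "real^2 => real" and i j x
 have dB: "dom a (B H J i j)" if "\<And>k. Ck_on k S H" "\<And>k. Ck_on k S J" for H J i j unfolding B_def by (intro dom_add dom_mult[OF a] dX cp that)
 define A1 where "A1 i j x = E x * D i (D j X1) x + F x * D i (D j X2) x" for i j x
 define A2 where "A2 i j x = F x * D i (D j X1) x + G x * D i (D j X2) x" for i j x
 have A: "D i (%x. H x * D j X1 x + J x * D j X2 x) x =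
   B H J i j x + (H x * D i (D j X1) x + J x * D i (D j X2) x)"
  if "\<And>k. Ck_on k S H" "\<And>k. Ck_on k S J" "x \<in> S" for H J i j x
  unfolding B_def partial_mult2[OF S that(3) that(1) C1[OF sm(4)] that(2) C1[OF sm(5)]] by simp
 have Z: "D i Q x = 0" if "\<And>x. x \<in> S ==> Q x = 0" "x \<in> S" for i Q x
  using partial_within_cong[OF that(2), of Q "%_. 0" i] that(1) partial_const[OF S that(2)] by simp
 have C2: "Ck_on 1 S (%x. X1 x * D1 H x + X2 x * D2 H x)" if "\<And>k. Ck_on k S H" for H by (intro Ck_intros C1 that)
 have C3: "Ck_on 1 S (%x. H x * D j X1 x + J x * D j X2 x)" if "\<And>k. Ck_on k S H" "\<And>k. Ck_on k S J" for H J j by (intro Ck_intros C1 that)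
 have e11: "lo E i x + 2 * (B E F i 1 x + A1 i 1 x) = 0" if x: "x \<in> S" for i x
 proof -
  have z: "D i (%x. X1 x * D1 E x + X2 x * D2 E x + 2 * (E x * D1 X1 x + F x * D1 X2 x)) x = 0" by (rule Z[OF _ x]) (rule K11)
  show ?thesis using z unfolding A1_def lo_def partial_add[OF S x C2[OF sm(1)] Ck_on_cmult[OF S C3[OF sm(1,2)]]]
   partial_cmult[OF S x C3[OF sm(1,2)]] exp[OF sm(1) x] A[OF sm(1,2) x] .
 qed
 have e22: "lo G i x + 2 * (B F G i 2 x + A2 i 2 x) = 0" if x: "x \<in> S" for i x
 proof -
  have z: "D i (%x. X1 x * D1 G x + X2 x * D2 G x + 2 * (F x * D2 X1 x + G x * D2 X2 x)) x = 0" by (rule Z[OF _ x]) (rule K22)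
  show ?thesis using z unfolding A2_def lo_def partial_add[OF S x C2[OF sm(3)] Ck_on_cmult[OF S C3[OF sm(2,3)]]]
   partial_cmult[OF S x C3[OF sm(2,3)]] exp[OF sm(3) x] A[OF sm(2,3) x] .
 qed
 have e12: "lo F i x + (B F G i 1 x + A2 i 1 x) + (B E F i 2 x + A1 i 2 x) = 0" if x: "x \<in> S" for i x
 proof -
  have z: "D i (%x. X1 x * D1 F x + X2 x * D2 F x + (F x * D1 X1 x + G x * D1 X2 x) + (E x * D2 X1 x + F x * D2 X2 x)) x = 0" by (rule Z[OF _ x]) (rule K12)
  show ?thesis using z unfolding A1_def A2_def lo_def
   partial_add[OF S x Ck_on_add[OF S C2[OF sm(2)] C3[OF sm(2,3)]] C3[OF sm(1,2)]] partial_add[OF S x C2[OF sm(2)] C3[OF sm(2,3)]]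
   exp[OF sm(2) x] A[OF sm(2,3) x] A[OF sm(1,2) x] .
 qed
 have sym: "A1 2 1 x = A1 1 2 x" "A2 2 1 x = A2 1 2 x" if "x \<in> S" for x unfolding A1_def A2_def using mix[OF sm(4) that] mix[OF sm(5) that] by simp_all
 have cc: "continuous_on S (%_. c::real)" for c by simp
 have a11: "dom a (A1 i 1)" for i by (rule dom_cong[of _ "%x. (-1/2) * lo E i x + (-1) * B E F i 1 x"], intro dom_add dom_mult[OF a cc] dlo dB sm)
    (use e11[of _ i] in force)
 have a22: "dom a (A2 i 2)" for i by (rule dom_cong[of _ "%x. (-1/2) * lo G i x + (-1) * B F G i 2 x"], intro dom_add dom_mult[OF a cc] dlo dB sm)
    (use e22[of _ i] in force)
 have a121: "dom a (A1 1 2)" "dom a (A2 2 1)" by (rule dom_cong[OF a11[of 2]], use sym in auto) (rule dom_cong[OF a22[of 1]], use sym in auto)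
 have a112: "dom a (A2 1 1)" by (rule dom_cong[of _ "%x. (-1) * lo F 1 x + (-1) * B F G 1 1 x + ((-1) * B E F 1 2 x + (-1) * A1 1 2 x)"],
    intro dom_add dom_mult[OF a cc] dlo dB sm a121) (use e12[of _ 1] in force)
 have a221: "dom a (A1 2 2)" by (rule dom_cong[of _ "%x. (-1) * lo F 2 x + (-1) * B F G 2 1 x + ((-1) * B E F 2 2 x + (-1) * A2 2 1 x)"],
    intro dom_add dom_mult[OF a cc] dlo dB sm a121) (use e12[of _ 2] in force)
 have A1: "dom a (A1 i j)" for i j using ii[of i] ii[of j] a11 a121 a221 by auto
 have A2: "dom a (A2 i j)" for i j using ii[of i] ii[of j] a22 a121 a112 by auto
 have p: "dom a (D i (D j X1))" for i j
 proof (rule dom_cong[of _ "%x. (inverse (r x * r x)) * (G x * A1 i j x + (- F x) * A2 i j x)"])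
  show "dom a (%x. (inverse (r x * r x)) * (G x * A1 i j x + (- F x) * A2 i j x))" by (intro dom_mult[OF a] dom_add ci A1 A2 cE continuous_on_minus)
  fix x assume x: "x \<in> S"
  have "G x * A1 i j x + (- F x) * A2 i j x = (r x * r x) * D i (D j X1) x" unfolding A1_def A2_def r_sq[OF x] by (simp add: algebra_simps)
  then show "D i (D j X1) x = (inverse (r x * r x)) * (G x * A1 i j x + (- F x) * A2 i j x)" using r_pos[OF x] by (simp add: field_simps)
 qed
 have q: "dom a (D i (D j X2))" for i j
 proof (rule dom_cong[of _ "%x. (inverse (r x * r x)) * (E x * A2 i j x + (- F x) * A1 i j x)"])
  show "dom a (%x. (inverse (r x * r x)) * (E x * A2 i j x + (- F x) * A1 i j x))" by (intro dom_mult[OF a] dom_add ci A1 A2 cE continuous_on_minus)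
  fix x assume x: "x \<in> S"
  have "E x * A2 i j x + (- F x) * A1 i j x = (r x * r x) * D i (D j X2) x" unfolding A1_def A2_def r_sq[OF x] by (simp add: algebra_simps)
  then show "D i (D j X2) x = (inverse (r x * r x)) * (E x * A2 i j x + (- F x) * A1 i j x)" using r_pos[OF x] by (simp add: field_simps)
 qed
 show "dom a (D i (D1 X1))" "dom a (D i (D2 X1))"
  "dom a (D i (D1 X2))" "dom a (D i (D2 X2))" by (rule p q)+
qed

text \<open>A Gronwall argument by a maximum: let M be the maximum of \<open>mm\<close> on the
  segment from a. The mean value theorem bounds each component of the one-jet by a small multiple of
  M, so M \<le> M / 2.\<close>

lemma unique_continuation:
 assumes a: "a \<in> S" "mm a = 0"
 shows "\<exists>d>0. \<forall>x\<in>S \<inter> ball a d. X1 x = 0 \<and> X2 x = 0"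
proof -
 define W where "W = {X1, X2, D1 X1, D2 X1, D1 X2, D2 X2}"
 have fin: "finite W" unfolding W_def by simp
 have domW: "dom a (D i c)" if "c \<in> W" for c i
 proof -
  have "i = 1 \<or> i = 2" using exhaust_2 .
  then have "dom a (D i X1)" "dom a (D i X2)" using dom_base by auto
  then show ?thesis using that dom_second[OF a(1), of i] unfolding W_def by auto
 qed
 have "\<exists>C d. 0 \<le> C \<and> 0 < d \<and> (\<forall>x\<in>S \<inter> ball a d. \<bar>D1 c x\<bar> \<le> C * mm x \<and> \<bar>D2 c x\<bar> \<le> C * mm x)" if c: "c \<in> W" for c
 proof -
  obtain C d where 1: "0 \<le> C" "0 < d" "\<And>x. x \<in> S \<inter> ball a d ==> \<bar>D1 c x\<bar> \<le> C * mm x"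
   using domW[OF c, of 1] unfolding dom_def by blast
  obtain C' d' where 2: "0 \<le> C'" "0 < d'" "\<And>x. x \<in> S \<inter> ball a d' ==> \<bar>D2 c x\<bar> \<le> C' * mm x"
   using domW[OF c, of 2] unfolding dom_def by blast
  have "\<bar>D1 c x\<bar> \<le> (C + C') * mm x \<and> \<bar>D2 c x\<bar> \<le> (C + C') * mm x" if "x \<in> S \<inter> ball a (min d d')" for x
  proof -
   have "\<bar>D1 c x\<bar> \<le> C * mm x" "\<bar>D2 c x\<bar> \<le> C' * mm x" using 1(3)[of x] 2(3)[of x] that by auto
   moreover have "0 \<le> C * mm x" "0 \<le> C' * mm x" using 1(1) 2(1) mm_nonneg by auto
   ultimately show ?thesis by (auto simp: distrib_right)
  qed
  then show ?thesis using 1(1,2) 2(1,2) by (intro exI[of _ "C + C'"] exI[of _ "min d d'"]) auto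
 qed
 then obtain C d where Cd: "\<And>c. c \<in> W ==> 0 \<le> C c \<and> 0 < d c \<and> (\<forall>x\<in>S \<inter> ball a (d c). \<bar>D1 c x\<bar> \<le> C c * mm x \<and> \<bar>D2 c x\<bar> \<le> C c * mm x)"
  by metis
 have Wne: "W \<noteq> {}" unfolding W_def by simp
 define K where "K = 1 + Max (C ` W)"
 define e where "e = Min (d ` W)"
 have CM: "C c \<le> Max (C ` W)" if "c \<in> W" for c using fin that by (intro Max_ge) auto
 have CK: "C c \<le> K" if "c \<in> W" for c unfolding K_def using CM[OF that] by linarith
 have K1: "1 \<le> K"
 proof -
  obtain c where c: "c \<in> W" using Wne by blast
  then show ?thesis unfolding K_def using CM[OF c] Cd[OF c] by linarith
 qed
 have e: "0 < e" "\<And>c. c \<in> W ==> e \<le> d c" unfolding e_def using fin Wne Cd by (auto simp: Min_gr_iff)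
 obtain \<rho> where rho: "0 < \<rho>" "ball a \<rho> \<inter> half_plane \<subseteq> S" using rel_open_ball[OF S a(1)] .
 \<comment> \<open>Six components with two partial derivatives each give M \<le> 12 K d0 M, so the
   bound 1 / (24 K) leaves M / 2.\<close>
 define d0 where "d0 = min (min e \<rho>) (1 / (24 * K))"
 have d0: "0 < d0" "d0 \<le> e" "d0 \<le> \<rho>" "d0 \<le> 1 / (24 * K)" unfolding d0_def using e(1) rho(1) K1 by auto
 have zW: "c a = 0" if "c \<in> W" for c using a(2) that unfolding W_def mm_def by (auto simp: add_nonneg_eq_0_iff)
 have C1W: "Ck_on 1 S c" if "c \<in> W" for c
 proof -
  have "Ck_on 1 S (D i X1)" "Ck_on 1 S (D i X2)" for i by (rule partial_smooth, rule smooth)+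
  then show ?thesis using that smooth(4,5)[of 1] unfolding W_def by blast
 qed
 have "X1 x = 0 \<and> X2 x = 0" if x: "x \<in> S \<inter> ball a d0" for x
 proof -
  define v where "v = x - a"
  have nv: "norm v < d0" using x unfolding v_def by (auto simp: dist_norm norm_minus_commute)
  have P: "a + t *\<^sub>R v \<in> S \<inter> ball a d0" if "t \<in> {0..1}" for t
  proof -
   have "a + t *\<^sub>R v \<in> ball a d0 \<inter> half_plane" unfolding v_def
    using x a(1) d0(1) rel_open_half_plane[OF S] that by (intro segment_in_half_ball) auto
   then show ?thesis using rho(2) d0(3) by force
  qed
  have cm: "continuous_on S mm" unfolding mm_def using Ck_on_continuous[OF smooth(4)] Ck_on_continuous[OF smooth(5)]
    Ck_on_continuous[OF partial_smooth[OF smooth(4)]] Ck_on_continuous[OF partial_smooth[OF smooth(5)]] by (intro continuous_intros) blast+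
  have "continuous_on {0..1} (%t. mm (a + t *\<^sub>R v))" by (rule continuous_on_compose2[OF cm]) (use P in \<open>auto intro!: continuous_intros\<close>)
  then obtain t0 where t0: "t0 \<in> {0..1}" "\<And>t. t \<in> {0..1} ==> mm (a + t *\<^sub>R v) \<le> mm (a + t0 *\<^sub>R v)"
   using continuous_attains_sup[of "{0..1::real}" "%t. mm (a + t *\<^sub>R v)"] by auto
  define M where "M = mm (a + t0 *\<^sub>R v)"
  have M0: "0 \<le> M" unfolding M_def by (rule mm_nonneg)
  have cb: "\<bar>c (a + t0 *\<^sub>R v)\<bar> \<le> 2 * K * d0 * M" if c: "c \<in> W" for c
  proof (cases "t0 = 0")
   case True then show ?thesis using zW[OF c] K1 d0 M0 by simp
  next
   case False
   then have t0p: "0 < t0" using t0(1) by auto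
   have Pt: "a + t *\<^sub>R v \<in> S \<inter> ball a d0" if "t \<in> {0..t0}" for t using P[of t] that t0(1) by auto
   have "\<exists>z\<in>{0<..<t0}. c (a + t0 *\<^sub>R v) - c (a + 0 *\<^sub>R v) = (t0 - 0) * (D1 c (a + z *\<^sub>R v) * v $ 1 + D2 c (a + z *\<^sub>R v) * v $ 2)"
   proof (rule mvt_within[OF t0p])
    fix s assume s: "s \<in> {0..t0}"
    show "((%t. c (a + t *\<^sub>R v)) has_real_derivative D1 c (a + s *\<^sub>R v) * v $ 1 + D2 c (a + s *\<^sub>R v) * v $ 2) (at s within {0..t0})"
     by (rule line_derivative[where S = S]) (use Ck_on_partials[of 0 S c] C1W[OF c] Pt s in auto)
   qed
   then obtain z where z: "z \<in> {0<..<t0}" "c (a + t0 *\<^sub>R v) = t0 * (D1 c (a + z *\<^sub>R v) * v $ 1 + D2 c (a + z *\<^sub>R v) * v $ 2)"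
    using zW[OF c] by auto
   let ?y = "a + z *\<^sub>R v"
   have y: "?y \<in> S \<inter> ball a (d c)" using Pt[of z] z(1) d0(2) e(2)[OF c] by auto
   have mM: "mm ?y \<le> M" unfolding M_def using t0(2)[of z] z(1) t0(1) by auto
   have "C c * mm ?y \<le> K * M" using CK[OF c] mM mm_nonneg K1 by (intro mult_mono) auto
   then have b: "\<bar>D1 c ?y\<bar> \<le> K * M" "\<bar>D2 c ?y\<bar> \<le> K * M" using Cd[OF c] y by force+
   have vn: "\<bar>v $ 1\<bar> \<le> d0" "\<bar>v $ 2\<bar> \<le> d0" using component_le_norm_cart[of v 1] component_le_norm_cart[of v 2] nv by auto
   have "\<bar>D1 c ?y * v $ 1\<bar> \<le> K * M * d0" "\<bar>D2 c ?y * v $ 2\<bar> \<le> K * M * d0"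
    unfolding abs_mult using b vn K1 M0 by (auto intro!: mult_mono)
   then have s: "\<bar>D1 c ?y * v $ 1 + D2 c ?y * v $ 2\<bar> \<le> 2 * K * d0 * M" by (simp add: algebra_simps)
   have "\<bar>c (a + t0 *\<^sub>R v)\<bar> = t0 * \<bar>D1 c ?y * v $ 1 + D2 c ?y * v $ 2\<bar>" unfolding z(2) abs_mult using t0p by simp
   also have "\<dots> \<le> 1 * (2 * K * d0 * M)" using s t0(1) by (intro mult_mono) auto
   finally show ?thesis by simp
  qed
  have "M \<le> 6 * (2 * K * d0 * M)" using cb[of X1] cb[of X2] cb[of "D1 X1"] cb[of "D2 X1"] cb[of "D1 X2"] cb[of "D2 X2"]
   unfolding M_def mm_def W_def by simp
  also have "\<dots> = (12 * K * d0) * M" by simp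
  also have "\<dots> \<le> 1/2 * M"
  proof (rule mult_right_mono[OF _ M0])
   show "12 * K * d0 \<le> 1 / 2" using d0(4) K1 by (simp add: field_simps)
  qed
  finally have "M = 0" using M0 by simp
  moreover have "mm (a + 1 *\<^sub>R v) \<le> M" unfolding M_def by (rule t0(2)) simp
  ultimately have "mm x = 0" using mm_nonneg[of x] unfolding v_def by simp
  then show ?thesis unfolding mm_def by (auto simp: add_nonneg_eq_0_iff)
 qed
 then show ?thesis using d0(1) by blast
qed

lemma mm_zero_iff_near:
 assumes "a \<in> S" "d > 0" "\<And>x. x \<in> S \<inter> ball a d ==> X1 x = 0 \<and> X2 x = 0"
 shows "mm a = 0"
proof -
 let ?S = "S \<inter> ball a d"
 have o: "rel_open ?S" using S by (simp add: openin_Int_open)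
 have aS: "a \<in> ?S" using assms by auto
 have "D i X1 a = 0" "D i X2 a = 0" for i using partial_within_subset[OF o aS _ S, of i X1] partial_within_subset[OF o aS _ S, of i X2]
   partial_within_cong[OF aS, of X1 "%_. 0" i] partial_within_cong[OF aS, of X2 "%_. 0" i]
   partial_const[OF o aS, of i 0] assms(3) by auto
 then show ?thesis unfolding mm_def using assms(3)[OF aS] by simp
qed

end

section \<open>Level sets near a point\<close>

text \<open>An implicit function by monotonicity alone. It works up to the ends of the interval and
  in polar coordinates, where the derivative in t vanishes at the centre.\<close>

lemma monotone_fibre_section:
 fixes H :: "real => real => real"
 assumes H: "continuous_on (I \<times> {t0..q}) (%(s,t). H s t)" and tq: "t0 \<le> q"
  and mono: "\<And>s t t'. s \<in> I ==> t0 \<le> t ==> t < t' ==> t' \<le> q ==> H s t < H s t'"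
  and v: "\<And>s. s \<in> I ==> H s t0 \<le> v \<and> v \<le> H s q"
 obtains \<tau> where "continuous_on I \<tau>" "\<And>s. s \<in> I ==> \<tau> s \<in> {t0..q}" "\<And>s. s \<in> I ==> H s (\<tau> s) = v"
  "\<And>s t. s \<in> I ==> t \<in> {t0..q} ==> H s t = v ==> t = \<tau> s"
proof -
 have c1: "continuous_on {t0..q} (H s)" if "s \<in> I" for s
 proof -
  have "continuous_on {t0..q} ((%(s,t). H s t) \<circ> (%t. (s,t)))"
   by (rule continuous_on_compose) (use that in \<open>auto intro!: continuous_intros continuous_on_subset[OF H]\<close>)
  then show ?thesis by (simp add: o_def)
 qed
 have c2: "continuous_on I (%s. H s t)" if "t \<in> {t0..q}" for t
 proof -
  have "continuous_on I ((%(s,t). H s t) \<circ> (%s. (s,t)))"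
   by (rule continuous_on_compose) (use that in \<open>auto intro!: continuous_intros continuous_on_subset[OF H]\<close>)
  then show ?thesis by (simp add: o_def)
 qed
 have "\<exists>t. t \<in> {t0..q} \<and> H s t = v" if s: "s \<in> I" for s using IVT'[of "H s" t0 v q] v[OF s] tq c1[OF s] by auto
 then obtain \<tau> where tau: "\<And>s. s \<in> I ==> \<tau> s \<in> {t0..q} \<and> H s (\<tau> s) = v" by metis
 have uniq: "t = \<tau> s" if "s \<in> I" "t \<in> {t0..q}" "H s t = v" for s t
 proof (rule ccontr)
  assume "t \<noteq> \<tau> s"
  then consider "t < \<tau> s" | "\<tau> s < t" by linarith
  then show False using mono[OF that(1), of t "\<tau> s"] mono[OF that(1), of "\<tau> s" t] tau[OF that(1)] that by cases auto
 qed
 have "continuous_on I \<tau>" unfolding continuous_on_iff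
 proof (intro ballI allI impI)
  fix s0 e :: real assume s0: "s0 \<in> I" and e: "0 < e"
  have t0s: "\<tau> s0 \<in> {t0..q}" "H s0 (\<tau> s0) = v" using tau[OF s0] by auto
  have up: "\<exists>d>0. \<forall>s\<in>I. dist s s0 < d --> \<tau> s < \<tau> s0 + e"
  proof (cases "\<tau> s0 + e/2 \<le> q")
   case False
   have "\<tau> s < \<tau> s0 + e" if "s \<in> I" for s using tau[OF that] False e by auto
   then show ?thesis by (intro exI[of _ 1]) auto
  next
   case True
   then have m: "\<tau> s0 + e/2 \<in> {t0..q}" using t0s e by auto
   have "v < H s0 (\<tau> s0 + e/2)" using mono[OF s0, of "\<tau> s0" "\<tau> s0 + e/2"] t0s True e by auto
   then obtain d where d: "d > 0" "\<And>s. s \<in> I ==> dist s s0 < d ==> dist (H s (\<tau> s0 + e/2)) (H s0 (\<tau> s0 + e/2)) < H s0 (\<tau> s0 + e/2) - v"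
    using c2[OF m] s0 unfolding continuous_on_iff by (metis diff_gt_0_iff_gt)
   have "\<tau> s < \<tau> s0 + e" if s: "s \<in> I" "dist s s0 < d" for s
   proof (rule ccontr)
    assume "\<not> \<tau> s < \<tau> s0 + e"
    then have "H s (\<tau> s0 + e/2) < H s (\<tau> s)" using mono[OF s(1), of "\<tau> s0 + e/2" "\<tau> s"] tau[OF s(1)] m e by auto
    moreover have "v < H s (\<tau> s0 + e/2)" using d(2)[OF s] by (auto simp: dist_real_def)
    ultimately show False using tau[OF s(1)] by auto
   qed
   then show ?thesis using d(1) by blast
  qed
  have dn: "\<exists>d>0. \<forall>s\<in>I. dist s s0 < d --> \<tau> s0 - e < \<tau> s"
  proof (cases "t0 \<le> \<tau> s0 - e/2")
   case False
   have "\<tau> s0 - e < \<tau> s" if "s \<in> I" for s using tau[OF that] False e by auto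
   then show ?thesis by (intro exI[of _ 1]) auto
  next
   case True
   then have m: "\<tau> s0 - e/2 \<in> {t0..q}" using t0s e by auto
   have "H s0 (\<tau> s0 - e/2) < v" using mono[OF s0, of "\<tau> s0 - e/2" "\<tau> s0"] t0s True e by auto
   then obtain d where d: "d > 0" "\<And>s. s \<in> I ==> dist s s0 < d ==> dist (H s (\<tau> s0 - e/2)) (H s0 (\<tau> s0 - e/2)) < v - H s0 (\<tau> s0 - e/2)"
    using c2[OF m] s0 unfolding continuous_on_iff by (metis diff_gt_0_iff_gt)
   have "\<tau> s0 - e < \<tau> s" if s: "s \<in> I" "dist s s0 < d" for s
   proof (rule ccontr)
    assume "\<not> \<tau> s0 - e < \<tau> s"
    then have "H s (\<tau> s) < H s (\<tau> s0 - e/2)" using mono[OF s(1), of "\<tau> s" "\<tau> s0 - e/2"] tau[OF s(1)] m e by auto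
    moreover have "H s (\<tau> s0 - e/2) < v" using d(2)[OF s] by (auto simp: dist_real_def)
    ultimately show False using tau[OF s(1)] by auto
   qed
   then show ?thesis using d(1) by blast
  qed
  obtain d d' where "d > 0" "\<forall>s\<in>I. dist s s0 < d --> \<tau> s < \<tau> s0 + e" "d' > 0" "\<forall>s\<in>I. dist s s0 < d' --> \<tau> s0 - e < \<tau> s"
   using up dn by blast
  then show "\<exists>d>0. \<forall>s\<in>I. dist s s0 < d --> dist (\<tau> s) (\<tau> s0) < e"
   by (intro exI[of _ "min d d'"]) (auto simp: dist_real_def abs_less_iff)
 qed
 then show thesis using that tau uniq by blast
qed

text \<open>Each fibre of h is the continuous image of I under a section given by
  \<open>monotone_fibre_section\<close>, hence connected. \<Psi> need not be injective, so that
  polar coordinates, which collapse t = 0 to a point, are covered. The flag \<open>two\<close> tells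
  whether values below \<open>h0\<close> occur.\<close>

lemma patch_of_parametrization:
 fixes h :: "'b::metric_space => real" and t0 q :: real and I :: "real set"
 assumes I: "connected I" "I \<noteq> {}" and tq: "t0 < q" and e: "0 < e"
  and Psi: "continuous_on (I \<times> {t0..q}) (%(s,t). \<Psi> s t)" and hPsi: "continuous_on (I \<times> {t0..q}) (%(s,t). h (\<Psi> s t))"
  and mono: "\<And>s t t'. s \<in> I ==> t0 \<le> t ==> t < t' ==> t' \<le> q ==> h (\<Psi> s t) < h (\<Psi> s t')"
  and top: "\<And>s. s \<in> I ==> h0 + e \<le> h (\<Psi> s q)"
  and bot: "if two then (\<forall>s\<in>I. h (\<Psi> s t0) \<le> h0 - e) else (\<forall>s\<in>I. h (\<Psi> s t0) = h0)"
  and U: "U = {y \<in> (%(s,t). \<Psi> s t) ` (I \<times> (if two then {t0<..<q} else {t0..<q})). \<bar>h y - h0\<bar> < e}"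
  and oU: "openin (top_of_set S) U"
 shows "level_patch (top_of_set S) h h0 U (if two then {h0 - e<..<h0 + e} else {h0..<h0 + e}) e"
proof -
 define J where "J = (if two then {h0 - e<..<h0 + e} else {h0..<h0 + e})"
 define T0 where "T0 = (if two then {t0<..<q} else {t0..<q})"
 have T0s: "T0 \<subseteq> {t0..q}" unfolding T0_def by auto
 have U': "y \<in> U \<longleftrightarrow> (\<exists>s\<in>I. \<exists>t\<in>T0. y = \<Psi> s t \<and> \<bar>h y - h0\<bar> < e)" for y
  unfolding U T0_def[symmetric] by auto
 have low: "h0 \<le> h (\<Psi> s t)" if "\<not> two" "s \<in> I" "t \<in> {t0..q}" for s t using bot that mono[of s t0 t] by (cases "t = t0") auto
 have inT: "t \<in> T0" if "s \<in> I" "t \<in> {t0..q}" "\<bar>h (\<Psi> s t) - h0\<bar> < e" for s t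
  using that top[OF that(1)] bot unfolding T0_def by (cases "t = t0"; cases "t = q") (auto split: if_splits)
 have hJ: "h y \<in> J" if "y \<in> U" for y using that low T0s unfolding U' J_def by (force simp: abs_less_iff)
 have vb: "h (\<Psi> s t0) \<le> v \<and> v \<le> h (\<Psi> s q)" if "v \<in> J" "s \<in> I" for v s
  using that bot top[OF that(2)] unfolding J_def by (auto split: if_splits intro: order_trans[of _ "h0 - e"] order_trans[of _ "h0 + e"])
 have Je: "\<bar>v - h0\<bar> < e" if "v \<in> J" for v using that e unfolding J_def by (auto split: if_splits)
 have fib: "\<exists>\<tau>. continuous_on I \<tau> \<and> (\<forall>s\<in>I. \<tau> s \<in> {t0..q}) \<and> {y\<in>U. h y = v} = (%s. \<Psi> s (\<tau> s)) ` I" if v: "v \<in> J" for v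
 proof -
  obtain \<tau> where tau: "continuous_on I \<tau>" "\<And>s. s \<in> I ==> \<tau> s \<in> {t0..q}" "\<And>s. s \<in> I ==> h (\<Psi> s (\<tau> s)) = v"
   "\<And>s t. s \<in> I ==> t \<in> {t0..q} ==> h (\<Psi> s t) = v ==> t = \<tau> s"
   using monotone_fibre_section[OF hPsi less_imp_le[OF tq] mono vb[OF v]] by blast
  have "{y\<in>U. h y = v} = (%s. \<Psi> s (\<tau> s)) ` I"
  proof (intro equalityI subsetI)
   fix y assume "y \<in> {y\<in>U. h y = v}"
   then obtain s t where "s \<in> I" "t \<in> T0" "y = \<Psi> s t" "h y = v" unfolding U' by blast
   then show "y \<in> (%s. \<Psi> s (\<tau> s)) ` I" using tau(4)[of s t] T0s by auto
  next
   fix y assume "y \<in> (%s. \<Psi> s (\<tau> s)) ` I"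
   then obtain s where s: "s \<in> I" "y = \<Psi> s (\<tau> s)" by blast
   then have "\<tau> s \<in> T0" using inT[OF s(1) tau(2)[OF s(1)]] tau(3)[OF s(1)] Je[OF v] by simp
   then show "y \<in> {y\<in>U. h y = v}" unfolding U' using s tau(3)[OF s(1)] Je[OF v] by auto
  qed
  then show ?thesis using tau by blast
 qed
 have sub: "U \<subseteq> S" using oU openin_imp_subset by blast
 have "h ` U = J"
 proof (intro equalityI subsetI)
  fix v assume v: "v \<in> J"
  then obtain \<tau> where "{y\<in>U. h y = v} = (%s. \<Psi> s (\<tau> s)) ` I" using fib by blast
  then have "{y\<in>U. h y = v} \<noteq> {}" using I(2) by simp
  then show "v \<in> h ` U" by blast
 qed (use hJ in auto)
 moreover have "connectedin (top_of_set S) {y\<in>U. h y = v}" for v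
 proof (cases "v \<in> J")
  case True
  then obtain \<tau> where tau: "continuous_on I \<tau>" "\<forall>s\<in>I. \<tau> s \<in> {t0..q}" "{y\<in>U. h y = v} = (%s. \<Psi> s (\<tau> s)) ` I" using fib by blast
  have "continuous_on I ((%(s,t). \<Psi> s t) \<circ> (%s. (s, \<tau> s)))"
   by (rule continuous_on_compose) (use tau(1,2) in \<open>auto intro!: continuous_intros continuous_on_subset[OF Psi]\<close>)
  then have "connected ((%s. \<Psi> s (\<tau> s)) ` I)" using I(1) connected_continuous_image by (fastforce simp: o_def)
  then show ?thesis unfolding tau(3)[symmetric] using sub by (simp add: connectedin_subtopology) blast
 next
  case False
  then have "{y\<in>U. h y = v} = {}" using hJ by blast
  then show ?thesis by (simp only: connectedin_empty)
 qed
 moreover have "openin (top_of_set J) (h ` V)" if V: "openin (top_of_set S) V" "V \<subseteq> U" for V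
 proof (subst openin_subopen, clarify)
  fix y assume y: "y \<in> V"
  then have "y \<in> U" using V(2) by blast
  then obtain s t where st: "s \<in> I" "t \<in> T0" "y = \<Psi> s t" using U'[of y] by blast
  have cs: "continuous_on {t0..q} (\<Psi> s)" "continuous_on {t0..q} (%t. h (\<Psi> s t))"
  proof -
   have "continuous_on {t0..q} ((%(s,t). \<Psi> s t) \<circ> (%t. (s,t)))" "continuous_on {t0..q} ((%(s,t). h (\<Psi> s t)) \<circ> (%t. (s,t)))"
    by (rule continuous_on_compose; use st(1) in \<open>auto intro!: continuous_intros continuous_on_subset[OF Psi] continuous_on_subset[OF hPsi]\<close>)+
   then show "continuous_on {t0..q} (\<Psi> s)" "continuous_on {t0..q} (%t. h (\<Psi> s t))" by (simp_all add: o_def)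
  qed
  obtain W where W: "open W" "V = S \<inter> W" using V(1) by (auto simp: openin_open)
  obtain W' where W': "open W'" "U = S \<inter> W'" using oU by (auto simp: openin_open)
  have tt: "t \<in> {t0..q}" "t < q" using st(2) T0s unfolding T0_def by (auto split: if_splits)
  have "y \<in> W" using y W by blast
  then obtain d0 where d0: "d0 > 0" "ball y d0 \<subseteq> W" using W(1) open_contains_ball by blast
  obtain d where d: "d > 0" "\<And>t'. t' \<in> {t0..q} ==> dist t' t < d ==> dist (\<Psi> s t') (\<Psi> s t) < d0"
   using cs(1) tt(1) d0(1) unfolding continuous_on_iff by metis
  define t1 where "t1 = max t0 (t - d/2)"
  define t2 where "t2 = min q (t + d/2)"
  have t12: "t0 \<le> t1" "t1 \<le> t" "t < t2" "t2 \<le> q" unfolding t1_def t2_def using tt d(1) by auto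
  have t1lt: "t1 < t \<or> (\<not> two \<and> t = t0)" using st(2) d(1) unfolding t1_def T0_def by (auto split: if_splits)
  have up: "h y < h (\<Psi> s t2)" using mono[OF st(1), of t t2] t12 st(3) tt by auto
  define A where "A = (if t1 < t then {h (\<Psi> s t1)<..<h (\<Psi> s t2)} else {..<h (\<Psi> s t2)})"
  have oA: "open A" unfolding A_def by simp
  have yA: "h y \<in> A" unfolding A_def using up mono[OF st(1), of t1 t] t12 tt st(3) by auto
  have "J \<inter> A \<subseteq> h ` V"
  proof
   fix v assume v: "v \<in> J \<inter> A"
   have "h (\<Psi> s t1) \<le> v"
   proof (cases "t1 < t")
    case False
    then have "\<not> two" "t = t0" "t1 = t0" using t1lt t12 by auto
    then show ?thesis using v bot st(1) unfolding J_def by auto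
   qed (use v in \<open>auto simp: A_def\<close>)
   moreover have "v \<le> h (\<Psi> s t2)" using v unfolding A_def by (auto split: if_splits)
   ultimately obtain t' where t': "t1 \<le> t'" "t' \<le> t2" "h (\<Psi> s t') = v"
    using IVT'[of "%t. h (\<Psi> s t)" t1 v t2] continuous_on_subset[OF cs(2), of "{t1..t2}"] t12 by force
   have t'q: "t' \<in> {t0..q}" using t' t12 by auto
   have "dist t' t < d" using t' d(1) unfolding t1_def t2_def dist_real_def by auto
   then have "\<Psi> s t' \<in> W" using d(2)[OF t'q] d0(2) st(3) by (auto simp: dist_commute)
   moreover have "\<Psi> s t' \<in> U" unfolding U' using inT[OF st(1) t'q] t'(3) Je[of v] v st(1) by auto
   ultimately have "\<Psi> s t' \<in> V" using W(2) sub by auto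
   then show "v \<in> h ` V" using t'(3) by blast
  qed
  moreover have "openin (top_of_set J) (J \<inter> A)" using oA by (simp add: openin_open_Int)
  moreover have "h y \<in> J" using hJ V(2) y by blast
  ultimately show "\<exists>T. openin (top_of_set J) T \<and> h y \<in> T \<and> T \<subseteq> h ` V" using yA by blast
 qed
 ultimately have "level_patch (top_of_set S) h h0 U J e" unfolding level_patch_def using oU e J_def by auto
 then show ?thesis unfolding J_def .
qed

lemma level_patch_minus:
 assumes "level_patch X (%x. - h x) (- a) U J e"
 shows "level_patch X h a U (uminus ` J) e"
proof -
 note p = level_patchD[OF assms]
 have J: "uminus ` J = {a - e<..<a + e} \<or> uminus ` J = {a..<a + e} \<or> uminus ` J = {a - e<..a}" using p(3) by (elim disjE) (simp_all add: algebra_simps)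
 have im: "h ` V = uminus ` (%x. - h x) ` V" for V by (auto simp: image_image)
 have hom: "homeomorphism J (uminus ` J) uminus uminus" by (auto simp: homeomorphism_def image_image intro!: continuous_intros)
 have "openin (top_of_set (uminus ` J)) (h ` V)" if "openin X V" "V \<subseteq> U" for V
  unfolding im[of V] using homeomorphism_imp_open_map[OF hom p(5)[OF that]] .
 moreover have "connectedin X {y\<in>U. h y = v}" for v using p(6)[of "- v"] by (simp add: minus_equation_iff eq_commute)
 moreover have "h ` U = uminus ` J" unfolding im[of U] p(4) ..
 ultimately show ?thesis unfolding level_patch_def using p(1,2) J by auto
qed

text \<open>Stated for an arbitrary function with continuous gradient (b1, b2), so that it applies
  to a primitive and to its negative alike.\<close>

locale graded_function =
 fixes S :: "(real^2) set" and h b1 b2 :: "real^2 => real"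
 assumes S: "rel_open S"
  and h: "x \<in> S ==> has_partials h (b1 x) (b2 x) x S"
  and b_cont: "continuous_on S b1" "continuous_on S b2"
begin

definition b :: "2 => real^2 => real" where "b k x = (if k = 1 then b1 x else b2 x)"

lemma b_cont': "continuous_on S (b k)" using b_cont unfolding b_def by (cases "k = 1") simp_all

lemma h_cont: "continuous_on S h"
proof -
 have "h differentiable_on S" unfolding differentiable_on_def using has_partials_imp_differentiable[OF h] by simp
 then show ?thesis by (rule differentiable_imp_continuous_on)
qed

lemma openin_h: "openin (top_of_set S) {y \<in> S. h y \<in> {u<..<v}}"
proof -
 have "{y \<in> S. h y \<in> {u<..<v}} = S \<inter> h -` {u<..<v}" by auto
 then show ?thesis using continuous_openin_preimage_gen[OF h_cont open_greaterThanLessThan] by simp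
qed

lemma h_line:
 assumes "x + s *\<^sub>R v \<in> S" "\<And>t. t \<in> I ==> x + t *\<^sub>R v \<in> S"
 shows "((%t. h (x + t *\<^sub>R v)) has_real_derivative b1 (x + s *\<^sub>R v) * v $ 1 + b2 (x + s *\<^sub>R v) * v $ 2) (at s within I)"
 by (rule line_derivative[OF h[OF assms(1)] assms(2)])

lemma h_mvt:
 assumes "s < s'" "\<And>t. t \<in> {s..s'} ==> x + t *\<^sub>R axis k 1 \<in> S"
 obtains z where "z \<in> {s<..<s'}" "h (x + s' *\<^sub>R axis k 1) - h (x + s *\<^sub>R axis k 1) = (s' - s) * b k (x + z *\<^sub>R axis k 1)"
proof -
 have "\<exists>z\<in>{s<..<s'}. h (x + s' *\<^sub>R axis k 1) - h (x + s *\<^sub>R axis k 1) = (s' - s) *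
   (b1 (x + z *\<^sub>R axis k 1) * axis k 1 $ 1 + b2 (x + z *\<^sub>R axis k 1) * axis k 1 $ 2)"
  using assms by (intro mvt_within h_line) auto
 moreover have "b1 y * axis k 1 $ 1 + b2 y * axis k 1 $ 2 = b k y" for y using exhaust_2[of k] unfolding b_def axis_def by auto
 ultimately show thesis using that by auto
qed

text \<open>A box with sides in the directions i and j on which h increases in direction i at rate
  at least c. At a boundary point i is the normal direction, and the bottom side lies on the
  boundary, where h is constant because \<open>b1\<close> vanishes there.\<close>

lemma box_setup:
 assumes a: "a \<in> S" and i: "0 < b i a" "j \<noteq> i" and bd: "a $ 2 = 0 --> i = 2 \<and> (\<forall>x\<in>S. x $ 2 = 0 --> b1 x = 0)"
 obtains p q t0 e c C where "0 < p" "0 < q" "p \<le> q" "0 < e" "0 < c" "0 \<le> C" "t0 = (if 0 < a $ 2 then - q else 0)"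
  "\<And>s t. \<bar>s\<bar> \<le> q ==> t \<in> {t0..q} ==> a + s *\<^sub>R axis j 1 + t *\<^sub>R axis i 1 \<in> S"
  "\<And>s t. \<bar>s\<bar> \<le> q ==> t \<in> {t0..q} ==> c \<le> b i (a + s *\<^sub>R axis j 1 + t *\<^sub>R axis i 1)"
  "\<And>s t. \<bar>s\<bar> \<le> q ==> t \<in> {t0..q} ==> \<bar>b j (a + s *\<^sub>R axis j 1 + t *\<^sub>R axis i 1)\<bar> \<le> C"
  "\<And>s. \<bar>s\<bar> \<le> p ==> h a + e \<le> h (a + s *\<^sub>R axis j 1 + q *\<^sub>R axis i 1)"
  "\<And>s. \<bar>s\<bar> \<le> p ==> 0 < a $ 2 ==> h (a + s *\<^sub>R axis j 1 + t0 *\<^sub>R axis i 1) \<le> h a - e"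
  "\<And>s. \<bar>s\<bar> \<le> p ==> \<not> 0 < a $ 2 ==> h (a + s *\<^sub>R axis j 1 + t0 *\<^sub>R axis i 1) = h a"
proof -
 define c where "c = b i a / 2"
 define C where "C = \<bar>b j a\<bar> + 1"
 let ?\<Psi> = "%s t. a + s *\<^sub>R axis j 1 + t *\<^sub>R axis i 1 :: real^2"
 have c: "0 < c" unfolding c_def using i by simp
 have a2: "0 \<le> a $ 2" using rel_open_half_plane[OF S] a unfolding half_plane_def by auto
 obtain r0' where r0': "0 < r0'" "ball a r0' \<inter> half_plane \<subseteq> S" using rel_open_ball[OF S a] .
 obtain r1 where r1: "0 < r1" "\<And>x. x \<in> S ==> dist x a < r1 ==> dist (b i x) (b i a) < c" using b_cont'[of i] a c unfolding continuous_on_iff by metis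
 obtain r2 where r2: "0 < r2" "\<And>x. x \<in> S ==> dist x a < r2 ==> dist (b j x) (b j a) < 1"
  using b_cont'[of j] a unfolding continuous_on_iff by (metis zero_less_one)
 define \<rho> where "\<rho> = min (min r0' (if 0 < a $ 2 then a $ 2 else 1)) (min r1 r2)"
 have rho: "0 < \<rho>" "\<rho> \<le> r0'" "\<rho> \<le> r1" "\<rho> \<le> r2" "0 < a $ 2 ==> \<rho> \<le> a $ 2" unfolding \<rho>_def using r0' r1 r2 by auto
 define q where "q = \<rho> / 4"
 have q: "0 < q" unfolding q_def using rho by simp
 define t0 where "t0 = (if 0 < a $ 2 then - q else 0)"
 have t0: "t0 \<in> {-q..0}" unfolding t0_def using q by auto
 have nrm: "dist (?\<Psi> s t) a \<le> \<bar>s\<bar> + \<bar>t\<bar>" for s t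
  using norm_triangle_ineq[of "s *\<^sub>R axis j 1 :: real^2" "t *\<^sub>R axis i 1"] by (simp add: dist_norm add.assoc)
 have ij: "axis i 1 $ j = (0::real)" "axis j 1 $ i = (0::real)" "axis i 1 $ i = (1::real)" "axis j 1 $ j = (1::real)" using i by (auto simp: axis_def)
 have near: "dist (?\<Psi> s t) a < \<rho>" if "\<bar>s\<bar> \<le> q" "t \<in> {t0..q}" for s t using nrm[of s t] that t0 rho(1) unfolding q_def by auto
 have PS: "?\<Psi> s t \<in> S" if st: "\<bar>s\<bar> \<le> q" "t \<in> {t0..q}" for s t
 proof -
  have "0 \<le> ?\<Psi> s t $ 2"
  proof (cases "0 < a $ 2")
   case True
   have "\<bar>(?\<Psi> s t - a) $ 2\<bar> \<le> dist (?\<Psi> s t) a" unfolding dist_norm by (rule component_le_norm_cart)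
   then show ?thesis using near[OF st] rho(5)[OF True] by simp
  next
   case False
   then have "a $ 2 = 0" using a2 by simp
   then have i2: "i = 2" using bd by blast
   have "0 \<le> t" using st(2) False unfolding t0_def by auto
   then show ?thesis using i2 ij \<open>a $ 2 = 0\<close> by simp
  qed
  then show ?thesis using near[OF st] rho(2) r0'(2) unfolding half_plane_def by (auto simp: dist_commute)
 qed
 have cb: "c \<le> b i (?\<Psi> s t)" if st: "\<bar>s\<bar> \<le> q" "t \<in> {t0..q}" for s t
 proof -
  have "\<bar>b i (?\<Psi> s t) - b i a\<bar> < b i a / 2" using r1(2)[OF PS[OF st]] near[OF st] rho(3) unfolding c_def dist_real_def by auto
  then show ?thesis unfolding c_def using abs_ge_minus_self[of "b i (?\<Psi> s t) - b i a"] by linarith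
 qed
 have Cb: "\<bar>b j (?\<Psi> s t)\<bar> \<le> C" if st: "\<bar>s\<bar> \<le> q" "t \<in> {t0..q}" for s t
  using r2(2)[OF PS[OF st]] near[OF st] rho(4) unfolding C_def dist_real_def by auto
 have mono: "h (?\<Psi> s t) < h (?\<Psi> s t')" if st: "\<bar>s\<bar> \<le> q" "t0 \<le> t" "t < t'" "t' \<le> q" for s t t'
 proof -
  obtain z where z: "z \<in> {t<..<t'}" "h (?\<Psi> s t') - h (?\<Psi> s t) = (t' - t) * b i (?\<Psi> s z)"
   by (rule h_mvt[OF st(3), of "a + s *\<^sub>R axis j 1" i]) (use PS st in auto)
  have "0 < b i (?\<Psi> s z)" using cb[of s z] c z(1) st by auto
  then have "0 < (t' - t) * b i (?\<Psi> s z)" using st by simp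
  then show ?thesis using z(2) by linarith
 qed
 have hcs: "continuous_on {-q..q} (%s. h (?\<Psi> s t))" if "t \<in> {t0..q}" for t
  by (rule continuous_on_compose2[OF h_cont]) (use PS that in \<open>auto intro!: continuous_intros\<close>)
 have up0: "h a < h (?\<Psi> 0 q)" using mono[of 0 0 q] q t0 by simp
 have dn0: "h (?\<Psi> 0 t0) < h a" if "0 < a $ 2" using mono[of 0 t0 0] q that unfolding t0_def by simp
 \<comment> \<open>Half of the room available at s = 0, so that after shrinking the box in direction
   j a margin e remains.\<close>
 define e where "e = (if 0 < a $ 2 then min (h (?\<Psi> 0 q) - h a) (h a - h (?\<Psi> 0 t0)) / 2 else (h (?\<Psi> 0 q) - h a) / 2)"
 have e: "0 < e" "h a + 2 * e \<le> h (?\<Psi> 0 q)" "0 < a $ 2 ==> h (?\<Psi> 0 t0) \<le> h a - 2 * e"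
  unfolding e_def using up0 dn0 by (auto simp: min_def field_simps)
 have qq: "q \<in> {t0..q}" "t0 \<in> {t0..q}" "(0::real) \<in> {-q..q}" using q t0 by auto
 obtain p1 where p1: "0 < p1" "\<And>s. s \<in> {-q..q} ==> dist s 0 < p1 ==> dist (h (?\<Psi> s q)) (h (?\<Psi> 0 q)) < e"
  using hcs[OF qq(1)] qq(3) e(1) unfolding continuous_on_iff by metis
 obtain p2 where p2: "0 < p2" "\<And>s. s \<in> {-q..q} ==> dist s 0 < p2 ==> dist (h (?\<Psi> s t0)) (h (?\<Psi> 0 t0)) < e"
  using hcs[OF qq(2)] qq(3) e(1) unfolding continuous_on_iff by metis
 define p where "p = min q (min (p1/2) (p2/2))"
 have p: "0 < p" "p \<le> q" "p < p1" "p < p2" unfolding p_def using q p1 p2 by auto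
 have t0e: "h (?\<Psi> s t0) = h a" if s: "\<bar>s\<bar> \<le> p" and "\<not> 0 < a $ 2" for s
 proof -
  have a20: "a $ 2 = 0" using a2 that by simp
  then have i2: "i = 2" and b10: "\<And>x. x \<in> S ==> x $ 2 = 0 ==> b1 x = 0" using bd by auto
  have j1: "j = 1" using i(2) i2 exhaust_2[of j] by auto
  have t00: "t0 = 0" using that unfolding t0_def by simp
  have P0: "?\<Psi> s 0 \<in> S" "?\<Psi> s 0 $ 2 = 0" if "\<bar>s\<bar> \<le> q" for s using PS[of s 0] that t00 q a20 ij i2 by auto
  have bz: "b j (a + s *\<^sub>R axis j 1) = 0" if "\<bar>s\<bar> \<le> q" for s using P0[OF that] b10 unfolding b_def j1 by simp
  have "h (a + s *\<^sub>R axis j 1) = h a"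
  proof (cases "s = 0")
   case False
   then consider "0 < s" | "s < 0" by linarith
   then show ?thesis
   proof cases
    case 1
    obtain z where "z \<in> {0<..<s}" "h (a + s *\<^sub>R axis j 1) - h (a + 0 *\<^sub>R axis j 1) = (s - 0) * b j (a + z *\<^sub>R axis j 1)"
     by (rule h_mvt[OF 1, of a j]) (use P0 s p in auto)
    then show ?thesis using bz[of z] s p by auto
   next
    case 2
    obtain z where "z \<in> {s<..<0}" "h (a + 0 *\<^sub>R axis j 1) - h (a + s *\<^sub>R axis j 1) = (0 - s) * b j (a + z *\<^sub>R axis j 1)"
     by (rule h_mvt[OF 2, of a j]) (use P0 s p in auto)
    then show ?thesis using bz[of z] s p by auto
   qed
  qed simp
  then show ?thesis using t00 by simp
 qed
 show thesis
 proof (rule that[OF p(1) q p(2) e(1) c _ t0_def PS cb Cb _ _ t0e])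
  show "0 \<le> C" unfolding C_def by simp
  fix s assume s: "\<bar>s\<bar> \<le> p"
  have s': "s \<in> {-q..q}" "dist s 0 < p1" "dist s 0 < p2" using s p by (auto simp: dist_real_def)
  show "h a + e \<le> h (?\<Psi> s q)" using p1(2)[OF s'(1,2)] e(2) by (auto simp: dist_real_def abs_less_iff)
  show "h (?\<Psi> s t0) \<le> h a - e" if "0 < a $ 2" using p2(2)[OF s'(1,3)] e(3)[OF that] by (auto simp: dist_real_def abs_less_iff)
 qed
qed

lemma box_mono:
 assumes "\<And>t. t \<in> {t0..q} ==> x + t *\<^sub>R axis i 1 \<in> S" "\<And>t. t \<in> {t0..q} ==> c \<le> b i (x + t *\<^sub>R axis i 1)"
  and t: "t0 \<le> t" "t < t'" "t' \<le> q"
 shows "c * (t' - t) \<le> h (x + t' *\<^sub>R axis i 1) - h (x + t *\<^sub>R axis i 1)"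
proof -
 obtain z where z: "z \<in> {t<..<t'}" "h (x + t' *\<^sub>R axis i 1) - h (x + t *\<^sub>R axis i 1) = (t' - t) * b i (x + z *\<^sub>R axis i 1)"
  by (rule h_mvt[OF t(2), of x i]) (use assms in auto)
 have "c \<le> b i (x + z *\<^sub>R axis i 1)" using assms(2)[of z] z(1) t by auto
 then have "(t' - t) * c \<le> (t' - t) * b i (x + z *\<^sub>R axis i 1)" using t by (intro mult_left_mono) auto
 then show ?thesis using z(2) by (simp add: mult.commute)
qed

lemma other_index: obtains j :: 2 where "j \<noteq> i" by (cases "i = 1") (rule that[of 2], simp, rule that[of 1], simp)

lemma regular_patch:
 assumes a: "a \<in> S" and i: "0 < b i a" and bd: "a $ 2 = 0 --> i = 2 \<and> (\<forall>x\<in>S. x $ 2 = 0 --> b1 x = 0)"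
 shows "\<exists>U e. level_patch (top_of_set S) h (h a) U (if 0 < a $ 2 then {h a - e<..<h a + e} else {h a..<h a + e}) e \<and> a \<in> U"
proof -
 obtain j where ji: "j \<noteq> i" by (rule other_index)
 let ?P = "%s t. a + s *\<^sub>R axis j 1 + t *\<^sub>R axis i 1 :: real^2"
 show ?thesis
 proof (rule box_setup[OF a i ji bd])
  fix p q t0 e c C
  assume B: "0 < p" "0 < q" "p \<le> q" "0 < e" "0 < c" "0 \<le> C" "t0 = (if 0 < a $ 2 then - q else 0)"
  and PS: "\<And>s t. \<bar>s\<bar> \<le> q ==> t \<in> {t0..q} ==> ?P s t \<in> S"
  and cb: "\<And>s t. \<bar>s\<bar> \<le> q ==> t \<in> {t0..q} ==> c \<le> b i (?P s t)"
  and up: "\<And>s. \<bar>s\<bar> \<le> p ==> h a + e \<le> h (?P s q)"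
  and dn: "\<And>s. \<bar>s\<bar> \<le> p ==> 0 < a $ 2 ==> h (?P s t0) \<le> h a - e"
  and z: "\<And>s. \<bar>s\<bar> \<le> p ==> \<not> 0 < a $ 2 ==> h (?P s t0) = h a"
 have a2: "0 \<le> a $ 2" using rel_open_half_plane[OF S] a unfolding half_plane_def by auto
 define I where "I = {-p<..<p}"
 define T0 where "T0 = (if 0 < a $ 2 then {t0<..<q} else {t0..<q})"
 define U where "U = {y \<in> (%(s,t). ?P s t) ` (I \<times> T0). \<bar>h y - h a\<bar> < e}"
 have ij: "axis i 1 $ j = (0::real)" "axis j 1 $ i = (0::real)" "axis i 1 $ i = (1::real)" "axis j 1 $ j = (1::real)" using ji by (auto simp: axis_def)
 have two: "k = i \<or> k = j" for k using exhaust_2[of k] exhaust_2[of i] exhaust_2[of j] ji by auto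
 have t0q: "t0 < q" using B by (auto split: if_splits)
 have IJ: "\<bar>s\<bar> \<le> q" "\<bar>s\<bar> \<le> p" if "s \<in> I" for s using that B(3) unfolding I_def by auto
 define Ob where "Ob = {y::real^2. \<bar>y $ j - a $ j\<bar> < p} \<inter> {y. \<bar>y $ i - a $ i\<bar> < q}"
 have oOb: "open Ob" unfolding Ob_def by (intro open_Int open_Collect_less continuous_intros)
 have Ueq: "U = {y \<in> S. h y \<in> {h a - e<..<h a + e}} \<inter> (S \<inter> Ob)"
 proof (intro equalityI subsetI)
  fix y assume "y \<in> U"
  then obtain s t where st: "s \<in> I" "t \<in> T0" "y = ?P s t" "\<bar>h y - h a\<bar> < e" unfolding U_def by auto
  have t: "t \<in> {t0..q}" "\<bar>t\<bar> < q" using st(2) B unfolding T0_def by (auto split: if_splits)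
  have "y \<in> S" using PS[OF IJ(1)[OF st(1)] t(1)] st(3) by simp
  moreover have "y \<in> Ob" using st(1) t(2) unfolding Ob_def st(3) I_def by (simp add: ij abs_less_iff)
  ultimately show "y \<in> {y \<in> S. h y \<in> {h a - e<..<h a + e}} \<inter> (S \<inter> Ob)" using st(4) by (auto simp: abs_less_iff)
 next
  fix y assume y: "y \<in> {y \<in> S. h y \<in> {h a - e<..<h a + e}} \<inter> (S \<inter> Ob)"
  define s where "s = y $ j - a $ j"
  define t where "t = y $ i - a $ i"
  have "y $ k = ?P s t $ k" for k using two[of k] unfolding s_def t_def by (auto simp: ij)
  then have ye: "y = ?P s t" by (simp add: vec_eq_iff)
  have "s \<in> I" using y unfolding Ob_def s_def I_def by (auto simp: abs_less_iff)
  moreover have "t \<in> T0"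
  proof (cases "0 < a $ 2")
   case True then show ?thesis using y B(7) unfolding Ob_def t_def T0_def by (auto simp: abs_less_iff)
  next
   case False
   then have "a $ 2 = 0" using a2 by simp
   then have "i = 2" using bd by blast
   then have "0 \<le> t" using y rel_open_half_plane[OF S] \<open>a $ 2 = 0\<close> unfolding t_def half_plane_def by auto
   then show ?thesis using y False B(7) unfolding Ob_def t_def T0_def by (auto simp: abs_less_iff)
  qed
  moreover have "\<bar>h y - h a\<bar> < e" using y by (auto simp: abs_less_iff)
  ultimately show "y \<in> U" unfolding U_def using ye by (auto intro!: image_eqI[of _ _ "(s,t)"])
 qed
 have oU: "openin (top_of_set S) U" unfolding Ueq using openin_Int[OF openin_h openin_open_Int[OF oOb]] by simp
 have Pc: "continuous_on (I \<times> {t0..q}) (%(s,t). ?P s t)" unfolding case_prod_beta by (intro continuous_intros)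
 have "level_patch (top_of_set S) h (h a) U (if 0 < a $ 2 then {h a - e<..<h a + e} else {h a..<h a + e}) e"
 proof (rule patch_of_parametrization[OF _ _ t0q B(4) Pc])
  show "connected I" "I \<noteq> {}" unfolding I_def using B(1) by auto
  show "continuous_on (I \<times> {t0..q}) (%(s,t). h (?P s t))" unfolding case_prod_beta
   by (rule continuous_on_compose2[OF h_cont]) (use PS IJ in \<open>auto intro!: continuous_intros\<close>)
  show "h (?P s t) < h (?P s t')" if st: "s \<in> I" "t0 \<le> t" "t < t'" "t' \<le> q" for s t t'
  proof -
   have "c * (t' - t) \<le> h (?P s t') - h (?P s t)" by (rule box_mono[where c = c and i = i]) (use PS cb IJ[OF st(1)] st in auto)
   moreover have "0 < c * (t' - t)" using B(5) st(3) by simp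
   ultimately show ?thesis by linarith
  qed
  show "h a + e \<le> h (?P s q)" if "s \<in> I" for s using up IJ[OF that] by blast
  show "if 0 < a $ 2 then \<forall>s\<in>I. h (?P s t0) \<le> h a - e else \<forall>s\<in>I. h (?P s t0) = h a" using dn z IJ by auto
 qed (use U_def T0_def oU in auto)
 moreover have "a \<in> U" unfolding Ueq using a B unfolding Ob_def by auto
 ultimately show ?thesis by blast
 qed
qed

text \<open>Polar coordinates around a nondegenerate minimum: the Hessian is positive definite, so h
  increases along every ray up to a common radius q. Only differentiability of the gradient at the
  centre is used.\<close>

lemma centre_patch:
 assumes a: "a \<in> S" "0 < a $ 2" and z: "b1 a = 0" "b2 a = 0"
  and H: "has_partials b1 A B a S" "has_partials b2 B C a S" and pos: "0 < A" "0 < A * C - B * B"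
 shows "\<exists>U e. level_patch (top_of_set S) h (h a) U {h a..<h a + e} e \<and> a \<in> U"
proof -
 \<comment> \<open>Determinant over trace of the Hessian H, a lower bound for its eigenvalues: by
   Cayley-Hamilton, (tr H) H - (det H) 1 is the square of H.\<close>
 define l where "l = (A * C - B * B) / (A + C)"
 have C: "0 < C"
 proof -
  have "0 < A * C" using pos(2) zero_le_square[of B] by linarith
  then show ?thesis using pos(1) by (simp add: zero_less_mult_iff)
 qed
 have l: "0 < l" unfolding l_def using pos C by simp
 have form: "l * (x * x + y * y) \<le> A * x * x + 2 * B * x * y + C * y * y" for x y
 proof -
  have "(A + C) * (A * x * x + 2 * B * x * y + C * y * y - l * (x * x + y * y)) = (A * x + B * y)\<^sup>2 + (B * x + C * y)\<^sup>2"
   unfolding l_def using pos(1) C by (simp add: power2_eq_square field_simps)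
  then have "0 \<le> (A + C) * (A * x * x + 2 * B * x * y + C * y * y - l * (x * x + y * y))" by simp
  then show ?thesis using pos(1) C by (simp add: zero_le_mult_iff)
 qed
 have ainS: "a \<in> interior S" using rel_open_interior[OF S a] .
 obtain r0 where r0: "0 < r0" "ball a r0 \<subseteq> S" using ainS by (meson mem_interior)
 \<comment> \<open>The errors of the two gradient components then add up to at most half of the
   radial growth l t.\<close>
 define e1 where "e1 = l / 4"
 have e1: "0 < e1" unfolding e1_def using l by simp
 obtain d1 where d1: "0 < d1" "\<And>y. y \<in> S ==> norm (y - a) < d1 ==> norm (b1 y - b1 a - (A * (y - a) $ 1 + B * (y - a) $ 2)) \<le> e1 * norm (y - a)"
  using H(1) e1 unfolding has_partials_def has_derivative_within_alt by blast
 obtain d2 where d2: "0 < d2" "\<And>y. y \<in> S ==> norm (y - a) < d2 ==> norm (b2 y - b2 a - (B * (y - a) $ 1 + C * (y - a) $ 2)) \<le> e1 * norm (y - a)"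
  using H(2) e1 unfolding has_partials_def has_derivative_within_alt by blast
 define q where "q = min (r0/2) (min (d1/2) (d2/2))"
 have q: "0 < q" "q < r0" "q < d1" "q < d2" unfolding q_def using r0 d1 d2 by auto
 define w :: "real => real^2" where "w \<theta> = cos \<theta> *\<^sub>R axis 1 1 + sin \<theta> *\<^sub>R axis 2 1" for \<theta>
 have w1: "w \<theta> $ 1 = cos \<theta>" "w \<theta> $ 2 = sin \<theta>" for \<theta> unfolding w_def by (auto simp: axis_def)
 have nw: "norm (w \<theta>) = 1" for \<theta> unfolding norm_vec_def L2_set_def by (simp add: sum_2 w1)
 have PS: "a + t *\<^sub>R w \<theta> \<in> S" if "t \<in> {0..q}" for t \<theta> using r0(2) q that nw[of \<theta>] by (auto simp: dist_norm)
 have rad: "0 < b1 (a + t *\<^sub>R w \<theta>) * w \<theta> $ 1 + b2 (a + t *\<^sub>R w \<theta>) * w \<theta> $ 2" if t: "0 < t" "t \<le> q" for t \<theta>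
 proof -
  let ?y = "a + t *\<^sub>R w \<theta>" let ?c = "cos \<theta>" let ?s = "sin \<theta>"
  have y: "?y \<in> S" "norm (?y - a) = t" using PS[of t \<theta>] t nw[of \<theta>] by auto
  have 1: "\<bar>b1 ?y - t * (A * ?c + B * ?s)\<bar> \<le> e1 * t" using d1(2)[OF y(1)] y(2) t q z by (simp add: w1 algebra_simps)
  have 2: "\<bar>b2 ?y - t * (B * ?c + C * ?s)\<bar> \<le> e1 * t" using d2(2)[OF y(1)] y(2) t q z by (simp add: w1 algebra_simps)
  have "\<bar>(b1 ?y - t * (A * ?c + B * ?s)) * ?c\<bar> \<le> (e1 * t) * 1" "\<bar>(b2 ?y - t * (B * ?c + C * ?s)) * ?s\<bar> \<le> (e1 * t) * 1"
   unfolding abs_mult using 1 2 by (intro mult_mono; simp)+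
  moreover have "b1 ?y * ?c + b2 ?y * ?s = (b1 ?y - t * (A * ?c + B * ?s)) * ?c + (b2 ?y - t * (B * ?c + C * ?s)) * ?s
    + t * (A * ?c * ?c + 2 * B * ?c * ?s + C * ?s * ?s)" by (simp add: algebra_simps)
  moreover have "t * l \<le> t * (A * ?c * ?c + 2 * B * ?c * ?s + C * ?s * ?s)"
   using form[of ?c ?s] t sin_cos_squared_add3[of \<theta>] by (intro mult_left_mono) auto
  moreover have "e1 * t * 4 = t * l" unfolding e1_def by simp
  moreover have "0 < t * l" using t l by simp
  ultimately show ?thesis unfolding w1 abs_le_iff by linarith
 qed
 have mono: "h (a + t *\<^sub>R w \<theta>) < h (a + t' *\<^sub>R w \<theta>)" if t: "0 \<le> t" "t < t'" "t' \<le> q" for t t' \<theta>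
 proof -
  have "\<exists>z\<in>{t<..<t'}. h (a + t' *\<^sub>R w \<theta>) - h (a + t *\<^sub>R w \<theta>) = (t' - t) *
    (b1 (a + z *\<^sub>R w \<theta>) * w \<theta> $ 1 + b2 (a + z *\<^sub>R w \<theta>) * w \<theta> $ 2)"
   using t PS by (intro mvt_within h_line) auto
  then obtain z where zz: "z \<in> {t<..<t'}" "h (a + t' *\<^sub>R w \<theta>) - h (a + t *\<^sub>R w \<theta>) = (t' - t) *
    (b1 (a + z *\<^sub>R w \<theta>) * w \<theta> $ 1 + b2 (a + z *\<^sub>R w \<theta>) * w \<theta> $ 2)" by blast
  have "0 < (t' - t) * (b1 (a + z *\<^sub>R w \<theta>) * w \<theta> $ 1 + b2 (a + z *\<^sub>R w \<theta>) * w \<theta> $ 2)"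
   using rad[of z \<theta>] zz(1) t by (intro mult_pos_pos) auto
  then show ?thesis using zz(2) by linarith
 qed
 have wc: "continuous_on A w" for A unfolding w_def by (intro continuous_intros)
 have "continuous_on {0..2*pi} (%\<theta>. h (a + q *\<^sub>R w \<theta>))"
  by (rule continuous_on_compose2[OF h_cont]) (use PS q in \<open>auto intro!: continuous_intros wc\<close>)
 then obtain \<theta>0 where th0': "\<forall>\<theta>\<in>{0..2*pi}. h (a + q *\<^sub>R w \<theta>0) \<le> h (a + q *\<^sub>R w \<theta>)"
  using continuous_attains_inf[of "{0..2*pi}" "%\<theta>. h (a + q *\<^sub>R w \<theta>)"] by auto
 have th0: "h (a + q *\<^sub>R w \<theta>0) \<le> h (a + q *\<^sub>R w \<theta>)" if "\<theta> \<in> {0..2*pi}" for \<theta> using th0' that by blast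
 define e where "e = h (a + q *\<^sub>R w \<theta>0) - h a"
 have e: "0 < e" unfolding e_def using mono[of 0 q \<theta>0] q by simp
 define I where "I = {0..2*pi}"
 define U where "U = {y \<in> (%(s,t). a + t *\<^sub>R w s) ` (I \<times> {0..<q}). \<bar>h y - h a\<bar> < e}"
 have img: "(%(s,t). a + t *\<^sub>R w s) ` (I \<times> {0..<q}) = ball a q"
 proof (intro equalityI subsetI)
  fix y assume "y \<in> (%(s,t). a + t *\<^sub>R w s) ` (I \<times> {0..<q})"
  then show "y \<in> ball a q" using nw by (auto simp: dist_norm)
 next
  fix y assume y: "y \<in> ball a q"
  define t where "t = norm (y - a)"
  have t: "t \<in> {0..<q}" using y unfolding t_def by (auto simp: dist_norm norm_minus_commute)
  have "\<exists>s\<in>I. y = a + t *\<^sub>R w s"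
  proof (cases "t = 0")
   case True then show ?thesis unfolding t_def I_def by (intro bexI[of _ 0]) auto
  next
   case False
   have "t\<^sup>2 = ((y - a) $ 1)\<^sup>2 + ((y - a) $ 2)\<^sup>2" unfolding t_def norm_vec_def L2_set_def by (simp add: sum_2)
   moreover have "((y - a) $ 1 / t)\<^sup>2 + ((y - a) $ 2 / t)\<^sup>2 = (((y - a) $ 1)\<^sup>2 + ((y - a) $ 2)\<^sup>2) / t\<^sup>2"
    by (simp only: power_divide add_divide_distrib)
   ultimately have "((y - a) $ 1 / t)\<^sup>2 + ((y - a) $ 2 / t)\<^sup>2 = t\<^sup>2 / t\<^sup>2" by (simp only:)
   then have "((y - a) $ 1 / t)\<^sup>2 + ((y - a) $ 2 / t)\<^sup>2 = 1" using False by simp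
   then obtain s where s: "0 \<le> s" "s < 2 * pi" "(y - a) $ 1 / t = cos s" "(y - a) $ 2 / t = sin s" using sincos_total_2pi by blast
   then have "(y - a) $ 1 = t * cos s" "(y - a) $ 2 = t * sin s" using False by (auto simp: field_simps)
   then have "y = a + t *\<^sub>R w s" by (simp add: vec_eq_iff forall_2 w1 algebra_simps)
   then show ?thesis using s unfolding I_def by (intro bexI[of _ s]) auto
  qed
  then show "y \<in> (%(s,t). a + t *\<^sub>R w s) ` (I \<times> {0..<q})" using t by auto
 qed
 have bS: "ball a q \<subseteq> S" using r0(2) q(2) by auto
 have Ueq: "U = {y \<in> S. h y \<in> {h a - e<..<h a + e}} \<inter> (S \<inter> ball a q)" unfolding U_def img using bS by (auto simp: abs_less_iff)
 have oU: "openin (top_of_set S) U" unfolding Ueq using openin_Int[OF openin_h openin_open_Int[OF open_ball]] by simp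
 have Pc: "continuous_on (I \<times> {0..q}) (%(s,t). a + t *\<^sub>R w s)" unfolding case_prod_beta
  by (intro continuous_intros continuous_on_compose2[OF wc]) auto
 have "level_patch (top_of_set S) h (h a) U (if False then {h a - e<..<h a + e} else {h a..<h a + e}) e"
 proof (rule patch_of_parametrization[OF _ _ q(1) e Pc])
  show "connected I" "I \<noteq> {}" unfolding I_def by auto
  show "continuous_on (I \<times> {0..q}) (%(s,t). h (a + t *\<^sub>R w s))" unfolding case_prod_beta
   by (rule continuous_on_compose2[OF h_cont]) (use PS in \<open>auto intro!: continuous_intros continuous_on_compose2[OF wc]\<close>)
  show "h (a + t *\<^sub>R w s) < h (a + t' *\<^sub>R w s)" if "s \<in> I" "0 \<le> t" "t < t'" "t' \<le> q" for s t t' using mono that by blast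
  show "h a + e \<le> h (a + q *\<^sub>R w s)" if "s \<in> I" for s using th0[of s] that unfolding I_def e_def by simp
 qed (use U_def oU in auto)
 moreover have "a \<in> U" unfolding Ueq using a e q by auto
 ultimately show ?thesis by auto
qed

lemma box_coordinates:
 assumes a: "a \<in> S" and ji: "j \<noteq> i" and bd: "a $ 2 = 0 --> i = 2" and y: "y \<in> S" "\<bar>y $ i - a $ i\<bar> < q"
 shows "y = a + (y $ j - a $ j) *\<^sub>R axis j 1 + (y $ i - a $ i) *\<^sub>R axis i 1"
  "y $ i - a $ i \<in> {(if 0 < a $ 2 then - q else 0)..q}"
proof -
 have ij: "axis i 1 $ j = (0::real)" "axis j 1 $ i = (0::real)" "axis i 1 $ i = (1::real)" "axis j 1 $ j = (1::real)" using ji by (auto simp: axis_def)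
 have two: "k = i \<or> k = j" for k using exhaust_2[of k] exhaust_2[of i] exhaust_2[of j] ji by auto
 have "y $ k = (a + (y $ j - a $ j) *\<^sub>R axis j 1 + (y $ i - a $ i) *\<^sub>R axis i 1) $ k" for k using two[of k] by (auto simp: ij)
 then show "y = a + (y $ j - a $ j) *\<^sub>R axis j 1 + (y $ i - a $ i) *\<^sub>R axis i 1" by (intro iffD2[OF vec_eq_iff] allI)
 have a2: "0 \<le> a $ 2" "0 \<le> y $ 2" using rel_open_half_plane[OF S] a y(1) unfolding half_plane_def by auto
 show "y $ i - a $ i \<in> {(if 0 < a $ 2 then - q else 0)..q}" using a2 bd y(2) by (cases "0 < a $ 2") (auto simp: abs_less_iff)
qed

text \<open>dN is a multiple of dh, so N should be constant where h is. The fibre is only a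
  Lipschitz curve, so the derivative of N along it is estimated rather than computed by the chain
  rule.\<close>

lemma fibre_invariant_pos:
 assumes a: "a \<in> S" and i: "0 < b i a" and bd: "a $ 2 = 0 --> i = 2 \<and> (\<forall>x\<in>S. x $ 2 = 0 --> b1 x = 0)"
  and N: "\<And>x. x \<in> S ==> has_partials N (kp x * b1 x) (kp x * b2 x) x S"
 shows "\<exists>V. openin (top_of_set S) V \<and> a \<in> V \<and> (\<forall>z\<in>V. h z = h a --> N z = N a)"
proof -
 obtain j where ji: "j \<noteq> i" by (rule other_index)
 let ?P = "%s t. a + s *\<^sub>R axis j 1 + t *\<^sub>R axis i 1 :: real^2"
 show ?thesis
 proof (rule box_setup[OF a i ji bd])
  fix p q t0 e c C
  assume B: "0 < p" "0 < q" "p \<le> q" "0 < e" "0 < c" "0 \<le> C" "t0 = (if 0 < a $ 2 then - q else 0)"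
  and PS: "\<And>s t. \<bar>s\<bar> \<le> q ==> t \<in> {t0..q} ==> ?P s t \<in> S"
  and cb: "\<And>s t. \<bar>s\<bar> \<le> q ==> t \<in> {t0..q} ==> c \<le> b i (?P s t)"
  and Cb: "\<And>s t. \<bar>s\<bar> \<le> q ==> t \<in> {t0..q} ==> \<bar>b j (?P s t)\<bar> \<le> C"
  and up: "\<And>s. \<bar>s\<bar> \<le> p ==> h a + e \<le> h (?P s q)"
  and dn: "\<And>s. \<bar>s\<bar> \<le> p ==> 0 < a $ 2 ==> h (?P s t0) \<le> h a - e"
  and z: "\<And>s. \<bar>s\<bar> \<le> p ==> \<not> 0 < a $ 2 ==> h (?P s t0) = h a"
  define I where "I = {-p..p}"
  have Iq: "\<bar>s\<bar> \<le> q" "\<bar>s\<bar> \<le> p" if "s \<in> I" for s using that B(3) unfolding I_def by auto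
  have t0q: "t0 \<le> q" "t0 \<le> 0" "0 \<le> q" using B(2,7) by auto
  have mono: "c * (t' - t) \<le> h (?P s t') - h (?P s t)" if "s \<in> I" "t0 \<le> t" "t < t'" "t' \<le> q" for s t t'
   by (rule box_mono[where c = c and i = i]) (use PS cb Iq[OF that(1)] that in auto)
  have mono': "h (?P s t) < h (?P s t')" if "s \<in> I" "t0 \<le> t" "t < t'" "t' \<le> q" for s t t'
  proof -
   have "0 < c * (t' - t)" using B(5) that(3) by simp
   then show ?thesis using mono[OF that] by linarith
  qed
  have cont: "continuous_on (I \<times> {t0..q}) (%(s,t). h (?P s t))" unfolding case_prod_beta
   by (rule continuous_on_compose2[OF h_cont]) (use PS Iq in \<open>auto intro!: continuous_intros\<close>)
  have vb: "h (?P s t0) \<le> h a \<and> h a \<le> h (?P s q)" if "s \<in> I" for s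
   using up[OF Iq(2)[OF that]] dn[OF Iq(2)[OF that]] z[OF Iq(2)[OF that]] B(4) by (cases "0 < a $ 2") auto
  obtain \<tau> where tau: "continuous_on I \<tau>" "\<And>s. s \<in> I ==> \<tau> s \<in> {t0..q}" "\<And>s. s \<in> I ==> h (?P s (\<tau> s)) = h a"
   "\<And>s t. s \<in> I ==> t \<in> {t0..q} ==> h (?P s t) = h a ==> t = \<tau> s" using monotone_fibre_section[OF cont t0q(1) mono' vb] by blast
  have PI: "?P s t \<in> S" if "s \<in> I" "t \<in> {t0..q}" for s t using PS Iq(1) that by blast
  have tlip: "c * \<bar>\<tau> s' - \<tau> s\<bar> \<le> C * \<bar>s' - s\<bar>" if s: "s \<in> I" "s' \<in> I" for s s'
  proof -
   let ?t = "\<tau> s" let ?t' = "\<tau> s'"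
   have t: "?t \<in> {t0..q}" "?t' \<in> {t0..q}" using tau(2) s by auto
   have 1: "c * \<bar>?t' - ?t\<bar> \<le> \<bar>h (?P s' ?t') - h (?P s' ?t)\<bar>"
   proof (cases "?t = ?t'")
    case False
    then consider "?t < ?t'" | "?t' < ?t" by linarith
    then show ?thesis using mono[OF s(2), of ?t ?t'] mono[OF s(2), of ?t' ?t] t by cases auto
   qed simp
   have 2: "\<bar>h (?P s' ?t) - h (?P s ?t)\<bar> \<le> C * \<bar>s' - s\<bar>"
   proof -
    have sw: "?P s ?t = (a + ?t *\<^sub>R axis i 1) + s *\<^sub>R axis j 1" for s by simp
    have main: "\<bar>h (?P u' ?t) - h (?P u ?t)\<bar> \<le> C * \<bar>u' - u\<bar>" if u: "u < u'" "u \<in> I" "u' \<in> I" for u u'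
    proof -
     have St: "(a + ?t *\<^sub>R axis i 1) + x *\<^sub>R axis j 1 \<in> S" if "x \<in> {u..u'}" for x
      using PI[OF _ t(1), of x] that u unfolding sw I_def by auto
     obtain zz where zz: "zz \<in> {u<..<u'}" "h (?P u' ?t) - h (?P u ?t) = (u' - u) * b j (?P zz ?t)"
      unfolding sw by (rule h_mvt[OF u(1), of "a + ?t *\<^sub>R axis i 1" j])
       (use St in auto)
     have "zz \<in> I" using zz(1) u unfolding I_def by auto
     then have "\<bar>b j (?P zz ?t)\<bar> \<le> C" using Cb[OF Iq(1) t(1)] by blast
     then have "\<bar>u' - u\<bar> * \<bar>b j (?P zz ?t)\<bar> \<le> \<bar>u' - u\<bar> * C" by (intro mult_left_mono) auto
     then show ?thesis unfolding zz(2) by (simp add: abs_mult mult.commute)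
    qed
    show ?thesis
    proof (cases "s = s'")
     case False
     then consider "s < s'" | "s' < s" by linarith
     then show ?thesis using main[of s s'] main[of s' s] s by cases (auto simp: abs_minus_commute)
    qed simp
   qed
   have "h (?P s' ?t') = h (?P s ?t)" using tau(3) s by auto
   then show ?thesis using 1 2 by (simp add: abs_minus_commute)
  qed
  define L where "L = 1 + C / c"
  have L: "0 < L" unfolding L_def using B by (simp add: add_pos_nonneg)
  have Plip: "norm (?P s' (\<tau> s') - ?P s (\<tau> s)) \<le> L * \<bar>s' - s\<bar>" if s: "s \<in> I" "s' \<in> I" for s s'
  proof -
   have "?P s' (\<tau> s') - ?P s (\<tau> s) = (s' - s) *\<^sub>R axis j 1 + (\<tau> s' - \<tau> s) *\<^sub>R axis i 1" by (simp add: algebra_simps)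
   then have "norm (?P s' (\<tau> s') - ?P s (\<tau> s)) \<le> \<bar>s' - s\<bar> + \<bar>\<tau> s' - \<tau> s\<bar>"
    using norm_triangle_ineq[of "(s' - s) *\<^sub>R axis j 1 :: real^2" "(\<tau> s' - \<tau> s) *\<^sub>R axis i 1"] by simp
   moreover have "\<bar>\<tau> s' - \<tau> s\<bar> \<le> C / c * \<bar>s' - s\<bar>" using tlip[OF s] B(5) by (simp add: field_simps)
   ultimately show ?thesis unfolding L_def by (simp add: algebra_simps)
  qed
  define \<phi> where "\<phi> s = N (?P s (\<tau> s))" for s
  have "(\<phi> has_field_derivative 0) (at s within I)" if s: "s \<in> I" for s
  proof -
   let ?y = "?P s (\<tau> s)"
   have y: "?y \<in> S" using PI[OF s tau(2)[OF s]] .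
   \<comment> \<open>Subtracting a multiple of h, which is constant on the fibre, leaves a function
     with derivative 0 at y; the Lipschitz bound on the curve turns this into a zero derivative
     along the fibre.\<close>
   have "has_partials (%x. N x - kp ?y * h x) (kp ?y * b1 ?y - kp ?y * b1 ?y) (kp ?y * b2 ?y - kp ?y * b2 ?y) ?y S"
    by (intro has_partials_diff has_partials_cmult N h y)
   then have D: "((%x. N x - kp ?y * h x) has_derivative (%v. 0)) (at ?y within S)" unfolding has_partials_def by simp
   show ?thesis unfolding has_field_derivative_def has_derivative_within_alt
   proof (intro conjI allI impI)
    show "bounded_linear ((*) (0::real))" by (rule bounded_linear_mult_right)
    fix ee :: real assume ee: "0 < ee"
    then have "0 < ee / L" using L by simp
    then obtain d where d: "0 < d" "\<And>x. x \<in> S ==> norm (x - ?y) < d ==> norm (N x - kp ?y * h x - (N ?y - kp ?y * h ?y) - 0) \<le> ee / L * norm (x - ?y)"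
     using D unfolding has_derivative_within_alt by blast
    show "\<exists>d>0. \<forall>y\<in>I. norm (y - s) < d --> norm (\<phi> y - \<phi> s - 0 * (y - s)) \<le> ee * norm (y - s)"
    proof (intro exI[of _ "d / L"] conjI ballI impI)
     show "0 < d / L" using d L by simp
     fix s' assume s': "s' \<in> I" "norm (s' - s) < d / L"
     let ?x = "?P s' (\<tau> s')"
     have x: "?x \<in> S" using PI[OF s'(1) tau(2)[OF s'(1)]] .
     have nx: "norm (?x - ?y) \<le> L * \<bar>s' - s\<bar>" by (rule Plip[OF s s'(1)])
     moreover have "L * \<bar>s' - s\<bar> < d" using s'(2) L by (simp add: field_simps)
     ultimately have "norm (N ?x - kp ?y * h ?x - (N ?y - kp ?y * h ?y) - 0) \<le> ee / L * norm (?x - ?y)" using d(2)[OF x] by linarith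
     moreover have "h ?x = h ?y" using tau(3) s s'(1) by simp
     ultimately have "\<bar>N ?x - N ?y\<bar> \<le> ee / L * norm (?x - ?y)" by simp
     also have "\<dots> \<le> ee / L * (L * \<bar>s' - s\<bar>)" using nx ee L by (intro mult_left_mono) auto
     also have "\<dots> = ee * \<bar>s' - s\<bar>" using L by simp
     finally show "norm (\<phi> s' - \<phi> s - 0 * (s' - s)) \<le> ee * norm (s' - s)" unfolding \<phi>_def by simp
    qed
   qed
  qed
  then obtain k where k: "\<And>s. s \<in> I ==> \<phi> s = k" using has_field_derivative_zero_constant[of I \<phi>] unfolding I_def by auto
  have I0: "0 \<in> I" unfolding I_def using B(1) by simp
  have tau0: "\<tau> 0 = 0" using tau(4)[OF I0, of 0] t0q by simp
  define Ob where "Ob = {y::real^2. \<bar>y $ j - a $ j\<bar> < p} \<inter> {y. \<bar>y $ i - a $ i\<bar> < q}"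
  have oOb: "open Ob" unfolding Ob_def by (intro open_Int open_Collect_less continuous_intros)
  have "N z = N a" if zz: "z \<in> S \<inter> Ob" "h z = h a" for z
  proof -
   let ?s = "z $ j - a $ j" let ?t = "z $ i - a $ i"
   have c: "z = ?P ?s ?t" "?t \<in> {t0..q}" using box_coordinates[OF a ji _, of z q] zz(1) bd unfolding Ob_def B(7) by auto
   have sI: "?s \<in> I" using zz(1) unfolding I_def Ob_def by (auto simp: abs_less_iff)
   have "h (?P ?s ?t) = h a" using zz(2) c(1) by simp
   then have "?t = \<tau> ?s" by (rule tau(4)[OF sI c(2)])
   then have "N z = \<phi> ?s" unfolding \<phi>_def using c(1) by simp
   also have "\<dots> = \<phi> 0" using k[OF sI] k[OF I0] by simp
   finally show ?thesis unfolding \<phi>_def tau0 by simp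
  qed
  moreover have "a \<in> S \<inter> Ob" using a B unfolding Ob_def by simp
  ultimately show ?thesis using openin_open_Int[OF oOb, of S] by blast
 qed
qed

text \<open>
 A probe is a path from \<open>a\<close> into the side \<open>\<sigma> (h - h a) > 0\<close>; along it the derivative of \<open>N\<close> with respect to \<open>h\<close> can
 be read off.
\<close>

definition probe :: "(real^2 => real) => (real^2 => real) => real => real^2 => bool" where
 "probe N kp \<sigma> a \<longleftrightarrow> (\<forall>\<epsilon>>0. \<exists>\<eta>>0. \<forall>t. 0 < \<sigma> * (t - h a) \<and> \<sigma> * (t - h a) < \<eta> -->
   (\<exists>z\<in>S. h z = t \<and> \<bar>N z - N a - kp a * (t - h a)\<bar> \<le> \<epsilon> * \<bar>t - h a\<bar> \<and> \<bar>kp z - kp a\<bar> \<le> \<epsilon>))"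

text \<open>Both N and h are followed along a straight segment on which h is strictly monotone. The
  derivative of h may vanish at the starting point, so that extremal points are included.\<close>

lemma probe_line:
 assumes a: "a \<in> S" and N: "\<And>x. x \<in> S ==> has_partials N (kp x * b1 x) (kp x * b2 x) x S"
  and kp: "continuous_on S kp" and d: "0 < \<delta>" and P: "\<And>s. s \<in> {0..\<delta>} ==> a + s *\<^sub>R w \<in> S"
  and pos: "\<And>s. 0 < s ==> s \<le> \<delta> ==> 0 < \<sigma> * (b1 (a + s *\<^sub>R w) * w $ 1 + b2 (a + s *\<^sub>R w) * w $ 2)"
  and sg: "\<bar>\<sigma>\<bar> = 1"
 shows "probe N kp \<sigma> a" unfolding probe_def
proof (intro allI impI)
 fix \<epsilon> :: real assume e: "0 < \<epsilon>"
 have ss: "\<sigma> * \<sigma> = 1" using sg by (auto simp: abs_if split: if_splits)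
 obtain d2 where d2: "0 < d2" "\<forall>x\<in>S. dist x a < d2 --> dist (kp x) (kp a) < \<epsilon>" using bspec[OF kp[unfolded continuous_on_iff] a] e by meson
 define D where "D = min \<delta> (d2 / (2 * (norm w + 1)))"
 have D0: "0 < D" "D \<le> \<delta>" unfolding D_def using d d2 by (auto intro!: divide_pos_pos add_nonneg_pos)
 have near: "dist (a + s *\<^sub>R w) a < d2" if "s \<in> {0..D}" for s
 proof -
  have "s * norm w \<le> D * (norm w + 1)" using that by (intro mult_mono) auto
  also have "\<dots> \<le> d2 / (2 * (norm w + 1)) * (norm w + 1)" unfolding D_def by (intro mult_right_mono) auto
  also have "\<dots> = d2 / 2"
  proof -
   have "c / (2 * q) * q = c / 2" if "q \<noteq> 0" for c q :: real using that by simp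
   moreover have "norm w + 1 \<noteq> 0" using norm_ge_zero[of w] by linarith
   ultimately show ?thesis by blast
  qed
  also have "\<dots> < d2" using d2 by auto
  finally show ?thesis using that by (simp add: dist_norm)
 qed
 have PV: "\<bar>kp (a + s *\<^sub>R w) - kp a\<bar> \<le> \<epsilon>" "a + s *\<^sub>R w \<in> S" if "s \<in> {0..D}" for s
 proof -
  show S: "a + s *\<^sub>R w \<in> S" using P[of s] that D0 by auto
  show "\<bar>kp (a + s *\<^sub>R w) - kp a\<bar> \<le> \<epsilon>" using bspec[OF d2(2) S] near[OF that] by (auto simp: dist_real_def)
 qed
 let ?g = "%s. \<sigma> * h (a + s *\<^sub>R w)"
 let ?b = "%s. b1 (a + s *\<^sub>R w) * w $ 1 + b2 (a + s *\<^sub>R w) * w $ 2"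
 have dg: "(?g has_real_derivative \<sigma> * ?b s) (at s within {0..u})" if "s \<in> {0..u}" "u \<le> D" for s u
  by (intro DERIV_cmult h_line) (use that PV in auto)
 have dN: "((%s. N (a + s *\<^sub>R w)) has_real_derivative kp (a + s *\<^sub>R w) * ?b s) (at s within {0..u})" if "s \<in> {0..u}" "u \<le> D" for s u
 proof -
  have "((%s. N (a + s *\<^sub>R w)) has_real_derivative kp (a + s *\<^sub>R w) * b1 (a + s *\<^sub>R w) * w $ 1 + kp (a + s *\<^sub>R w) * b2 (a + s *\<^sub>R w) * w $ 2) (at s within {0..u})"
   by (rule line_derivative[OF N]) (use that PV in auto)
  then show ?thesis by (simp add: algebra_simps)
 qed
 define \<eta> where "\<eta> = ?g D - ?g 0"
 have eta: "0 < \<eta>"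
 proof -
  obtain z where z: "z \<in> {0<..<D}" "?g D - ?g 0 = (D - 0) * (\<sigma> * ?b z)" using mvt_within[OF D0(1), of ?g "%s. \<sigma> * ?b s"] dg by blast
  have "0 < \<sigma> * ?b z" using pos[of z] z(1) D0 by auto
  then show ?thesis unfolding \<eta>_def z(2) using D0 by simp
 qed
 show "\<exists>\<eta>>0. \<forall>t. 0 < \<sigma> * (t - h a) \<and> \<sigma> * (t - h a) < \<eta> -->
   (\<exists>z\<in>S. h z = t \<and> \<bar>N z - N a - kp a * (t - h a)\<bar> \<le> \<epsilon> * \<bar>t - h a\<bar> \<and> \<bar>kp z - kp a\<bar> \<le> \<epsilon>)"
 proof (intro exI[of _ \<eta>] conjI allI impI eta)
  fix t assume t: "0 < \<sigma> * (t - h a) \<and> \<sigma> * (t - h a) < \<eta>"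
  have "continuous_on {0..D} ?g" by (rule DERIV_continuous_on) (rule dg, auto)
  then obtain s where s: "0 \<le> s" "s \<le> D" "?g s = \<sigma> * t"
   using IVT'[of ?g 0 "\<sigma> * t" D] t D0 unfolding \<eta>_def by (auto simp: algebra_simps)
  have "\<sigma> * ?g s = \<sigma> * (\<sigma> * t)" using s(3) by simp
  then have hs: "h (a + s *\<^sub>R w) = t" using ss by (simp add: mult.assoc[symmetric])
  have s0: "0 < s" using s(1) hs t by (cases "s = 0") auto
  \<comment> \<open>For \<rho> = 1 and \<rho> = -1, the function \<epsilon> \<sigma> h + \<rho> (N -
    kp(a) h) has a nonnegative derivative on the segment, because kp varies there by at most
    \<epsilon>. The two signs give the two-sided estimate.\<close>
  have est: "0 \<le> \<epsilon> * (?g s - ?g 0) + \<rho> * ((N (a + s *\<^sub>R w) - kp a * h (a + s *\<^sub>R w)) - (N a - kp a * h a))" if rho: "\<bar>\<rho>\<bar> = 1" for \<rho>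
  proof -
   let ?f = "%s. \<epsilon> * ?g s + \<rho> * (N (a + s *\<^sub>R w) - kp a * h (a + s *\<^sub>R w))"
   let ?f' = "%s. \<epsilon> * (\<sigma> * ?b s) + \<rho> * (kp (a + s *\<^sub>R w) * ?b s - kp a * ?b s)"
   have "(?f has_real_derivative ?f' x) (at x within {0..s})" if "x \<in> {0..s}" for x
    using that s by (intro DERIV_add DERIV_cmult DERIV_diff dg dN h_line) (use PV in auto)
   then obtain z where z: "z \<in> {0<..<s}" "?f s - ?f 0 = (s - 0) * ?f' z" using mvt_within[OF s0, of ?f ?f'] by blast
   have zD: "z \<in> {0..D}" using z(1) s by auto
   have bz: "0 < \<sigma> * ?b z" using pos[of z] z(1) s D0 by auto
   then have ab: "\<sigma> * ?b z = \<bar>?b z\<bar>" using sg by (auto simp: abs_if split: if_splits)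
   have "\<bar>\<rho> * (kp (a + z *\<^sub>R w) * ?b z - kp a * ?b z)\<bar> = \<bar>kp (a + z *\<^sub>R w) - kp a\<bar> * \<bar>?b z\<bar>"
    using rho by (simp add: abs_mult left_diff_distrib[symmetric])
   also have "\<dots> \<le> \<epsilon> * \<bar>?b z\<bar>" using PV(1)[OF zD] by (intro mult_right_mono) auto
   finally have "0 \<le> ?f' z" unfolding ab by (simp add: abs_le_iff)
   then have "0 \<le> (s - 0) * ?f' z" using s(1) by simp
   then show ?thesis using z(2) by (simp add: algebra_simps)
  qed
  have gs: "?g s - ?g 0 = \<bar>t - h a\<bar>"
  proof -
   have "?g s - ?g 0 = \<sigma> * (t - h a)" using s(3) by (simp add: algebra_simps)
   also have "\<dots> = \<bar>\<sigma> * (t - h a)\<bar>" using t by simp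
   finally show ?thesis using sg by (simp add: abs_mult)
  qed
  let ?z = "a + s *\<^sub>R w"
  have "\<bar>N ?z - N a - kp a * (t - h a)\<bar> \<le> \<epsilon> * \<bar>t - h a\<bar>"
   using est[of 1, unfolded gs, unfolded hs] est[of "-1", unfolded gs, unfolded hs] by (simp add: abs_le_iff algebra_simps)
  then show "\<exists>z\<in>S. h z = t \<and> \<bar>N z - N a - kp a * (t - h a)\<bar> \<le> \<epsilon> * \<bar>t - h a\<bar> \<and> \<bar>kp z - kp a\<bar> \<le> \<epsilon>"
   using PV[of s] s hs by (intro bexI[of _ ?z]) auto
 qed
qed

lemma regular_probes:
 assumes a: "a \<in> S" and i: "b i a \<noteq> 0" and bd: "a $ 2 = 0 --> i = 2"
  and N: "\<And>x. x \<in> S ==> has_partials N (kp x * b1 x) (kp x * b2 x) x S" and kp: "continuous_on S kp"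
 shows "probe N kp (sgn (b i a)) a" "0 < a $ 2 ==> probe N kp (- sgn (b i a)) a"
proof -
 let ?s = "sgn (b i a)"
 have s1: "\<bar>?s\<bar> = 1" using i by (simp add: abs_sgn_eq)
 have bk: "b1 y * axis i 1 $ 1 + b2 y * axis i 1 $ 2 = b i y" for y using exhaust_2[of i] unfolding b_def axis_def by auto
 obtain r0 where r0: "0 < r0" "ball a r0 \<inter> half_plane \<subseteq> S" using rel_open_ball[OF S a] .
 obtain r1 where r1: "0 < r1" "\<forall>x\<in>S. dist x a < r1 --> dist (b i x) (b i a) < \<bar>b i a\<bar>"
  using bspec[OF b_cont'[of i, unfolded continuous_on_iff] a] i zero_less_abs_iff[of "b i a"] by meson
 have sg: "0 < ?s * b i x" if "x \<in> S" "dist x a < r1" for x using bspec[OF r1(2) that(1)] that(2) by (auto simp: dist_real_def abs_less_iff sgn_if)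
 have a2: "0 \<le> a $ 2" using rel_open_half_plane[OF S] a unfolding half_plane_def by auto
 define d where "d = min (r0/2) (r1/2)"
 have d: "0 < d" "d < r0" "d < r1" unfolding d_def using r0 r1 by auto
 have PS: "a + s *\<^sub>R axis i 1 \<in> S" if "s \<in> {0..d}" for s
 proof -
  have "0 \<le> (a + s *\<^sub>R axis i 1) $ 2" using a2 that by (auto simp: axis_def)
  moreover have "dist (a + s *\<^sub>R axis i 1) a < r0" using that d by (simp add: dist_norm)
  ultimately show ?thesis using r0(2) unfolding half_plane_def by (auto simp: dist_commute)
 qed
 show "probe N kp ?s a"
 proof (rule probe_line[OF a N kp d(1) PS _ s1])
  fix s assume s: "0 < s" "s \<le> d"
  have "dist (a + s *\<^sub>R axis i 1) a < r1" using s d by (simp add: dist_norm)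
  then show "0 < ?s * (b1 (a + s *\<^sub>R axis i 1) * axis i 1 $ 1 + b2 (a + s *\<^sub>R axis i 1) * axis i 1 $ 2)" unfolding bk using sg PS[of s] s by auto
 qed
 assume a2p: "0 < a $ 2"
 define d' where "d' = min d (a $ 2)"
 have d': "0 < d'" "d' \<le> d" "d' \<le> a $ 2" unfolding d'_def using d a2p by auto
 have PS': "a + s *\<^sub>R (- axis i 1) \<in> S" if "s \<in> {0..d'}" for s
 proof -
  have "0 \<le> (a + s *\<^sub>R (- axis i 1)) $ 2" using that d' by (auto simp: axis_def)
  moreover have "dist (a + s *\<^sub>R (- axis i 1)) a < r0" using that d d' by (simp add: dist_norm)
  ultimately show ?thesis using r0(2) unfolding half_plane_def by (auto simp: dist_commute)
 qed
 show "probe N kp (- ?s) a"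
 proof (rule probe_line[OF a N kp d'(1) PS'])
  show "\<bar>- ?s\<bar> = 1" using s1 by simp
  fix s assume s: "0 < s" "s \<le> d'"
  have "dist (a + s *\<^sub>R (- axis i 1)) a < r1" using s d d' by (simp add: dist_norm)
  then have "0 < ?s * b i (a + s *\<^sub>R (- axis i 1))" using sg PS'[of s] s by auto
  then show "0 < - ?s * (b1 (a + s *\<^sub>R (- axis i 1)) * (- axis i 1) $ 1 + b2 (a + s *\<^sub>R (- axis i 1)) * (- axis i 1) $ 2)"
   unfolding bk[symmetric] by (simp add: algebra_simps)
 qed
qed

lemma centre_probe:
 assumes a: "a \<in> S" "0 < a $ 2" and z: "b1 a = 0" and H: "has_partials b1 A B a S" and A: "A \<noteq> 0"
  and N: "\<And>x. x \<in> S ==> has_partials N (kp x * b1 x) (kp x * b2 x) x S" and kp: "continuous_on S kp"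
 shows "probe N kp (sgn A) a"
proof -
 obtain r0 where r0: "0 < r0" "ball a r0 \<subseteq> S" using rel_open_interior[OF S a] by (meson mem_interior)
 have s1: "\<bar>sgn A\<bar> = 1" using A by (simp add: abs_sgn_eq)
 obtain d1 where d1: "0 < d1" "\<And>y. y \<in> S ==> norm (y - a) < d1 ==> norm (b1 y - b1 a - (A * (y - a) $ 1 + B * (y - a) $ 2)) \<le> \<bar>A\<bar>/2 * norm (y - a)"
  using H A unfolding has_partials_def has_derivative_within_alt by (meson half_gt_zero zero_less_abs_iff)
 define d where "d = min (r0/2) (d1/2)"
 have d: "0 < d" "d < r0" "d < d1" unfolding d_def using r0 d1 by auto
 have PS: "a + s *\<^sub>R axis 1 1 \<in> S" if "s \<in> {0..d}" for s using r0(2) d that by (auto simp: dist_norm)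
 show ?thesis
 proof (rule probe_line[OF a(1) N kp d(1) PS _ s1])
  fix s assume s: "0 < s" "s \<le> d"
  let ?y = "a + s *\<^sub>R axis 1 1"
  have ax: "(?y - a) $ 1 = s" "(?y - a) $ 2 = 0" "norm (?y - a) = s" using s by simp_all (simp_all add: axis_def)
  have "\<bar>b1 ?y - A * s\<bar> \<le> \<bar>A\<bar>/2 * s" using d1(2)[OF PS[of s], unfolded ax] s d z by simp
  moreover have "\<bar>A\<bar>/2 * s < \<bar>A * s\<bar>" using A s by (simp add: abs_mult)
  ultimately have l: "\<bar>b1 ?y - A * s\<bar> < \<bar>A * s\<bar>" by linarith
  have "0 < sgn A * b1 ?y"
  proof (cases "0 < A")
   case True
   then have "0 < A * s" using s by simp
   then show ?thesis using l True by (simp add: abs_less_iff)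
  next
   case False
   then have "A < 0" using A by simp
   then have "A * s < 0" using s by (simp add: mult_neg_pos)
   then show ?thesis using l \<open>A < 0\<close> by (simp add: abs_less_iff)
  qed
  then show "0 < sgn A * (b1 ?y * (axis 1 1 :: real^2) $ 1 + b2 ?y * (axis 1 1 :: real^2) $ 2)" by (simp add: axis_def)
 qed
qed

end

text \<open>The Poincare lemma on a convex half-ball: the form is integrated along rays from a, and
  the Leibniz rule differentiates the integral.\<close>

lemma closed_form_primitive:
 assumes S: "rel_open S" and c: "Ck_on 1 S c1" "Ck_on 1 S c2"
  and cl: "\<And>x. x \<in> S ==> partial_within S 2 c1 x = partial_within S 1 c2 x" and a: "a \<in> S"
 shows "\<exists>V h. rel_open V \<and> a \<in> V \<and> V \<subseteq> S \<and> (\<forall>x\<in>V. has_partials h (c1 x) (c2 x) x V)"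
proof -
 obtain r where r: "0 < r" "ball a r \<inter> half_plane \<subseteq> S" using rel_open_ball[OF S a] .
 define V where "V = ball a r \<inter> half_plane"
 have V: "rel_open V" unfolding V_def by (simp add: openin_open_Int Int_commute)
 have VS: "V \<subseteq> S" unfolding V_def by (rule r(2))
 have aV: "a \<in> V" using r a rel_open_half_plane[OF S] unfolding V_def by auto
 have seg: "a + t *\<^sub>R (x - a) \<in> V" if "x \<in> V" "t \<in> {0..1}" for x t using segment_in_half_ball[of a a r x t] aV that unfolding V_def by blast
 have cp: "has_partials c1 (partial_within S 1 c1 x) (partial_within S 2 c1 x) x V"
  "has_partials c2 (partial_within S 1 c2 x) (partial_within S 2 c2 x) x V" if "x \<in> V" for x
  using Ck_on_partials[of 0 S _ x] c that VS has_partials_mono[OF _ VS] by (auto simp del: Ck_on.simps)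
 let ?g = "%x t. a + t *\<^sub>R (x - a)"
 define f where "f x t = c1 (?g x t) * (x - a) $ 1 + c2 (?g x t) * (x - a) $ 2" for x t
 \<comment> \<open>The partial derivative of the integrand in direction i. Closedness makes it the
   t-derivative of t times the component \<open>c1\<close> or \<open>c2\<close> along the ray, so
   its integral is that component at x.\<close>
 define d where "d i x t = (if i = 1 then c1 (?g x t) else c2 (?g x t)) +
  t * (partial_within S i c1 (?g x t) * (x - a) $ 1 + partial_within S i c2 (?g x t) * (x - a) $ 2)" for i :: 2 and x t
 define B where "B i = Blinfun (%v::real^2. v $ i)" for i
 have B: "blinfun_apply (B i) = (%v. v $ i)" for i unfolding B_def by (rule bounded_linear_Blinfun_apply) (rule bounded_linear_vec_nth)
 have BB: "blinfun_apply (p *\<^sub>R B 1 + q *\<^sub>R B 2) = (%v. p * v $ 1 + q * v $ 2)" for p q by (rule ext) (simp add: blinfun.bilinear_simps B)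
 define fx where "fx x t = d 1 x t *\<^sub>R B 1 + d 2 x t *\<^sub>R B 2" for x t
 have cc: "continuous_on S c1" "continuous_on S c2" "continuous_on S (partial_within S i c1)" "continuous_on S (partial_within S i c2)" for i
  using c by (auto simp: differentiable_imp_continuous_on)
 have gS: "?g (fst z) (snd z) \<in> S" if "z \<in> V \<times> cbox 0 1" for z using seg[of "fst z" "snd z"] VS that by auto
 have gc: "continuous_on (V \<times> cbox 0 1) (%z. k (?g (fst z) (snd z)))" if "continuous_on S k" for k :: "real^2 => real"
  by (rule continuous_on_compose2[OF that]) (use gS in \<open>auto intro!: continuous_intros\<close>)
 have dc: "continuous_on (V \<times> cbox 0 1) (%z. d i (fst z) (snd z))" for i
  unfolding d_def by (cases "i = 1"; simp only: if_True if_False simp_thms; intro continuous_intros gc cc)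
 have fc: "continuous_on (V \<times> cbox 0 1) (%z. f (fst z) (snd z))" unfolding f_def by (intro continuous_intros gc cc)
 have "((%x. integral (cbox 0 1) (f x)) has_derivative integral (cbox 0 1) (fx x)) (at x within V)" if x: "x \<in> V" for x
 proof (rule leibniz_rule[where fx = fx])
  show "convex V" unfolding V_def by (intro convex_Int convex_ball convex_half_plane)
  show "continuous_on (V \<times> cbox 0 1) (%(x, t). fx x t)" unfolding fx_def case_prod_beta by (intro continuous_intros dc)
  show "f y integrable_on cbox 0 1" if "y \<in> V" for y
  proof (rule integrable_continuous)
   show "continuous_on (cbox 0 1) (f y)" using continuous_on_compose2[OF fc continuous_on_Pair[OF continuous_on_const[of _ y] continuous_on_id]] that by auto
  qed
  show "((%x. f x t) has_derivative blinfun_apply (fx y t)) (at y within V)" if y: "y \<in> V" and t: "t \<in> cbox 0 1" for y t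
  proof -
   have gV: "?g y t \<in> V" using seg[OF y] t by simp
   have im: "(%y. ?g y t) ` V \<subseteq> V" using seg t by auto
   have dg: "((%y. ?g y t) has_derivative (%v. t *\<^sub>R v)) (at y within V)" by (auto intro!: derivative_eq_intros)
   have comp: "has_partials (%y. k (?g y t)) (t * k1) (t * k2) y V" if "has_partials k k1 k2 (?g y t) V" for k k1 k2
    using has_derivative_in_compose[OF dg has_derivative_subset[OF that[unfolded has_partials_def] im]]
    unfolding has_partials_def by (simp add: algebra_simps)
   have "((%y. (y - a) $ 1) has_derivative (%v. v $ 1)) (at y within V)" "((%y. (y - a) $ 2) has_derivative (%v. v $ 2)) (at y within V)"
    by (auto intro!: derivative_eq_intros bounded_linear.has_derivative[OF bounded_linear_vec_nth])
   then have co: "has_partials (%y. (y - a) $ 1) 1 0 y V" "has_partials (%y. (y - a) $ 2) 0 1 y V" unfolding has_partials_def by simp_all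
   have "has_partials (%x. f x t) (d 1 y t) (d 2 y t) y V" unfolding f_def
    by (rule has_partials_add[OF has_partials_mult[OF comp[OF cp(1)[OF gV]] co(1)] has_partials_mult[OF comp[OF cp(2)[OF gV]] co(2)],
       THEN back_subst[where P = "%z. has_partials _ _ z _ _"], THEN back_subst[where P = "%z. has_partials _ z _ _ _"]])
     (simp_all add: d_def algebra_simps)
   then show ?thesis unfolding has_partials_def fx_def BB .
  qed
 qed (rule x)
 moreover have "integral (cbox 0 1) (fx x) = c1 x *\<^sub>R B 1 + c2 x *\<^sub>R B 2" if x: "x \<in> V" for x
 proof -
  have I: "((%t. d i x t) has_integral (if i = 1 then c1 x else c2 x)) (cbox 0 1)" for i
  proof -
   let ?k = "if i = 1 then c1 else c2"
   have "((%t. t * ?k (?g x t)) has_vector_derivative d i x t) (at t within {0..1})" if t: "t \<in> {0..1}" for t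
   proof -
    have gV: "?g x t \<in> V" by (rule seg[OF x t])
    have l1: "((%t. c1 (?g x t)) has_real_derivative partial_within S 1 c1 (?g x t) * (x - a) $ 1 + partial_within S 2 c1 (?g x t) * (x - a) $ 2) (at t within {0..1})"
     by (rule line_derivative[OF cp(1)[OF gV] seg[OF x]])
    have l2: "((%t. c2 (?g x t)) has_real_derivative partial_within S 1 c2 (?g x t) * (x - a) $ 1 + partial_within S 2 c2 (?g x t) * (x - a) $ 2) (at t within {0..1})"
     by (rule line_derivative[OF cp(2)[OF gV] seg[OF x]])
    have "partial_within S 2 c1 (?g x t) = partial_within S 1 c2 (?g x t)" using cl gV VS by blast
    then have "((%t. t * ?k (?g x t)) has_real_derivative d i x t) (at t within {0..1})"
     using DERIV_mult[OF DERIV_ident l1] DERIV_mult[OF DERIV_ident l2] exhaust_2[of i] unfolding d_def by (auto simp: algebra_simps)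
    then show ?thesis by (simp add: has_real_derivative_iff_has_vector_derivative)
   qed
   from fundamental_theorem_of_calculus[OF zero_le_one this] show ?thesis by (cases "i = 1") simp_all
  qed
  from I[of 1] I[of 2] have "((%t. fx x t) has_integral c1 x *\<^sub>R B 1 + c2 x *\<^sub>R B 2) (cbox 0 1)"
   unfolding fx_def by (intro has_integral_add has_integral_scaleR_left) simp_all
  then show ?thesis by (rule integral_unique)
 qed
 ultimately have "has_partials (%x. integral (cbox 0 1) (f x)) (c1 x) (c2 x) x V" if "x \<in> V" for x using that unfolding has_partials_def by (simp add: BB)
 then show ?thesis using V aV VS by blast
qed

lemma primitive_unique:
 assumes U: "rel_open U" "x \<in> U" and h: "\<And>y. y \<in> U ==> has_partials h (c1 y) (c2 y) y U"
  and h': "\<And>y. y \<in> U ==> has_partials h' (c1 y) (c2 y) y U" and e: "h x = h' x"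
 shows "\<exists>V. rel_open V \<and> x \<in> V \<and> V \<subseteq> U \<and> (\<forall>y\<in>V. h y = h' y)"
proof -
 obtain r where r: "0 < r" "ball x r \<inter> half_plane \<subseteq> U" using rel_open_ball[OF U] .
 let ?V = "ball x r \<inter> half_plane"
 have c: "convex ?V" by (intro convex_Int convex_ball convex_half_plane)
 have "((%y. h y - h' y) has_derivative (%v. 0)) (at y within ?V)" if "y \<in> ?V" for y
  using has_partials_mono[OF has_partials_diff[OF h h'] r(2), of y] that r(2) unfolding has_partials_def by auto
 then obtain k where k: "\<And>y. y \<in> ?V ==> h y - h' y = k" using has_derivative_zero_constant[OF c, of "%y. h y - h' y"] by blast
 have xV: "x \<in> ?V" using U r rel_open_half_plane[OF U(1)] by auto
 have "h y = h' y" if "y \<in> ?V" for y using k[OF that] k[OF xV] e by linarith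
 moreover have "rel_open ?V" by (simp add: openin_open_Int Int_commute)
 ultimately show ?thesis using xV r(2) by blast
qed

text \<open>Ties the shape of J to the type of the point: R holds for a regular point, and P
  \<sigma> for a probe on the side of sign \<sigma>. A probe is claimed exactly on the sides into
  which J extends.\<close>

definition sided :: "real set => real => real => bool => (real => bool) => bool" where
 "sided J a e R P \<longleftrightarrow> J = {a - e<..<a + e} \<and> R \<and> P 1 \<and> P (- 1) \<or> J = {a..<a + e} \<and> \<not> R \<and> P 1 \<or> J = {a - e<..a} \<and> \<not> R \<and> P (- 1)"

context killing_chart begin

lemma primitive_exists:
 assumes "a \<in> S"
 shows "\<exists>V h. rel_open V \<and> a \<in> V \<and> V \<subseteq> S \<and> (\<forall>x\<in>V. has_partials h (al1 x) (al2 x) x V)"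
 by (rule closed_form_primitive[OF S al_smooth alpha_closed assms])

text \<open>Since \<open>X2\<close> vanishes along the boundary line, so does its tangential
  derivative. At a zero of the field this forces \<open>kap\<close> = 0, and then the whole one-jet
  vanishes.\<close>

lemma boundary_nonzero:
 assumes V: "rel_open V" "V \<subseteq> S" and tan: "\<And>x. x \<in> V ==> x $ 2 = 0 ==> X2 x = 0"
  and a: "a \<in> V" and a20: "a $ 2 = 0" and nd: "mm a \<noteq> 0"
 shows "N a \<noteq> 0"
proof
 assume "N a = 0"
 have aS: "a \<in> S" using a V(2) by blast
 have x0: "X1 a = 0" "X2 a = 0" using N_nonneg[OF aS] \<open>N a = 0\<close> by auto
 obtain \<rho> where rho: "0 < \<rho>" "\<And>v. v $ 2 \<ge> 0 ==> norm v < \<rho> ==> a + v \<in> V" using rel_open_step[OF V(1) a] by blast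
 have hp: "has_partials X2 (D1 X2 a) (D2 X2 a) (a + 0 *\<^sub>R axis 1 1) V" using has_partials_mono[OF Ck_on_partials[OF smooth(5) aS] V(2)] by simp
 have in': "a + t *\<^sub>R axis 1 1 \<in> V" if "t \<in> {0..\<rho>/2}" for t using rho(1) that by (intro rho(2); simp) (simp add: axis_def)
 have e: "X2 (a + t *\<^sub>R axis 1 1) = 0" if "t \<in> {0..\<rho>/2}" for t using tan[OF in'[OF that]] a20 by (simp add: axis_def)
 have "((%t. X2 (a + t *\<^sub>R axis 1 1)) has_real_derivative D1 X2 a * (axis 1 1 :: real^2) $ 1 + D2 X2 a * (axis 1 1 :: real^2) $ 2) (at 0 within {0..\<rho>/2})"
  by (rule line_derivative[OF hp in'])
 then have "((%t. 0) has_real_derivative D1 X2 a * (axis 1 1 :: real^2) $ 1 + D2 X2 a * (axis 1 1::real^2) $ 2) (at 0 within {0..\<rho>/2})"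
  by (rule has_field_derivative_transform_within[OF _ zero_less_one]) (use rho(1) e in auto)
 then have "((%t. 0) has_real_derivative D1 X2 a) (at 0 within {0..\<rho>/2})" by (simp add: axis_def)
 then have "((%t. 0::real) has_vector_derivative D1 X2 a) (at 0 within cbox 0 (\<rho>/2))" by (simp add: has_real_derivative_iff_has_vector_derivative)
 from vector_derivative_unique_within_closed_interval[OF _ _ this, of 0] have "D1 X2 a = 0" using rho(1) by simp
 then have "kap a = 0" by (rule degenerate_zero(2)[OF aS x0])
 then show False using degenerate_zero(1)[OF aS x0] nd x0 unfolding mm_def by auto
qed

text \<open>Where N is nonzero the box construction applies to h or to -h, according to the sign of
  its derivative. A zero of the field is an interior point with \<open>kap\<close> \<noteq> 0,
  because its one-jet is nonzero, and the polar construction applies.\<close>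

lemma primitive_structure:
 assumes V: "rel_open V" "V \<subseteq> S" and h: "\<And>x. x \<in> V ==> has_partials h (al1 x) (al2 x) x V"
  and tan: "\<And>x. x \<in> V ==> x $ 2 = 0 ==> X2 x = 0" and a: "a \<in> V" and nd: "mm a \<noteq> 0"
 shows "\<exists>U J e. level_patch (top_of_set V) h (h a) U J e \<and> a \<in> U \<and>
   sided J (h a) e (0 < a $ 2 \<and> N a \<noteq> 0) (%\<sigma>. graded_function.probe V h N kap \<sigma> a)" (is ?patch)
  and "N a \<noteq> 0 ==> \<exists>W. openin (top_of_set V) W \<and> a \<in> W \<and> (\<forall>z\<in>W. h z = h a --> N z = N a)"
proof -
 note sm = al_smooth[of 0, simplified]
 have ac: "continuous_on V al1" "continuous_on V al2" using sm continuous_on_subset[OF _ V(2)] by auto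
 interpret P: graded_function V h al1 al2 by unfold_locales (use V h ac in auto)
 interpret M: graded_function V "%x. - h x" "%x. - al1 x" "%x. - al2 x"
  by unfold_locales (use V h ac in \<open>auto intro!: has_partials_minus continuous_on_minus\<close>)
 have aS: "a \<in> S" using a V(2) by blast
 have a2: "0 \<le> a $ 2" using rel_open_half_plane[OF V(1)] a unfolding half_plane_def by auto
 have NV: "has_partials N (kap x * al1 x) (kap x * al2 x) x V" if "x \<in> V" for x
  using has_partials_mono[OF Ck_on_partials[OF N_smooth] V(2), of x] N_partials[of x] that V(2) by auto
 have kc: "continuous_on V kap" using kap_smooth[of 0] continuous_on_subset[OF _ V(2)] by simp
 have Mb: "M.b i x = - P.b i x" for i x unfolding M.b_def P.b_def by simp
 have reg: "\<exists>i. P.b i a \<noteq> 0 \<and> (a $ 2 = 0 --> i = 2 \<and> (\<forall>x\<in>V. x $ 2 = 0 --> al1 x = 0))" if "N a \<noteq> 0"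
 proof (cases "a $ 2 = 0")
  case True
  have "X2 a = 0" using tan a True by blast
  then have "X1 a \<noteq> 0" using N_nonneg(2)[OF aS] that by blast
  then have "al2 a \<noteq> 0" unfolding al2_def using r_pos[OF aS] by simp
  moreover have "al1 x = 0" if "x \<in> V" "x $ 2 = 0" for x unfolding al1_def using tan[OF that] by simp
  ultimately show ?thesis unfolding P.b_def by (intro exI[of _ 2]) auto
 next
  case False
  have "al1 a \<noteq> 0 \<or> al2 a \<noteq> 0" unfolding al1_def al2_def using that N_nonneg(2)[OF aS] r_pos[OF aS] by auto
  then show ?thesis
  proof
   assume "al1 a \<noteq> 0" then show ?thesis using False by (intro exI[of _ 1]) (simp add: P.b_def)
  next
   assume "al2 a \<noteq> 0" then show ?thesis using False by (intro exI[of _ 2]) (simp add: P.b_def)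
  qed
 qed
 show "\<exists>W. openin (top_of_set V) W \<and> a \<in> W \<and> (\<forall>z\<in>W. h z = h a --> N z = N a)" if Na: "N a \<noteq> 0"
 proof -
  obtain i where i: "P.b i a \<noteq> 0" "a $ 2 = 0 --> i = 2 \<and> (\<forall>x\<in>V. x $ 2 = 0 --> al1 x = 0)" using reg[OF Na] by blast
  show ?thesis
  proof (cases "0 < P.b i a")
   case True
   show ?thesis by (rule P.fibre_invariant_pos[OF a True i(2) NV])
  next
   case False
   have m: "0 < M.b i a" using False i(1) unfolding Mb by simp
   have bd: "a $ 2 = 0 --> i = 2 \<and> (\<forall>x\<in>V. x $ 2 = 0 --> - al1 x = 0)" using i(2) by simp
   have "\<exists>W. openin (top_of_set V) W \<and> a \<in> W \<and> (\<forall>z\<in>W. - h z = - h a --> N z = N a)"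
    by (rule M.fibre_invariant_pos[OF a m bd, where kp = "%x. - kap x"]) (use NV in simp)
   then show ?thesis by simp
  qed
 qed
 have two: ?patch if "level_patch (top_of_set V) h (h a) U {h a - e<..<h a + e} e" "a \<in> U" "0 < a $ 2" "N a \<noteq> 0"
  "P.probe N kap 1 a" "P.probe N kap (- 1) a" for U e
  by (rule exI[of _ U], rule exI[of _ "{h a - e<..<h a + e}"], rule exI[of _ e]) (use that in \<open>simp add: sided_def\<close>)
 have right: ?patch if "level_patch (top_of_set V) h (h a) U {h a..<h a + e} e" "a \<in> U" "\<not> (0 < a $ 2 \<and> N a \<noteq> 0)"
  "P.probe N kap 1 a" for U e by (rule exI[of _ U], rule exI[of _ "{h a..<h a + e}"], rule exI[of _ e]) (use that in \<open>simp add: sided_def\<close>)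
 have left: ?patch if "level_patch (top_of_set V) h (h a) U {h a - e<..h a} e" "a \<in> U" "\<not> (0 < a $ 2 \<and> N a \<noteq> 0)"
  "P.probe N kap (- 1) a" for U e by (rule exI[of _ U], rule exI[of _ "{h a - e<..h a}"], rule exI[of _ e]) (use that in \<open>simp add: sided_def\<close>)
 show ?patch
 proof (cases "N a = 0")
  case False
  obtain i where i: "P.b i a \<noteq> 0" "a $ 2 = 0 --> i = 2 \<and> (\<forall>x\<in>V. x $ 2 = 0 --> al1 x = 0)" using reg[OF False] by blast
  have i2: "a $ 2 = 0 --> i = 2" using i(2) by blast
  note pr = P.regular_probes[OF a i(1) i2 NV kc]
  show ?thesis
  proof (cases "0 < P.b i a")
   case True
   obtain U e where U: "level_patch (top_of_set V) h (h a) U (if 0 < a $ 2 then {h a - e<..<h a + e} else {h a..<h a + e}) e" "a \<in> U"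
    using P.regular_patch[OF a True i(2)] by blast
   have s: "sgn (P.b i a) = 1" using True by simp
   show ?thesis
   proof (cases "0 < a $ 2")
    case a2p: True
    show ?thesis using two[OF U(1)[unfolded if_P[OF a2p]] U(2) a2p False] pr[unfolded s] a2p by blast
   next
    case a2n: False
    show ?thesis using right[OF U(1)[unfolded if_not_P[OF a2n]] U(2)] pr(1)[unfolded s] a2n by blast
   qed
  next
   case F: False
   have m: "0 < M.b i a" using F i(1) unfolding Mb by simp
   have s: "sgn (P.b i a) = - 1" using F i(1) by simp
   have bd: "a $ 2 = 0 --> i = 2 \<and> (\<forall>x\<in>V. x $ 2 = 0 --> - al1 x = 0)" using i(2) by simp
   obtain U e where U: "level_patch (top_of_set V) (%x. - h x) (- h a) U (if 0 < a $ 2 then {- h a - e<..<- h a + e} else {- h a..<- h a + e}) e" "a \<in> U"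
    using M.regular_patch[OF a m bd] by blast
   have J: "uminus ` (if 0 < a $ 2 then {- h a - e<..<- h a + e} else {- h a..<- h a + e}) = (if 0 < a $ 2 then {h a - e<..<h a + e} else {h a - e<..h a})"
    by (simp add: algebra_simps)
   note U' = level_patch_minus[OF U(1), unfolded J]
   show ?thesis
   proof (cases "0 < a $ 2")
    case a2p: True
    show ?thesis using two[OF U'[unfolded if_P[OF a2p]] U(2) a2p False] pr[unfolded s] a2p by simp
   next
    case a2n: False
    show ?thesis using left[OF U'[unfolded if_not_P[OF a2n]] U(2)] pr(1)[unfolded s] a2n by blast
   qed
  qed
 next
  case True
  then have x0: "X1 a = 0" "X2 a = 0" using N_nonneg(2)[OF aS] by auto
  have kn: "kap a \<noteq> 0" using degenerate_zero(1)[OF aS x0] nd x0 unfolding mm_def by auto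
  have ap: "0 < a $ 2" using boundary_nonzero[OF V tan a _ nd] a2 True by fastforce
  have hp: "has_partials al1 (kap a / 2 * E a) (kap a / 2 * F a) a V" "has_partials al2 (kap a / 2 * F a) (kap a / 2 * G a) a V"
   using has_partials_mono[OF Ck_on_partials[OF al_smooth(1) aS] V(2)] has_partials_mono[OF Ck_on_partials[OF al_smooth(2) aS] V(2)]
   unfolding zero_structure[OF aS x0] by auto
  have z: "al1 a = 0" "al2 a = 0" unfolding al1_def al2_def x0 by auto
  have An: "kap a / 2 * E a \<noteq> 0" using kn E_pos[OF aS] by simp
  note pr = P.centre_probe[OF a ap z(1) hp(1) An NV kc]
  have det: "0 < kap a / 2 * E a * (kap a / 2 * G a) - kap a / 2 * F a * (kap a / 2 * F a)"
  proof -
   have "0 < (kap a / 2)\<^sup>2 * (E a * G a - F a * F a)" using kn det_pos[OF aS] by simp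
   then show ?thesis by (simp add: power2_eq_square algebra_simps)
  qed
  show ?thesis
  proof (cases "0 < kap a")
   case T: True
   have A: "0 < kap a / 2 * E a" using T E_pos[OF aS] by simp
   obtain U e where U: "level_patch (top_of_set V) h (h a) U {h a..<h a + e} e" "a \<in> U" using P.centre_patch[OF a ap z hp A det] by blast
   have s: "sgn (kap a / 2 * E a) = 1" using A by simp
   show ?thesis using right[OF U] pr[unfolded s] True by simp
  next
   case F': False
   have k': "0 < - kap a" using F' kn by simp
   have A: "0 < - (kap a / 2 * E a)" using mult_pos_pos[OF k' E_pos[OF aS]] by simp
   have hm: "has_partials (%x. - al1 x) (- (kap a / 2 * E a)) (- (kap a / 2 * F a)) a V" "has_partials (%x. - al2 x) (- (kap a / 2 * F a)) (- (kap a / 2 * G a)) a V"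
    by (intro has_partials_minus hp)+
   have zm: "- al1 a = 0" "- al2 a = 0" using z by auto
   have dm: "0 < - (kap a / 2 * E a) * - (kap a / 2 * G a) - - (kap a / 2 * F a) * - (kap a / 2 * F a)" using det by simp
   obtain U e where U: "level_patch (top_of_set V) (%x. - h x) (- h a) U {- h a..<- h a + e} e" "a \<in> U" using M.centre_patch[OF a ap zm hm A dm] by blast
   have J: "uminus ` {- h a..<- h a + e} = {h a - e<..h a}" by (simp add: algebra_simps)
   have s: "sgn (kap a / 2 * E a) = - 1" using A by simp
   show ?thesis using left[OF level_patch_minus[OF U(1), unfolded J] U(2)] pr[unfolded s] True by simp
  qed
 qed
qed

end

section \<open>The level function on a component of the surface\<close>

context oriented_surface begin

lemma chart_rel_open: "c \<in> A ==> rel_open (chart_image c)" using chart_open_image by simp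

lemma chart_subset: "c \<in> A ==> fst c \<subseteq> topspace X" using chart_domain openin_subset by blast

lemma chart_topspace: "c \<in> A ==> topspace (subtopology X (fst c)) = fst c" using chart_subset by (simp add: Int_absorb1 topspace_subtopology)

lemma chart_inj: "c \<in> A ==> inj_on (snd c) (fst c)" using homeomorphic_imp_injective_map[OF chart_homeomorphic[of c]] chart_topspace by simp

lemma chart_in_image: "p \<in> fst c ==> snd c p \<in> chart_image c" unfolding chart_image_def by simp

lemma chart_inv_snd: "c \<in> A ==> p \<in> fst c ==> chart_inv c (snd c p) = p" unfolding chart_inv_def using chart_inj by simp

lemma chart_inv_in: "x \<in> chart_image c ==> chart_inv c x \<in> fst c" unfolding chart_inv_def chart_image_def by (rule inv_into_into)

lemma snd_chart_inv: "x \<in> chart_image c ==> snd c (chart_inv c x) = x" unfolding chart_inv_def chart_image_def by (rule f_inv_into_f)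

lemma chart_nonneg: "c \<in> A ==> p \<in> fst c ==> 0 \<le> snd c p $ 2"
 using rel_open_half_plane[OF chart_rel_open] chart_in_image[of p c] unfolding half_plane_def by blast

lemma chart_at: assumes "p \<in> topspace X" obtains c where "c \<in> A" "p \<in> fst c" using assms chart_cover by blast

lemma chart_open_iff:
 assumes "c \<in> A" "U \<subseteq> fst c"
 shows "openin X U \<longleftrightarrow> rel_open (snd c ` U)"
proof -
 have "rel_open (snd c ` U) \<longleftrightarrow> openin (top_of_set (chart_image c)) (snd c ` U)"
  using openin_subset_trans[of half_plane "snd c ` U" "chart_image c"] openin_trans[of "chart_image c" "snd c ` U" half_plane]
   chart_rel_open[OF assms(1)] rel_open_half_plane[OF chart_rel_open[OF assms(1)]] image_mono[OF assms(2), of "snd c"] unfolding chart_image_def by auto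
 also have "\<dots> \<longleftrightarrow> openin (subtopology X (fst c)) U"
  using homeomorphic_map_openness[OF chart_homeomorphic[OF assms(1)], of U, unfolded chart_topspace[OF assms(1)]] assms(2) by blast
 also have "\<dots> \<longleftrightarrow> openin X U" using openin_open_subtopology[OF chart_domain[OF assms(1)]] assms(2) by simp
 finally show ?thesis by simp
qed

lemma chart_image_open: "c \<in> A ==> openin X U ==> rel_open (snd c ` (fst c \<inter> U))" using chart_open_iff[of c "fst c \<inter> U"] chart_domain by blast

lemma chart_preimage:
 assumes "c \<in> A" "V \<subseteq> chart_image c"
 shows "snd c ` {p\<in>fst c. snd c p \<in> V} = V" "{p\<in>fst c. snd c p \<in> V} = chart_inv c ` V"
  and "rel_open V ==> openin X {p\<in>fst c. snd c p \<in> V}"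
proof -
 show 1: "snd c ` {p\<in>fst c. snd c p \<in> V} = V" using assms(2) unfolding chart_image_def by auto
 show "{p\<in>fst c. snd c p \<in> V} = chart_inv c ` V"
  using assms(2) by (auto simp: image_iff chart_inv_snd[OF assms(1)] intro: chart_inv_in dest: snd_chart_inv) (metis chart_inv_snd[OF assms(1)], metis snd_chart_inv subsetD)
 show "rel_open V ==> openin X {p\<in>fst c. snd c p \<in> V}" using chart_open_iff[OF assms(1), of "{p\<in>fst c. snd c p \<in> V}"] 1 by auto
qed

lemma chart_connected:
 assumes "c \<in> A" "V \<subseteq> chart_image c" "connected V"
 shows "connectedin X {p\<in>fst c. snd c p \<in> V}"
proof -
 let ?U = "{p\<in>fst c. snd c p \<in> V}"
 have "connectedin (top_of_set (chart_image c)) (snd c ` ?U)" using chart_preimage(1)[OF assms(1,2)] assms(2,3) by (simp add: connectedin_subtopology)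
 then have "connectedin (subtopology X (fst c)) ?U"
  using homeomorphic_map_connectedness[OF chart_homeomorphic[OF assms(1)], of ?U] chart_topspace[OF assms(1)] by auto
 then show ?thesis by (simp add: connectedin_subtopology)
qed

lemma has_partials_near:
 assumes c: "c \<in> A" "p \<in> fst c" and U: "openin X U" "p \<in> U"
  and e: "\<And>q. q \<in> fst c \<inter> U ==> f q = f' q"
 shows "has_partials (f \<circ> chart_inv c) a b (snd c p) (chart_image c) \<longleftrightarrow> has_partials (f' \<circ> chart_inv c) a b (snd c p) (chart_image c)"
proof -
 let ?V = "snd c ` (fst c \<inter> U)"
 have V: "rel_open ?V" "snd c p \<in> ?V" "?V \<subseteq> chart_image c" using chart_image_open[OF c(1) U(1)] c U unfolding chart_image_def by auto
 have "(f \<circ> chart_inv c) y = (f' \<circ> chart_inv c) y" if "y \<in> ?V" for y using that e by (auto simp: chart_inv_snd[OF c(1)])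
 then have "has_partials (f \<circ> chart_inv c) a b (snd c p) ?V \<longleftrightarrow> has_partials (f' \<circ> chart_inv c) a b (snd c p) ?V"
  using has_partials_cong[OF _ V(2), of "f \<circ> chart_inv c" a b "f' \<circ> chart_inv c"] has_partials_cong[OF _ V(2), of "f' \<circ> chart_inv c" a b "f \<circ> chart_inv c"] by metis
 then show ?thesis using has_partials_subset_iff[OF V chart_rel_open[OF c(1)]] by simp
qed

lemma transition_partials:
 assumes c: "c \<in> A" "d \<in> A" "p \<in> fst c" "p \<in> fst d"
 shows "has_partials (%x. snd d (chart_inv c x) $ i) (transition_jacobian c d p $ i $ 1) (transition_jacobian c d p $ i $ 2)
  (snd c p) (snd c ` (fst c \<inter> fst d))"
proof -
 let ?D = "snd c ` (fst c \<inter> fst d)"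
 have D: "rel_open ?D" "snd c p \<in> ?D" "?D \<subseteq> chart_image c" using chart_image_open[OF c(1) chart_domain[OF c(2)]] c unfolding chart_image_def by auto
 have "has_partials (%x. snd d (chart_inv c x) $ i) (partial_within ?D 1 (%x. snd d (chart_inv c x) $ i) (snd c p))
  (partial_within ?D 2 (%x. snd d (chart_inv c x) $ i) (snd c p)) (snd c p) ?D"
  using transition_smooth[OF c(1,2), of i] D(2) unfolding smooth_on_def by (intro Ck_on_partials[of 0]) auto
 moreover have "partial_within ?D j (%x. snd d (chart_inv c x) $ i) (snd c p) = transition_jacobian c d p $ i $ j" for j
  unfolding transition_jacobian_def chart_deriv_def using partial_within_subset[OF D chart_rel_open[OF c(1)]] by (simp add: o_def)
 ultimately show ?thesis by simp
qed

lemma partials_change: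
 assumes c: "c \<in> A" "d \<in> A" "p \<in> fst c" "p \<in> fst d"
  and f: "has_partials (f \<circ> chart_inv d) a b (snd d p) (chart_image d)"
 defines "J \<equiv> transition_jacobian c d p"
 shows "has_partials (f \<circ> chart_inv c) (a * J $ 1 $ 1 + b * J $ 2 $ 1) (a * J $ 1 $ 2 + b * J $ 2 $ 2) (snd c p) (chart_image c)"
proof -
 let ?D = "snd c ` (fst c \<inter> fst d)" and ?t = "%x. snd d (chart_inv c x)"
 have D: "rel_open ?D" "snd c p \<in> ?D" "?D \<subseteq> chart_image c" using chart_image_open[OF c(1) chart_domain[OF c(2)]] c unfolding chart_image_def by auto
 have t: "(?t has_derivative (%v. J *v v)) (at (snd c p) within ?D)"
 proof (rule iffD2[OF has_derivative_componentwise_within], rule)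
  fix i :: "real^2" assume "i \<in> Basis"
  then obtain k and y :: real where "i = axis k y" "y \<in> Basis" unfolding Basis_vec_def by blast
  then have k: "i = axis k 1" by simp
  have e: "(%v. (J *v v) \<bullet> i) = (%v. J $ k $ 1 * v $ 1 + J $ k $ 2 * v $ 2)" "(%x. ?t x \<bullet> i) = (%x. ?t x $ k)"
   unfolding k by (rule ext, simp add: inner_axis matrix_vector_mult_def sum_2)+
  show "((%x. ?t x \<bullet> i) has_derivative (%v. (J *v v) \<bullet> i)) (at (snd c p) within ?D)"
   using transition_partials[OF c, of k] unfolding has_partials_def J_def[symmetric] e .
 qed
 have td: "?t (snd c p) = snd d p" by (simp add: chart_inv_snd c)
 have im: "?t ` ?D \<subseteq> chart_image d" unfolding chart_image_def by (auto simp: chart_inv_snd[OF c(1)])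
 have fd: "((f \<circ> chart_inv d) has_derivative (%v. a * v $ 1 + b * v $ 2)) (at (?t (snd c p)) within ?t ` ?D)"
  unfolding td using f has_derivative_subset[OF _ im] unfolding has_partials_def by blast
 have "has_partials (%x. (f \<circ> chart_inv d) (?t x)) (a * J $ 1 $ 1 + b * J $ 2 $ 1) (a * J $ 1 $ 2 + b * J $ 2 $ 2) (snd c p) ?D"
  using has_derivative_in_compose[OF t fd] unfolding has_partials_def by (simp add: matrix_vector_mult_def sum_2 algebra_simps)
 then have "has_partials (f \<circ> chart_inv c) (a * J $ 1 $ 1 + b * J $ 2 $ 1) (a * J $ 1 $ 2 + b * J $ 2 $ 2) (snd c p) ?D"
  by (rule has_partials_cong[OF _ D(2)]) (auto simp: chart_inv_snd c)
 then show ?thesis using has_partials_subset_iff[OF D chart_rel_open[OF c(1)]] by simp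
qed

text \<open>If p were interior in c but on the boundary in d, the second coordinate of d would have
  an interior minimum in c. A row of the transition Jacobian would vanish, against its positive
  determinant.\<close>

lemma boundary_chart:
 assumes c: "c \<in> A" "p \<in> fst c"
 shows "p \<in> surface_boundary A \<longleftrightarrow> snd c p $ 2 = 0"
proof
 assume "p \<in> surface_boundary A"
 then obtain d where d: "d \<in> A" "p \<in> fst d" "snd d p $ 2 = 0" unfolding surface_boundary_def by blast
 show "snd c p $ 2 = 0"
 proof (rule ccontr)
  assume "snd c p $ 2 \<noteq> 0"
  then have pos: "0 < snd c p $ 2" using chart_nonneg[OF c] by simp
  let ?D = "snd c ` (fst c \<inter> fst d)" and ?J = "transition_jacobian c d p"
  have D: "rel_open ?D" "snd c p \<in> ?D" using chart_image_open[OF c(1) chart_domain[OF d(1)]] c d by auto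
  have i: "snd c p \<in> interior ?D" by (rule rel_open_interior[OF D pos])
  have "((%x. snd d (chart_inv c x) $ 2) has_derivative (%v. ?J $ 2 $ 1 * v $ 1 + ?J $ 2 $ 2 * v $ 2)) (at (snd c p))"
   using transition_partials[OF c(1) d(1) c(2) d(2), of 2] at_within_interior[OF i] unfolding has_partials_def by simp
  moreover have "\<forall>y\<in>interior ?D. snd d (chart_inv c (snd c p)) $ 2 \<le> snd d (chart_inv c y) $ 2"
  proof
   fix y assume "y \<in> interior ?D"
   then have "y \<in> ?D" using interior_subset by blast
   then obtain q where q: "q \<in> fst c" "q \<in> fst d" "y = snd c q" by auto
   show "snd d (chart_inv c (snd c p)) $ 2 \<le> snd d (chart_inv c y) $ 2"
    using chart_nonneg[OF d(1) q(2)] d(3) unfolding q(3) chart_inv_snd[OF c(1) q(1)] chart_inv_snd[OF c] by simp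
  qed
  ultimately have z: "(%v::real^2. ?J $ 2 $ 1 * v $ 1 + ?J $ 2 $ 2 * v $ 2) = (%v. 0)" using differential_zero_maxmin[OF i open_interior] by blast
  have "?J $ 2 $ 1 = 0" "?J $ 2 $ 2 = 0" using fun_cong[OF z, of "axis 1 1"] fun_cong[OF z, of "axis 2 1"] by (auto simp: axis_def)
  then show False using transition_oriented[OF c(1) d(1) c(2) d(2)] by (simp add: det_2)
 qed
qed (use c in \<open>auto simp: surface_boundary_def\<close>)

lemma continuous_map_charts:
 assumes G: "openin X G" and f: "\<And>c. c \<in> A ==> continuous_on (snd c ` (fst c \<inter> G)) (f \<circ> chart_inv c)"
 shows "continuous_map (subtopology X G) euclideanreal f" unfolding continuous_map
proof (intro conjI allI impI)
 fix T :: "real set" assume "openin euclideanreal T"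
 then have T: "open T" by simp
 have Gt: "G \<subseteq> topspace X" using openin_subset[OF G] .
 have "\<exists>W. openin X W \<and> p \<in> W \<and> W \<subseteq> {x\<in>G. f x \<in> T}" if p: "p \<in> G" "f p \<in> T" for p
 proof -
  obtain c where c: "c \<in> A" "p \<in> fst c" using chart_at p Gt by blast
  let ?V = "snd c ` (fst c \<inter> G)"
  have "openin (top_of_set ?V) {x \<in> ?V. (f \<circ> chart_inv c) x \<in> T}" using continuous_openin_preimage_gen[OF f[OF c(1)] T] by (simp add: vimage_def Int_def)
  then have o: "rel_open {x \<in> ?V. (f \<circ> chart_inv c) x \<in> T}" using openin_trans chart_image_open[OF c(1) G] by blast
  have eq: "{x \<in> ?V. (f \<circ> chart_inv c) x \<in> T} = snd c ` (fst c \<inter> {x\<in>G. f x \<in> T})" by (auto simp: chart_inv_snd[OF c(1)])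
  show ?thesis using o chart_open_iff[OF c(1), of "fst c \<inter> {x\<in>G. f x \<in> T}"] c p unfolding eq
   by (intro exI[of _ "fst c \<inter> {x\<in>G. f x \<in> T}"]) auto
 qed
 then have "openin X {x\<in>G. f x \<in> T}" by (subst openin_subopen) blast
 then show "openin (subtopology X G) {x \<in> topspace (subtopology X G). f x \<in> T}"
  using Gt openin_open_subtopology[OF G] by (simp add: topspace_subtopology Int_absorb1 subset_iff)
qed simp

lemma connected_component_open:
 assumes p: "p \<in> topspace X"
 shows "openin X (connected_component_of_set X p)"
proof (subst openin_subopen, intro ballI)
 fix q assume q: "q \<in> connected_component_of_set X p"
 then have qX: "q \<in> topspace X" using connected_component_of_subset_topspace by fastforce
 obtain c where c: "c \<in> A" "q \<in> fst c" using chart_at qX by blast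
 obtain r where r: "0 < r" "ball (snd c q) r \<inter> half_plane \<subseteq> chart_image c"
  using rel_open_ball[OF chart_rel_open[OF c(1)] chart_in_image[OF c(2)]] .
 let ?V = "ball (snd c q) r \<inter> half_plane" let ?W = "{x\<in>fst c. snd c x \<in> ?V}"
 have V: "connected ?V" "rel_open ?V" by (auto intro!: convex_connected convex_Int convex_half_plane simp: openin_open_Int Int_commute)
 have qW: "q \<in> ?W" using c r rel_open_half_plane[OF chart_rel_open[OF c(1)]] chart_in_image[OF c(2)] by auto
 have "?W \<subseteq> connected_component_of_set X q" using connected_component_of_maximal[OF chart_connected[OF c(1) r(2) V(1)] qW] .
 moreover have "connected_component_of_set X q = connected_component_of_set X p" using q connected_component_of_equiv[of X p q] by simp
 ultimately show "\<exists>T. openin X T \<and> q \<in> T \<and> T \<subseteq> connected_component_of_set X p"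
  using chart_preimage(3)[OF c(1) r(2) V(2)] qW by blast
qed

end

locale killing_surface = compact_riemannian_surface X A g
 for X :: "'a topology" and A :: "'a chart set" and g :: "'a tensor2" +
 fixes \<xi> :: "'a vfield"
 assumes killing: "killing_field A g \<xi>" and tangent: "tangent_to_boundary A \<xi>"
begin

abbreviation "gE c \<equiv> %x. g c (chart_inv c x) $ 1 $ 1"
abbreviation "gF c \<equiv> %x. g c (chart_inv c x) $ 1 $ 2"
abbreviation "gG c \<equiv> %x. g c (chart_inv c x) $ 2 $ 2"
abbreviation "X1 c \<equiv> %x. \<xi> c (chart_inv c x) $ 1"
abbreviation "X2 c \<equiv> %x. \<xi> c (chart_inv c x) $ 2"

lemma metric_symmetric: "c \<in> A ==> p \<in> fst c ==> g c p $ 2 $ 1 = g c p $ 1 $ 2"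
proof -
 assume "c \<in> A" "p \<in> fst c"
 then have "transpose (g c p) = g c p" using metric unfolding riemannian_metric_def by blast
 then have "transpose (g c p) $ 1 $ 2 = g c p $ 1 $ 2" by simp
 then show ?thesis by (simp add: transpose_def)
qed

lemma metric_positive:
 assumes "c \<in> A" "p \<in> fst c"
 shows "0 < g c p $ 1 $ 1" "0 < det (g c p)"
proof -
 have pos: "0 < v \<bullet> (g c p *v v)" if "v \<noteq> 0" for v using metric assms that unfolding riemannian_metric_def by blast
 have q: "v \<bullet> (g c p *v v) = g c p $ 1 $ 1 * v $ 1 * v $ 1 + 2 * g c p $ 1 $ 2 * v $ 1 * v $ 2 + g c p $ 2 $ 2 * v $ 2 * v $ 2" for v
  by (simp add: inner_vec_def matrix_vector_mult_def sum_2 metric_symmetric[OF assms] algebra_simps)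
 have "axis 1 1 \<noteq> (0::real^2)" by (simp add: axis_eq_0_iff)
 from pos[OF this] show E: "0 < g c p $ 1 $ 1" unfolding q by (simp add: axis_def)
 let ?v = "vector [- g c p $ 1 $ 2, g c p $ 1 $ 1] :: real^2"
 have "?v $ 2 \<noteq> 0" using E by simp
 then have "?v \<noteq> 0" by force
 from pos[OF this] have "0 < g c p $ 1 $ 1 * (g c p $ 1 $ 1 * g c p $ 2 $ 2 - g c p $ 1 $ 2 * g c p $ 1 $ 2)" unfolding q by (simp add: algebra_simps)
 then show "0 < det (g c p)" using E by (simp add: zero_less_mult_iff det_2 metric_symmetric[OF assms])
qed

lemma killing_chart:
 assumes c: "c \<in> A"
 shows "killing_chart (chart_image c) (gE c) (gF c) (gG c) (X1 c) (X2 c)"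
proof
 let ?S = "chart_image c"
 show "rel_open ?S" by (rule chart_rel_open[OF c])
 show "Ck_on k ?S (gE c)" "Ck_on k ?S (gF c)" "Ck_on k ?S (gG c)" for k using metric c unfolding riemannian_metric_def smooth_on_def by blast+
 show "Ck_on k ?S (X1 c)" "Ck_on k ?S (X2 c)" for k using killing c unfolding killing_field_def smooth_vector_field_def Ck_vector_field_def by blast+
 fix x assume x: "x \<in> ?S"
 let ?p = "chart_inv c x"
 have p: "?p \<in> fst c" "snd c ?p = x" using chart_inv_in[OF x] snd_chart_inv[OF x] by auto
 show "0 < gE c x" using metric_positive(1)[OF c p(1)] .
 show "0 < gE c x * gG c x - gF c x * gF c x" using metric_positive(2)[OF c p(1)] by (simp add: det_2 metric_symmetric[OF c p(1)])
 have K: "(lie_derivative_tensor2 \<xi> g c ?p) $ i $ j = 0" for i j using killing c p(1) unfolding killing_field_def by simp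
 have cd: "chart_deriv c k f ?p = partial_within ?S k (%x. f (chart_inv c x)) x" for k f unfolding chart_deriv_def p(2) by (simp add: o_def)
 have s: "g c ?p $ 2 $ 1 = g c ?p $ 1 $ 2" by (rule metric_symmetric[OF c p(1)])
 note simps = lie_derivative_tensor2_def sum_2 cd s
 show "X1 c x * partial_within ?S 1 (gE c) x + X2 c x * partial_within ?S 2 (gE c) x +
   2 * (gE c x * partial_within ?S 1 (X1 c) x + gF c x * partial_within ?S 1 (X2 c) x) = 0"
  using K[of 1 1] by (simp add: simps algebra_simps)
 show "X1 c x * partial_within ?S 1 (gF c) x + X2 c x * partial_within ?S 2 (gF c) x +
   (gF c x * partial_within ?S 1 (X1 c) x + gG c x * partial_within ?S 1 (X2 c) x) +
   (gE c x * partial_within ?S 2 (X1 c) x + gF c x * partial_within ?S 2 (X2 c) x) = 0"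
  using K[of 1 2] by (simp add: simps algebra_simps)
 show "X1 c x * partial_within ?S 1 (gG c) x + X2 c x * partial_within ?S 2 (gG c) x +
   2 * (gF c x * partial_within ?S 2 (X1 c) x + gG c x * partial_within ?S 2 (X2 c) x) = 0"
  using K[of 2 2] by (simp add: simps algebra_simps)
qed

definition "cal1 c = killing_chart.al1 (gE c) (gF c) (gG c) (X2 c)"
definition "cal2 c = killing_chart.al2 (gE c) (gF c) (gG c) (X1 c)"
definition "cN c = killing_chart.N (gE c) (gF c) (gG c) (X1 c) (X2 c)"
definition "ckap c = killing_chart.kap (chart_image c) (gE c) (gF c) (gG c) (X1 c) (X2 c)"
definition "cmm c = killing_chart.mm (chart_image c) (X1 c) (X2 c)"

lemma vector_law: "c \<in> A ==> d \<in> A ==> p \<in> fst c ==> p \<in> fst d ==> \<xi> d p = transition_jacobian c d p *v \<xi> c p"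
 using killing unfolding killing_field_def smooth_vector_field_def Ck_vector_field_def vector_field_def by blast

lemma metric_law: "c \<in> A ==> d \<in> A ==> p \<in> fst c ==> p \<in> fst d ==>
 g c p = transpose (transition_jacobian c d p) ** g d p ** transition_jacobian c d p"
 using metric unfolding riemannian_metric_def by blast

text \<open>The orientation enters here: \<open>r\<close> is multiplied by the Jacobian determinant
  itself, and not by its modulus, so that \<alpha> transforms as a covector.\<close>

lemma change_of_chart:
 assumes c: "c \<in> A" "d \<in> A" "p \<in> fst c" "p \<in> fst d"
 defines "J \<equiv> transition_jacobian c d p"
 shows "cN c (snd c p) = cN d (snd d p)"
  and "cal1 c (snd c p) = cal1 d (snd d p) * J $ 1 $ 1 + cal2 d (snd d p) * J $ 2 $ 1"
  and "cal2 c (snd c p) = cal1 d (snd d p) * J $ 1 $ 2 + cal2 d (snd d p) * J $ 2 $ 2"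
proof -
 interpret C: killing_chart "chart_image c" "gE c" "gF c" "gG c" "X1 c" "X2 c" by (rule killing_chart[OF c(1)])
 interpret D: killing_chart "chart_image d" "gE d" "gF d" "gG d" "X1 d" "X2 d" by (rule killing_chart[OF c(2)])
 have inv: "chart_inv c (snd c p) = p" "chart_inv d (snd d p) = p" using chart_inv_snd c by auto
 have sd: "g d p $ 2 $ 1 = g d p $ 1 $ 2" using metric_symmetric c by blast
 have xi: "\<xi> d p $ 1 = J $ 1 $ 1 * \<xi> c p $ 1 + J $ 1 $ 2 * \<xi> c p $ 2" "\<xi> d p $ 2 = J $ 2 $ 1 * \<xi> c p $ 1 + J $ 2 $ 2 * \<xi> c p $ 2"
  unfolding vector_law[OF c] J_def by (simp_all add: matrix_vector_mult_def sum_2)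
 have gl: "g c p $ i $ j = (J $ 1 $ i * g d p $ 1 $ 1 + J $ 2 $ i * g d p $ 1 $ 2) * J $ 1 $ j + (J $ 1 $ i * g d p $ 1 $ 2 + J $ 2 $ i * g d p $ 2 $ 2) * J $ 2 $ j" for i j
  unfolding metric_law[OF c] J_def by (simp add: matrix_matrix_mult_def transpose_def sum_2 sd)
 show "cN c (snd c p) = cN d (snd d p)" unfolding cN_def C.N_def D.N_def C.Y1_def C.Y2_def D.Y1_def D.Y2_def inv xi gl by (simp add: algebra_simps)
 have dJ: "0 < J $ 1 $ 1 * J $ 2 $ 2 - J $ 1 $ 2 * J $ 2 $ 1" using transition_oriented[OF c] by (simp add: J_def det_2)
 have "gE c (snd c p) * gG c (snd c p) - gF c (snd c p) * gF c (snd c p)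
   = (gE d (snd d p) * gG d (snd d p) - gF d (snd d p) * gF d (snd d p)) * (J $ 1 $ 1 * J $ 2 $ 2 - J $ 1 $ 2 * J $ 2 $ 1)\<^sup>2"
  unfolding inv gl by (simp add: power2_eq_square algebra_simps)
 then have r: "C.r (snd c p) = D.r (snd d p) * (J $ 1 $ 1 * J $ 2 $ 2 - J $ 1 $ 2 * J $ 2 $ 1)"
  unfolding C.r_def D.r_def using dJ by (simp add: real_sqrt_mult)
 show "cal1 c (snd c p) = cal1 d (snd d p) * J $ 1 $ 1 + cal2 d (snd d p) * J $ 2 $ 1"
  "cal2 c (snd c p) = cal1 d (snd d p) * J $ 1 $ 2 + cal2 d (snd d p) * J $ 2 $ 2"
  unfolding cal1_def cal2_def C.al1_def C.al2_def D.al1_def D.al2_def r inv xi by (simp_all add: algebra_simps)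
qed

text \<open>The equation dh = \<alpha> at p.\<close>

definition grad :: "('a => real) => 'a => bool" where
 "grad h p \<longleftrightarrow> (\<forall>c\<in>A. p \<in> fst c -->
   has_partials (h \<circ> chart_inv c) (cal1 c (snd c p)) (cal2 c (snd c p)) (snd c p) (chart_image c))"

lemma gradI:
 assumes "d \<in> A" "p \<in> fst d" "has_partials (h \<circ> chart_inv d) (cal1 d (snd d p)) (cal2 d (snd d p)) (snd d p) (chart_image d)"
 shows "grad h p" unfolding grad_def
proof (intro ballI impI)
 fix c assume c: "c \<in> A" "p \<in> fst c"
 show "has_partials (h \<circ> chart_inv c) (cal1 c (snd c p)) (cal2 c (snd c p)) (snd c p) (chart_image c)"
  unfolding change_of_chart(2,3)[OF c(1) assms(1) c(2) assms(2)] by (rule partials_change[OF c(1) assms(1) c(2) assms(2,3)])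
qed

lemma gradD: "grad h p ==> c \<in> A ==> p \<in> fst c ==>
 has_partials (h \<circ> chart_inv c) (cal1 c (snd c p)) (cal2 c (snd c p)) (snd c p) (chart_image c)"
 unfolding grad_def by blast

lemma grad_near:
 assumes "openin X U" "p \<in> U" "\<And>q. q \<in> U ==> h q = h' q" "grad h p"
 shows "grad h' p" unfolding grad_def
proof (intro ballI impI)
 fix c assume c: "c \<in> A" "p \<in> fst c"
 show "has_partials (h' \<circ> chart_inv c) (cal1 c (snd c p)) (cal2 c (snd c p)) (snd c p) (chart_image c)"
  using has_partials_near[OF c assms(1,2), of h h'] assms(3) gradD[OF assms(4) c] by blast
qed

definition vanishing :: "'a => bool" where
 "vanishing p \<longleftrightarrow> (\<exists>W. openin X W \<and> p \<in> W \<and> (\<forall>q\<in>W. \<forall>c\<in>A. q \<in> fst c --> \<xi> c q = 0))"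

text \<open>The definition of \<open>vanishing\<close> is an open condition and, by unique
  continuation, the right-hand side is a closed one. Hence a connected component consists of
  vanishing points only or of none.\<close>

lemma vanishing_iff:
 assumes c: "c \<in> A" "p \<in> fst c"
 shows "vanishing p \<longleftrightarrow> cmm c (snd c p) = 0"
proof -
 interpret C: killing_chart "chart_image c" "gE c" "gF c" "gG c" "X1 c" "X2 c" by (rule killing_chart[OF c(1)])
 have pi: "snd c p \<in> chart_image c" by (rule chart_in_image[OF c(2)])
 show ?thesis
 proof
  assume "vanishing p"
  then obtain W where W: "openin X W" "p \<in> W" "\<forall>q\<in>W. \<forall>c\<in>A. q \<in> fst c --> \<xi> c q = 0" unfolding vanishing_def by blast
  have "rel_open (snd c ` (fst c \<inter> W))" by (rule chart_image_open[OF c(1) W(1)])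
  then obtain r where r: "0 < r" "ball (snd c p) r \<inter> half_plane \<subseteq> snd c ` (fst c \<inter> W)"
   using rel_open_ball[of _ "snd c p"] c W(2) by blast
  show "cmm c (snd c p) = 0" unfolding cmm_def
  proof (rule C.mm_zero_iff_near[OF pi r(1)])
   fix x assume "x \<in> chart_image c \<inter> ball (snd c p) r"
   then have "x \<in> snd c ` (fst c \<inter> W)" using r(2) rel_open_half_plane[OF C.S] by blast
   then obtain q where q: "q \<in> fst c" "q \<in> W" "x = snd c q" by blast
   have "\<xi> c q = 0" using W(3) q c(1) by blast
   then show "X1 c x = 0 \<and> X2 c x = 0" unfolding q(3) chart_inv_snd[OF c(1) q(1)] by simp
  qed
 next
  assume "cmm c (snd c p) = 0"
  then obtain d where d: "0 < d" "\<forall>x\<in>chart_image c \<inter> ball (snd c p) d. X1 c x = 0 \<and> X2 c x = 0"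
   using C.unique_continuation[OF pi] unfolding cmm_def by blast
  let ?V = "chart_image c \<inter> ball (snd c p) d" let ?W = "{q\<in>fst c. snd c q \<in> ?V}"
  have V: "rel_open ?V" using C.S by (simp add: openin_Int_open)
  have "\<xi> e q = 0" if q: "q \<in> ?W" "e \<in> A" "q \<in> fst e" for q e
  proof -
   have "\<xi> c q $ 1 = 0" "\<xi> c q $ 2 = 0" using bspec[OF d(2), of "snd c q"] q(1) chart_inv_snd[OF c(1), of q] by simp_all
   then have "\<xi> c q = 0" by (simp add: vec_eq_iff forall_2)
   then show ?thesis using vector_law[OF c(1) q(2) _ q(3)] q(1) by auto
  qed
  then show "vanishing p" unfolding vanishing_def using chart_preimage(3)[OF c(1) _ V] pi c d(1) by (intro exI[of _ ?W]) auto
 qed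
qed

lemma vanishing_open: "openin X {p\<in>topspace X. vanishing p}"
proof (subst openin_subopen, intro ballI)
 fix p assume "p \<in> {p\<in>topspace X. vanishing p}"
 then obtain W where W: "openin X W" "p \<in> W" "\<forall>q\<in>W. \<forall>c\<in>A. q \<in> fst c --> \<xi> c q = 0" unfolding vanishing_def by blast
 then have "W \<subseteq> {p\<in>topspace X. vanishing p}" unfolding vanishing_def using openin_subset[OF W(1)] by blast
 then show "\<exists>T. openin X T \<and> p \<in> T \<and> T \<subseteq> {p\<in>topspace X. vanishing p}" using W by blast
qed

lemma nonvanishing_open: "openin X {p\<in>topspace X. \<not> vanishing p}"
proof (subst openin_subopen, intro ballI)
 fix p assume p: "p \<in> {p\<in>topspace X. \<not> vanishing p}"
 then obtain c where c: "c \<in> A" "p \<in> fst c" using chart_at by blast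
 interpret C: killing_chart "chart_image c" "gE c" "gF c" "gG c" "X1 c" "X2 c" by (rule killing_chart[OF c(1)])
 have "continuous_on (chart_image c) (C.D1 (X1 c))" "continuous_on (chart_image c) (C.D2 (X1 c))" "continuous_on (chart_image c) (C.D1 (X2 c))"
  "continuous_on (chart_image c) (C.D2 (X2 c))" "continuous_on (chart_image c) (X1 c)" "continuous_on (chart_image c) (X2 c)"
  by (rule Ck_on_continuous[of 0], intro C.partial_smooth C.smooth)+
 then have cont: "continuous_on (chart_image c) (cmm c)" unfolding cmm_def C.mm_def[abs_def] by (intro continuous_on_add continuous_on_rabs)
 let ?V = "{x\<in>chart_image c. cmm c x \<in> - {0}}"
 have "openin (top_of_set (chart_image c)) ?V" using continuous_openin_preimage_gen[OF cont, of "- {0}"] by (simp add: vimage_def Int_def open_Compl)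
 then have V: "rel_open ?V" using openin_trans C.S by blast
 let ?W = "{q\<in>fst c. snd c q \<in> ?V}"
 have "?W \<subseteq> {p\<in>topspace X. \<not> vanishing p}" using vanishing_iff[OF c(1)] chart_subset[OF c(1)] by auto
 moreover have "p \<in> ?W" using p vanishing_iff[OF c] c chart_in_image[OF c(2)] by auto
 ultimately show "\<exists>T. openin X T \<and> p \<in> T \<and> T \<subseteq> {p\<in>topspace X. \<not> vanishing p}"
  using chart_preimage(3)[OF c(1) _ V] by blast
qed

end

locale killing_component = killing_surface +
 fixes E :: "'a set"
 assumes E_open: "openin X E" and E_closed: "closedin X E" and E_connected: "connectedin X E"
  and nonvanishing: "p \<in> E ==> \<not> vanishing p"
begin

section \<open>Primitives of the one-form on a component\<close>

abbreviation "XE \<equiv> subtopology X E"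

lemma openin_XE: "openin XE U \<longleftrightarrow> openin X U \<and> U \<subseteq> E" using openin_open_subtopology[OF E_open] .

lemma E_top: "E \<subseteq> topspace X" using openin_subset[OF E_open] .

lemma topspace_XE: "topspace XE = E" using E_top by (simp add: Int_absorb1)

lemma XE_sub: "U \<subseteq> E ==> subtopology XE U = subtopology X U" by (simp add: subtopology_subtopology Int_absorb1)

definition loc :: "'a set => ('a => real) => bool" where
 "loc G h \<longleftrightarrow> openin X G \<and> G \<subseteq> E \<and> (\<forall>p\<in>G. grad h p)"

lemma locD:
 assumes "loc G h" "c \<in> A" "x \<in> snd c ` (fst c \<inter> G)"
 shows "has_partials (h \<circ> chart_inv c) (cal1 c x) (cal2 c x) x (snd c ` (fst c \<inter> G))"
proof -
 obtain p where p: "p \<in> fst c" "p \<in> G" "x = snd c p" using assms(3) by blast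
 have "has_partials (h \<circ> chart_inv c) (cal1 c x) (cal2 c x) x (chart_image c)"
  unfolding p(3) using gradD[OF _ assms(2) p(1)] assms(1) p(2) unfolding loc_def by blast
 then show ?thesis by (rule has_partials_mono) (auto simp: chart_image_def)
qed

definition regular :: "'a => bool" where
 "regular p \<longleftrightarrow> p \<notin> surface_boundary A \<and> (\<forall>c\<in>A. p \<in> fst c --> cN c (snd c p) \<noteq> 0)"

lemma regular_iff:
 assumes "c \<in> A" "p \<in> fst c"
 shows "regular p \<longleftrightarrow> 0 < snd c p $ 2 \<and> cN c (snd c p) \<noteq> 0"
proof -
 have "(\<forall>d\<in>A. p \<in> fst d --> cN d (snd d p) \<noteq> 0) \<longleftrightarrow> cN c (snd c p) \<noteq> 0"
  using change_of_chart(1)[OF _ assms(1) _ assms(2)] assms by metis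
 then show ?thesis unfolding regular_def boundary_chart[OF assms] using chart_nonneg[OF assms] by (simp add: less_le)
qed

text \<open>The notion \<open>probe\<close> carried over to the surface, with N and
  \<open>kap\<close> read in the chart c.\<close>

definition probe_at :: "('a => real) => 'a chart => 'a => real => 'a set => bool" where
 "probe_at h c p \<sigma> G \<longleftrightarrow> (\<forall>\<epsilon>>0. \<exists>\<eta>>0. \<forall>t. 0 < \<sigma> * (t - h p) \<and> \<sigma> * (t - h p) < \<eta> -->
   (\<exists>q\<in>fst c \<inter> G. h q = t \<and> \<bar>cN c (snd c q) - cN c (snd c p) - ckap c (snd c p) * (t - h p)\<bar> \<le> \<epsilon> * \<bar>t - h p\<bar> \<and>
    \<bar>ckap c (snd c q) - ckap c (snd c p)\<bar> \<le> \<epsilon>))"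

lemma loc_structure:
 assumes G: "loc G h" "p \<in> G" and c: "c \<in> A" "p \<in> fst c"
 shows "\<exists>U J e. level_patch XE h (h p) U J e \<and> p \<in> U \<and> U \<subseteq> G \<and> sided J (h p) e (regular p) (%\<sigma>. probe_at h c p \<sigma> G)" (is ?patch)
  and "regular p \<or> cN c (snd c p) \<noteq> 0 ==> \<exists>W. openin X W \<and> p \<in> W \<and> W \<subseteq> fst c \<inter> G \<and> (\<forall>q\<in>W. h q = h p --> cN c (snd c q) = cN c (snd c p))"
proof -
 interpret C: killing_chart "chart_image c" "gE c" "gF c" "gG c" "X1 c" "X2 c" by (rule killing_chart[OF c(1)])
 have oG: "openin X G" "G \<subseteq> E" using G(1) unfolding loc_def by auto
 define V where "V = snd c ` (fst c \<inter> G)"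
 define k where "k = h \<circ> chart_inv c"
 have V: "rel_open V" "V \<subseteq> chart_image c" "snd c p \<in> V" using chart_image_open[OF c(1) oG(1)] c(2) G(2) unfolding V_def chart_image_def by auto
 have inv: "chart_inv c (snd c q) = q" if "q \<in> fst c" for q using chart_inv_snd[OF c(1) that] .
 have hk: "k (snd c q) = h q" if "q \<in> fst c" for q using inv[OF that] unfolding k_def by simp
 have part: "has_partials k (C.al1 x) (C.al2 x) x V" if "x \<in> V" for x using locD[OF G(1) c(1)] that unfolding V_def k_def cal1_def cal2_def by blast
 have tan: "X2 c x = 0" if "x \<in> V" "x $ 2 = 0" for x
 proof -
  obtain q where q: "q \<in> fst c" "x = snd c q" using \<open>x \<in> V\<close> unfolding V_def by blast
  have "q \<in> surface_boundary A" using boundary_chart[OF c(1) q(1)] that(2) q(2) by simp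
  then show ?thesis using tangent q(1) c(1) unfolding tangent_to_boundary_def q(2) inv[OF q(1)] by blast
 qed
 have mm: "C.mm (snd c p) \<noteq> 0" using nonvanishing[of p] vanishing_iff[OF c] G(2) oG(2) unfolding cmm_def by blast
 note st = C.primitive_structure[OF V(1,2) part tan V(3) mm]
 have reg: "regular p \<longleftrightarrow> 0 < snd c p $ 2 \<and> C.N (snd c p) \<noteq> 0" using regular_iff[OF c] unfolding cN_def by simp
 have pull: "\<exists>q\<in>fst c. q \<in> G \<and> snd c q = z" if "z \<in> V" for z using that unfolding V_def by blast
 have gf: "graded_function V k C.al1 C.al2"
  using V(1) part continuous_on_subset[OF Ck_on_continuous[OF C.al_smooth(1)] V(2)] continuous_on_subset[OF Ck_on_continuous[OF C.al_smooth(2)] V(2)]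
  by unfold_locales auto
 have pr: "probe_at h c p \<sigma> G" if pr0: "graded_function.probe V k C.N C.kap \<sigma> (snd c p)" for \<sigma> unfolding probe_at_def
 proof (intro allI impI)
  fix \<epsilon> :: real assume e: "0 < \<epsilon>"
  obtain \<eta> where eta: "0 < \<eta>" "\<And>t. 0 < \<sigma> * (t - k (snd c p)) \<and> \<sigma> * (t - k (snd c p)) < \<eta> ==>
    (\<exists>z\<in>V. k z = t \<and> \<bar>C.N z - C.N (snd c p) - C.kap (snd c p) * (t - k (snd c p))\<bar> \<le> \<epsilon> * \<bar>t - k (snd c p)\<bar> \<and> \<bar>C.kap z - C.kap (snd c p)\<bar> \<le> \<epsilon>)"
   using pr0[unfolded graded_function.probe_def[OF gf], THEN spec, THEN mp, OF e] by blast
  show "\<exists>\<eta>>0. \<forall>t. 0 < \<sigma> * (t - h p) \<and> \<sigma> * (t - h p) < \<eta> -->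
   (\<exists>q\<in>fst c \<inter> G. h q = t \<and> \<bar>cN c (snd c q) - cN c (snd c p) - ckap c (snd c p) * (t - h p)\<bar> \<le> \<epsilon> * \<bar>t - h p\<bar> \<and>
    \<bar>ckap c (snd c q) - ckap c (snd c p)\<bar> \<le> \<epsilon>)"
  proof (intro exI[of _ \<eta>] conjI eta(1) allI impI)
   fix t assume "0 < \<sigma> * (t - h p) \<and> \<sigma> * (t - h p) < \<eta>"
   then obtain z where z: "z \<in> V" "k z = t" "\<bar>C.N z - C.N (snd c p) - C.kap (snd c p) * (t - h p)\<bar> \<le> \<epsilon> * \<bar>t - h p\<bar>" "\<bar>C.kap z - C.kap (snd c p)\<bar> \<le> \<epsilon>"
    using eta(2)[of t] unfolding hk[OF c(2)] by blast
   obtain q where q: "q \<in> fst c" "q \<in> G" "snd c q = z" using pull[OF z(1)] by blast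
   show "\<exists>q\<in>fst c \<inter> G. h q = t \<and> \<bar>cN c (snd c q) - cN c (snd c p) - ckap c (snd c p) * (t - h p)\<bar> \<le> \<epsilon> * \<bar>t - h p\<bar> \<and>
     \<bar>ckap c (snd c q) - ckap c (snd c p)\<bar> \<le> \<epsilon>"
    unfolding cN_def ckap_def using z q hk[OF q(1)] by (intro bexI[of _ q]) auto
  qed
 qed
 show ?patch
 proof -
  obtain U J e where U: "level_patch (top_of_set V) k (h p) U J e" "snd c p \<in> U"
   and J: "sided J (h p) e (regular p) (%\<sigma>. graded_function.probe V k C.N C.kap \<sigma> (snd c p))" using st(1) unfolding hk[OF c(2)] reg by blast
  note lp = level_patchD[OF U(1)]
  let ?U = "{q\<in>fst c. snd c q \<in> U}"
  have oU: "rel_open U" using lp(1) V(1) openin_trans by blast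
  have UV: "U \<subseteq> V" using openin_imp_subset[OF lp(1)] .
  have UG: "?U \<subseteq> G" using UV chart_inj[OF c(1)] unfolding V_def by (auto dest: inj_onD)
  have UC: "U \<subseteq> chart_image c" using UV V(2) by blast
  have im: "h ` W = k ` (snd c ` W)" if "W \<subseteq> fst c" for W using hk that by (auto simp: image_image intro!: image_cong)
  have "level_patch XE h (h p) ?U J e" unfolding level_patch_def
  proof (intro conjI allI impI)
   show "openin XE ?U" using chart_preimage(3)[OF c(1) UC oU] UG oG(2) openin_XE by blast
   show "0 < e" "J \<in> {{h p - e<..<h p + e}, {h p..<h p + e}, {h p - e<..h p}}" using lp(2,3) by auto
   show "h ` ?U = J" using im[of ?U] chart_preimage(1)[OF c(1) UC] lp(4) by auto
  next
   fix W assume W: "openin XE W \<and> W \<subseteq> ?U"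
   then have "rel_open (snd c ` (fst c \<inter> W))" "fst c \<inter> W = W" using chart_image_open[OF c(1), of W] openin_XE by auto
   then have "openin (top_of_set V) (snd c ` W)" using openin_subset_trans[of half_plane "snd c ` W" V] W UV rel_open_half_plane[OF V(1)] by auto
   moreover have "W \<subseteq> fst c" "snd c ` W \<subseteq> U" using W by blast+
   ultimately show "openin (top_of_set J) (h ` W)" using lp(5)[of "snd c ` W"] im[of W] by simp
  next
   fix v
   have "connectedin (top_of_set V) {y\<in>U. k y = v}" by (rule lp(6))
   then have "connected {y\<in>U. k y = v}" by (simp add: connectedin_subtopology)
   then have "connectedin X {q\<in>fst c. snd c q \<in> {y\<in>U. k y = v}}" by (intro chart_connected[OF c(1)]) (use UC in auto)
   moreover have "{q\<in>fst c. snd c q \<in> {y\<in>U. k y = v}} = {q\<in>?U. h q = v}" using hk by auto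
   ultimately show "connectedin XE {y\<in>?U. h y = v}" using UG oG(2) by (auto simp: connectedin_subtopology)
  qed
  moreover have "p \<in> ?U" using U(2) c(2) by simp
  moreover have "sided J (h p) e (regular p) (%\<sigma>. probe_at h c p \<sigma> G)" using J pr[of 1] pr[of "- 1"] unfolding sided_def by meson
  ultimately show ?thesis using UG by (intro exI[of _ ?U] exI[of _ J] exI[of _ e] conjI)
 qed
 show "\<exists>W. openin X W \<and> p \<in> W \<and> W \<subseteq> fst c \<inter> G \<and> (\<forall>q\<in>W. h q = h p --> cN c (snd c q) = cN c (snd c p))" if "regular p \<or> cN c (snd c p) \<noteq> 0"
 proof -
  have "C.N (snd c p) \<noteq> 0" using that reg unfolding cN_def by blast
  then obtain W where W: "openin (top_of_set V) W" "snd c p \<in> W" "\<forall>z\<in>W. k z = k (snd c p) --> C.N z = C.N (snd c p)" using st(2) by blast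
  have WV: "W \<subseteq> V" using openin_imp_subset[OF W(1)] .
  then have WC: "W \<subseteq> chart_image c" using V(2) by blast
  have oW: "rel_open W" using W(1) V(1) openin_trans by blast
  let ?W = "{q\<in>fst c. snd c q \<in> W}"
  have sub: "?W \<subseteq> fst c \<inter> G" using WV chart_inj[OF c(1)] unfolding V_def by (auto dest: inj_onD)
  have "cN c (snd c q) = cN c (snd c p)" if q: "q \<in> fst c" "snd c q \<in> W" "h q = h p" for q
   using bspec[OF W(3) q(2)] unfolding hk[OF q(1)] hk[OF c(2)] cN_def using q(3) by (rule mp)
  then have "\<forall>q\<in>?W. h q = h p --> cN c (snd c q) = cN c (snd c p)" by blast
  moreover have "p \<in> ?W" using W(2) c(2) by simp
  ultimately show ?thesis using chart_preimage(3)[OF c(1) WC oW] sub by (intro exI[of _ ?W] conjI)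
 qed
qed

sublocale level_foliation XE loc
proof
 show "compact_space XE" using closedin_compact_space[OF compact E_closed] by (simp add: compact_space_subtopology)
 show "Hausdorff_space XE" by (rule Hausdorff_space_subtopology[OF Hausdorff])
 show "connected_space XE" using E_connected by (simp add: connectedin_def)
 show "openin XE U" if "loc U h" for U h using that unfolding loc_def openin_XE by simp
 show "continuous_map (subtopology XE U) euclideanreal h" if l: "loc U h" for U h
 proof -
  have o: "openin X U" "U \<subseteq> E" using l unfolding loc_def by auto
  show ?thesis unfolding XE_sub[OF o(2)]
  proof (rule continuous_map_charts[OF o(1)])
   fix c assume c: "c \<in> A"
   show "continuous_on (snd c ` (fst c \<inter> U)) (h \<circ> chart_inv c)" unfolding continuous_on_eq_continuous_within
    by (intro ballI differentiable_imp_continuous_within has_partials_imp_differentiable[OF locD[OF l c]])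
  qed
 qed
 show "loc U h" if o: "openin XE U" and l: "\<And>x. x \<in> U ==> \<exists>V k. loc V k \<and> x \<in> V \<and> (\<forall>y\<in>V \<inter> U. k y = h y)" for U h
 proof -
  have "grad h p" if p: "p \<in> U" for p
  proof -
   obtain V k where V: "loc V k" "p \<in> V" "\<forall>y\<in>V \<inter> U. k y = h y" using l[OF p] by blast
   show ?thesis by (rule grad_near[of "V \<inter> U" p k]) (use V p o in \<open>auto simp: loc_def openin_XE\<close>)
  qed
  then show ?thesis using o unfolding loc_def openin_XE by blast
 qed
 show "loc U (%x. h x + k)" if "loc U h" for U h k
 proof -
  have "grad (%x. h x + k) p" if "grad h p" for p using that has_partials_add[OF _ has_partials_const[of k]] unfolding grad_def by (fastforce simp: o_def)
  then show ?thesis using that unfolding loc_def by blast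
 qed
 show "\<exists>V. openin XE V \<and> x \<in> V \<and> V \<subseteq> U \<and> (\<forall>y\<in>V. h y = h' y)" if l: "loc U h" "loc U h'" "x \<in> U" "h x = h' x" for U h h' x
 proof -
  have o: "openin X U" "U \<subseteq> E" using l(1) unfolding loc_def by auto
  obtain c where c: "c \<in> A" "x \<in> fst c" using chart_at[of x] o E_top l(3) by blast
  let ?D = "snd c ` (fst c \<inter> U)"
  have D: "rel_open ?D" "snd c x \<in> ?D" using chart_image_open[OF c(1) o(1)] c l(3) by auto
  have "(h \<circ> chart_inv c) (snd c x) = (h' \<circ> chart_inv c) (snd c x)" using l(4) chart_inv_snd[OF c] by simp
  then obtain V where V: "rel_open V" "snd c x \<in> V" "V \<subseteq> ?D" "\<forall>y\<in>V. (h \<circ> chart_inv c) y = (h' \<circ> chart_inv c) y"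
   using primitive_unique[OF D locD[OF l(1) c(1)] locD[OF l(2) c(1)]] by blast
  let ?V = "{q\<in>fst c. snd c q \<in> V}"
  have VC: "V \<subseteq> chart_image c" using V(3) unfolding chart_image_def by blast
  have VU: "?V \<subseteq> U" using V(3) chart_inj[OF c(1)] by (auto dest: inj_onD)
  have "h y = h' y" if "y \<in> ?V" for y using bspec[OF V(4), of "snd c y"] that chart_inv_snd[OF c(1)] by simp
  then show ?thesis using chart_preimage(3)[OF c(1) VC V(1)] VU o(2) c V(2) openin_XE by (intro exI[of _ ?V]) auto
 qed
 show "\<exists>U h. loc U h \<and> x \<in> U" if "x \<in> topspace XE" for x
 proof -
  have x: "x \<in> E" using that topspace_XE by simp
  obtain c where c: "c \<in> A" "x \<in> fst c" using chart_at[of x] E_top x by blast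
  interpret C: killing_chart "chart_image c" "gE c" "gF c" "gG c" "X1 c" "X2 c" by (rule killing_chart[OF c(1)])
  obtain V h where V: "rel_open V" "snd c x \<in> V" "V \<subseteq> chart_image c" "\<forall>x\<in>V. has_partials h (C.al1 x) (C.al2 x) x V"
   using C.primitive_exists[OF chart_in_image[OF c(2)]] by blast
  let ?U = "{q\<in>fst c. snd c q \<in> V} \<inter> E"
  have oU: "openin X ?U" using chart_preimage(3)[OF c(1) V(3,1)] E_open by blast
  have "grad (h \<circ> snd c) q" if q: "q \<in> ?U" for q
  proof (rule gradI[OF c(1)])
   show "q \<in> fst c" using q by simp
   have "has_partials h (cal1 c (snd c q)) (cal2 c (snd c q)) (snd c q) (chart_image c)"
    using V(4) q has_partials_subset_iff[OF V(1) _ V(3) C.S] unfolding cal1_def cal2_def by auto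
   then show "has_partials (h \<circ> snd c \<circ> chart_inv c) (cal1 c (snd c q)) (cal2 c (snd c q)) (snd c q) (chart_image c)"
    by (rule has_partials_cong) (use q in \<open>simp_all add: chart_in_image snd_chart_inv\<close>)
  qed
  then have "loc ?U (h \<circ> snd c)" unfolding loc_def using oU by blast
  then show ?thesis using x c(2) V(2) by (intro exI[of _ ?U] exI[of _ "h \<circ> snd c"]) auto
 qed
 show "\<exists>U J e. level_patch XE h (h x) U J e \<and> x \<in> U \<and> U \<subseteq> G" if G: "loc G h" "x \<in> G" for G h x
 proof -
  have "x \<in> topspace X" using G E_top unfolding loc_def by blast
  then obtain c where c: "c \<in> A" "x \<in> fst c" by (rule chart_at)
  show ?thesis using loc_structure(1)[OF G c] by blast
 qed
qed

lemma boundary_nonzero: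
 assumes p: "p \<in> E" "p \<in> surface_boundary A" and c: "c \<in> A" "p \<in> fst c"
 shows "cN c (snd c p) \<noteq> 0"
proof -
 interpret C: killing_chart "chart_image c" "gE c" "gF c" "gG c" "X1 c" "X2 c" by (rule killing_chart[OF c(1)])
 have tan: "X2 c x = 0" if "x \<in> chart_image c" "x $ 2 = 0" for x
 proof -
  have q: "chart_inv c x \<in> fst c" "snd c (chart_inv c x) = x" using chart_inv_in[OF that(1)] snd_chart_inv[OF that(1)] by auto
  then have "chart_inv c x \<in> surface_boundary A" using boundary_chart[OF c(1) q(1)] that(2) by simp
  then show ?thesis using tangent q(1) c(1) unfolding tangent_to_boundary_def by blast
 qed
 have mm: "C.mm (snd c p) \<noteq> 0" using nonvanishing[OF p(1)] vanishing_iff[OF c] unfolding cmm_def by blast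
 have p2: "snd c p $ 2 = 0" using boundary_chart[OF c] p(2) by simp
 show ?thesis unfolding cN_def by (rule C.boundary_nonzero[OF C.S subset_refl tan chart_in_image[OF c(2)] p2 mm])
qed

lemma extremal_iff:
 assumes p: "p \<in> E"
 shows "regular p \<longleftrightarrow> \<not> lmin p \<and> \<not> lmax p"
proof -
 have pX: "p \<in> topspace XE" using p topspace_XE by simp
 obtain G h where G: "loc G h" "p \<in> G" using loc_exists[OF pX] by blast
 obtain c where c: "c \<in> A" "p \<in> fst c" using chart_at p E_top by blast
 obtain U J e where U: "level_patch XE h (h p) U J e" "p \<in> U" "U \<subseteq> G" and J: "sided J (h p) e (regular p) (%\<sigma>. probe_at h c p \<sigma> G)"
  using loc_structure(1)[OF G c] by blast
 have U': "loc U h" using loc_restrict[OF G(1) level_patchD(1)[OF U(1)] U(3)] .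
 have e: "0 < e" by (rule level_patchD(2)[OF U(1)])
 from J[unfolded sided_def] show ?thesis
 proof (elim disjE conjE)
  assume J: "J = {h p - e<..<h p + e}" and r: "regular p"
  have "\<not> lmin p" by (rule patch_not_lmin[OF U(1) U' _ U(2), of "h p - e/2"]) (use J e in auto)
  moreover have "\<not> lmax p" by (rule patch_not_lmax[OF U(1) U' _ U(2), of "h p + e/2"]) (use J e in auto)
  ultimately show ?thesis using r by blast
 next
  assume J: "J = {h p..<h p + e}" and r: "\<not> regular p"
  have "lmin p" unfolding lmin_def using U' U(2) level_patchD(7)[OF U(1)] J by (intro exI[of _ U] exI[of _ h]) auto
  then show ?thesis using r by blast
 next
  assume J: "J = {h p - e<..h p}" and r: "\<not> regular p"
  have "lmax p" unfolding lmax_def using U' U(2) level_patchD(7)[OF U(1)] J by (intro exI[of _ U] exI[of _ h]) auto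
  then show ?thesis using r by blast
 qed
qed

lemma chart_choice: "\<exists>ch. \<forall>p\<in>E. ch p \<in> A \<and> p \<in> fst (ch p)"
proof (rule bchoice, intro ballI)
 fix p assume "p \<in> E"
 then show "\<exists>c. c \<in> A \<and> p \<in> fst c" using chart_cover E_top by blast
qed

text \<open>Near a point with N \<noteq> 0 the value of N is constant on the fibre; elsewhere N
  differs from it, an open condition. Connectedness of the fibre spreads the value. If N vanishes at
  both p and q there is nothing to show.\<close>

lemma fibre_constant:
 assumes k: "loc E k" and fib: "connectedin XE {y\<in>E. k y = s}" and p: "p \<in> E" "k p = s" and q: "q \<in> E" "k q = s"
  and c: "c \<in> A" "p \<in> fst c" and d: "d \<in> A" "q \<in> fst d"
 shows "cN c (snd c p) = cN d (snd d q)"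
proof -
 obtain ch where ch: "\<And>p. p \<in> E ==> ch p \<in> A \<and> p \<in> fst (ch p)" using chart_choice by blast
 define nn where "nn p = cN (ch p) (snd (ch p) p)" for p
 have nn: "nn p = cN c (snd c p)" if "p \<in> E" "c \<in> A" "p \<in> fst c" for p c
  unfolding nn_def by (rule change_of_chart(1)) (use ch[OF that(1)] that in auto)
 have cont: "continuous_map XE euclideanreal nn"
 proof (rule continuous_map_charts[OF E_open])
  fix c assume c: "c \<in> A"
  interpret C: killing_chart "chart_image c" "gE c" "gF c" "gG c" "X1 c" "X2 c" by (rule killing_chart[OF c])
  have "continuous_on (snd c ` (fst c \<inter> E)) (cN c)" unfolding cN_def
   by (rule continuous_on_subset[OF Ck_on_continuous[OF C.N_smooth]]) (auto simp: chart_image_def)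
  then show "continuous_on (snd c ` (fst c \<inter> E)) (nn \<circ> chart_inv c)"
   by (rule continuous_on_eq) (use c in \<open>auto simp: chart_inv_snd nn\<close>)
 qed
 have main: "nn y = nn x" if x: "x \<in> E" "k x = s" "nn x \<noteq> 0" and y: "y \<in> E" "k y = s" for x y
 proof -
  define M where "M = {z\<in>E. nn z \<in> - {nn x}}"
  define L where "L = {z. \<exists>W. openin XE W \<and> z \<in> W \<and> (\<forall>w\<in>W. k w = s --> nn w = nn x)}"
  have oM: "openin XE M" using openin_continuous_map_preimage[OF cont, of "- {nn x}"] unfolding topspace_XE M_def by (simp add: open_Compl)
  have oL: "openin XE L" unfolding L_def by (subst openin_subopen) blast
  have cov: "z \<in> L \<union> M" if z: "z \<in> E" "k z = s" for z
  proof (cases "nn z = nn x")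
   case True
   obtain c where c: "c \<in> A" "z \<in> fst c" using chart_at z E_top by blast
   have nz: "cN c (snd c z) \<noteq> 0" using nn[OF z(1) c] True x(3) by simp
   obtain W where W0: "openin X W \<and> z \<in> W \<and> W \<subseteq> fst c \<inter> E \<and> (\<forall>q\<in>W. k q = k z --> cN c (snd c q) = cN c (snd c z))"
    by (rule exE[OF loc_structure(2)[OF k z(1) c disjI2[OF nz]]])
   then have W: "openin X W" "z \<in> W" "W \<subseteq> fst c \<inter> E" by simp_all
   have W4: "\<forall>q\<in>W. k q = k z --> cN c (snd c q) = cN c (snd c z)" using W0 by (elim conjE)
   have "nn w = nn x" if w: "w \<in> W" "k w = s" for w
   proof -
    have "cN c (snd c w) = cN c (snd c z)" by (rule mp[OF bspec[OF W4 w(1)]]) (simp add: w(2) z(2))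
    moreover have "w \<in> E" "w \<in> fst c" using W(3) w(1) by auto
    ultimately show ?thesis using nn[OF _ c(1)] nn[OF z(1) c] True by simp
   qed
   then have "\<forall>w\<in>W. k w = s --> nn w = nn x" by blast
   moreover have "openin XE W" unfolding openin_XE using W by simp
   ultimately have "z \<in> L" unfolding L_def mem_Collect_eq using W(2) by (intro exI[of _ W] conjI)
   then show ?thesis by blast
  qed (use z in \<open>simp add: M_def\<close>)
  have dis: "L \<inter> M \<inter> {y\<in>E. k y = s} = {}" unfolding L_def M_def by blast
  have "{y\<in>E. k y = s} \<subseteq> L \<or> {y\<in>E. k y = s} \<subseteq> M" by (rule connectedin_two[OF fib oL oM _ dis]) (use cov in blast)
  moreover have "x \<notin> M" unfolding M_def by simp
  ultimately have "y \<in> L" using x y by blast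
  then show ?thesis unfolding L_def using y(2) by blast
 qed
 have "nn p = nn q" using main[OF p _ q] main[OF q _ p] by metis
 then show ?thesis using nn[OF p(1) c] nn[OF q(1) d] by simp
qed

text \<open>By \<open>fibre_constant\<close> N descends to a function n of the level. The probes
  show that n has derivative \<open>kap\<close>, so that \<open>kap\<close> descends too, and that
  this derivative is continuous.\<close>

lemma level_profile:
 assumes b: "lmin b" "b \<in> surface_boundary A"
 obtains k T n dn where "loc E k" "0 < T" "k ` E = {0..T}" "sturm_liouville n dn T"
  "\<And>p c. p \<in> E ==> c \<in> A ==> p \<in> fst c ==> cN c (snd c p) = n (k p) \<and> ckap c (snd c p) = dn (k p)"
  "\<And>p. p \<in> E ==> p \<in> surface_boundary A ==> k p = 0 \<or> k p = T \<and> 0 < n T"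
proof -
 obtain k T where k: "loc E k" "0 < T" "k ` E = {0..T}" "\<And>r. connectedin XE {y\<in>E. k y = r}"
  "\<And>y. y \<in> E ==> 0 < k y ==> k y < T ==> \<not> lmin y \<and> \<not> lmax y" using global_level_function[OF b(1)] unfolding topspace_XE by blast
 obtain ch where ch: "\<And>p. p \<in> E ==> ch p \<in> A \<and> p \<in> fst (ch p)" using chart_choice by blast
 have k0T: "0 \<le> k p" "k p \<le> T" if "p \<in> E" for p using k(3) that by (auto dest: equalityD1 imageI)
 define P where "P t = (SOME p. p \<in> E \<and> k p = t)" for t
 have P: "P t \<in> E" "k (P t) = t" if "t \<in> {0..T}" for t
 proof -
  have "t \<in> k ` E" using that k(3) by simp
  then obtain p where "p \<in> E \<and> k p = t" by blast
  then show "P t \<in> E" "k (P t) = t" using someI[of "%p. p \<in> E \<and> k p = t" p] unfolding P_def by auto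
 qed
 have pch: "ch (P t) \<in> A" "P t \<in> fst (ch (P t))" if "t \<in> {0..T}" for t using ch[OF P(1)[OF that]] by auto
 define n where "n t = cN (ch (P t)) (snd (ch (P t)) (P t))" for t
 define dn where "dn t = ckap (ch (P t)) (snd (ch (P t)) (P t))" for t
 have N: "cN c (snd c p) = n (k p)" if p: "p \<in> E" "c \<in> A" "p \<in> fst c" for p c
 proof -
  have t: "k p \<in> {0..T}" using k0T[OF p(1)] by simp
  show ?thesis unfolding n_def by (rule fibre_constant[OF k(1) k(4) p(1) refl P[OF t] p(2,3) pch[OF t]])
 qed
 \<comment> \<open>Extrema occur only at the levels 0 and T, and a minimum at level T would also be
   a maximum.\<close>
 have at0: "k p = 0" if "lmin p" "p \<in> E" for p
 proof (rule ccontr)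
  assume "k p \<noteq> 0"
  then have kT: "k p = T" using k(5)[OF that(2)] that(1) k0T[OF that(2)] by fastforce
  have "lmax p" unfolding lmax_def using k(1) that(2) kT k0T(2) by blast
  then show False using not_lmin_lmax that(1) by blast
 qed
 have atT: "k p = T" if "lmax p" "p \<in> E" for p
 proof (rule ccontr)
  assume "k p \<noteq> T"
  then have k0: "k p = 0" using k(5)[OF that(2)] that(1) k0T[OF that(2)] by fastforce
  have "lmin p" unfolding lmin_def using k(1) that(2) k0 k0T(1) by (intro exI[of _ E] exI[of _ k]) simp
  then show False using not_lmin_lmax that(1) by blast
 qed
 \<comment> \<open>A point without a probe on one side is extremal, hence at level 0 or T, where no
   levels exist on that side.\<close>
 have pr: "(\<forall>t'\<in>{0..T}. k p < t' --> probe_at k c p 1 E) \<and> (\<forall>t'\<in>{0..T}. t' < k p --> probe_at k c p (- 1) E)"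
  if p: "p \<in> E" and c: "c \<in> A" "p \<in> fst c" for p c
 proof -
  obtain U J e where U: "level_patch XE k (k p) U J e" "p \<in> U" "U \<subseteq> E" and J: "sided J (k p) e (regular p) (%\<sigma>. probe_at k c p \<sigma> E)"
   using loc_structure(1)[OF k(1) p c] by blast
  have lU: "loc U k" using loc_restrict[OF k(1) level_patchD(1)[OF U(1)] U(3)] .
  note J7 = level_patchD(7)[OF U(1)]
  from J[unfolded sided_def] show ?thesis
  proof (elim disjE conjE)
   assume J: "J = {k p..<k p + e}" and pr: "probe_at k c p 1 E"
   have "lmin p" unfolding lmin_def using lU U(2) J7 J by (intro exI[of _ U] exI[of _ k]) auto
   then have "k p = 0" using at0 p by blast
   then show ?thesis using pr by auto
  next
   assume J: "J = {k p - e<..k p}" and pr: "probe_at k c p (- 1) E"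
   have "lmax p" unfolding lmax_def using lU U(2) J7 J by (intro exI[of _ U] exI[of _ k]) auto
   then have "k p = T" using atT p by blast
   then show ?thesis using pr by auto
  qed blast
 qed
 define Q where "Q \<epsilon> p c t \<longleftrightarrow> (\<exists>q\<in>fst c \<inter> E. k q = t \<and>
   \<bar>cN c (snd c q) - cN c (snd c p) - ckap c (snd c p) * (t - k p)\<bar> \<le> \<epsilon> * \<bar>t - k p\<bar> \<and> \<bar>ckap c (snd c q) - ckap c (snd c p)\<bar> \<le> \<epsilon>)" for \<epsilon> p c t
 have near: "\<exists>\<eta>>0. \<forall>t\<in>{0..T}. \<bar>t - k p\<bar> < \<eta> --> Q \<epsilon> p c t"
  if e: "0 < \<epsilon>" and p: "p \<in> E" and c: "c \<in> A" "p \<in> fst c" for \<epsilon> p c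
 proof -
  have side: "\<exists>\<eta>>0. \<forall>t'\<in>{0..T}. 0 < \<sigma> * (t' - k p) \<and> \<sigma> * (t' - k p) < \<eta> --> Q \<epsilon> p c t'"
   if s: "\<forall>t'\<in>{0..T}. 0 < \<sigma> * (t' - k p) --> probe_at k c p \<sigma> E" for \<sigma>
  proof (cases "\<exists>t'\<in>{0..T}. 0 < \<sigma> * (t' - k p)")
   case True
   then have pa: "probe_at k c p \<sigma> E" using s by blast
   show ?thesis by (rule exE[OF pa[unfolded probe_at_def Q_def[symmetric], THEN spec, THEN mp, OF e]], erule conjE, rule exI, erule conjI) simp
  qed (auto intro: exI[of _ "1::real"])
  obtain \<eta>1 where 1: "0 < \<eta>1" "\<forall>t'\<in>{0..T}. 0 < 1 * (t' - k p) \<and> 1 * (t' - k p) < \<eta>1 --> Q \<epsilon> p c t'"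
   using side[of 1] pr[OF p c] by auto
  obtain \<eta>2 where 2: "0 < \<eta>2" "\<forall>t'\<in>{0..T}. 0 < (- 1) * (t' - k p) \<and> (- 1) * (t' - k p) < \<eta>2 --> Q \<epsilon> p c t'"
   using side[of "- 1"] pr[OF p c] by auto
  have "Q \<epsilon> p c t'" if t': "t' \<in> {0..T}" "\<bar>t' - k p\<bar> < min \<eta>1 \<eta>2" for t'
  proof (cases "t' = k p")
   case True then show ?thesis unfolding Q_def using p c e by (intro bexI[of _ p]) auto
  next
   case False
   then consider "k p < t'" | "t' < k p" by linarith
   then show ?thesis
   proof cases
    case h: 1 show ?thesis by (rule mp[OF bspec[OF 1(2) t'(1)]]) (use h t'(2) in auto)
   next
    case h: 2 show ?thesis by (rule mp[OF bspec[OF 2(2) t'(1)]]) (use h t'(2) in auto)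
   qed
  qed
  then show ?thesis using 1(1) 2(1) by (intro exI[of _ "min \<eta>1 \<eta>2"]) auto
 qed
 have D: "(n has_real_derivative ckap c (snd c p)) (at (k p) within {0..T})" if p: "p \<in> E" and c: "c \<in> A" "p \<in> fst c" for p c
  unfolding has_field_derivative_def has_derivative_within_alt
 proof (intro conjI allI impI)
  show "bounded_linear ((*) (ckap c (snd c p)))" by (rule bounded_linear_mult_right)
  fix \<epsilon> :: real assume "0 < \<epsilon>"
  then obtain \<eta> where eta: "0 < \<eta>" "\<forall>t\<in>{0..T}. \<bar>t - k p\<bar> < \<eta> --> Q \<epsilon> p c t" using near[OF _ p c] by blast
  show "\<exists>d>0. \<forall>y\<in>{0..T}. norm (y - k p) < d --> norm (n y - n (k p) - ckap c (snd c p) * (y - k p)) \<le> \<epsilon> * norm (y - k p)"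
  proof (intro exI[of _ \<eta>] conjI eta(1) ballI impI)
   fix t assume t: "t \<in> {0..T}" "norm (t - k p) < \<eta>"
   then obtain q where q: "q \<in> fst c" "q \<in> E" "k q = t" "\<bar>cN c (snd c q) - cN c (snd c p) - ckap c (snd c p) * (t - k p)\<bar> \<le> \<epsilon> * \<bar>t - k p\<bar>"
    using eta(2) unfolding Q_def by auto
   show "norm (n t - n (k p) - ckap c (snd c p) * (t - k p)) \<le> \<epsilon> * norm (t - k p)"
    using q(4) unfolding N[OF q(2) c(1) q(1)] N[OF p c] q(3) by simp
  qed
 qed
 \<comment> \<open>The derivative of n within {0..T} is unique, so \<open>kap\<close> takes the same
   value at all points of a fibre.\<close>
 have kap: "ckap c (snd c p) = dn (k p)" if p: "p \<in> E" and c: "c \<in> A" "p \<in> fst c" for p c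
 proof -
  have t: "k p \<in> {0..T}" using k0T[OF p] by simp
  have 1: "(n has_vector_derivative ckap c (snd c p)) (at (k p) within cbox 0 T)" using D[OF p c] by (simp add: has_real_derivative_iff_has_vector_derivative)
  have 2: "(n has_vector_derivative dn (k p)) (at (k p) within cbox 0 T)"
   using D[OF P(1)[OF t] pch[OF t]] P(2)[OF t] unfolding dn_def by (simp add: has_real_derivative_iff_has_vector_derivative)
  show ?thesis using vector_derivative_unique_within_closed_interval[OF k(2) _ 1 2] t by simp
 qed
 have n0: "0 \<le> n t" if "t \<in> {0..T}" for t
 proof -
  interpret C: killing_chart "chart_image (ch (P t))" "gE (ch (P t))" "gF (ch (P t))" "gG (ch (P t))" "X1 (ch (P t))" "X2 (ch (P t))"
   by (rule killing_chart[OF pch(1)[OF that]])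
  show ?thesis unfolding n_def cN_def by (rule C.N_nonneg(1)[OF chart_in_image[OF pch(2)[OF that]]])
 qed
 have bE: "b \<in> E" using b(1) loc_sub topspace_XE unfolding lmin_def by blast
 have bnd: "n (k p) \<noteq> 0" if "p \<in> E" "p \<in> surface_boundary A" for p using boundary_nonzero[OF that] ch[OF that(1)] N[OF that(1)] by metis
 have npos: "0 < n t" if t: "0 \<le> t" "t < T" for t
 proof -
  have tT: "t \<in> {0..T}" using t by simp
  have "n t \<noteq> 0"
  proof (cases "t = 0")
   case True then show ?thesis using bnd[OF bE b(2)] at0[OF b(1) bE] by simp
  next
   case False
   then have "\<not> lmin (P t) \<and> \<not> lmax (P t)" using k(5)[OF P(1)[OF tT]] P(2)[OF tT] t by auto
   then have "regular (P t)" using extremal_iff[OF P(1)[OF tT]] by blast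
   then show ?thesis using pch[OF tT] unfolding regular_def n_def by blast
  qed
  then show ?thesis using n0[OF tT] by linarith
 qed
 have SL: "sturm_liouville n dn T"
 proof (rule sturm_liouville.intro)
  show "0 < T" by (rule k(2))
  show Dn: "(n has_real_derivative dn t) (at t within {0..T})" if "t \<in> {0..T}" for t
   using D[OF P(1)[OF that] pch[OF that]] P(2)[OF that] unfolding dn_def by simp
  show "0 < n t" if "0 \<le> t" "t < T" for t by (rule npos[OF that])
  show "continuous_on {0..T} dn" unfolding continuous_on_iff
  proof (intro ballI allI impI)
   fix t and \<epsilon> :: real assume t: "t \<in> {0..T}" and e: "0 < \<epsilon>"
   then have "0 < \<epsilon> / 2" by simp
   from near[OF this P(1)[OF t] pch[OF t]] obtain \<eta> where eta: "0 < \<eta>"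
    "\<forall>t'\<in>{0..T}. \<bar>t' - t\<bar> < \<eta> --> (\<exists>q\<in>fst (ch (P t)) \<inter> E. k q = t' \<and> \<bar>ckap (ch (P t)) (snd (ch (P t)) q) - dn t\<bar> \<le> \<epsilon> / 2)"
    unfolding P(2)[OF t] dn_def Q_def by blast
   have "dist (dn t') (dn t) < \<epsilon>" if t': "t' \<in> {0..T}" "dist t' t < \<eta>" for t'
   proof -
    obtain q where q: "q \<in> fst (ch (P t))" "q \<in> E" "k q = t'" "\<bar>ckap (ch (P t)) (snd (ch (P t)) q) - dn t\<bar> \<le> \<epsilon> / 2"
     using eta(2) t' by (auto simp: dist_real_def)
    show ?thesis using q(4) e unfolding kap[OF q(2) pch(1)[OF t] q(1)] q(3) dist_real_def by linarith
   qed
   then show "\<exists>d>0. \<forall>x'\<in>{0..T}. dist x' t < d --> dist (dn x') (dn t) < \<epsilon>" using eta(1) by blast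
  qed
  \<comment> \<open>If n(T) = 0, the fibre at T consists of zeros of the field, which are
    nondegenerate, so dn(T) \<noteq> 0; a positive derivative would make n negative to the left of
    T.\<close>
  show "0 < n T \<or> n T = 0 \<and> dn T < 0"
  proof (cases "n T = 0")
   case True
   have TT: "T \<in> {0..T}" using k(2) by simp
   let ?c = "ch (P T)" and ?p = "P T"
   have p: "?p \<in> E" and c: "?c \<in> A" "?p \<in> fst ?c" using P(1)[OF TT] pch[OF TT] by auto
   interpret C: killing_chart "chart_image ?c" "gE ?c" "gF ?c" "gG ?c" "X1 ?c" "X2 ?c" by (rule killing_chart[OF c(1)])
   have ci: "snd ?c ?p \<in> chart_image ?c" by (rule chart_in_image[OF c(2)])
   have z: "X1 ?c (snd ?c ?p) = 0" "X2 ?c (snd ?c ?p) = 0" using C.N_nonneg(2)[OF ci] True unfolding n_def cN_def by auto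
   have "C.mm (snd ?c ?p) \<noteq> 0" using nonvanishing[OF p] vanishing_iff[OF c] unfolding cmm_def by blast
   then have "dn T \<noteq> 0" unfolding dn_def ckap_def using C.degenerate_zero(1)[OF ci z] z unfolding C.mm_def by auto
   moreover have "\<not> 0 < dn T"
   proof
    assume "0 < dn T"
    then obtain d where d: "0 < d" "\<forall>h>0. T - h \<in> {0..T} --> h < d --> n (T - h) < n T"
     using has_real_derivative_pos_inc_left[OF Dn[OF TT]] by blast
    define h where "h = min (d / 2) T"
    have h: "0 < h" "h < d" "T - h \<in> {0..T}" unfolding h_def using d k(2) by auto
    have "n (T - h) < 0" using d(2) h True by auto
    then show False using n0[OF h(3)] by linarith
   qed
   ultimately show ?thesis using True by auto
  next
   case False
   then show ?thesis using n0[of T] k(2) by auto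
  qed
 qed
 show thesis
 proof (rule that[OF k(1-3) SL])
  show "cN c (snd c p) = n (k p) \<and> ckap c (snd c p) = dn (k p)" if "p \<in> E" "c \<in> A" "p \<in> fst c" for p c using N[OF that] kap[OF that] by blast
  show "k p = 0 \<or> k p = T \<and> 0 < n T" if p: "p \<in> E" "p \<in> surface_boundary A" for p
  proof -
   have "\<not> regular p" unfolding regular_def using p by blast
   then have "lmin p \<or> lmax p" using extremal_iff[OF p(1)] by blast
   then have kp: "k p = 0 \<or> k p = T" using at0 atT p(1) by blast
   have "0 < n (k p)" using bnd[OF p] n0[of "k p"] k0T[OF p(1)] by force
   then show ?thesis using kp by auto
  qed
 qed
qed

end

section \<open>The Laplacian\<close>

text \<open>Where the second factor vanishes, continuity of the first suffices. This is needed at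
  zeros of the field, where W' o k is not known to be differentiable but is multiplied by \<alpha> =
  0.\<close>

lemma has_partials_mult_zero:
 assumes u: "continuous (at x within S) u" and a: "has_partials a a1 a2 x S" and z: "a x = 0"
 shows "has_partials (%y. u y * a y) (u x * a1) (u x * a2) x S"
proof -
 have "has_partials (%y. u x * a y) (u x * a1) (u x * a2) x S" by (rule has_partials_cmult[OF a])
 moreover have "((%y. (u y - u x) * a y) has_derivative (%v. 0)) (at x within S)" unfolding has_derivative_within_alt
 proof (intro conjI allI impI)
  show "bounded_linear (%v::real^2. 0::real)" by (rule bounded_linear_zero)
  fix e :: real assume e: "0 < e"
  obtain d1 where d1: "0 < d1" "\<forall>y\<in>S. norm (y - x) < d1 --> norm (a y - a x - (a1 * (y - x) $ 1 + a2 * (y - x) $ 2)) \<le> 1 * norm (y - x)"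
   using a unfolding has_partials_def has_derivative_within_alt by (meson zero_less_one)
  define M where "M = 1 + \<bar>a1\<bar> + \<bar>a2\<bar>"
  have M: "0 < M" unfolding M_def by simp
  then have "0 < e / M" using e by simp
  then obtain d2 where d2: "0 < d2" "\<forall>y\<in>S. dist y x < d2 --> dist (u y) (u x) < e / M" using u unfolding continuous_within_eps_delta by meson
  show "\<exists>d>0. \<forall>y\<in>S. norm (y - x) < d --> norm ((u y - u x) * a y - (u x - u x) * a x - 0) \<le> e * norm (y - x)"
  proof (intro exI[of _ "min d1 d2"] conjI ballI impI)
   show "0 < min d1 d2" using d1 d2 by simp
   fix y assume y: "y \<in> S" "norm (y - x) < min d1 d2"
   have "\<bar>a y - (a1 * (y - x) $ 1 + a2 * (y - x) $ 2)\<bar> \<le> norm (y - x)" using bspec[OF d1(2) y(1)] y(2) z by simp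
   moreover have "\<bar>a1 * (y - x) $ 1\<bar> \<le> \<bar>a1\<bar> * norm (y - x)" "\<bar>a2 * (y - x) $ 2\<bar> \<le> \<bar>a2\<bar> * norm (y - x)"
    unfolding abs_mult by (intro mult_left_mono component_le_norm_cart abs_ge_zero)+
   ultimately have "\<bar>a y\<bar> \<le> M * norm (y - x)" unfolding M_def distrib_right by linarith
   moreover have "\<bar>u y - u x\<bar> \<le> e / M" using bspec[OF d2(2) y(1)] y(2) by (simp add: dist_norm)
   ultimately have "\<bar>u y - u x\<bar> * \<bar>a y\<bar> \<le> e / M * (M * norm (y - x))" by (intro mult_mono) (use M e in auto)
   then show "norm ((u y - u x) * a y - (u x - u x) * a x - 0) \<le> e * norm (y - x)" using M by (simp add: abs_mult)
  qed
 qed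
 ultimately have "has_partials (%y. u x * a y + (u y - u x) * a y) (u x * a1 + 0) (u x * a2 + 0) x S"
  by (intro has_partials_add) (simp_all add: has_partials_def)
 then show ?thesis by (simp add: algebra_simps)
qed

context killing_chart begin

text \<open>\<open>c11\<close>, \<open>c12\<close>, \<open>c22\<close> are the entries of
  \<open>r\<close> times the inverse metric.\<close>

definition c11 :: "real^2 => real" where "c11 x = G x / r x"
definition c12 :: "real^2 => real" where "c12 x = - (F x / r x)"
definition c22 :: "real^2 => real" where "c22 x = E x / r x"

definition lap :: "(real^2 => real) => real^2 => real" where
 "lap f x = (D1 (%y. c11 y * D1 f y + c12 y * D2 f y) x + D2 (%y. c12 y * D1 f y + c22 y * D2 f y) x) / r x"

lemma c_smooth: "Ck_on k S c11" "Ck_on k S c12" "Ck_on k S c22" unfolding c11_def c12_def c22_def divide_inverse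
 by (intro Ck_intros Ck_on_inverse[OF S] r_smooth; use r_pos in force)+

lemma subchart:
 assumes "rel_open V" "V \<subseteq> S"
 shows "killing_chart V E F G X1 X2"
proof
 show "Ck_on k V E" "Ck_on k V F" "Ck_on k V G" "Ck_on k V X1" "Ck_on k V X2" for k using Ck_on_subset[OF assms S] smooth by blast+
qed (use assms E_pos det_pos K11 K12 K22 partial_within_subset[OF assms(1) _ assms(2) S] in auto)

lemma lap_cong:
 assumes "x \<in> S" "\<And>y. y \<in> S ==> f y = f' y"
 shows "lap f x = lap f' x"
proof -
 have e: "D i f y = D i f' y" if "y \<in> S" for i y by (rule partial_within_cong[OF that assms(2)])
 have "D1 (%y. c11 y * D1 f y + c12 y * D2 f y) x = D1 (%y. c11 y * D1 f' y + c12 y * D2 f' y) x"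
  "D2 (%y. c12 y * D1 f y + c22 y * D2 f y) x = D2 (%y. c12 y * D1 f' y + c22 y * D2 f' y) x" by (rule partial_within_cong[OF assms(1)], simp add: e)+
 then show ?thesis unfolding lap_def by simp
qed

lemma lap_subset:
 assumes V: "rel_open V" "V \<subseteq> S" and x: "x \<in> V"
 shows "killing_chart.lap V E F G f x = lap f x"
proof -
 interpret V: killing_chart V E F G X1 X2 by (rule subchart[OF V])
 have e: "partial_within V i f y = D i f y" if "y \<in> V" for i y f by (rule partial_within_subset[OF V(1) that V(2) S])
 have 1: "D 1 (%y. c11 y * V.D1 f y + c12 y * V.D2 f y) x = D 1 (%y. c11 y * D1 f y + c12 y * D2 f y) x"
  "D 2 (%y. c12 y * V.D1 f y + c22 y * V.D2 f y) x = D 2 (%y. c12 y * D1 f y + c22 y * D2 f y) x"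
  unfolding e[OF x, symmetric] by (rule partial_within_cong[OF x], simp add: e)+
 show ?thesis unfolding V.lap_def lap_def e[OF x] 1 ..
qed

lemma C2D:
 assumes "Ck_on 2 S f"
 shows "Ck_on 1 S f" "Ck_on 1 S (D i f)"
proof -
 have "Ck_on (Suc 1) S f" using assms by (simp only: Suc_1)
 then show "Ck_on 1 S f" "Ck_on 1 S (D i f)" by (rule Ck_on_SucD, simp only: Ck_on.simps(2))
qed

lemma lap_expand:
 assumes x: "x \<in> S" and f: "Ck_on 2 S f"
 shows "lap f x * r x = c11 x * D1 (D1 f) x + c12 x * (D1 (D2 f) x + D2 (D1 f) x) + c22 x * D2 (D2 f) x
  + (D1 c11 x + D2 c12 x) * D1 f x + (D1 c12 x + D2 c22 x) * D2 f x"
proof -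
 have n: "q / r x * r x = q" for q using r_pos[OF x] by simp
 show ?thesis unfolding lap_def n partial_mult2[OF S x c_smooth(1) C2D(2)[OF f] c_smooth(2) C2D(2)[OF f]]
  partial_mult2[OF S x c_smooth(2) C2D(2)[OF f] c_smooth(3) C2D(2)[OF f]] by (simp add: algebra_simps)
qed

lemma lap_const:
 assumes x: "x \<in> S" shows "lap (%_. k) x = 0"
proof -
 have "D1 (%y. c11 y * D1 (%_. k) y + c12 y * D2 (%_. k) y) x = D1 (%_. 0) x"
  "D2 (%y. c12 y * D1 (%_. k) y + c22 y * D2 (%_. k) y) x = D2 (%_. 0) x" by (rule partial_within_cong[OF x], simp add: partial_const[OF S])+
 then show ?thesis unfolding lap_def by (simp add: partial_const[OF S x])
qed

lemma lap_linear:
 assumes x: "x \<in> S" and f: "Ck_on 2 S f" and w: "Ck_on 2 S w"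
 shows "lap (%y. f y - l * w y) x = lap f x - l * lap w x"
proof -
 have lw: "Ck_on 2 S (%y. l * w y)" by (rule Ck_on_cmult[OF S w])
 have p1: "D i (%y. f y - l * w y) y = D i f y - l * D i w y" if "y \<in> S" for i y
  using partial_diff[OF S that C2D(1)[OF f] C2D(1)[OF lw]] partial_cmult[OF S that C2D(1)[OF w]] by simp
 have p2: "D j (D i (%y. f y - l * w y)) x = D j (D i f) x - l * D j (D i w) x" for i j
  using partial_within_cong[OF x p1[of _ i], where i = j] partial_diff[OF S x C2D(2)[OF f] Ck_on_cmult[OF S C2D(2)[OF w]]] partial_cmult[OF S x C2D(2)[OF w]] by simp
 have "lap (%y. f y - l * w y) x * r x = (lap f x - l * lap w x) * r x"
  unfolding lap_expand[OF x Ck_on_diff[OF S f lw]] left_diff_distrib mult.assoc lap_expand[OF x f] lap_expand[OF x w] p1[OF x] p2 by (simp add: algebra_simps)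
 then show ?thesis using r_pos[OF x] by simp
qed

text \<open>If the second derivative in direction v were positive, the first derivative along the
  ray, which is 0 at x, would become positive, and f would exceed its maximum.\<close>

lemma second_derivative_max:
 fixes v :: "real^2"
 assumes f: "Ck_on 2 S f" and x: "x \<in> interior S" and mx: "\<And>y. y \<in> S ==> f y \<le> f x"
 shows "D1 f x = 0" "D2 f x = 0"
  "v $ 1 * v $ 1 * D1 (D1 f) x + v $ 1 * v $ 2 * (D1 (D2 f) x + D2 (D1 f) x) + v $ 2 * v $ 2 * D2 (D2 f) x \<le> 0"
proof -
 have xS: "x \<in> S" using x interior_subset by blast
 have hp: "has_partials f (D1 f y) (D2 f y) y S" if "y \<in> S" for y using Ck_on_partials[of 0 S f y] C2D(1)[OF f] that by simp
 have D: "(f has_derivative (%v. D1 f x * v $ 1 + D2 f x * v $ 2)) (at x)" using hp[OF xS] unfolding has_partials_def at_within_interior[OF x] .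
 have le: "\<forall>y\<in>interior S. f y \<le> f x" using mx interior_subset by blast
 note z = differential_zero_maxmin[OF x open_interior D disjI1[OF le]]
 from fun_cong[OF z, of "axis 1 1"] fun_cong[OF z, of "axis 2 1"] show g0: "D1 f x = 0" "D2 f x = 0" by (auto simp: axis_def)
 let ?Q = "v $ 1 * v $ 1 * D1 (D1 f) x + v $ 1 * v $ 2 * (D1 (D2 f) x + D2 (D1 f) x) + v $ 2 * v $ 2 * D2 (D2 f) x"
 let ?g = "%t. D1 f (x + t *\<^sub>R v) * v $ 1 + D2 f (x + t *\<^sub>R v) * v $ 2"
 show "?Q \<le> 0"
 proof (rule ccontr)
  assume Q: "\<not> ?Q \<le> 0"
  then have "v \<noteq> 0" by auto
  obtain e where e: "0 < e" "ball x e \<subseteq> S" using x by (meson mem_interior)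
  define d where "d = e / (2 * norm v)"
  have d: "0 < d" unfolding d_def using e \<open>v \<noteq> 0\<close> by simp
  have inS: "x + t *\<^sub>R v \<in> S" if "t \<in> {0..d}" for t
  proof -
   have "t * norm v \<le> d * norm v" using that by (intro mult_right_mono) auto
   also have "\<dots> < e" unfolding d_def using e \<open>v \<noteq> 0\<close> by simp
   finally show ?thesis using e(2) that by (auto simp: dist_norm)
  qed
  have hp2: "has_partials (D i f) (D1 (D i f) x) (D2 (D i f) x) (x + 0 *\<^sub>R v) S" for i using Ck_on_partials[of 0 S "D i f" x] C2D(2)[OF f] xS by simp
  have l: "((%t. D i f (x + t *\<^sub>R v)) has_real_derivative D1 (D i f) x * v $ 1 + D2 (D i f) x * v $ 2) (at 0 within {0..d})" for i
   by (rule line_derivative[OF hp2 inS])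
  have "(?g has_real_derivative ((D1 (D1 f) x * v $ 1 + D2 (D1 f) x * v $ 2) * v $ 1 + (D1 (D2 f) x * v $ 1 + D2 (D2 f) x * v $ 2) * v $ 2)) (at 0 within {0..d})"
   by (intro DERIV_add DERIV_cmult_right l)
  then have "(?g has_real_derivative ?Q) (at 0 within {0..d})" by (simp add: algebra_simps)
  then obtain d' where d': "0 < d'" "\<And>h. 0 < h ==> 0 + h \<in> {0..d} ==> h < d' ==> ?g 0 < ?g (0 + h)"
   using has_real_derivative_pos_inc_right[of ?g ?Q 0 "{0..d}"] Q by (meson not_le)
  define t where "t = min d (d' / 2)"
  have t: "0 < t" "t \<le> d" "t < d'" unfolding t_def using d d' by auto
  have ds: "((%t. f (x + t *\<^sub>R v)) has_real_derivative ?g s) (at s within {0..t})" if "s \<in> {0..t}" for s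
   by (rule line_derivative[OF hp]) (use inS that t in auto)
  obtain z where z: "z \<in> {0<..<t}" "f (x + t *\<^sub>R v) - f (x + 0 *\<^sub>R v) = (t - 0) * ?g z" using mvt_within[OF t(1) ds] by blast
  have "0 < ?g z" using d'(2)[of z] z(1) t g0 by auto
  then have "0 < (t - 0) * ?g z" using t by simp
  then have "f x < f (x + t *\<^sub>R v)" using z(2) by simp
  then show False using mx[OF inS[of t]] t by auto
 qed
qed

lemma lap_max:
 assumes f: "Ck_on 2 S f" and x: "x \<in> interior S" and mx: "\<And>y. y \<in> S ==> f y \<le> f x"
 shows "lap f x \<le> 0"
proof -
 have xS: "x \<in> S" using x interior_subset by blast
 note s = second_derivative_max[OF assms]
 have rp: "0 < r x" by (rule r_pos[OF xS])
 define u where "u = D1 (D1 f) x"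
 define v where "v = D1 (D2 f) x + D2 (D1 f) x"
 define w where "w = D2 (D2 f) x"
 have q: "a * a * u + a * b * v + b * b * w \<le> 0" for a b using s(3)[of "vector [a, b] :: real^2"] unfolding u_def v_def w_def by simp
 have "lap f x * r x = G x / r x * u + - (F x / r x) * v + E x / r x * w"
  using lap_expand[OF xS f] s(1,2) unfolding c11_def[of x] c12_def[of x] c22_def[of x] u_def v_def w_def by simp
 then have m: "lap f x * r x * r x = G x * u - F x * v + E x * w" using rp by (simp add: field_simps)
 \<comment> \<open>After multiplication by E the trace against the inverse metric is a nonnegative
   combination of the second derivative in the directions (1, 0) and (-F, E).\<close>
 have "E x * (lap f x * r x * r x) = E x * G x * u - E x * F x * v + E x * E x * w" unfolding m by (simp add: algebra_simps)
 also have "\<dots> = (E x * G x - F x * F x) * (1 * 1 * u + 1 * 0 * v + 0 * 0 * w) + ((- F x) * (- F x) * u + (- F x) * E x * v + E x * E x * w)"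
  by (simp add: algebra_simps)
 also have "\<dots> \<le> 0" using mult_nonneg_nonpos[OF less_imp_le[OF det_pos[OF xS]] q[of 1 0]] q[of "- F x" "E x"] by linarith
 finally have le: "E x * (lap f x * r x * r x) \<le> 0" .
 show ?thesis
 proof (rule ccontr)
  assume "\<not> lap f x \<le> 0"
  then have "0 < E x * (lap f x * r x * r x)" using rp E_pos[OF xS] by simp
  then show False using le by linarith
 qed
qed

text \<open>W'' o k carries the factor 1 / N; in second derivatives of W o k it is multiplied by
  products of components of \<alpha>, which are O(N).\<close>

lemma alpha_bound:
 assumes x: "x \<in> S"
 shows "\<bar>al1 x * al1 x\<bar> \<le> (E x + G x) * N x" "\<bar>al1 x * al2 x\<bar> \<le> (E x + G x) * N x" "\<bar>al2 x * al1 x\<bar> \<le> (E x + G x) * N x" "\<bar>al2 x * al2 x\<bar> \<le> (E x + G x) * N x"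
proof -
 have rr: "r x * r x = E x * G x - F x * F x" by (rule r_sq[OF x])
 have "E x * N x = (E x * X1 x + F x * X2 x)\<^sup>2 + (r x * r x) * (X2 x * X2 x)" "G x * N x = (G x * X2 x + F x * X1 x)\<^sup>2 + (r x * r x) * (X1 x * X1 x)"
  unfolding rr N_def Y1_def Y2_def by (simp_all add: power2_eq_square algebra_simps)
 then have e: "al1 x * al1 x \<le> E x * N x" "al2 x * al2 x \<le> G x * N x" unfolding al1_def al2_def by (simp_all add: algebra_simps)
 have nn: "0 \<le> al1 x * al1 x" "0 \<le> al2 x * al2 x" by simp_all
 have "0 \<le> (al1 x - al2 x)\<^sup>2" "0 \<le> (al1 x + al2 x)\<^sup>2" by simp_all
 then have m: "\<bar>al1 x * al2 x\<bar> \<le> al1 x * al1 x + al2 x * al2 x" using nn by (simp add: power2_eq_square algebra_simps abs_le_iff)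
 show "\<bar>al1 x * al2 x\<bar> \<le> (E x + G x) * N x" "\<bar>al2 x * al1 x\<bar> \<le> (E x + G x) * N x"
  using m e by (simp_all add: distrib_right mult.commute)
 show "\<bar>al1 x * al1 x\<bar> \<le> (E x + G x) * N x" "\<bar>al2 x * al2 x\<bar> \<le> (E x + G x) * N x"
  using e nn order_trans[OF nn(1) e(1)] order_trans[OF nn(2) e(2)] by (simp_all add: distrib_right)
qed

text \<open>The second derivatives of W o h are W'' \<alpha>_i \<alpha>_j + W' D_i \<alpha>_j. At a
  zero of N the first term tends to 0, since it is bounded by the numerator of W'', which vanishes
  there by the end condition in \<open>sol\<close>.\<close>

lemma level_composition:
 assumes SL: "sturm_liouville n dn T" and so: "sturm_liouville.sol n dn T \<nu> W W1"
  and h: "\<And>x. x \<in> S ==> has_partials h (al1 x) (al2 x) x S" and hT: "\<And>x. x \<in> S ==> h x \<in> {0..T}"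
  and Nn: "\<And>x. x \<in> S ==> N x = n (h x)" and kn: "\<And>x. x \<in> S ==> kap x = dn (h x)"
 shows "Ck_on 2 S (%x. W (h x))" and "x \<in> S ==> lap (%x. W (h x)) x = - \<nu> * W (h x)"
proof -
 interpret SL: sturm_liouville n dn T by (rule SL)
 note sD = SL.solD[OF so]
 \<comment> \<open>Stands for W'' o h. Division by zero makes it 0 where N = 0, which is the right
   value for the products with components of \<alpha>.\<close>
 define W2 where "W2 x = - (\<nu> * W (h x) + dn (h x) * W1 (h x)) / N x" for x
 define Z where "Z a i al x = W2 x * al x * a x + W1 (h x) * D i a x" for a al :: "real^2 => real" and i x
 have hS: "h ` S \<subseteq> {0..T}" using hT by auto
 have hc: "continuous_on S h" unfolding continuous_on_eq_continuous_within
  by (intro ballI differentiable_imp_continuous_within has_partials_imp_differentiable[OF h])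
 have cc: "continuous_on S (%x. W1 (h x))" "continuous_on S (%x. W (h x))" "continuous_on S (%x. dn (h x))"
  by (rule continuous_on_compose2[OF _ hc hS], rule sD(1) SL.sol_cont[OF so] SL.dn_cont)+
 have hW: "has_partials (%x. W (h x)) (W1 (h x) * al1 x) (W1 (h x) * al2 x) x S" if "x \<in> S" for x
  by (rule has_partials_compose[OF h[OF that] sD(2)[OF hT[OF that]] hS])
 have end0: "\<nu> * W (h x) + dn (h x) * W1 (h x) = 0" if x: "x \<in> S" "N x = 0" for x
 proof -
  have "n (h x) = 0" using Nn[OF x(1)] x(2) by simp
  then have "\<not> h x < T" using SL.n_pos[of "h x"] hT[OF x(1)] by auto
  then have "h x = T" using hT[OF x(1)] by auto
  then show ?thesis using sD(4) \<open>n (h x) = 0\<close> by simp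
 qed
 have ZP: "has_partials (%x. W1 (h x) * a x) (Z a 1 al1 x) (Z a 2 al2 x) x S"
  if x: "x \<in> S" and a: "Ck_on 1 S a" "N x = 0 ==> a x = 0" for a x
 proof -
  have ap: "has_partials a (D1 a x) (D2 a x) x S" using Ck_on_partials[of 0 S a x] a(1) x by simp
  show ?thesis
  proof (cases "N x = 0")
   case True
   have "continuous (at x within S) (%x. W1 (h x))" using cc(1) x unfolding continuous_on_eq_continuous_within by blast
   from has_partials_mult_zero[OF this ap a(2)[OF True]] show ?thesis unfolding Z_def W2_def True by simp
  next
   case False
   then have "0 < n (h x)" using N_nonneg(1)[OF x] Nn[OF x] by simp
   from has_partials_compose[OF h[OF x] sD(3)[OF hT[OF x] this] hS]
   have "has_partials (%x. W1 (h x)) (W2 x * al1 x) (W2 x * al2 x) x S" unfolding W2_def Nn[OF x] .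
   from has_partials_mult[OF this ap] show ?thesis unfolding Z_def .
  qed
 qed
 have al0: "al1 x = 0" "al2 x = 0" "Y1 x = 0" "Y2 x = 0" if "x \<in> S" "N x = 0" for x
  using N_nonneg(2)[OF that(1)] that(2) unfolding al1_def al2_def Y1_def Y2_def by auto
 have Wc: "continuous_on S (%x. W2 x * b x * a x)"
  if ab: "\<And>x. x \<in> S ==> \<bar>b x * a x\<bar> \<le> (E x + G x) * N x" "continuous_on S a" "continuous_on S b" for a b
  unfolding continuous_on_eq_continuous_within
 proof
  fix x assume x: "x \<in> S"
  note cw = ab(2,3) cc Ck_on_continuous[OF N_smooth[of 0]] Ck_on_continuous[OF smooth(1)[of 0]] Ck_on_continuous[OF smooth(3)[of 0]]
  note cw = cw[unfolded continuous_on_eq_continuous_within, THEN bspec, OF x]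
  show "continuous (at x within S) (%x. W2 x * b x * a x)"
  proof (cases "N x = 0")
   case False
   then show ?thesis unfolding W2_def by (intro continuous_mult continuous_at_within_divide continuous_minus continuous_add continuous_const cw)
  next
   case True
   let ?B = "%y. \<bar>\<nu> * W (h y) + dn (h y) * W1 (h y)\<bar> * (E y + G y)"
   have "continuous (at x within S) ?B" by (intro continuous_mult continuous_rabs continuous_add continuous_const cw)
   then have lim: "(?B \<longlongrightarrow> 0) (at x within S)" unfolding continuous_within using end0[OF x True] by simp
   have le: "norm (W2 y * b y * a y) \<le> ?B y" if y: "y \<in> S" for y
   proof (cases "N y = 0")
    case True then show ?thesis unfolding W2_def using end0[OF y True] by simp
   next
    case False
    then have Np: "0 < N y" using N_nonneg(1)[OF y] by simp
    have "norm (W2 y * b y * a y) = \<bar>W2 y\<bar> * \<bar>b y * a y\<bar>" by (simp add: abs_mult mult.assoc)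
    also have "\<dots> \<le> \<bar>W2 y\<bar> * ((E y + G y) * N y)" by (intro mult_left_mono ab(1)[OF y]) simp
    also have "\<dots> = ?B y" unfolding W2_def abs_divide abs_minus_cancel using Np by simp
    finally show ?thesis .
   qed
   have "eventually (%y. norm (W2 y * b y * a y) \<le> ?B y) (at x within S)" unfolding eventually_at_filter by (intro always_eventually allI impI le)
   then have "((%y. W2 y * b y * a y) \<longlongrightarrow> 0) (at x within S)" by (rule Lim_null_comparison[OF _ lim])
   moreover have "W2 x * b x * a x = 0" unfolding W2_def True by simp
   ultimately show ?thesis unfolding continuous_within by (simp only:)
  qed
 qed
 note alc = Ck_on_continuous[OF al_smooth(1)[of 0]] Ck_on_continuous[OF al_smooth(2)[of 0]]
 have pc: "continuous_on S (D i al1)" "continuous_on S (D i al2)" for i by (rule Ck_on_continuous[of 0], intro partial_smooth al_smooth)+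
 have Zc: "continuous_on S (Z al1 1 al1)" "continuous_on S (Z al1 2 al2)" "continuous_on S (Z al2 1 al1)" "continuous_on S (Z al2 2 al2)"
  unfolding Z_def[abs_def] by (intro continuous_on_add continuous_on_mult cc pc Wc alpha_bound alc; assumption)+
 show C2: "Ck_on 2 S (%x. W (h x))" unfolding Suc_1[symmetric] One_nat_def
  by (rule Ck_on_SucI[OF S hW Ck_on_SucI[OF S ZP[OF _ al_smooth(1) al0(1)]] Ck_on_SucI[OF S ZP[OF _ al_smooth(2) al0(2)]]])
   (use Zc in simp_all)
 show "lap (%x. W (h x)) x = - \<nu> * W (h x)" if x: "x \<in> S"
 proof -
  have rp: "r y \<noteq> 0" if "y \<in> S" for y using r_pos[OF that] by simp
  \<comment> \<open>The flux of W o h is W'(h) times the rotated dual one-form (Y2, -Y1): the Hodge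
    star maps \<alpha> to the dual form of the field up to sign.\<close>
  have c: "c11 y * D1 (%x. W (h x)) y + c12 y * D2 (%x. W (h x)) y = W1 (h y) * Y2 y"
   "c12 y * D1 (%x. W (h x)) y + c22 y * D2 (%x. W (h x)) y = W1 (h y) * - Y1 y" if "y \<in> S" for y
   unfolding has_partials_eq[OF S that hW[OF that]] c11_def c12_def c22_def al1_def al2_def Y1_def Y2_def using rp[OF that] by (simp_all add: field_simps)
  have ym: "Ck_on 1 S (%y. - Y1 y)" by (intro Ck_intros Y_smooth)
  have 1: "D1 (%y. W1 (h y) * Y2 y) x = Z Y2 1 al1 x" "D2 (%y. W1 (h y) * - Y1 y) x = Z (%y. - Y1 y) 2 al2 x"
   using has_partials_eq(1)[OF S x ZP[OF x Y_smooth(2) al0(4)]] has_partials_eq(2)[OF S x ZP[OF x ym]] al0(3)[OF x] x by auto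
  have e: "D1 (%y. c11 y * D1 (%x. W (h x)) y + c12 y * D2 (%x. W (h x)) y) x = D1 (%y. W1 (h y) * Y2 y) x"
   "D2 (%y. c12 y * D1 (%x. W (h x)) y + c22 y * D2 (%x. W (h x)) y) x = D2 (%y. W1 (h y) * - Y1 y) x"
   by (rule partial_within_cong[OF x], rule c, assumption)+
  have "lap (%x. W (h x)) x * r x = Z Y2 1 al1 x + Z (%y. - Y1 y) 2 al2 x" unfolding lap_def e 1 using rp[OF x] by simp
  also have "\<dots> = W2 x * (al1 x * Y2 x - al2 x * Y1 x) + W1 (h x) * (D1 Y2 x - D2 Y1 x)"
   unfolding Z_def partial_minus[OF S x Y_smooth(1)] by (simp add: algebra_simps)
  also have "\<dots> = (W2 x * N x + W1 (h x) * kap x) * r x"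
  proof -
   have "D1 Y2 x - D2 Y1 x = kap x * r x" unfolding kap_def using rp[OF x] by simp
   then show ?thesis unfolding N_alpha[OF x, symmetric] by (simp add: algebra_simps)
  qed
  also have "W2 x * N x + W1 (h x) * kap x = - \<nu> * W (h x)"
  proof (cases "N x = 0")
   case True then show ?thesis using end0[OF x True] unfolding kn[OF x] by (simp add: algebra_simps)
  next
   case False then show ?thesis unfolding W2_def kn[OF x] by (simp add: field_simps)
  qed
  finally show ?thesis using rp[OF x] by (simp only: mult_cancel_right) simp
 qed
qed

text \<open>A Killing field preserves the inverse metric and the area density, hence their product;
  these are the components of that statement.\<close>

lemma lie_c:
 assumes x: "x \<in> S"
 shows "X1 x * D1 c11 x + X2 x * D2 c11 x = c11 x * (D1 X1 x - D2 X2 x) + 2 * c12 x * D2 X1 x"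
  "X1 x * D1 c12 x + X2 x * D2 c12 x = c11 x * D1 X2 x + c22 x * D2 X1 x"
  "X1 x * D1 c22 x + X2 x * D2 c22 x = c22 x * (D2 X2 x - D1 X1 x) + 2 * c12 x * D1 X2 x"
proof -
 have rp: "r x \<noteq> 0" using r_pos[OF x] by simp
 have dq: "D i (%y. a y / r y) x = (D i a x * r x - a x * D i r x) / (r x * r x)" if "Ck_on 1 S a" for a i by (rule partial_divide[OF S x that r_smooth rp])
 have q: "X1 x * D1 (%y. a y / r y) x + X2 x * D2 (%y. a y / r y) x = (X1 x * D1 a x + X2 x * D2 a x + a x * (D1 X1 x + D2 X2 x)) / r x" if a: "Ck_on 1 S a" for a
 proof -
  have "X1 x * D1 (%y. a y / r y) x + X2 x * D2 (%y. a y / r y) x = ((X1 x * D1 a x + X2 x * D2 a x) * r x - a x * (X1 x * D1 r x + X2 x * D2 r x)) / (r x * r x)"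
   unfolding dq[OF a] using rp by (simp add: field_simps)
  moreover have "(b * r x - a x * (- r x * d)) / (r x * r x) = (b + a x * d) / r x" for b d using rp by (simp add: field_simps)
  ultimately show ?thesis unfolding div_free[OF x] by simp
 qed
 have m: "Ck_on 1 S (%y. - F y)" by (intro Ck_intros)
 note K = K11[OF x] K12[OF x] K22[OF x]
 have k: "X1 x * D1 G x + X2 x * D2 G x = - 2 * (F x * D2 X1 x + G x * D2 X2 x)"
  "X1 x * D1 E x + X2 x * D2 E x = - 2 * (E x * D1 X1 x + F x * D1 X2 x)"
  "X1 x * D1 F x + X2 x * D2 F x = - (F x * D1 X1 x + G x * D1 X2 x) - (E x * D2 X1 x + F x * D2 X2 x)" using K by linarith+
 show "X1 x * D1 c11 x + X2 x * D2 c11 x = c11 x * (D1 X1 x - D2 X2 x) + 2 * c12 x * D2 X1 x"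
  unfolding c11_def[abs_def] c12_def q[OF smooth(3)] k using rp by (simp add: field_simps)
 show "X1 x * D1 c22 x + X2 x * D2 c22 x = c22 x * (D2 X2 x - D1 X1 x) + 2 * c12 x * D1 X2 x"
  unfolding c22_def[abs_def] c12_def q[OF smooth(1)] k using rp by (simp add: field_simps)
 have "X1 x * D1 c12 x + X2 x * D2 c12 x = ((X1 x * - D1 F x + X2 x * - D2 F x) + - F x * (D1 X1 x + D2 X2 x)) / r x"
  using q[OF m] unfolding c12_def[abs_def] partial_minus[OF S x smooth(2)] by simp
 also have "X1 x * - D1 F x + X2 x * - D2 F x = (F x * D1 X1 x + G x * D1 X2 x) + (E x * D2 X1 x + F x * D2 X2 x)" using k(3) by linarith
 finally show "X1 x * D1 c12 x + X2 x * D2 c12 x = c11 x * D1 X2 x + c22 x * D2 X1 x" unfolding c11_def c22_def using rp by (simp add: field_simps)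
qed

text \<open>By \<open>lie_c\<close> the flux of X\<psi> is the Lie derivative, as a vector density,
  of the flux (P1, P2) of \<psi>. The divergence commutes with the Lie derivative by symmetry of
  mixed partials, and \<open>div_free\<close> absorbs the division by \<open>r\<close>.\<close>

lemma lap_commutes:
 assumes p: "Ck_on 1 S \<psi>" "Ck_on 2 S (D1 \<psi>)" "Ck_on 2 S (D2 \<psi>)" and x: "x \<in> S"
 defines "f \<equiv> %x. X1 x * D1 \<psi> x + X2 x * D2 \<psi> x"
 shows "lap f x = X1 x * D1 (lap \<psi>) x + X2 x * D2 (lap \<psi>) x"
proof -
 have p1: "Ck_on 1 S (D1 \<psi>)" "Ck_on 1 S (D2 \<psi>)" using C2D(1) p by auto
 have "Ck_on (Suc 1) S \<psi>" by (rule Ck_on_SucI[OF S Ck_on_partials[of 0] p1]) (use p(1) in simp_all)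
 then have mp: "D2 (D1 \<psi>) y = D1 (D2 \<psi>) y" if "y \<in> S" for y using mixed_partials[OF S _ that] by (simp only: Suc_1)
 define P1 where "P1 y = c11 y * D1 \<psi> y + c12 y * D2 \<psi> y" for y
 define P2 where "P2 y = c12 y * D1 \<psi> y + c22 y * D2 \<psi> y" for y
 have P: "Ck_on 2 S P1" "Ck_on 2 S P2" unfolding P1_def[abs_def] P2_def[abs_def] by (intro Ck_intros c_smooth p)+
 note P1s = C2D(1)[OF P(1)] C2D(1)[OF P(2)] note DP = C2D(2)[OF P(1)] C2D(2)[OF P(2)]
 have dX: "Ck_on k S (D i X1)" "Ck_on k S (D i X2)" for k i by (intro partial_smooth smooth)+
 have dP: "D i P1 y = D i c11 y * D1 \<psi> y + c11 y * D i (D1 \<psi>) y + (D i c12 y * D2 \<psi> y + c12 y * D i (D2 \<psi>) y)"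
  "D i P2 y = D i c12 y * D1 \<psi> y + c12 y * D i (D1 \<psi>) y + (D i c22 y * D2 \<psi> y + c22 y * D i (D2 \<psi>) y)" if "y \<in> S" for i y
  unfolding P1_def[abs_def] P2_def[abs_def] by (rule partial_mult2[OF S that c_smooth(1) p1(1) c_smooth(2) p1(2)] partial_mult2[OF S that c_smooth(2) p1(1) c_smooth(3) p1(2)])+
 have df: "D i f y = D i X1 y * D1 \<psi> y + X1 y * D i (D1 \<psi>) y + (D i X2 y * D2 \<psi> y + X2 y * D i (D2 \<psi>) y)" if "y \<in> S" for i y
  unfolding f_def by (rule partial_mult2[OF S that smooth(4) p1(1) smooth(5) p1(2)])
 have Q: "c11 y * D1 f y + c12 y * D2 f y = (X1 y * D1 P1 y + X2 y * D2 P1 y) + (P1 y * D2 X2 y - P2 y * D2 X1 y)"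
  "c12 y * D1 f y + c22 y * D2 f y = (X1 y * D1 P2 y + X2 y * D2 P2 y) + (P2 y * D1 X1 y - P1 y * D1 X2 y)" if y: "y \<in> S" for y
  unfolding df[OF y] dP[OF y] P1_def P2_def mp[OF y] using lie_c[OF y] by algebra+
 have dQ: "D i (%y. (X1 y * D1 P y + X2 y * D2 P y) + (A y * a y - B y * b y)) x =
   (D i X1 x * D1 P x + X1 x * D i (D1 P) x + (D i X2 x * D2 P x + X2 x * D i (D2 P) x))
   + ((D i A x * a x + A x * D i a x) - (D i B x * b x + B x * D i b x))"
  if c: "Ck_on 1 S (D1 P)" "Ck_on 1 S (D2 P)" "Ck_on 1 S A" "Ck_on 1 S B" "Ck_on 1 S a" "Ck_on 1 S b" for P A B a b i
  unfolding partial_add[OF S x Ck_on_add[OF S Ck_on_mult[OF S smooth(4) c(1)] Ck_on_mult[OF S smooth(5) c(2)]] Ck_on_diff[OF S Ck_on_mult[OF S c(3,5)] Ck_on_mult[OF S c(4,6)]]]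
   partial_mult2[OF S x smooth(4) c(1) smooth(5) c(2)] partial_diff[OF S x Ck_on_mult[OF S c(3,5)] Ck_on_mult[OF S c(4,6)]]
   partial_mult[OF S x c(3,5)] partial_mult[OF S x c(4,6)] ..
 have rp: "r x \<noteq> 0" using r_pos[OF x] by simp
 define \<rho> where "\<rho> y = D1 P1 y + D2 P2 y" for y
 have rho: "Ck_on 1 S \<rho>" unfolding \<rho>_def[abs_def] by (intro Ck_intros DP)
 have dr: "D i \<rho> x = D i (D1 P1) x + D i (D2 P2) x" for i unfolding \<rho>_def[abs_def] by (rule partial_add[OF S x DP])
 have lr: "lap \<psi> y = \<rho> y / r y" for y unfolding lap_def \<rho>_def P1_def[abs_def] P2_def[abs_def] ..
 have m2: "D2 (D1 q) x = D1 (D2 q) x" if "Ck_on 2 S q" for q by (rule mixed_partials[OF S that x])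
 have e: "D1 (%y. c11 y * D1 f y + c12 y * D2 f y) x = D1 (%y. (X1 y * D1 P1 y + X2 y * D2 P1 y) + (P1 y * D2 X2 y - P2 y * D2 X1 y)) x"
  "D2 (%y. c12 y * D1 f y + c22 y * D2 f y) x = D2 (%y. (X1 y * D1 P2 y + X2 y * D2 P2 y) + (P2 y * D1 X1 y - P1 y * D1 X2 y)) x"
  by (rule partial_within_cong[OF x], rule Q, assumption)+
 have n: "q / r x * r x = q" for q using rp by simp
 have "lap f x * r x = (X1 x * D1 \<rho> x + X2 x * D2 \<rho> x) + (D1 X1 x + D2 X2 x) * \<rho> x"
  unfolding lap_def n e dQ[OF DP(1) DP(1) P1s dX(2) dX(1)] dQ[OF DP(2) DP(2) P1s(2,1) dX(1) dX(2)] dr \<rho>_def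
   m2[OF P(1)] m2[OF P(2)] m2[OF smooth(4)] m2[OF smooth(5)] by (simp add: algebra_simps)
 moreover have "(X1 x * D1 (lap \<psi>) x + X2 x * D2 (lap \<psi>) x) * r x = (X1 x * D1 \<rho> x + X2 x * D2 \<rho> x) + (D1 X1 x + D2 X2 x) * \<rho> x"
 proof -
  have d: "D i (lap \<psi>) x = (D i \<rho> x * r x - \<rho> x * D i r x) / (r x * r x)" for i
   unfolding lr[abs_def] by (rule partial_divide[OF S x rho r_smooth rp])
  have "(X1 x * D1 (lap \<psi>) x + X2 x * D2 (lap \<psi>) x) * r x = ((X1 x * D1 \<rho> x + X2 x * D2 \<rho> x) * r x - \<rho> x * (X1 x * D1 r x + X2 x * D2 r x)) / r x"
   unfolding d using rp by (simp add: field_simps)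
  moreover have "(b * r x - \<rho> x * (- r x * d)) / r x = b + d * \<rho> x" for b d using rp by (simp add: field_simps)
  ultimately show ?thesis unfolding div_free[OF x] by simp
 qed
 ultimately have "lap f x * r x = (X1 x * D1 (lap \<psi>) x + X2 x * D2 (lap \<psi>) x) * r x" by simp
 then show ?thesis using rp by simp
qed

end

lemma Ck_on_local:
 assumes S: "rel_open S" and l: "\<And>x. x \<in> S ==> \<exists>V. rel_open V \<and> x \<in> V \<and> V \<subseteq> S \<and> Ck_on k V f"
 shows "Ck_on k S f" using l
proof (induction k arbitrary: f)
 case 0
 have "continuous (at x within S) f" if x: "x \<in> S" for x
 proof -
  obtain V where V: "rel_open V" "x \<in> V" "V \<subseteq> S" "Ck_on 0 V f" using 0 x by meson
  then have "continuous (at x within V) f" by (simp add: continuous_on_eq_continuous_within)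
  then show ?thesis unfolding continuous_within at_within_rel_open[OF V(1-3) S] .
 qed
 then show ?case by (simp add: continuous_on_eq_continuous_within)
next
 case (Suc k)
 have "f differentiable (at x within S)" if x: "x \<in> S" for x
 proof -
  obtain V where V: "rel_open V" "x \<in> V" "V \<subseteq> S" "Ck_on (Suc k) V f" using Suc.prems x by meson
  then have "f differentiable (at x within V)" by (simp add: differentiable_on_def)
  then show ?thesis unfolding at_within_rel_open[OF V(1-3) S] .
 qed
 moreover have "Ck_on k S (partial_within S i f)" for i
 proof (rule Suc.IH)
  fix x assume x: "x \<in> S"
  obtain V where V: "rel_open V" "x \<in> V" "V \<subseteq> S" "Ck_on (Suc k) V f" using Suc.prems x by meson
  then have "Ck_on k V (partial_within V i f)" by simp
  then have "Ck_on k V (partial_within S i f)"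
   using Ck_on_cong[of V "partial_within V i f" "partial_within S i f" k] partial_within_subset[OF V(1) _ V(3) S] by blast
  then show "\<exists>V. rel_open V \<and> x \<in> V \<and> V \<subseteq> S \<and> Ck_on k V (partial_within S i f)" using V by blast
 qed
 ultimately show ?case by (simp add: differentiable_on_def)
qed

lemma matrix_inv_2:
 fixes B :: "real^2^2"
 assumes "det B \<noteq> 0"
 shows "matrix_inv B $ 1 $ 1 = B $ 2 $ 2 / det B" "matrix_inv B $ 1 $ 2 = - B $ 1 $ 2 / det B"
  "matrix_inv B $ 2 $ 1 = - B $ 2 $ 1 / det B" "matrix_inv B $ 2 $ 2 = B $ 1 $ 1 / det B"
proof -
 let ?I = "matrix_inv B" and ?d = "B $ 1 $ 1 * B $ 2 $ 2 - B $ 1 $ 2 * B $ 2 $ 1"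
 have d: "?d \<noteq> 0" using assms unfolding det_2 .
 have "B ** ?I = mat 1 \<and> ?I ** B = mat 1"
  unfolding matrix_inv_def using assms invertible_det_nz[of B] unfolding invertible_def by (rule_tac someI_ex) blast
 then have "(B ** ?I) $ i $ j = mat 1 $ i $ j" for i j by simp
 then have e: "B $ i $ 1 * ?I $ 1 $ j + B $ i $ 2 * ?I $ 2 $ j = (if i = j then 1 else 0)" for i j by (simp add: matrix_matrix_mult_def sum_2 mat_def)
 have "?I $ 1 $ 1 * ?d = B $ 2 $ 2" "?I $ 1 $ 2 * ?d = - B $ 1 $ 2" "?I $ 2 $ 1 * ?d = - B $ 2 $ 1" "?I $ 2 $ 2 * ?d = B $ 1 $ 1"
  using e[of 1 1, simplified] e[of 2 1, simplified] e[of 1 2, simplified] e[of 2 2, simplified] by algebra+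
 then show "?I $ 1 $ 1 = B $ 2 $ 2 / det B" "?I $ 1 $ 2 = - B $ 1 $ 2 / det B"
  "?I $ 2 $ 1 = - B $ 2 $ 1 / det B" "?I $ 2 $ 2 = B $ 1 $ 1 / det B" unfolding det_2 using d by (simp_all add: field_simps)
qed

section \<open>The Laplacian on the surface and the maximum principle\<close>

context killing_surface begin

definition "clap c = killing_chart.lap (chart_image c) (gE c) (gF c) (gG c)"

lemma chart_deriv_inv: "x \<in> chart_image c ==> chart_deriv c i f (chart_inv c x) = partial_within (chart_image c) i (f \<circ> chart_inv c) x"
 unfolding chart_deriv_def by (simp add: snd_chart_inv)

lemma laplace_chart:
 assumes c: "c \<in> A" "p \<in> fst c"
 shows "laplace_beltrami g f c p = clap c (f \<circ> chart_inv c) (snd c p)"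
proof -
 interpret C: killing_chart "chart_image c" "gE c" "gF c" "gG c" "X1 c" "X2 c" by (rule killing_chart[OF c(1)])
 let ?f = "f \<circ> chart_inv c"
 have det: "det (g c q) = gE c (snd c q) * gG c (snd c q) - gF c (snd c q) * gF c (snd c q)" if "q \<in> fst c" for q
  using that c(1) by (simp add: det_2 chart_inv_snd metric_symmetric)
 have sq: "sqrt (det (g c q)) = C.r (snd c q)" "det (g c q) = C.r (snd c q) * C.r (snd c q)" "C.r (snd c q) \<noteq> 0" if "q \<in> fst c" for q
  using det[OF that] C.r_sq[OF chart_in_image[OF that]] C.r_pos[OF chart_in_image[OF that]] unfolding C.r_def by auto
 have inv: "sqrt (det (g c q)) * matrix_inv (g c q) $ 1 $ 1 = C.c11 (snd c q)" "sqrt (det (g c q)) * matrix_inv (g c q) $ 1 $ 2 = C.c12 (snd c q)"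
  "sqrt (det (g c q)) * matrix_inv (g c q) $ 2 $ 1 = C.c12 (snd c q)" "sqrt (det (g c q)) * matrix_inv (g c q) $ 2 $ 2 = C.c22 (snd c q)" if "q \<in> fst c" for q
 proof -
  have "det (g c q) \<noteq> 0" using metric_positive(2)[OF c(1) that] by simp
  note m = matrix_inv_2[OF this]
  show "sqrt (det (g c q)) * matrix_inv (g c q) $ 1 $ 1 = C.c11 (snd c q)" "sqrt (det (g c q)) * matrix_inv (g c q) $ 1 $ 2 = C.c12 (snd c q)"
   "sqrt (det (g c q)) * matrix_inv (g c q) $ 2 $ 1 = C.c12 (snd c q)" "sqrt (det (g c q)) * matrix_inv (g c q) $ 2 $ 2 = C.c22 (snd c q)"
   unfolding m sq(1)[OF that] C.c11_def C.c12_def C.c22_def chart_inv_snd[OF c(1) that] metric_symmetric[OF c(1) that]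
   unfolding sq(2)[OF that] using sq(3)[OF that] by simp_all
 qed
 have cd: "chart_deriv c i h p = partial_within (chart_image c) i (h \<circ> chart_inv c) (snd c p)" for i h unfolding chart_deriv_def ..
 have flux: "((%q. sqrt (det (g c q)) * (\<Sum>j\<in>UNIV. matrix_inv (g c q) $ i $ j * chart_deriv c j f q)) \<circ> chart_inv c) x
   = (if i = 1 then C.c11 x * C.D1 ?f x + C.c12 x * C.D2 ?f x else C.c12 x * C.D1 ?f x + C.c22 x * C.D2 ?f x)" if x: "x \<in> chart_image c" for i x
  using inv[OF chart_inv_in[OF x]] exhaust_2[of i] by (auto simp: o_def sum_2 distrib_left mult.assoc[symmetric] chart_deriv_inv[OF x] snd_chart_inv[OF x])
 have "chart_deriv c i (%q. sqrt (det (g c q)) * (\<Sum>j\<in>UNIV. matrix_inv (g c q) $ i $ j * chart_deriv c j f q)) p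
  = partial_within (chart_image c) i (%x. if i = 1 then C.c11 x * C.D1 ?f x + C.c12 x * C.D2 ?f x else C.c12 x * C.D1 ?f x + C.c22 x * C.D2 ?f x) (snd c p)" for i
  unfolding cd by (rule partial_within_cong[OF chart_in_image[OF c(2)] flux])
 from this[of 1] this[of 2] show ?thesis unfolding laplace_beltrami_def clap_def C.lap_def sq(1)[OF c(2)] sum_2 by simp
qed

text \<open>With l the maximum of f / w, the function f - l w has maximum 0 at the same point, so
  its Laplacian is \<le> 0 there. This avoids the equation of the quotient and its first-order
  terms. The strict inequality for w gives the contradiction if l > 0.\<close>

lemma max_principle:
 assumes K: "openin X K" "closedin X K" and w: "Ck_function A 2 w" "\<And>p. p \<in> K ==> 0 < w p"
  and f: "Ck_function A 2 f" "\<And>p. p \<in> K ==> p \<in> surface_boundary A ==> f p \<le> 0"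
  and lf: "\<And>c p. c \<in> A ==> p \<in> fst c ==> p \<in> K ==> laplace_beltrami g f c p = q p * f p"
  and lw: "\<And>c p. c \<in> A ==> p \<in> fst c ==> p \<in> K ==> laplace_beltrami g w c p < q p * w p"
  and p0: "p0 \<in> K"
 shows "f p0 \<le> 0"
proof -
 have cont: "continuous_map (subtopology X K) euclideanreal h" if h: "Ck_function A 2 h" for h
 proof (rule continuous_map_charts[OF K(1)])
  fix c assume "c \<in> A"
  then have "continuous_on (chart_image c) (h \<circ> chart_inv c)" using h unfolding Ck_function_def by (intro Ck_on_continuous) blast
  then show "continuous_on (snd c ` (fst c \<inter> K)) (h \<circ> chart_inv c)" by (rule continuous_on_subset) (auto simp: chart_image_def)
 qed
 have "compactin X K" using closedin_compact_space[OF compact K(2)] .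
 then have cK: "compact_space (subtopology X K)" by (simp add: compact_space_subtopology)
 have Kt: "topspace (subtopology X K) = K" using openin_subset[OF K(1)] by (simp add: Int_absorb1)
 have "continuous_map (subtopology X K) euclideanreal (%p. f p / w p)" using w(2) Kt by (intro continuous_map_real_divide cont f(1) w(1)) force
 then have "compact ((%p. f p / w p) ` K)" using image_compactin[of "subtopology X K" K euclideanreal] cK Kt unfolding compact_space_def by auto
 then obtain m where m: "m \<in> K" "\<And>p. p \<in> K ==> f p / w p \<le> f m / w m" using compact_attains_sup[of "(%p. f p / w p) ` K"] p0 by auto
 have "f m \<le> 0"
 proof (rule ccontr)
  assume fm: "\<not> f m \<le> 0"
  obtain c where c: "c \<in> A" "m \<in> fst c" using chart_at m(1) openin_subset[OF K(1)] by blast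
  interpret C: killing_chart "chart_image c" "gE c" "gF c" "gG c" "X1 c" "X2 c" by (rule killing_chart[OF c(1)])
  define l where "l = f m / w m"
  let ?V = "snd c ` (fst c \<inter> K)" and ?u = "%x. (f \<circ> chart_inv c) x - l * (w \<circ> chart_inv c) x"
  have V: "rel_open ?V" "?V \<subseteq> chart_image c" "snd c m \<in> ?V" using chart_image_open[OF c(1) K(1)] c(2) m(1) by (auto simp: chart_image_def)
  interpret V: killing_chart ?V "gE c" "gF c" "gG c" "X1 c" "X2 c" by (rule C.subchart[OF V(1,2)])
  have fw: "Ck_on 2 (chart_image c) (f \<circ> chart_inv c)" "Ck_on 2 (chart_image c) (w \<circ> chart_inv c)" using f(1) w(1) c(1) unfolding Ck_function_def by auto
  have u: "Ck_on 2 (chart_image c) ?u" by (intro Ck_on_diff[OF C.S] Ck_on_cmult[OF C.S] fw)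
  have "m \<notin> surface_boundary A" using f(2)[OF m(1)] fm by blast
  then have pos: "0 < snd c m $ 2" using boundary_chart[OF c] chart_nonneg[OF c] by simp
  have le: "?u y \<le> ?u (snd c m)" if y: "y \<in> ?V" for y
  proof -
   obtain z where z: "z \<in> fst c" "z \<in> K" "y = snd c z" using y by blast
   have "f z \<le> l * w z" using m(2)[OF z(2)] w(2)[OF z(2)] unfolding l_def by (simp add: pos_divide_le_eq)
   moreover have "f m = l * w m" using w(2)[OF m(1)] unfolding l_def by simp
   ultimately show ?thesis unfolding z(3) by (simp add: chart_inv_snd[OF c(1)] z(1) c(2))
  qed
  have "V.lap ?u (snd c m) \<le> 0" by (rule V.lap_max[OF Ck_on_subset[OF V(1,2) C.S u] rel_open_interior[OF V(1,3) pos] le])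
  then have "C.lap ?u (snd c m) \<le> 0" using C.lap_subset[OF V] by simp
  then have le0: "laplace_beltrami g f c m - l * laplace_beltrami g w c m \<le> 0"
   unfolding laplace_chart[OF c] clap_def using C.lap_linear[OF chart_in_image[OF c(2)] fw] by simp
  have lp: "0 < l" "f m = l * w m" using w(2)[OF m(1)] fm unfolding l_def by auto
  have "l * laplace_beltrami g w c m < l * (q m * w m)" by (rule mult_strict_left_mono[OF lw[OF c m(1)] lp(1)])
  also have "\<dots> = q m * f m" unfolding lp(2) by simp
  finally show False using le0 unfolding lf[OF c m(1)] by linarith
 qed
 then have "f m / w m \<le> 0" using w(2)[OF m(1)] by (simp add: divide_nonpos_pos)
 then have "f p0 / w p0 \<le> 0" using m(2)[OF p0] by linarith
 then show ?thesis using w(2)[OF p0] by (simp add: pos_divide_le_eq)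
qed

text \<open>Eigenfunctions are required on all of X, which need not be connected, so functions built
  on one component are extended by 0.\<close>

lemma glue:
 assumes K: "openin X K" "closedin X K"
  and f: "\<And>c. c \<in> A ==> Ck_on 2 (snd c ` (fst c \<inter> K)) (f \<circ> chart_inv c)"
  and lf: "\<And>c x. c \<in> A ==> x \<in> snd c ` (fst c \<inter> K) ==> killing_chart.lap (snd c ` (fst c \<inter> K)) (gE c) (gF c) (gG c) (f \<circ> chart_inv c) x = q (chart_inv c x)"
 defines "F \<equiv> %p. if p \<in> K then f p else 0"
 shows "Ck_function A 2 F" "\<And>c p. c \<in> A ==> p \<in> fst c ==> laplace_beltrami g F c p = (if p \<in> K then q p else 0)"
proof -
 have oK: "openin X (topspace X - K)" using K(2) by blast
 have main: "Ck_on 2 (chart_image c) (F \<circ> chart_inv c) \<and> (\<forall>p\<in>fst c. laplace_beltrami g F c p = (if p \<in> K then q p else 0))" if c: "c \<in> A" for c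
 proof -
  interpret C: killing_chart "chart_image c" "gE c" "gF c" "gG c" "X1 c" "X2 c" by (rule killing_chart[OF c])
  let ?V = "snd c ` (fst c \<inter> K)" and ?U = "snd c ` (fst c \<inter> (topspace X - K))"
  have V: "rel_open ?V" "?V \<subseteq> chart_image c" and U: "rel_open ?U" "?U \<subseteq> chart_image c"
   using chart_image_open[OF c K(1)] chart_image_open[OF c oK] by (auto simp: chart_image_def)
  have cov: "chart_image c = ?V \<union> ?U" using chart_subset[OF c] unfolding chart_image_def by auto
  have eV: "(F \<circ> chart_inv c) x = (f \<circ> chart_inv c) x" if "x \<in> ?V" for x using that unfolding F_def by (auto simp: chart_inv_snd[OF c])
  have eU: "(F \<circ> chart_inv c) x = 0" if "x \<in> ?U" for x using that unfolding F_def by (auto simp: chart_inv_snd[OF c])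
  have C2: "Ck_on 2 ?V (F \<circ> chart_inv c)" by (rule iffD2[OF Ck_on_cong f[OF c]], erule eV)
  have C2': "Ck_on 2 ?U (F \<circ> chart_inv c)" by (rule iffD2[OF Ck_on_cong Ck_on_const[OF U(1)]], erule eU)
  have "Ck_on 2 (chart_image c) (F \<circ> chart_inv c)"
  proof (rule Ck_on_local[OF C.S])
   fix x assume "x \<in> chart_image c"
   then consider "x \<in> ?V" | "x \<in> ?U" unfolding cov by (rule UnE)
   then show "\<exists>W. rel_open W \<and> x \<in> W \<and> W \<subseteq> chart_image c \<and> Ck_on 2 W (F \<circ> chart_inv c)"
    by cases (use U V C2 C2' in blast)+
  qed
  moreover have "laplace_beltrami g F c p = (if p \<in> K then q p else 0)" if p: "p \<in> fst c" for p
  proof (cases "p \<in> K")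
   case True
   interpret V: killing_chart ?V "gE c" "gF c" "gG c" "X1 c" "X2 c" by (rule C.subchart[OF V])
   have pV: "snd c p \<in> ?V" using p True by blast
   have "laplace_beltrami g F c p = V.lap (F \<circ> chart_inv c) (snd c p)" unfolding laplace_chart[OF c p] clap_def C.lap_subset[OF V pV] ..
   also have "\<dots> = V.lap (f \<circ> chart_inv c) (snd c p)" by (rule V.lap_cong[OF pV eV])
   also have "\<dots> = q p" using lf[OF c pV] chart_inv_snd[OF c p] by simp
   finally show ?thesis using True by simp
  next
   case False
   interpret U: killing_chart ?U "gE c" "gF c" "gG c" "X1 c" "X2 c" by (rule C.subchart[OF U])
   have pU: "snd c p \<in> ?U" using p False chart_subset[OF c] by blast
   have "laplace_beltrami g F c p = U.lap (F \<circ> chart_inv c) (snd c p)" unfolding laplace_chart[OF c p] clap_def C.lap_subset[OF U pU] ..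
   also have "\<dots> = U.lap (%_. 0) (snd c p)" by (rule U.lap_cong[OF pU eU])
   also have "\<dots> = 0" by (rule U.lap_const[OF pU])
   finally show ?thesis using False by simp
  qed
  ultimately show ?thesis by blast
 qed
 show "Ck_function A 2 F" unfolding Ck_function_def using main by blast
 show "\<And>c p. c \<in> A ==> p \<in> fst c ==> laplace_beltrami g F c p = (if p \<in> K then q p else 0)" using main by blast
qed

lemma laplace_minus:
 assumes f: "Ck_function A 2 f" and c: "c \<in> A" "p \<in> fst c"
 shows "laplace_beltrami g (%p. - f p) c p = - laplace_beltrami g f c p"
proof -
 interpret C: killing_chart "chart_image c" "gE c" "gF c" "gG c" "X1 c" "X2 c" by (rule killing_chart[OF c(1)])
 have f2: "Ck_on 2 (chart_image c) (f \<circ> chart_inv c)" using f c(1) unfolding Ck_function_def by blast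
 have "C.lap (%y. 0 - 1 * (f \<circ> chart_inv c) y) (snd c p) = C.lap (%_. 0) (snd c p) - 1 * C.lap (f \<circ> chart_inv c) (snd c p)"
  by (rule C.lap_linear[OF chart_in_image[OF c(2)] Ck_on_const[OF C.S] f2])
 then show ?thesis unfolding laplace_chart[OF c] clap_def using C.lap_const[OF chart_in_image[OF c(2)]] by (simp add: o_def)
qed

lemma lie_derivative_chart:
 assumes \<psi>: "Ck_function A 1 \<psi>" and c: "c \<in> A" "d \<in> A" "p \<in> fst c" "p \<in> fst d"
 shows "lie_derivative \<xi> \<psi> c p = lie_derivative \<xi> \<psi> d p"
proof -
 let ?J = "transition_jacobian c d p"
 have hp: "has_partials (\<psi> \<circ> chart_inv e) (chart_deriv e 1 \<psi> p) (chart_deriv e 2 \<psi> p) (snd e p) (chart_image e)" if "e \<in> A" "p \<in> fst e" for e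
  unfolding chart_deriv_def using \<psi> that by (intro Ck_on_partials[of 0]) (auto simp: Ck_function_def chart_in_image)
 have "chart_deriv c j \<psi> p = chart_deriv d 1 \<psi> p * ?J $ 1 $ j + chart_deriv d 2 \<psi> p * ?J $ 2 $ j" for j
  using has_partials_eq[OF chart_rel_open[OF c(1)] chart_in_image[OF c(3)] partials_change[OF c hp[OF c(2,4)]]] exhaust_2[of j]
  unfolding chart_deriv_def by auto
 then show ?thesis unfolding lie_derivative_def sum_2 vector_law[OF c] by (simp add: matrix_vector_mult_def sum_2 algebra_simps)
qed

text \<open>Inverting the rotated gradient expresses d\<psi> through u. The stream function thereby
  inherits one order of regularity more than u, as needed to apply the Laplacian to its Lie
  derivative.\<close>

lemma stream_partials:
 assumes c: "c \<in> A" "x \<in> chart_image c" and u: "u c (chart_inv c x) = grad_perp g \<psi> c (chart_inv c x)"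
 shows "partial_within (chart_image c) 1 (\<psi> \<circ> chart_inv c) x = killing_chart.r (gE c) (gF c) (gG c) x * u c (chart_inv c x) $ 2"
  "partial_within (chart_image c) 2 (\<psi> \<circ> chart_inv c) x = - (killing_chart.r (gE c) (gF c) (gG c) x * u c (chart_inv c x) $ 1)"
proof -
 interpret C: killing_chart "chart_image c" "gE c" "gF c" "gG c" "X1 c" "X2 c" by (rule killing_chart[OF c(1)])
 let ?q = "chart_inv c x"
 have q: "?q \<in> fst c" by (rule chart_inv_in[OF c(2)])
 have d: "det (g c ?q) = C.r x * C.r x" "sqrt (det (g c ?q)) = C.r x" "C.r x \<noteq> 0" "det (g c ?q) \<noteq> 0"
  using C.r_sq[OF c(2)] C.r_pos[OF c(2)] metric_positive(2)[OF c(1) q] metric_symmetric[OF c(1) q] unfolding C.r_def by (auto simp: det_2)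
 define a b e where "a = g c ?q $ 1 $ 1" and "b = g c ?q $ 1 $ 2" and "e = g c ?q $ 2 $ 2"
 have rr: "C.r x * C.r x = a * e - b * b" using C.r_sq[OF c(2)] unfolding a_def b_def e_def .
 note m = matrix_inv_2[OF d(4), unfolded metric_symmetric[OF c(1) q] d(1), folded a_def b_def e_def]
 let ?p1 = "partial_within (chart_image c) 1 (\<psi> \<circ> chart_inv c) x" and ?p2 = "partial_within (chart_image c) 2 (\<psi> \<circ> chart_inv c) x"
 have "u c ?q $ 1 = - C.r x * ((a * e - b * b) / ((C.r x * C.r x) * (C.r x * C.r x)) * ?p2)" "u c ?q $ 2 = - C.r x * (- (a * e - b * b) / ((C.r x * C.r x) * (C.r x * C.r x)) * ?p1)"
  unfolding u grad_perp_def d(2) using d(3) by (simp_all add: sum_2 levi_civita_def m chart_deriv_inv[OF c(2)] divide_simps) (simp_all add: algebra_simps)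
 then show "?p1 = C.r x * u c ?q $ 2" "?p2 = - (C.r x * u c ?q $ 1)" unfolding rr[symmetric] using d(3) by simp_all
qed

text \<open>The Lie derivative is defined chart by chart; \<open>lie_derivative_chart\<close> makes
  it a function L on the surface. Its equation is \<open>lap_commutes\<close> followed by the chain
  rule for F o \<psi>.\<close>

lemma lie_derivative_stream:
 assumes \<psi>: "Ck_function A 1 \<psi>" and u: "Ck_vector_field A 2 u" and st: "steady_euler_state X A g F \<psi> u"
 obtains L where "Ck_function A 2 L" "\<And>c p. c \<in> A ==> p \<in> fst c ==> lie_derivative \<xi> \<psi> c p = L p"
  "\<And>c p. c \<in> A ==> p \<in> fst c ==> laplace_beltrami g L c p = deriv F (\<psi> p) * L p" "\<And>p. p \<in> surface_boundary A ==> L p = 0"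
proof -
 have st1: "\<And>c p. c \<in> A ==> p \<in> fst c ==> u c p = grad_perp g \<psi> c p" "\<And>s. F differentiable (at s)"
  "\<And>c p. c \<in> A ==> p \<in> fst c ==> laplace_beltrami g \<psi> c p = F (\<psi> p)"
  "\<And>C. C \<in> connected_components_of (subtopology X (surface_boundary A)) ==> \<exists>b. \<forall>p\<in>C. \<psi> p = b"
  using st unfolding steady_euler_state_def by blast+
 define L where "L p = lie_derivative \<xi> \<psi> (SOME c. c \<in> A \<and> p \<in> fst c) p" for p
 have L: "lie_derivative \<xi> \<psi> c p = L p" if c: "c \<in> A" "p \<in> fst c" for c p
 proof -
  have "(SOME c. c \<in> A \<and> p \<in> fst c) \<in> A \<and> p \<in> fst (SOME c. c \<in> A \<and> p \<in> fst c)"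
   by (rule someI[of "%c. c \<in> A \<and> p \<in> fst c"]) (use c in blast)
  then show ?thesis unfolding L_def by (intro lie_derivative_chart[OF \<psi>]) (use c in auto)
 qed
 have chart: "Ck_on 2 (chart_image c) (L \<circ> chart_inv c) \<and> (\<forall>p\<in>fst c. laplace_beltrami g L c p = deriv F (\<psi> p) * L p)" if c: "c \<in> A" for c
 proof -
  interpret C: killing_chart "chart_image c" "gE c" "gF c" "gG c" "X1 c" "X2 c" by (rule killing_chart[OF c])
  let ?\<psi> = "\<psi> \<circ> chart_inv c"
  have p1: "Ck_on 1 (chart_image c) ?\<psi>" using \<psi> c unfolding Ck_function_def by blast
  have u2: "Ck_on 2 (chart_image c) (%x. u c (chart_inv c x) $ i)" for i using u c unfolding Ck_vector_field_def by blast
  have D: "C.D1 ?\<psi> x = C.r x * u c (chart_inv c x) $ 2" "C.D2 ?\<psi> x = - (C.r x * u c (chart_inv c x) $ 1)" if "x \<in> chart_image c" for x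
   using stream_partials[OF c that, of u, OF st1(1)[OF c chart_inv_in[OF that]]] .
  have p2: "Ck_on 2 (chart_image c) (C.D1 ?\<psi>)" "Ck_on 2 (chart_image c) (C.D2 ?\<psi>)"
   by (rule iffD2[OF Ck_on_cong[OF D(1)]] iffD2[OF Ck_on_cong[OF D(2)]], assumption, intro Ck_on_mult[OF C.S] Ck_on_minus[OF C.S] C.r_smooth u2)+
  have Lx: "(L \<circ> chart_inv c) x = X1 c x * C.D1 ?\<psi> x + X2 c x * C.D2 ?\<psi> x" if "x \<in> chart_image c" for x
   using L[OF c chart_inv_in[OF that]] unfolding lie_derivative_def sum_2 chart_deriv_inv[OF that] by simp
  have "Ck_on 2 (chart_image c) (L \<circ> chart_inv c)"
   by (rule iffD2[OF Ck_on_cong[OF Lx]], assumption, intro Ck_on_add[OF C.S] Ck_on_mult[OF C.S] C.smooth p2)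
  moreover have "laplace_beltrami g L c p = deriv F (\<psi> p) * L p" if p: "p \<in> fst c" for p
  proof -
   let ?x = "snd c p"
   have x: "?x \<in> chart_image c" by (rule chart_in_image[OF p])
   have lp: "C.lap ?\<psi> y = F (?\<psi> y)" if "y \<in> chart_image c" for y
    using st1(3)[OF c chart_inv_in[OF that]] laplace_chart[OF c chart_inv_in[OF that], of \<psi>] snd_chart_inv[OF that] unfolding clap_def by simp
   have hp: "has_partials ?\<psi> (C.D1 ?\<psi> ?x) (C.D2 ?\<psi> ?x) ?x (chart_image c)" using Ck_on_partials[of 0] p1 x by simp
   have "(F has_real_derivative deriv F (?\<psi> ?x)) (at (?\<psi> ?x))" using st1(2) by (simp add: DERIV_deriv_iff_real_differentiable)
   from has_partials_compose[OF hp this] have "has_partials (%y. F (?\<psi> y)) (deriv F (?\<psi> ?x) * C.D1 ?\<psi> ?x) (deriv F (?\<psi> ?x) * C.D2 ?\<psi> ?x) ?x (chart_image c)" by simp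
   from has_partials_cong[OF this x lp] have e: "C.D1 (C.lap ?\<psi>) ?x = deriv F (?\<psi> ?x) * C.D1 ?\<psi> ?x" "C.D2 (C.lap ?\<psi>) ?x = deriv F (?\<psi> ?x) * C.D2 ?\<psi> ?x"
    using has_partials_eq[OF C.S x] by blast+
   have "laplace_beltrami g L c p = C.lap (%x. X1 c x * C.D1 ?\<psi> x + X2 c x * C.D2 ?\<psi> x) ?x"
    unfolding laplace_chart[OF c p] clap_def by (rule C.lap_cong[OF x Lx])
   also have "\<dots> = deriv F (?\<psi> ?x) * (L \<circ> chart_inv c) ?x" unfolding C.lap_commutes[OF p1 p2 x] e Lx[OF x] by (simp add: algebra_simps)
   finally show ?thesis using chart_inv_snd[OF c p] by simp
  qed
  ultimately show ?thesis by blast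
 qed
 \<comment> \<open>A short segment of the boundary line lies in one component of the boundary, so
   \<psi> is constant on it and its tangential derivative vanishes; the normal component of \<xi>
   vanishes by tangency.\<close>
 have zero: "L p = 0" if pb: "p \<in> surface_boundary A" for p
 proof -
  obtain c where c: "c \<in> A" "p \<in> fst c" "snd c p $ 2 = 0" using pb unfolding surface_boundary_def by blast
  interpret C: killing_chart "chart_image c" "gE c" "gF c" "gG c" "X1 c" "X2 c" by (rule killing_chart[OF c(1)])
  let ?x = "snd c p" and ?\<psi> = "\<psi> \<circ> chart_inv c"
  have x: "?x \<in> chart_image c" by (rule chart_in_image[OF c(2)])
  obtain r where r: "0 < r" "\<And>v. v $ 2 \<ge> 0 ==> norm v < r ==> ?x + v \<in> chart_image c" using rel_open_step[OF C.S x] by blast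
  let ?l = "%t. ?x + t *\<^sub>R axis 1 1"
  have ax: "(t *\<^sub>R axis 1 1 :: real^2) $ 2 = 0" for t by (simp add: axis_def)
  have lin: "?l t \<in> chart_image c" if "t \<in> {0..r/2}" for t using r(1) that by (intro r(2); simp) (simp add: axis_def)
  let ?V = "?l ` {0..r/2}" let ?W = "{q\<in>fst c. snd c q \<in> ?V}"
  have VC: "?V \<subseteq> chart_image c" using lin by blast
  have "connected ?V" by (intro connected_continuous_image continuous_intros) simp
  then have "connectedin X ?W" by (rule chart_connected[OF c(1) VC])
  moreover have "?W \<subseteq> surface_boundary A" using c(1,3) ax by (auto simp: surface_boundary_def intro!: bexI[of _ c])
  ultimately have cW: "connectedin (subtopology X (surface_boundary A)) ?W" by (simp add: connectedin_subtopology)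
  have pW: "p \<in> ?W" using c(2) r(1) by (auto intro!: image_eqI[of _ _ 0])
  have sub: "?W \<subseteq> connected_component_of_set (subtopology X (surface_boundary A)) p" by (rule connected_component_of_maximal[OF cW pW])
  have "p \<in> topspace (subtopology X (surface_boundary A))" using connectedin_subset_topspace[OF cW] pW by blast
  then have "connected_component_of_set (subtopology X (surface_boundary A)) p \<in> connected_components_of (subtopology X (surface_boundary A))"
   unfolding connected_components_of_def by blast
  from st1(4)[OF this] obtain k where k: "\<forall>q\<in>?W. \<psi> q = k" using sub by blast
  have const: "?\<psi> (?l t) = k" if "t \<in> {0..r/2}" for t
  proof -
   have "chart_inv c (?l t) \<in> ?W" using chart_inv_in[OF lin[OF that]] snd_chart_inv[OF lin[OF that]] that by auto
   then show ?thesis using k by simp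
  qed
  have hp: "has_partials ?\<psi> (C.D1 ?\<psi> ?x) (C.D2 ?\<psi> ?x) (?x + 0 *\<^sub>R axis 1 1) (chart_image c)"
   using Ck_on_partials[of 0 "chart_image c" ?\<psi> ?x] \<psi> c(1) x unfolding Ck_function_def by simp
  have "((%t. ?\<psi> (?l t)) has_real_derivative C.D1 ?\<psi> ?x * (axis 1 1 :: real^2) $ 1 + C.D2 ?\<psi> ?x * (axis 1 1 :: real^2) $ 2) (at 0 within {0..r/2})"
   by (rule line_derivative[OF hp lin])
  then have "((%t. k) has_real_derivative C.D1 ?\<psi> ?x * (axis 1 1 :: real^2) $ 1 + C.D2 ?\<psi> ?x * (axis 1 1 :: real^2) $ 2) (at 0 within {0..r/2})"
   by (rule has_field_derivative_transform_within[OF _ zero_less_one]) (use r(1) const in auto)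
  then have 1: "((%t. k) has_vector_derivative C.D1 ?\<psi> ?x) (at 0 within cbox 0 (r/2))"
   by (simp add: axis_def has_real_derivative_iff_has_vector_derivative)
  have d0: "C.D1 ?\<psi> ?x = 0" using vector_derivative_unique_within_closed_interval[OF _ _ 1 has_vector_derivative_const[of k]] r(1) by simp
  have "\<xi> c p $ 2 = 0" using tangent c(1,2) pb unfolding tangent_to_boundary_def by blast
  then show ?thesis using L[OF c(1,2)] d0 unfolding lie_derivative_def sum_2 chart_deriv_def by simp
 qed
 show thesis by (rule that[OF _ L _ zero]) (use chart in \<open>auto simp: Ck_function_def\<close>)
qed

lemma minus_field: "killing_surface X A g (%c p. - \<xi> c p)"
proof
 show "tangent_to_boundary A (%c p. - \<xi> c p)" using tangent unfolding tangent_to_boundary_def by simp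
 show "killing_field A g (%c p. - \<xi> c p)" unfolding killing_field_def smooth_vector_field_def Ck_vector_field_def vector_field_def
 proof (intro conjI allI ballI)
  fix k and c i assume c: "c \<in> A"
  have "Ck_on k (chart_image c) (%x. \<xi> c (chart_inv c x) $ i)"
   using killing c unfolding killing_field_def smooth_vector_field_def Ck_vector_field_def by blast
  then show "Ck_on k (chart_image c) (%x. (- \<xi> c (chart_inv c x)) $ i)" using Ck_on_minus[OF chart_rel_open[OF c]] by simp
 next
  fix c d p assume c: "c \<in> A" "d \<in> A" "p \<in> fst c \<inter> fst d"
  show "- \<xi> d p = transition_jacobian c d p *v - \<xi> c p" using vector_law[OF c(1,2)] c(3) by (simp add: matrix_vector_mult_def vec_eq_iff sum_negf)
 next
  fix c p assume c: "c \<in> A" "p \<in> fst c"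
  interpret C: killing_chart "chart_image c" "gE c" "gF c" "gG c" "X1 c" "X2 c" by (rule killing_chart[OF c(1)])
  have sm: "Ck_on 1 (chart_image c) (%x. \<xi> c (chart_inv c x) $ k)" for k using C.smooth(4,5)[of 1] exhaust_2[of k] by auto
  have cd: "chart_deriv c i (%q. - \<xi> c q $ k) p = - chart_deriv c i (%q. \<xi> c q $ k) p" for i k
   using partial_minus[OF C.S chart_in_image[OF c(2)] sm, of i k] unfolding chart_deriv_def by (simp add: o_def)
  have "lie_derivative_tensor2 \<xi> g c p = 0" using killing c unfolding killing_field_def by blast
  moreover have "lie_derivative_tensor2 (%c p. - \<xi> c p) g c p $ i $ j = - (lie_derivative_tensor2 \<xi> g c p $ i $ j)" for i j
   unfolding lie_derivative_tensor2_def by (simp add: sum_2 cd)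
  ultimately show "lie_derivative_tensor2 (%c p. - \<xi> c p) g c p = 0" by (simp add: vec_eq_iff)
 qed
qed

end

section \<open>Eigenfunctions and supersolutions from the level function\<close>

context killing_component begin

lemma minus_component: "killing_component X A g (%c p. - \<xi> c p) E"
proof -
 interpret M: killing_surface X A g "%c p. - \<xi> c p" by (rule minus_field)
 show ?thesis by unfold_locales (use E_open E_closed E_connected nonvanishing in \<open>simp_all add: vanishing_def M.vanishing_def\<close>)
qed

text \<open>Reversing the field changes the sign of \<alpha> and of its primitives. A boundary
  maximum thus becomes a boundary minimum, and the construction may always start at a boundary
  circle.\<close>

lemma minus_lmin:
 assumes "lmax b"
 shows "level_foliation.lmin (killing_component.loc X A g (%c p. - \<xi> c p) E) b"
proof -
 interpret M: killing_component X A g "%c p. - \<xi> c p" E by (rule minus_component)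
 obtain U h where U: "loc U h" "b \<in> U" "\<forall>y\<in>U. h y \<le> h b" using assms unfolding lmax_def by blast
 have "M.grad (%x. - h x) p" if p: "grad h p" for p unfolding M.grad_def
 proof (intro ballI impI)
  fix c assume c: "c \<in> A" "p \<in> fst c"
  interpret C: killing_chart "chart_image c" "gE c" "gF c" "gG c" "X1 c" "X2 c" by (rule killing_chart[OF c(1)])
  interpret D: killing_chart "chart_image c" "gE c" "gF c" "gG c" "%x. (- \<xi> c (chart_inv c x)) $ 1" "%x. (- \<xi> c (chart_inv c x)) $ 2"
   by (rule M.killing_chart[OF c(1)])
  have "M.cal1 c x = - cal1 c x" "M.cal2 c x = - cal2 c x" for x
   unfolding M.cal1_def M.cal2_def cal1_def cal2_def D.al1_def D.al2_def C.al1_def C.al2_def by simp_all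
  then show "has_partials ((%x. - h x) \<circ> chart_inv c) (M.cal1 c (snd c p)) (M.cal2 c (snd c p)) (snd c p) (chart_image c)"
   using has_partials_minus[OF gradD[OF p c]] by (simp add: o_def)
 qed
 then have "M.loc U (%x. - h x)" using U(1) unfolding loc_def M.loc_def by blast
 then show ?thesis unfolding M.lmin_def using U(2,3) by (intro exI[of _ U] exI[of _ "%x. - h x"]) auto
qed

text \<open>The boundary of E lies on the level 0 and, only if n(T) > 0, on the level T. The end
  conditions in \<open>shooting\<close> are therefore exactly the Dirichlet condition for W o
  k.\<close>

lemma eigenfunction_or_supersolution_lmin:
 assumes b: "lmin b" "b \<in> surface_boundary A" and m: "0 \<le> m"
 shows "(\<exists>\<nu>\<le>m. dirichlet_eigenvalue A g \<nu>) \<or>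
  (\<exists>w. Ck_function A 2 w \<and> (\<forall>p\<in>E. 0 < w p) \<and> (\<forall>c\<in>A. \<forall>p\<in>fst c \<inter> E. laplace_beltrami g w c p = - m * w p))"
proof (rule level_profile[OF b])
 fix k T n dn
 assume k: "loc E k" "0 < T" "k ` E = {0..T}" "sturm_liouville n dn T"
  and Nk: "\<And>p c. p \<in> E ==> c \<in> A ==> p \<in> fst c ==> cN c (snd c p) = n (k p) \<and> ckap c (snd c p) = dn (k p)"
  and bd: "\<And>p. p \<in> E ==> p \<in> surface_boundary A ==> k p = 0 \<or> k p = T \<and> 0 < n T"
 interpret SL: sturm_liouville n dn T by (rule k(4))
 have ext: "Ck_function A 2 (%p. if p \<in> E then W (k p) else 0) \<and>
   (\<forall>c\<in>A. \<forall>p\<in>fst c. laplace_beltrami g (%p. if p \<in> E then W (k p) else 0) c p = (if p \<in> E then - \<nu> * W (k p) else 0))"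
  if so: "SL.sol \<nu> W W1" for \<nu> W W1
 proof -
  have comp: "Ck_on 2 (snd c ` (fst c \<inter> E)) ((%p. W (k p)) \<circ> chart_inv c)"
   "x \<in> snd c ` (fst c \<inter> E) ==> killing_chart.lap (snd c ` (fst c \<inter> E)) (gE c) (gF c) (gG c) ((%p. W (k p)) \<circ> chart_inv c) x = - \<nu> * W (k (chart_inv c x))" if c: "c \<in> A" for c x
  proof -
   interpret C: killing_chart "chart_image c" "gE c" "gF c" "gG c" "X1 c" "X2 c" by (rule killing_chart[OF c])
   let ?V = "snd c ` (fst c \<inter> E)"
   have V: "rel_open ?V" "?V \<subseteq> chart_image c" using chart_image_open[OF c E_open] by (auto simp: chart_image_def)
   interpret V: killing_chart ?V "gE c" "gF c" "gG c" "X1 c" "X2 c" by (rule C.subchart[OF V])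
   have h: "has_partials (k \<circ> chart_inv c) (V.al1 x) (V.al2 x) x ?V" if "x \<in> ?V" for x using locD[OF k(1) c that] unfolding cal1_def cal2_def .
   have in': "chart_inv c x \<in> E" "chart_inv c x \<in> fst c" "snd c (chart_inv c x) = x" if "x \<in> ?V" for x using that chart_inv_snd[OF c] by auto
   have hT: "(k \<circ> chart_inv c) x \<in> {0..T}" if "x \<in> ?V" for x using k(3) in'(1)[OF that] by auto
   have Nn: "V.N x = n ((k \<circ> chart_inv c) x)" if "x \<in> ?V" for x
    using Nk[OF in'(1)[OF that] c in'(2)[OF that]] in'(3)[OF that] unfolding cN_def by simp
   have kn: "V.kap x = dn ((k \<circ> chart_inv c) x)" if x: "x \<in> ?V" for x
   proof -
    have "V.kap x = C.kap x" unfolding V.kap_def C.kap_def using partial_within_subset[OF V(1) x V(2) C.S] by simp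
    then show ?thesis using Nk[OF in'(1)[OF x] c in'(2)[OF x]] in'(3)[OF x] unfolding ckap_def by simp
   qed
   have "Ck_on 2 ?V (%x. W ((k \<circ> chart_inv c) x))" by (rule V.level_composition(1)[OF k(4) so h hT Nn kn])
   then show "Ck_on 2 ?V ((%p. W (k p)) \<circ> chart_inv c)" by (simp add: o_def)
   have "V.lap (%x. W ((k \<circ> chart_inv c) x)) x = - \<nu> * W ((k \<circ> chart_inv c) x)" if "x \<in> ?V"
    by (rule V.level_composition(2)[OF k(4) so h hT Nn kn that])
   then show "V.lap ((%p. W (k p)) \<circ> chart_inv c) x = - \<nu> * W (k (chart_inv c x))" if "x \<in> ?V" using that by (simp add: o_def)
  qed
  have "Ck_function A 2 (%p. if p \<in> E then W (k p) else 0)"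
   by (rule glue(1)[OF E_open E_closed, where f = "%p. W (k p)" and q = "%p. - \<nu> * W (k p)"]) (rule comp; assumption)+
  moreover have "laplace_beltrami g (%p. if p \<in> E then W (k p) else 0) c p = (if p \<in> E then - \<nu> * W (k p) else 0)" if "c \<in> A" "p \<in> fst c" for c p
   by (rule glue(2)[OF E_open E_closed _ _ that, where f = "%p. W (k p)" and q = "%p. - \<nu> * W (k p)"]) (rule comp; assumption)+
  ultimately show ?thesis by blast
 qed
 from SL.shooting[OF m] show ?thesis
 proof (elim disjE exE conjE)
  fix \<nu> W W1 assume so: "SL.sol \<nu> W W1" and \<nu>: "\<nu> \<le> m" and W0: "W 0 = 0" "0 < n T --> W T = 0" "\<exists>t\<in>{0..T}. W t \<noteq> 0"
  let ?f = "%p. if p \<in> E then W (k p) else 0"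
  obtain p where p: "p \<in> E" "W (k p) \<noteq> 0" using W0(3) k(3) by (metis imageE)
  have "dirichlet_eigenvalue A g \<nu>" unfolding dirichlet_eigenvalue_def
  proof (intro exI[of _ ?f] conjI)
   show "Ck_function A 2 ?f" using ext[OF so] by blast
   obtain c where "c \<in> A" "p \<in> fst c" using chart_at p(1) E_top by blast
   then show "\<exists>c\<in>A. \<exists>p\<in>fst c. ?f p \<noteq> 0" using p by auto
   show "\<forall>p\<in>surface_boundary A. ?f p = 0" using bd W0(1,2) by fastforce
   show "\<forall>c\<in>A. \<forall>p\<in>fst c. - laplace_beltrami g ?f c p = \<nu> * ?f p" using ext[OF so] by simp
  qed
  then show ?thesis using \<nu> by blast
 next
  fix W W1 assume so: "SL.sol m W W1" and pos: "\<forall>t\<in>{0..T}. 0 < W t"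
  let ?w = "%p. if p \<in> E then W (k p) else 0"
  have "0 < ?w p" if "p \<in> E" for p using pos k(3) that by auto
  moreover have "laplace_beltrami g ?w c p = - m * ?w p" if "c \<in> A" "p \<in> fst c \<inter> E" for c p using ext[OF so] that by simp
  ultimately show ?thesis using ext[OF so] by blast
 qed
qed

lemma eigenfunction_or_supersolution:
 assumes b: "b \<in> E" "b \<in> surface_boundary A" and m: "0 \<le> m"
 shows "(\<exists>\<nu>\<le>m. dirichlet_eigenvalue A g \<nu>) \<or>
  (\<exists>w. Ck_function A 2 w \<and> (\<forall>p\<in>E. 0 < w p) \<and> (\<forall>c\<in>A. \<forall>p\<in>fst c \<inter> E. laplace_beltrami g w c p = - m * w p))"
proof -
 interpret M: killing_component X A g "%c p. - \<xi> c p" E by (rule minus_component)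
 have "\<not> regular b" unfolding regular_def using b(2) by blast
 then have "lmin b \<or> lmax b" using extremal_iff[OF b(1)] by blast
 then show ?thesis
 proof
  assume "lmin b" then show ?thesis using eigenfunction_or_supersolution_lmin[OF _ b(2) m] by blast
 next
  assume "lmax b"
  then show ?thesis using M.eigenfunction_or_supersolution_lmin[OF minus_lmin b(2) m] by blast
 qed
qed

end

theorem proposition1p1:
  fixes X :: "'a topology" and A :: "'a chart set" and g :: "'a tensor2"
    and \<xi> u :: "'a vfield" and \<psi> :: "'a \<Rightarrow> real" and F :: "real \<Rightarrow> real"
  assumes surface: "compact_riemannian_surface X A g"
    and killing: "killing_field A g \<xi>"
    and tangent: "tangent_to_boundary A \<xi>"
    and stream_C1: "Ck_function A 1 \<psi>"
    and velocity_C2: "Ck_vector_field A 2 u"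
    and stable: "arnold_stable_state X A g F \<psi> u"
  shows "\<forall>c\<in>A. \<forall>p\<in>fst c. lie_derivative \<xi> \<psi> c p = 0"
proof -
 interpret killing_surface X A g \<xi> using surface killing tangent by (intro killing_surface.intro killing_surface_axioms.intro)
 have st: "steady_euler_state X A g F \<psi> u" using stable unfolding arnold_stable_state_def by blast
 have cF: "continuous_on UNIV (deriv F)" using st unfolding steady_euler_state_def by blast
 show ?thesis
 proof (rule lie_derivative_stream[OF stream_C1 velocity_C2 st])
  fix L assume L: "Ck_function A 2 L" "\<And>c p. c \<in> A ==> p \<in> fst c ==> lie_derivative \<xi> \<psi> c p = L p"
   and lapL: "\<And>c p. c \<in> A ==> p \<in> fst c ==> laplace_beltrami g L c p = deriv F (\<psi> p) * L p"
   and L0: "\<And>p. p \<in> surface_boundary A ==> L p = 0"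
  have Lm: "Ck_function A 2 (%p. - L p)" using L(1) Ck_on_minus[OF chart_rel_open] unfolding Ck_function_def by (simp add: o_def)
  \<comment> \<open>The equation is linear, so the maximum principle applies to L and to -L with the
    same w.\<close>
  have vanish: "L p = 0" if K: "openin X K" "closedin X K" and w: "Ck_function A 2 w" "\<And>p. p \<in> K ==> 0 < w p"
   and lw: "\<And>c p. c \<in> A ==> p \<in> fst c ==> p \<in> K ==> laplace_beltrami g w c p < deriv F (\<psi> p) * w p" and p: "p \<in> K" for K w p
  proof -
   have "L p \<le> 0" by (rule max_principle[OF K w L(1) _ lapL lw p]) (simp_all add: L0)
   moreover have "- L p \<le> 0" by (rule max_principle[OF K w Lm _ _ lw p]) (simp_all add: L0 laplace_minus[OF L(1)] lapL)
   ultimately show ?thesis by linarith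
  qed
  have "L p0 = 0" if p0: "p0 \<in> topspace X" for p0
  proof (cases "\<forall>p\<in>topspace X. 0 < deriv F (\<psi> p)")
   case True
   have one: "Ck_function A 2 (%_. 1)" unfolding Ck_function_def using Ck_on_const[OF chart_rel_open] by (simp add: o_def)
   have lap1: "laplace_beltrami g (%_. 1) c p = 0" if c: "c \<in> A" "p \<in> fst c" for c p
   proof -
    interpret C: killing_chart "chart_image c" "gE c" "gF c" "gG c" "X1 c" "X2 c" by (rule killing_chart[OF c(1)])
    show ?thesis unfolding laplace_chart[OF c] clap_def using C.lap_const[OF chart_in_image[OF c(2)]] by (simp add: o_def)
   qed
   show ?thesis by (rule vanish[OF openin_topspace closedin_topspace one _ _ p0]) (use True lap1 in auto)
  next
   case False
   then obtain \<mu> where mu: "smallest_dirichlet_eigenvalue A g \<mu>" "\<And>p. p \<in> topspace X ==> - \<mu> < deriv F (\<psi> p) \<and> deriv F (\<psi> p) < 0"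
    using stable unfolding arnold_stable_state_def by blast
   have least: "\<mu> \<le> \<nu>" if "dirichlet_eigenvalue A g \<nu>" for \<nu> using mu(1) that unfolding smallest_dirichlet_eigenvalue_def by blast
   define E where "E = connected_component_of_set X p0"
   have E: "openin X E" "closedin X E" "connectedin X E" "p0 \<in> E"
    unfolding E_def using connected_component_open[OF p0] closedin_connected_component_of connectedin_connected_component_of p0
    by (auto simp: connected_component_of_refl)
   have Et: "E \<subseteq> topspace X" using openin_subset[OF E(1)] .
   obtain c0 where c0: "c0 \<in> A" "p0 \<in> fst c0" using chart_at p0 by blast
   show ?thesis
   proof (rule ccontr)
    assume nz: "L p0 \<noteq> 0"
    have "\<not> vanishing p0"
    proof
     assume "vanishing p0"
     then have "\<xi> c0 p0 = 0" using c0 unfolding vanishing_def by blast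
     then show False using nz L(2)[OF c0] unfolding lie_derivative_def by simp
    qed
    then have "\<not> E \<subseteq> {p\<in>topspace X. vanishing p}" using E(4) by blast
    \<comment> \<open>Vanishing and nonvanishing points form two open sets covering the connected
      set E, so one of them contains E.\<close>
    then have nv: "E \<subseteq> {p\<in>topspace X. \<not> vanishing p}" using connectedin_two[OF E(3) vanishing_open nonvanishing_open] Et by blast
    interpret killing_component X A g \<xi> E by unfold_locales (use E nv in auto)
    obtain b where b: "b \<in> E" "b \<in> surface_boundary A"
    proof (cases "E \<inter> surface_boundary A = {}")
     case True
     have one: "Ck_on 2 (snd c ` (fst c \<inter> E)) ((%_. 1) \<circ> chart_inv c)" if "c \<in> A" for c
      using Ck_on_const[OF chart_image_open[OF that E(1)]] by (simp add: o_def)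
     have zero: "killing_chart.lap (snd c ` (fst c \<inter> E)) (gE c) (gF c) (gG c) ((%_. 1) \<circ> chart_inv c) x = 0"
      if c: "c \<in> A" and x: "x \<in> snd c ` (fst c \<inter> E)" for c x
     proof -
      interpret C: killing_chart "chart_image c" "gE c" "gF c" "gG c" "X1 c" "X2 c" by (rule killing_chart[OF c])
      interpret V: killing_chart "snd c ` (fst c \<inter> E)" "gE c" "gF c" "gG c" "X1 c" "X2 c"
       by (rule C.subchart[OF chart_image_open[OF c E(1)]]) (auto simp: chart_image_def)
      show ?thesis using V.lap_const[OF x, of 1] by (simp add: o_def)
     qed
     note ind = glue[OF E(1,2) one zero]
     \<comment> \<open>On a component without boundary the indicator function is an eigenfunction
       for 0, hence \<mu> \<le> 0, and no value lies strictly between -\<mu> and 0.\<close>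
     have "dirichlet_eigenvalue A g 0" unfolding dirichlet_eigenvalue_def
     proof (intro exI[of _ "%p. if p \<in> E then 1 else 0"] conjI)
      show "Ck_function A 2 (%p. if p \<in> E then 1 else 0)" by (rule ind(1))
      show "\<exists>c\<in>A. \<exists>p\<in>fst c. (if p \<in> E then 1 else 0) \<noteq> (0::real)" using c0 E(4) by auto
      show "\<forall>p\<in>surface_boundary A. (if p \<in> E then 1 else 0) = (0::real)" using True by auto
      show "\<forall>c\<in>A. \<forall>p\<in>fst c. - laplace_beltrami g (%p. if p \<in> E then 1 else 0) c p = 0 * (if p \<in> E then 1 else 0)"
       using ind(2) by simp
     qed
     then have "\<mu> \<le> 0" by (rule least)
     then show ?thesis using mu(2)[OF p0] by linarith
    qed blast
    have "continuous_map X euclideanreal \<psi>"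
    proof -
     have "continuous_map (subtopology X (topspace X)) euclideanreal \<psi>"
     proof (rule continuous_map_charts[OF openin_topspace])
      fix c assume "c \<in> A"
      then have "continuous_on (chart_image c) (\<psi> \<circ> chart_inv c)" using stream_C1 unfolding Ck_function_def by (intro Ck_on_continuous) blast
      then show "continuous_on (snd c ` (fst c \<inter> topspace X)) (\<psi> \<circ> chart_inv c)" by (rule continuous_on_subset) (auto simp: chart_image_def)
     qed
     then show ?thesis by simp
    qed
    then have "compact (\<psi> ` topspace X)" using image_compactin[of X "topspace X" euclideanreal \<psi>] compact unfolding compact_space_def by simp
    then have "compact (deriv F ` \<psi> ` topspace X)" by (rule compact_continuous_image[OF continuous_on_subset[OF cF subset_UNIV]])
    moreover have "deriv F ` \<psi> ` topspace X \<noteq> {}" using p0 by blast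
    ultimately have "\<exists>s\<in>deriv F ` \<psi> ` topspace X. \<forall>t\<in>deriv F ` \<psi> ` topspace X. s \<le> t" by (rule compact_attains_inf)
    then obtain q where q: "q \<in> topspace X" "\<And>p. p \<in> topspace X ==> deriv F (\<psi> q) \<le> deriv F (\<psi> p)" by blast
    \<comment> \<open>The midpoint between \<mu> and the maximum of -F'(\<psi>), which is attained
      at q; both inequalities for m are therefore strict.\<close>
    define m where "m = (\<mu> - deriv F (\<psi> q)) / 2"
    have m: "0 \<le> m" "m < \<mu>" using mu(2)[OF q(1)] unfolding m_def by auto
    have mF: "- m < deriv F (\<psi> p)" if "p \<in> topspace X" for p using mu(2)[OF q(1)] q(2)[OF that] unfolding m_def by argo
    from eigenfunction_or_supersolution[OF b m(1)] show False
    proof (elim disjE exE conjE)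
     fix \<nu> assume "\<nu> \<le> m" "dirichlet_eigenvalue A g \<nu>"
     then show False using least[of \<nu>] m(2) by linarith
    next
     fix w assume w: "Ck_function A 2 w" "\<forall>p\<in>E. 0 < w p" "\<forall>c\<in>A. \<forall>p\<in>fst c \<inter> E. laplace_beltrami g w c p = - m * w p"
     have lw: "laplace_beltrami g w c p < deriv F (\<psi> p) * w p" if c: "c \<in> A" "p \<in> fst c" "p \<in> E" for c p
     proof -
      have "- m * w p < deriv F (\<psi> p) * w p" using mF[of p] w(2) c(3) Et by (intro mult_strict_right_mono) auto
      then show ?thesis using w(3) c by simp
     qed
     have "0 < w p" if "p \<in> E" for p using w(2) that by blast
     from vanish[OF E(1,2) w(1) this lw E(4)] have "L p0 = 0" .
     then show False using nz by simp
    qed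
   qed
  qed
  then show ?thesis using L(2) chart_subset by (metis subsetD)
 qed
qed

end
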